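(* Let $k\ge 0$ be an integer and $r=k+1$. Let $u$ be the solution of the Burgers problem $u_t+uu_x-\nu u_{xx}=0$ in $I\times J$, $u(x,0)=g(x)$ for $x\in I$, $u(0,t)=u(1,t)=0$ for $t\in J$, and assume $u\in H^2(0,T;H^{1+r}(I))$. For a partition $I_h$ of $I$ with mesh size $h$ and a time step $\tau=T/M$ ($M$ a positive integer), $t_n=n\tau$, let $U_n\in S_h^0$ ($n=0,1,\dots,M$) be a solution of the fully-discrete weak Galerkin scheme $$(\bar\partial_tU_n^0,v^0)_h+\nu(d_{w,r}U_n,d_{w,r}v)_h+\tfrac13(U_n^0\,d_{w,r}U_n,v^0)_h-\tfrac13(U_n^0U_n^0,d_{w,r}v)_h=0,\quad\forall v\in S_h^0,\ n=1,\dots,M,$$ with $U_0=g_h=Q_hg$, where $\bar\partial_tU_n=(U_n-U_{n-1})/\tau$. Then there exists a constant $C$, independent of the partition $I_h$ (in particular of $h$), of $\tau$ and of $n$, such that for $n=1,\dots,M$ $$\|u_x(t_n)-d_{w,r}U_n\|_h^2\le C\Big(h^{2(k+1)}\max_{1\le j\le n}\|u(t_j)\|_{k+2}^2+h^{2(k+1)}\max_{1\le j\le n}\|u_t(t_j)\|_{k+2}^2+\tau^2\int_0^{t_n}\|u_{tt}(s)\|_{k+2}^2\,ds\Big).$$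
   Context: $I=(0,1)$, $J=(0,T]$ with $0<T<\infty$, and $\nu>0$ is a constant (inverse Reynolds number). $\|\cdot\|_s$ is the norm of the Sobolev space $H^s(I)$. $H^l(0,T;H^s(I))$ is the usual space of functions of $t\in(0,T)$ with values in $H^s(I)$ whose time derivatives up to order $l$ are square integrable in time with values in $H^s(I)$. Partition: $I_h:\ 0=x_1<x_2<\dots<x_N=1$, $I_i=(x_i,x_{i+1})$, $h_i=x_{i+1}-x_i$, $h=\max_i h_i$. $P_m(I_i)$ denotes polynomials of degree at most $m$ on $I_i$. Weak functions: $S_h$ is the space of $v$ consisting of an interior part $v^0$ with $v^0|_{I_i}\in P_k(I_i)$ for each $i=1,\dots,N-1$ (no continuity between elements required), together with one real nodal value $v^i$ at each node $x_i$, $i=1,\dots,N$ (not necessarily related to traces of $v^0$). $S_h^0=\{v\in S_h: v^1=v^N=0\}$. $U_n^0$ denotes the interior part of $U_n$. Discrete weak derivative: for $v\in S_h$, $d_{w,r}v$ is the piecewise polynomial with $d_{w,r}v|_{I_i}\in P_r(I_i)$ determined on each element by $\int_{I_i}(d_{w,r}v)\,q\,dx=-\int_{I_i}v^0q'\,dx+v^{i+1}q(x_{i+1})-v^iq(x_i)$ for all $q\in P_r(I_i)$. Discrete inner product: $(u,v)_h=\sum_{i=1}^{N-1}\int_{I_i}uv\,dx$, $\|u\|_h^2=(u,u)_h$. Projection: for $w\in H^1(I)$, $Q_hw\in S_h$ has interior part $Q_h^0w$ equal on each $I_i$ to the $L^2(I_i)$-orthogonal projection of $w$ onto $P_k(I_i)$,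 and nodal values $(Q_hw)^i=w(x_i)$. The constant $C$ may depend on $u$, $\nu$, $T$, $k$. *)

theory Defs
  imports "HOL-Analysis.Analysis" "HOL-Computational_Algebra.Polynomial"
begin

definition test_function :: "real \<Rightarrow> real \<Rightarrow> (real \<Rightarrow> real) \<Rightarrow> bool" where
  "test_function a b \<phi> \<longleftrightarrow>
     (\<forall>n x. ((deriv ^^ n) \<phi>) differentiable (at x)) \<and>
     (\<exists>K. compact K \<and> K \<subseteq> {a<..<b} \<and> (\<forall>x. x \<notin> K \<longrightarrow> \<phi> x = 0))"

abbreviation unit_I :: "real set" where
  "unit_I \<equiv> {0<..<1}"

definition L2_I :: "(real \<Rightarrow> real) \<Rightarrow> bool" where
  "L2_I w \<longleftrightarrow> w \<in> borel_measurable (lebesgue_on unit_I) \<and>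
     integrable (lebesgue_on unit_I) (\<lambda>x. (w x)\<^sup>2)"

definition is_weak_deriv :: "nat \<Rightarrow> (real \<Rightarrow> real) \<Rightarrow> (real \<Rightarrow> real) \<Rightarrow> bool" where
  "is_weak_deriv j w d \<longleftrightarrow> L2_I w \<and> L2_I d \<and>
     (\<forall>\<phi>. test_function 0 1 \<phi> \<longrightarrow>
        (LINT x|lebesgue_on unit_I. w x * (deriv ^^ j) \<phi> x)
          = (- 1) ^ j * (LINT x|lebesgue_on unit_I. d x * \<phi> x))"

definition in_H :: "nat \<Rightarrow> (real \<Rightarrow> real) \<Rightarrow> bool" where
  "in_H s w \<longleftrightarrow> (\<forall>j\<le>s. \<exists>d. is_weak_deriv j w d)"

text \<open>Weak derivatives are determined up to null sets; \<open>weak_deriv\<close> picks one of them.\<close>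

definition weak_deriv :: "nat \<Rightarrow> (real \<Rightarrow> real) \<Rightarrow> real \<Rightarrow> real" where
  "weak_deriv j w = (SOME d. is_weak_deriv j w d)"

definition H_norm :: "nat \<Rightarrow> (real \<Rightarrow> real) \<Rightarrow> real" where
  "H_norm s w = sqrt (\<Sum>j\<le>s. LINT x|lebesgue_on unit_I. (weak_deriv j w x)\<^sup>2)"

text \<open>
  \<open>H\<^sup>s\<close> is not a type here, as the order \<open>s\<close> is a variable. The Bochner notions are therefore
  spelled out with respect to \<open>H_norm s\<close>. A map into \<open>H\<^sup>s\<close> is written \<open>f t x\<close>, with time first.
\<close>

definition H_simple :: "real \<Rightarrow> nat \<Rightarrow> (real \<Rightarrow> real \<Rightarrow> real) \<Rightarrow> bool" where
  "H_simple T s F \<longleftrightarrow> simple_function (lebesgue_on {0<..<T}) F \<and> (\<forall>t\<in>{0<..<T}. in_H s (F t))"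

definition H_simple_integral :: "real \<Rightarrow> (real \<Rightarrow> real \<Rightarrow> real) \<Rightarrow> real \<Rightarrow> real" where
  "H_simple_integral T F =
     (\<lambda>x. \<Sum>w\<in>F ` {0<..<T}. measure lebesgue {t\<in>{0<..<T}. F t = w} * w x)"

definition H_strongly_measurable :: "real \<Rightarrow> nat \<Rightarrow> (real \<Rightarrow> real \<Rightarrow> real) \<Rightarrow> bool" where
  "H_strongly_measurable T s f \<longleftrightarrow>
     (AE t in lebesgue_on {0<..<T}. in_H s (f t)) \<and>
     (\<exists>F. (\<forall>n. H_simple T s (F n)) \<and>
        (AE t in lebesgue_on {0<..<T}.
           (\<lambda>n. H_norm s (\<lambda>x. F n t x - f t x)) \<longlonglongrightarrow> 0))"

definition has_H_integral ::
  "real \<Rightarrow> nat \<Rightarrow> (real \<Rightarrow> real \<Rightarrow> real) \<Rightarrow> (real \<Rightarrow> real) \<Rightarrow> bool" where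
  "has_H_integral T s f z \<longleftrightarrow> H_strongly_measurable T s f \<and> in_H s z \<and>
     (\<exists>F. (\<forall>n. H_simple T s (F n)) \<and>
        (\<lambda>n. \<integral>\<^sup>+ t. ennreal (H_norm s (\<lambda>x. f t x - F n t x)) \<partial>lebesgue_on {0<..<T})
          \<longlonglongrightarrow> 0 \<and>
        (\<lambda>n. H_norm s (\<lambda>x. H_simple_integral T (F n) x - z x)) \<longlonglongrightarrow> 0)"

definition L2_time_H :: "real \<Rightarrow> nat \<Rightarrow> (real \<Rightarrow> real \<Rightarrow> real) \<Rightarrow> bool" where
  "L2_time_H T s f \<longleftrightarrow> H_strongly_measurable T s f \<and>
     integrable (lebesgue_on {0<..<T}) (\<lambda>t. (H_norm s (f t))\<^sup>2)"

definition is_time_deriv ::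
  "real \<Rightarrow> nat \<Rightarrow> (real \<Rightarrow> real \<Rightarrow> real) \<Rightarrow> (real \<Rightarrow> real \<Rightarrow> real) \<Rightarrow> bool" where
  "is_time_deriv T s f f' \<longleftrightarrow> L2_time_H T s f \<and> L2_time_H T s f' \<and>
     (\<forall>\<phi>. test_function 0 T \<phi> \<longrightarrow>
        (\<exists>z. has_H_integral T s (\<lambda>t x. deriv \<phi> t * f t x) z \<and>
             has_H_integral T s (\<lambda>t x. \<phi> t * f' t x) (\<lambda>x. - z x)))"

definition H_time_H :: "nat \<Rightarrow> real \<Rightarrow> nat \<Rightarrow> (real \<Rightarrow> real \<Rightarrow> real) \<Rightarrow> bool" where
  "H_time_H l T s f \<longleftrightarrow>
     (\<exists>D. D 0 = f \<and> (\<forall>j\<le>l. L2_time_H T s (D j)) \<and>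
          (\<forall>j<l. is_time_deriv T s (D j) (D (Suc j))))"

text \<open>
  Membership in \<open>H_time_H\<close> only determines \<open>f t\<close> for almost every \<open>t\<close>. For \<open>l \<ge> 1\<close> there is a
  representative satisfying the following predicate, which is the one meant by point values in time.
\<close>

definition H_continuous :: "real \<Rightarrow> nat \<Rightarrow> (real \<Rightarrow> real \<Rightarrow> real) \<Rightarrow> bool" where
  "H_continuous T s f \<longleftrightarrow>
     (\<forall>t\<in>{0..T}. in_H s (f t) \<and>
        ((\<lambda>t'. H_norm s (\<lambda>x. f t' x - f t x)) \<longlongrightarrow> 0) (at t within {0..T}))"

definition burgers_solution ::
  "real \<Rightarrow> real \<Rightarrow> (real \<Rightarrow> real) \<Rightarrow> (real \<Rightarrow> real \<Rightarrow> real) \<Rightarrow> (real \<Rightarrow> real \<Rightarrow> real) \<Rightarrow> bool" where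
  "burgers_solution \<nu> T g u u\<^sub>t \<longleftrightarrow>
     (\<forall>t\<in>{0<..T}. AE x in lebesgue_on unit_I.
        u\<^sub>t t x + u t x * weak_deriv 1 (u t) x - \<nu> * weak_deriv 2 (u t) x = 0) \<and>
     (\<forall>x\<in>unit_I. u 0 x = g x) \<and>
     (\<forall>t\<in>{0<..T}. u t 0 = 0 \<and> u t 1 = 0)"

definition is_partition :: "(nat \<Rightarrow> real) \<Rightarrow> nat \<Rightarrow> bool" where
  "is_partition X N \<longleftrightarrow> 2 \<le> N \<and> X 1 = 0 \<and> X N = 1 \<and> (\<forall>i\<in>{1..<N}. X i < X (i + 1))"

definition mesh_size :: "(nat \<Rightarrow> real) \<Rightarrow> nat \<Rightarrow> real" where
  "mesh_size X N = Max ((\<lambda>i. X (i + 1) - X i) ` {1..<N})"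

definition elt :: "(nat \<Rightarrow> real) \<Rightarrow> nat \<Rightarrow> real set" where
  "elt X i = {X i<..<X (i + 1)}"

text \<open>
  The interior part is given by one polynomial per element. Functions that are only defined
  elementwise have type \<open>nat \<Rightarrow> real \<Rightarrow> real\<close>, the first argument being the element.
\<close>

datatype weak_fun = Weak_Fun (inner_part: "nat \<Rightarrow> real poly") (node_val: "nat \<Rightarrow> real")

abbreviation inner_fun :: "weak_fun \<Rightarrow> nat \<Rightarrow> real \<Rightarrow> real" where
  "inner_fun v \<equiv> (\<lambda>i. poly (inner_part v i))"

text \<open>Entries at indices that carry no data are 0, so each weak function has one representation.\<close>

definition S_h :: "nat \<Rightarrow> nat \<Rightarrow> weak_fun set" where
  "S_h N k = {v. (\<forall>i\<in>{1..<N}. degree (inner_part v i) \<le> k) \<and>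
                 (\<forall>i. i \<notin> {1..<N} \<longrightarrow> inner_part v i = 0) \<and>
                 (\<forall>i. i \<notin> {1..N} \<longrightarrow> node_val v i = 0)}"

definition S_h0 :: "nat \<Rightarrow> nat \<Rightarrow> weak_fun set" where
  "S_h0 N k = {v \<in> S_h N k. node_val v 1 = 0 \<and> node_val v N = 0}"

definition weak_diff :: "(nat \<Rightarrow> real) \<Rightarrow> nat \<Rightarrow> weak_fun \<Rightarrow> nat \<Rightarrow> real poly" where
  "weak_diff X r v i = (THE p. degree p \<le> r \<and>
     (\<forall>q. degree q \<le> r \<longrightarrow>
        (LINT y|lebesgue_on (elt X i). poly p y * poly q y) =
          - (LINT y|lebesgue_on (elt X i). poly (inner_part v i) y * poly (pderiv q) y)
          + node_val v (i + 1) * poly q (X (i + 1)) - node_val v i * poly q (X i)))"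

abbreviation weak_diff_fun :: "(nat \<Rightarrow> real) \<Rightarrow> nat \<Rightarrow> weak_fun \<Rightarrow> nat \<Rightarrow> real \<Rightarrow> real" where
  "weak_diff_fun X r v \<equiv> (\<lambda>i. poly (weak_diff X r v i))"

definition inner_h ::
  "(nat \<Rightarrow> real) \<Rightarrow> nat \<Rightarrow> (nat \<Rightarrow> real \<Rightarrow> real) \<Rightarrow> (nat \<Rightarrow> real \<Rightarrow> real) \<Rightarrow> real" where
  "inner_h X N f f' = (\<Sum>i\<in>{1..<N}. LINT y|lebesgue_on (elt X i). f i y * f' i y)"

definition norm_h :: "(nat \<Rightarrow> real) \<Rightarrow> nat \<Rightarrow> (nat \<Rightarrow> real \<Rightarrow> real) \<Rightarrow> real" where
  "norm_h X N f = sqrt (inner_h X N f f)"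

definition L2_proj :: "(nat \<Rightarrow> real) \<Rightarrow> nat \<Rightarrow> (real \<Rightarrow> real) \<Rightarrow> nat \<Rightarrow> real poly" where
  "L2_proj X k w i = (THE p. degree p \<le> k \<and>
     (\<forall>q. degree q \<le> k \<longrightarrow>
        (LINT y|lebesgue_on (elt X i). poly p y * poly q y) =
          (LINT y|lebesgue_on (elt X i). w y * poly q y)))"

text \<open>
  The nodal values refer to the continuous representative: \<open>w\<close> is to be continuous on \<open>{0..1}\<close>.
\<close>

definition Q_h :: "(nat \<Rightarrow> real) \<Rightarrow> nat \<Rightarrow> nat \<Rightarrow> (real \<Rightarrow> real) \<Rightarrow> weak_fun" where
  "Q_h X N k w = Weak_Fun (\<lambda>i. if i \<in> {1..<N} then L2_proj X k w i else 0)
                          (\<lambda>i. if i \<in> {1..N} then w (X i) else 0)"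

definition wg_solution ::
  "real \<Rightarrow> (real \<Rightarrow> real) \<Rightarrow> nat \<Rightarrow> nat \<Rightarrow> (nat \<Rightarrow> real) \<Rightarrow> nat \<Rightarrow> real \<Rightarrow> nat
     \<Rightarrow> (nat \<Rightarrow> weak_fun) \<Rightarrow> bool" where
  "wg_solution \<nu> g k r X N \<tau> M U \<longleftrightarrow>
     U 0 = Q_h X N k g \<and> (\<forall>n\<le>M. U n \<in> S_h0 N k) \<and>
     (\<forall>n\<in>{1..M}. \<forall>v\<in>S_h0 N k.
        inner_h X N (\<lambda>i y. (inner_fun (U n) i y - inner_fun (U (n - 1)) i y) / \<tau>) (inner_fun v)
        + \<nu> * inner_h X N (weak_diff_fun X r (U n)) (weak_diff_fun X r v)
        + 1 / 3 * inner_h X N (\<lambda>i y. inner_fun (U n) i y * weak_diff_fun X r (U n) i y) (inner_fun v)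
        - 1 / 3 * inner_h X N (\<lambda>i y. inner_fun (U n) i y * inner_fun (U n) i y) (weak_diff_fun X r v)
        = 0)"

end

theory Submission
  imports Defs
begin

text \<open>
  The interior part of a weak function \<open>v\<close> vanishing at the boundary is the projection of an
  antiderivative of \<open>d v\<close>, so \<open>\<bar>v\<^sup>0\<bar> \<le> K \<parallel>d v\<parallel>\<close> uniformly; and \<open>d (Q\<^sub>h w)\<close> is the projection of \<open>w'\<close>.
  Hence the consistency error of \<open>W\<^sub>n = Q\<^sub>h u(t\<^sub>n)\<close> is the sum of a functional bounded by \<open>\<parallel>v\<^sup>0\<parallel>\<close> and a
  functional \<open>S\<^sub>n\<close> bounded only by \<open>\<parallel>d v\<parallel>\<close>. Testing the error equation with \<open>e\<^sub>n = W\<^sub>n - U\<^sub>n\<close> gives the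
  \<open>L\<^sup>2\<close> estimate. Testing it with \<open>e\<^sub>n - e\<^bsub>n-1\<^esub>\<close>, with \<open>S\<^sub>n\<close> summed by parts in time, gives the gradient
  estimate as soon as \<open>\<parallel>d U\<^sub>n\<parallel>\<close> is bounded. For short times this is replaced by the smallness of the
  \<open>L\<^sup>2\<close> error, which absorbs the cubic terms; it also bounds some difference quotient of \<open>U\<close>. Later
  difference quotients \<open>D\<^sub>n\<close> grow by at most a fixed factor, and \<open>\<nu> \<parallel>d U\<^sub>n\<parallel>\<^sup>2 \<le> \<parallel>D\<^sub>n\<parallel> \<parallel>U\<^sub>0\<parallel>\<close> bounds the gradient.

  This needs \<open>\<tau>\<close> small. Only finitely many time steps are large; for each of them the error is bounded,
  and the term with \<open>u\<^sub>t\<^sub>t\<close> is a positive constant unless \<open>u\<close> is affine in time on \<open>[0, t\<^sub>n]\<close>. In that case the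
  energy identity forces \<open>u = 0\<close>, and the scheme is exact.
\<close>

section \<open>Integrals on an interval\<close>

text \<open>The obstacle is a gradient bound for \<open>U\<close> that depends neither on the mesh
  nor on the step. The convection terms are skew, so stability and the L2 estimate hold without such
  a bound, but they control the gradient only after summation in time. An inverse inequality would
  cost negative powers of element sizes, and the partition is arbitrary.

  Tested with the increment, the error equation contains the increment under a derivative, while
  only its L2 norm is controlled; hence the regrouping into time differences of
  \<open>\<Phi>\<close>. What remains is quartic in the gradient of the error. Gronwall closes
  because two of the four powers, summed in time, are bounded by the L2 estimate. In implicit form
  it also needs every single weight to be small, and \<open>\<Phi>\<close> contains a cubic term:
  short-time smallness or a gradient bound for \<open>U\<close> settles both.

  The estimates are made for abstract forms, so that no constant can depend on the mesh. Large steps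
  are a case of their own because the right-hand side of the claim contains no fixed positive
  constant.\<close>

abbreviation leb :: "real \<Rightarrow> real \<Rightarrow> real measure" where
  "leb a b \<equiv> lebesgue_on {a<..<b}"

text \<open>Measurability is a separate conjunct because measurability of the square does not imply
  that of \<open>f\<close>.\<close>

definition sqint :: "real \<Rightarrow> real \<Rightarrow> (real \<Rightarrow> real) \<Rightarrow> bool" where
  "sqint a b f \<longleftrightarrow> f \<in> borel_measurable (leb a b) \<and> integrable (leb a b) (\<lambda>x. (f x)\<^sup>2)"

lemma integrable_leb_subinterval:
  assumes "integrable (leb a b) f" "a \<le> c" "d \<le> b"
  shows "integrable (leb c d) (f :: real \<Rightarrow> real)"
proof -
  have "set_integrable lebesgue {a<..<b} f"
    using assms(1) by (simp add: integrable_restrict_space set_integrable_def)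
  then have "set_integrable lebesgue {c<..<d} f"
    by (rule set_integrable_subset) (use assms in auto)
  then show ?thesis
    by (simp add: integrable_restrict_space set_integrable_def)
qed

lemma borel_measurable_leb_subinterval:
  assumes "f \<in> borel_measurable (leb a b)" "a \<le> c" "d \<le> b"
  shows "(f :: real \<Rightarrow> real) \<in> borel_measurable (leb c d)"
  by (rule measurable_restrict_mono[OF assms(1)]) (use assms in auto)

lemma AE_leb_subinterval:
  assumes "AE x in leb a b. P x" "a \<le> c" "d \<le> b"
  shows "AE x in leb c d. P x"
proof -
  have "AE x in lebesgue. x \<in> {a<..<b} \<longrightarrow> P x"
    using assms(1) by (simp add: AE_restrict_space_iff)
  then have "AE x in lebesgue. x \<in> {c<..<d} \<longrightarrow> P x"
    by eventually_elim (use assms in auto)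
  then show ?thesis
    by (simp add: AE_restrict_space_iff)
qed

lemma measure_leb [simp]: "a \<le> b \<Longrightarrow> measure (leb a b) {a<..<b} = b - a"
  by (simp add: measure_restrict_space)

lemma emeasure_leb_finite: "emeasure (leb a b) (space (leb a b)) < \<infinity>"
  by (cases "a \<le> b") (auto simp: emeasure_restrict_space)

lemma integrable_leb_const [simp]: "integrable (leb a b) (\<lambda>x. c :: real)"
  using emeasure_leb_finite[of a b] by (intro finite_measure.integrable_const finite_measureI) auto

lemma integrable_leb_continuous:
  assumes "continuous_on {a..b} f"
  shows "integrable (leb a b) (f :: real \<Rightarrow> real)"
proof -
  have "f absolutely_integrable_on {a..b}"
    using absolutely_integrable_continuous_real[OF assms] .
  then have "set_integrable lebesgue {a..b} f" .
  then have "set_integrable lebesgue {a<..<b} f"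
    by (rule set_integrable_subset) auto
  then show ?thesis
    by (simp add: integrable_restrict_space set_integrable_def)
qed

lemma integral_leb_eq_integral:
  assumes "integrable (leb a b) f"
  shows "(LINT x|leb a b. f x) = integral {a..b} (f :: real \<Rightarrow> real)"
  using lebesgue_integral_eq_integral[OF assms] integral_open_interval_real[of a b f] by simp

lemma integrable_leb_on_closed:
  assumes "integrable (leb a b) f"
  shows "(f :: real \<Rightarrow> real) integrable_on {a..b}"
  using integrable_on_lebesgue_on[OF assms] integrable_on_open_interval_real[of f a b] by simp

lemma integral_leb_combine:
  assumes "integrable (leb a b) f" "a \<le> c" "c \<le> b"
  shows "(LINT x|leb a c. f x) + (LINT x|leb c b. f x) = (LINT x|leb a b. (f x :: real))"
proof -
  have "integrable (leb a c) f" "integrable (leb c b) f"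
    using assms by (auto intro: integrable_leb_subinterval)
  then show ?thesis
    using assms integrable_leb_on_closed[OF assms(1)]
    by (simp add: integral_leb_eq_integral Henstock_Kurzweil_Integration.integral_combine)
qed

lemma continuous_on_indefinite_leb:
  assumes "integrable (leb a b) f"
  shows "continuous_on {a..b} (\<lambda>x. LINT y|leb a x. (f y :: real))"
proof -
  have "continuous_on {a..b} (\<lambda>x. integral {a..x} f)"
    using integrable_leb_on_closed[OF assms] by (rule indefinite_integral_continuous_1)
  moreover have "integral {a..x} f = (LINT y|leb a x. f y)" if "x \<in> {a..b}" for x
    using that integrable_leb_subinterval[OF assms, of a x] by (simp add: integral_leb_eq_integral)
  ultimately show ?thesis
    by (rule continuous_on_eq)
qed

lemma integral_leb_FTC:
  assumes "a \<le> b" "\<And>x. x \<in> {a..b} \<Longrightarrow> (F has_real_derivative f x) (at x within {a..b})"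
    and "integrable (leb a b) f"
  shows "(LINT x|leb a b. f x) = F b - F a"
proof -
  have "(f has_integral (F b - F a)) {a..b}"
    using assms by (intro fundamental_theorem_of_calculus)
      (auto simp: has_real_derivative_iff_has_vector_derivative[symmetric])
  then show ?thesis
    using assms by (simp add: integral_leb_eq_integral integral_unique)
qed

lemma has_derivative_indefinite_leb:
  assumes "continuous_on {a..b} f" "x \<in> {a..b}"
  shows "((\<lambda>x. LINT y|leb a x. f y) has_real_derivative f x) (at x within {a..b})"
proof -
  have "((\<lambda>x. integral {a..x} f) has_real_derivative f x) (at x within {a..b})"
    using integral_has_real_derivative[OF assms] .
  moreover have "integral {a..x} f = (LINT y|leb a x. f y)" if "x \<in> {a..b}" for x
  proof -
    have "integrable (leb a x) f"
      using that by (intro integrable_leb_continuous continuous_on_subset[OF assms(1)]) auto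
    then show ?thesis by (simp add: integral_leb_eq_integral)
  qed
  ultimately show ?thesis
    using assms(2) by (auto intro: has_field_derivative_transform_within[where d=1])
qed

section \<open>Square integrable functions on an interval\<close>

lemma sqint_integrable_mult:
  assumes "sqint a b f" "sqint a b g"
  shows "integrable (leb a b) (\<lambda>x. f x * g x)"
proof (rule Bochner_Integration.integrable_bound)
  show "integrable (leb a b) (\<lambda>x. (f x)\<^sup>2 + (g x)\<^sup>2)"
    using assms by (simp add: sqint_def)
  show "(\<lambda>x. f x * g x) \<in> borel_measurable (leb a b)"
    using assms unfolding sqint_def by (intro borel_measurable_times) auto
  have "\<bar>f x * g x\<bar> \<le> (f x)\<^sup>2 + (g x)\<^sup>2" for x
  proof -
    have "0 \<le> (\<bar>f x\<bar> - \<bar>g x\<bar>)\<^sup>2 + (f x)\<^sup>2 + (g x)\<^sup>2" by simp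
    then show ?thesis by (simp add: power2_eq_square algebra_simps abs_mult)
  qed
  then show "AE x in leb a b. norm (f x * g x) \<le> norm ((f x)\<^sup>2 + (g x)\<^sup>2)"
    by (intro AE_I2) auto
qed

lemma sqint_continuous: "continuous_on {a..b} f \<Longrightarrow> sqint a b f"
  using integrable_leb_continuous[of a b f] integrable_leb_continuous[of a b "\<lambda>x. (f x)\<^sup>2"]
  by (auto simp: sqint_def intro!: continuous_intros)

lemma sqint_const [simp]: "sqint a b (\<lambda>x. c)"
  by (intro sqint_continuous continuous_intros)

lemma sqint_poly [simp]: "sqint a b (poly p)"
  by (intro sqint_continuous continuous_intros)

lemma sqint_poly' [simp]: "sqint a b (\<lambda>x. poly p x)"
  by (intro sqint_continuous continuous_intros)

lemma sqint_scale: "sqint a b f \<Longrightarrow> sqint a b (\<lambda>x. c * f x)"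
  by (auto simp: sqint_def power_mult_distrib)

lemma sqint_add: assumes "sqint a b f" "sqint a b g" shows "sqint a b (\<lambda>x. f x + g x)"
proof -
  have "integrable (leb a b) (\<lambda>x. (f x)\<^sup>2 + (g x)\<^sup>2 + 2 * (f x * g x))"
    using assms sqint_integrable_mult[OF assms] by (auto simp: sqint_def)
  then show ?thesis
    using assms by (auto simp: sqint_def power2_sum mult.assoc)
qed

lemma sqint_uminus: "sqint a b f \<Longrightarrow> sqint a b (\<lambda>x. - f x)"
  using sqint_scale[of a b f "-1"] by simp

lemma sqint_diff: "sqint a b f \<Longrightarrow> sqint a b g \<Longrightarrow> sqint a b (\<lambda>x. f x - g x)"
  using sqint_add[of a b f "\<lambda>x. - g x"] sqint_uminus[of a b g] by simp

lemma sqint_divide: "sqint a b f \<Longrightarrow> sqint a b (\<lambda>x. f x / c)"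
  using sqint_scale[of a b f "1 / c"] by simp

lemma sqint_mult_bounded:
  assumes "sqint a b f" "continuous_on {a..b} g"
  shows "sqint a b (\<lambda>x. g x * f x)"
proof -
  obtain B where B: "\<And>x. x \<in> {a..b} \<Longrightarrow> \<bar>g x\<bar> \<le> B"
    using compact_imp_bounded[OF compact_continuous_image[OF assms(2) compact_Icc]]
    unfolding bounded_iff by (metis imageI real_norm_def)
  have g: "g \<in> borel_measurable (leb a b)"
    using integrable_leb_continuous[OF assms(2)] by auto
  have "integrable (leb a b) (\<lambda>x. (g x * f x)\<^sup>2)"
  proof (rule Bochner_Integration.integrable_bound)
    show "integrable (leb a b) (\<lambda>x. B\<^sup>2 * (f x)\<^sup>2)" using assms by (simp add: sqint_def)
    show "(\<lambda>x. (g x * f x)\<^sup>2) \<in> borel_measurable (leb a b)"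
      using assms g unfolding sqint_def by (intro borel_measurable_power borel_measurable_times) auto
    show "AE x in leb a b. norm ((g x * f x)\<^sup>2) \<le> norm (B\<^sup>2 * (f x)\<^sup>2)"
    proof (rule AE_I2)
      fix x assume "x \<in> space (leb a b)"
      then have "(g x)\<^sup>2 \<le> B\<^sup>2" using B[of x] by (auto intro: abs_le_square_iff[THEN iffD1])
      then show "norm ((g x * f x)\<^sup>2) \<le> norm (B\<^sup>2 * (f x)\<^sup>2)"
        by (simp add: power_mult_distrib mult_right_mono)
    qed
  qed
  then show ?thesis using assms g unfolding sqint_def by (auto intro: borel_measurable_times)
qed

lemma sqint_integrable: "sqint a b f \<Longrightarrow> integrable (leb a b) f"
  using sqint_integrable_mult[of a b f "\<lambda>x. 1"] by simp

lemma sqint_abs: "sqint a b f \<Longrightarrow> sqint a b (\<lambda>x. \<bar>f x\<bar>)"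
  unfolding sqint_def by (auto intro: borel_measurable_abs)

lemma sqint_subinterval: "sqint a b f \<Longrightarrow> a \<le> c \<Longrightarrow> d \<le> b \<Longrightarrow> sqint c d f"
  by (auto simp: sqint_def intro: integrable_leb_subinterval borel_measurable_leb_subinterval)

text \<open>Lebesgue measure is complete, so changing a function on a null set keeps it
  measurable.\<close>

lemma borel_measurable_leb_AE:
  assumes "f \<in> borel_measurable (leb a b)" "AE x in leb a b. f x = g x"
  shows "(g :: real \<Rightarrow> real) \<in> borel_measurable (leb a b)"
proof -
  have "(\<lambda>x. if x \<in> {a<..<b} then f x else 0) \<in> borel_measurable lebesgue"
    using assms(1) by (subst borel_measurable_if) auto
  moreover have "AE x in lebesgue. (if x \<in> {a<..<b} then f x else 0) = (if x \<in> {a<..<b} then g x else 0)"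
    using assms(2) by (auto simp: AE_restrict_space_iff elim: eventually_mono)
  ultimately have "(\<lambda>x. if x \<in> {a<..<b} then g x else 0) \<in> borel_measurable lebesgue"
    by (rule borel_measurable_AE)
  then show ?thesis by (subst (asm) borel_measurable_if) auto
qed

lemma sqint_AE_cong:
  assumes "sqint a b f" "AE x in leb a b. f x = g x"
  shows "sqint a b g"
proof -
  have g: "g \<in> borel_measurable (leb a b)"
    using borel_measurable_leb_AE[OF _ assms(2)] assms(1) unfolding sqint_def by blast
  have "integrable (leb a b) (\<lambda>x. (g x)\<^sup>2)"
    by (rule integrable_cong_AE_imp[of _ "\<lambda>x. (f x)\<^sup>2"])
      (use assms g in \<open>auto simp: sqint_def elim: eventually_mono\<close>)
  then show ?thesis using g by (simp add: sqint_def)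
qed

text \<open>The discriminant criterion, with the sign of \<open>A\<close> left open: a negative
  \<open>A\<close> is refuted by a large \<open>s\<close>, and for \<open>A > 0\<close> the value at
  the minimum \<open>- B / A\<close> gives the claim.\<close>

lemma quadratic_nonneg_imp:
  assumes "\<And>s::real. 0 \<le> A * s\<^sup>2 + 2 * B * s + C"
  shows "B\<^sup>2 \<le> A * C"
proof (cases "A = 0")
  case True
  have "B = 0"
  proof (rule ccontr)
    assume "B \<noteq> 0"
    then show False using assms[of "- (C + 1) / (2 * B)"] True by simp
  qed
  then show ?thesis using True by simp
next
  case False
  have "A \<ge> 0"
  proof (rule ccontr)
    assume "\<not> A \<ge> 0"
    then have "A < 0" by simp
    have "C \<ge> 0" using assms[of 0] by simp
    \<comment> \<open>Chosen so large that \<open>- A * s\<close> exceeds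
      \<open>2 * \<bar>B\<bar> + C + 1\<close>; the quadratic term then outweighs the other
      two.\<close>
    define s where "s = (\<bar>B\<bar> * 2 + C + 1) / (- A) + 1"
    have s1: "s \<ge> 1" using \<open>A < 0\<close> \<open>C \<ge> 0\<close> by (simp add: s_def field_simps)
    have s2: "- A * s \<ge> \<bar>B\<bar> * 2 + C + 1" using \<open>A < 0\<close> by (simp add: s_def field_simps)
    have "A * s\<^sup>2 + 2 * B * s + C \<le> - (\<bar>B\<bar> * 2 + C + 1) * s + 2 * \<bar>B\<bar> * s + C"
    proof -
      have "A * s\<^sup>2 = - (- A * s) * s" by (simp add: power2_eq_square)
      also have "\<dots> \<le> - (\<bar>B\<bar> * 2 + C + 1) * s" using s1 s2 by (intro mult_right_mono) auto
      finally have "A * s\<^sup>2 \<le> - (\<bar>B\<bar> * 2 + C + 1) * s" .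
      moreover have "2 * B * s \<le> 2 * \<bar>B\<bar> * s" using s1 by (intro mult_right_mono) auto
      ultimately show ?thesis by linarith
    qed
    also have "\<dots> = - C * (s - 1) - s" by (simp add: algebra_simps)
    also have "\<dots> < 0" using s1 \<open>C \<ge> 0\<close> by (smt (verit) mult_nonneg_nonneg minus_mult_left)
    finally show False using assms[of s] by simp
  qed
  with False have "A > 0" by simp
  have "0 \<le> A * (A * (- B / A)\<^sup>2 + 2 * B * (- B / A) + C)"
    using assms[of "- B / A"] \<open>A > 0\<close> by simp
  also have "\<dots> = A * C - B\<^sup>2" using \<open>A > 0\<close> by (simp add: power2_eq_square field_simps)
  finally show ?thesis by simp
qed

lemma integral_cauchy_schwarz:
  assumes "sqint a b f" "sqint a b g"
  shows "(LINT x|leb a b. f x * g x)\<^sup>2 \<le> (LINT x|leb a b. (f x)\<^sup>2) * (LINT x|leb a b. (g x)\<^sup>2)"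
proof (rule quadratic_nonneg_imp)
  fix s
  have "0 \<le> (LINT x|leb a b. (s * f x + g x)\<^sup>2)" by simp
  also have "(\<lambda>x. (s * f x + g x)\<^sup>2) = (\<lambda>x. s\<^sup>2 * (f x)\<^sup>2 + (2 * s) * (f x * g x) + (g x)\<^sup>2)"
    by (auto simp: power2_eq_square algebra_simps)
  also have "(LINT x|leb a b. s\<^sup>2 * (f x)\<^sup>2 + (2 * s) * (f x * g x) + (g x)\<^sup>2) =
    s\<^sup>2 * (LINT x|leb a b. (f x)\<^sup>2) + (2 * s) * (LINT x|leb a b. f x * g x) + (LINT x|leb a b. (g x)\<^sup>2)"
    using assms sqint_integrable_mult[OF assms] by (simp add: sqint_def)
  finally show "0 \<le> (LINT x|leb a b. (f x)\<^sup>2) * s\<^sup>2 + 2 * (LINT x|leb a b. f x * g x) * s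
      + (LINT x|leb a b. (g x)\<^sup>2)"
    by (simp add: algebra_simps)
qed

lemma integral_abs_square_le:
  assumes "sqint a b f" "a \<le> b"
  shows "(LINT x|leb a b. \<bar>f x\<bar>)\<^sup>2 \<le> (b - a) * (LINT x|leb a b. (f x)\<^sup>2)"
  using integral_cauchy_schwarz[OF sqint_const[of a b 1] sqint_abs[OF assms(1)]] assms(2) by simp

text \<open>After passing to a Borel version of \<open>f\<close>, its positive and negative parts
  are densities of two finite measures that agree on all half lines. The measures are therefore
  equal, and densities are unique almost everywhere.\<close>

lemma AE_eq_0_if_interval_integrals_eq_0:
  assumes f: "integrable (leb a b) f"
    and z: "\<And>x y. a \<le> x \<Longrightarrow> x \<le> y \<Longrightarrow> y \<le> b \<Longrightarrow> (LINT s|leb x y. f s) = (0::real)"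
  shows "AE x in leb a b. f x = 0"
proof -
  define F where "F = (\<lambda>x. if x \<in> {a<..<b} then f x else 0)"
  have F: "integrable lebesgue F" using f unfolding F_def
    by (subst Lebesgue_Measure.integrable_restrict_UNIV) auto
  then obtain G where G: "G \<in> borel_measurable lborel" "AE x in lborel. F x = G x"
    using completion_ex_borel_measurable_real[of F lborel] by blast
  have Gl: "G \<in> borel_measurable lebesgue" using G(1) by (rule measurable_completion)
  have GA: "AE x in lebesgue. F x = G x" using G(2) by (rule AE_completion)
  have "integrable lebesgue G"
    using integrable_cong_AE_imp[OF F Gl] GA by (auto elim: eventually_mono)
  then have Gi: "integrable lborel G"
    using G(1) by (simp add: integrable_completion)
  have ind: "(indicator {c<..} :: real \<Rightarrow> real) \<in> borel_measurable lebesgue" for c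
    by (intro measurable_completion borel_measurable_indicator) auto
  have GI: "(LINT x|lborel. indicator {c<..} x * G x) = 0" for c
  proof -
    have "(LINT x|lborel. indicator {c<..} x * G x) = (LINT x|lebesgue. indicator {c<..} x * G x)"
      using G by (intro integral_completion[symmetric]) auto
    also have "\<dots> = (LINT x|lebesgue. indicator {c<..} x * F x)"
      using Gl borel_measurable_integrable[OF F] ind GA
      by (intro integral_cong_AE borel_measurable_times) (auto elim: eventually_mono)
    also have "\<dots> = (LINT x|lebesgue. (if x \<in> {max a c<..<b} then f x else 0))"
      by (intro Bochner_Integration.integral_cong) (auto simp: F_def indicator_def)
    also have "\<dots> = (LINT x|leb (max a c) b. f x)"
      by (rule Lebesgue_Measure.integral_restrict_UNIV) auto
    also have "\<dots> = 0" by (cases "max a c \<le> b") (use z[of "max a c" b] in auto)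
    finally show ?thesis .
  qed
  define Gp where "Gp = (\<lambda>x. max 0 (G x))"
  define Gm where "Gm = (\<lambda>x. max 0 (- G x))"
  have Gpi: "integrable lborel Gp" "integrable lborel Gm"
    using Gi by (auto simp: Gp_def Gm_def)
  have Gpb [measurable]: "Gp \<in> borel_measurable borel" "Gm \<in> borel_measurable borel"
    using Gpi by auto
  have em: "emeasure (density lborel (\<lambda>x. ennreal (H x))) {c<..}
      = ennreal (LINT x|lborel. indicator {c<..} x * H x)"
    if H: "integrable lborel H" "\<And>x. H x \<ge> 0" for H :: "real \<Rightarrow> real" and c
  proof -
    have "emeasure (density lborel (\<lambda>x. ennreal (H x))) {c<..} =
        (\<integral>\<^sup>+x. ennreal (H x) * indicator {c<..} x \<partial>lborel)"
      using H by (intro emeasure_density) auto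
    also have "\<dots> = (\<integral>\<^sup>+x. ennreal (indicator {c<..} x * H x) \<partial>lborel)"
      by (intro nn_integral_cong) (auto simp: indicator_def)
    also have "\<dots> = ennreal (LINT x|lborel. indicator {c<..} x * H x)"
      using H integrable_mult_indicator[of "{c<..}" lborel H] by (intro nn_integral_eq_integral) auto
    finally show ?thesis .
  qed
  have "density lborel (\<lambda>x. ennreal (Gp x)) = density lborel (\<lambda>x. ennreal (Gm x))"
  proof (rule measure_eqI_lessThan)
    fix c
    have "(LINT x|lborel. indicator {c<..} x * Gp x) - (LINT x|lborel. indicator {c<..} x * Gm x)
       = (LINT x|lborel. indicator {c<..} x * Gp x - indicator {c<..} x * Gm x)"
      using integrable_mult_indicator[of "{c<..}" lborel Gp] integrable_mult_indicator[of "{c<..}" lborel Gm]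
        Gpi by (intro Bochner_Integration.integral_diff[symmetric]) auto
    also have "\<dots> = (LINT x|lborel. indicator {c<..} x * G x)"
      by (intro Bochner_Integration.integral_cong) (auto simp: Gp_def Gm_def indicator_def)
    finally show "emeasure (density lborel (\<lambda>x. ennreal (Gp x))) {c<..} =
       emeasure (density lborel (\<lambda>x. ennreal (Gm x))) {c<..}"
      using GI[of c] Gpi by (subst (1 2) em) (auto simp: Gp_def Gm_def)
    show "emeasure (density lborel (\<lambda>x. ennreal (Gp x))) {c<..} < \<infinity>"
      using Gpi by (subst em) (auto simp: Gp_def)
  qed auto
  then have "AE x in lborel. ennreal (Gp x) = ennreal (Gm x)"
    by (intro sigma_finite_measure.density_unique[OF sigma_finite_lborel]) auto
  then have "AE x in lborel. F x = 0"
    using G(2) by eventually_elim (auto simp: Gp_def Gm_def max_def split: if_splits)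
  then have "AE x in lebesgue. F x = 0" by (rule AE_completion)
  then show ?thesis by (auto simp: AE_restrict_space_iff F_def elim: eventually_mono)
qed

text \<open>\<open>F\<close> is differentiable only almost everywhere, so \<open>P\<close>, the
  defect of the formula up to \<open>x\<close>, is treated directly. Its increment over
  \<open>[x, y]\<close> is at most \<open>y - x\<close> times a multiple of
  \<open>V y - V x\<close>, where \<open>V\<close> is the continuous variation of \<open>F\<close>.
  Hence \<open>P\<close> has derivative 0 everywhere and is constant.\<close>

lemma integral_by_parts_AC:
  assumes d: "integrable (leb a b) d" and F: "\<And>x. x \<in> {a..b} \<Longrightarrow> F x = F a + (LINT s|leb a x. d s)"
    and G: "\<And>x. x \<in> {a..b} \<Longrightarrow> (G has_real_derivative g x) (at x within {a..b})"
    and g: "continuous_on {a..b} g" and ab: "a \<le> b"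
  shows "(LINT x|leb a b. F x * g x) + (LINT x|leb a b. d x * G x) = F b * G b - F a * (G a :: real)"
proof -
  have Gc: "continuous_on {a..b} G"
    using G by (meson DERIV_continuous continuous_on_eq_continuous_within)
  have "continuous_on {a..b} (\<lambda>x. F a + (LINT s|leb a x. d s))"
    using continuous_on_indefinite_leb[OF d] by (intro continuous_intros)
  then have Fc: "continuous_on {a..b} F"
    by (rule continuous_on_eq) (rule F[symmetric])
  obtain B where B: "\<And>x. x \<in> {a..b} \<Longrightarrow> \<bar>g x\<bar> \<le> B"
    using compact_imp_bounded[OF compact_continuous_image[OF g compact_Icc]]
    unfolding bounded_iff by (metis imageI real_norm_def)
  have B0: "0 \<le> B" using B[of a] ab by auto
  have gi: "integrable (leb a b) g" by (rule integrable_leb_continuous[OF g])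
  have Fgi: "integrable (leb a b) (\<lambda>x. F x * g x)"
    by (intro integrable_leb_continuous continuous_intros Fc g)
  obtain BG where BG: "\<And>x. x \<in> {a..b} \<Longrightarrow> \<bar>G x\<bar> \<le> BG"
    using compact_imp_bounded[OF compact_continuous_image[OF Gc compact_Icc]]
    unfolding bounded_iff by (metis imageI real_norm_def)
  have dGi: "integrable (leb a b) (\<lambda>x. d x * G x)"
  proof (rule Bochner_Integration.integrable_bound)
    show "integrable (leb a b) (\<lambda>x. BG * d x)" using d by simp
    show "(\<lambda>x. d x * G x) \<in> borel_measurable (leb a b)"
      using d integrable_leb_continuous[OF Gc] by (intro borel_measurable_times) auto
    show "AE x in leb a b. norm (d x * G x) \<le> norm (BG * d x)"
    proof (rule AE_I2)
      fix x assume "x \<in> space (leb a b)"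
      then have "\<bar>G x\<bar> \<le> \<bar>BG\<bar>" using BG[of x] by auto
      then show "norm (d x * G x) \<le> norm (BG * d x)"
        by (simp add: abs_mult mult.commute mult_right_mono)
    qed
  qed
  define V where "V x = (LINT s|leb a x. \<bar>d s\<bar>)" for x
  define P where "P x = F x * G x - (LINT s|leb a x. F s * g s + d s * G s)" for x
  have Vc: "continuous_on {a..b} V"
    unfolding V_def using d by (intro continuous_on_indefinite_leb integrable_abs)
  have key: "\<bar>P y - P x\<bar> \<le> (y - x) * (2 * B * (V y - V x))" if xy: "a \<le> x" "x \<le> y" "y \<le> b" for x y
  proof -
    have sub: "integrable (leb x y) h" "integrable (leb a y) h" if "integrable (leb a b) h" for h :: "real \<Rightarrow> real"
      using that xy by (auto intro: integrable_leb_subinterval)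
    have split: "(LINT s|leb a y. h s) = (LINT s|leb a x. h s) + (LINT s|leb x y. h s)"
      if "integrable (leb a b) h" for h :: "real \<Rightarrow> real"
      using integral_leb_combine[OF sub(2)[OF that], of x] xy by simp
    have FD: "F t - F x = (LINT s|leb x t. d s)" if "x \<le> t" "t \<le> y" for t
    proof -
      have "integrable (leb a t) d" using d that xy by (auto intro: integrable_leb_subinterval)
      then show ?thesis using F[of t] F[of x] integral_leb_combine[of a t d x] xy that by simp
    qed
    have GD: "G y - G x = (LINT s|leb x y. g s)"
    proof -
      have "(LINT s|leb x y. g s) = G y - G x"
        using xy by (intro integral_leb_FTC sub gi DERIV_subset[OF G]) auto
      then show ?thesis by simp
    qed
    have VD: "V y - V x = (LINT s|leb x y. \<bar>d s\<bar>)"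
      unfolding V_def using split[of "\<lambda>s. \<bar>d s\<bar>"] d by simp
    have "P y - P x = (F y - F x) * G y + F x * (G y - G x) - (LINT s|leb x y. F s * g s + d s * G s)"
      unfolding P_def using split[of "\<lambda>s. F s * g s + d s * G s"] Fgi dGi by (simp add: algebra_simps)
    also have "\<dots> = (LINT s|leb x y. d s * G y + F x * g s - (F s * g s + d s * G s))"
      using FD[of y] GD xy sub[OF d] sub[OF gi] sub[OF Fgi] sub[OF dGi] by simp
    finally have PD: "P y - P x = (LINT s|leb x y. d s * G y + F x * g s - (F s * g s + d s * G s))" .
    have Glip: "\<bar>G y - G s\<bar> \<le> B * (y - x)" if "s \<in> {x..y}" for s
    proof -
      have "norm (G y - G s) \<le> B * norm (y - s)"
        using that xy B by (intro field_differentiable_bound[of "{s..y}" G g] DERIV_subset[OF G]) auto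
      also have "\<dots> \<le> B * (y - x)" using that B0 by (intro mult_left_mono) auto
      finally show ?thesis by simp
    qed
    have Flip: "\<bar>F s - F x\<bar> \<le> V y - V x" if "s \<in> {x..y}" for s
    proof -
      have i: "integrable (leb x y) (\<lambda>s. \<bar>d s\<bar>)" using sub(1)[OF d] by simp
      have "\<bar>F s - F x\<bar> \<le> (LINT t|leb x s. \<bar>d t\<bar>)"
        using FD[of s] that integral_abs_bound[of "leb x s" d] by simp
      also have "\<dots> \<le> (LINT t|leb x s. \<bar>d t\<bar>) + (LINT t|leb s y. \<bar>d t\<bar>)" by simp
      also have "\<dots> = V y - V x" using integral_leb_combine[OF i, of s] that VD by simp
      finally show ?thesis .
    qed
    have "\<bar>P y - P x\<bar> \<le> (LINT s|leb x y. B * (y - x) * \<bar>d s\<bar> + (V y - V x) * B)"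
      unfolding PD
    proof (rule order.trans[OF integral_abs_bound], rule integral_mono)
      show "integrable (leb x y) (\<lambda>s. \<bar>d s * G y + F x * g s - (F s * g s + d s * G s)\<bar>)"
        using sub[OF d] sub[OF gi] sub[OF Fgi] sub[OF dGi] by simp
      show "integrable (leb x y) (\<lambda>s. B * (y - x) * \<bar>d s\<bar> + (V y - V x) * B)"
        using sub(1)[OF d] by simp
      fix s assume "s \<in> space (leb x y)"
      then have s: "s \<in> {x..y}" by simp
      have "\<bar>d s * G y + F x * g s - (F s * g s + d s * G s)\<bar> = \<bar>d s * (G y - G s) - (F s - F x) * g s\<bar>"
        by (simp add: algebra_simps)
      also have "\<dots> \<le> \<bar>d s * (G y - G s)\<bar> + \<bar>(F s - F x) * g s\<bar>" by (rule abs_triangle_ineq4)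
      also have "\<dots> \<le> \<bar>d s\<bar> * (B * (y - x)) + (V y - V x) * B"
        unfolding abs_mult using Glip[OF s] Flip[OF s] B[of s] s xy
        by (intro add_mono mult_mono) (auto intro: order.trans[OF abs_ge_zero])
      finally show "\<bar>d s * G y + F x * g s - (F s * g s + d s * G s)\<bar> \<le> B * (y - x) * \<bar>d s\<bar> + (V y - V x) * B"
        by (simp add: mult_ac)
    qed
    also have "\<dots> = B * (y - x) * (V y - V x) + (y - x) * ((V y - V x) * B)"
      using sub(1)[OF d] xy VD by simp
    finally show ?thesis by (simp add: algebra_simps)
  qed
  have P': "(P has_real_derivative 0) (at x within {a..b})" if x: "x \<in> {a..b}" for x
    unfolding has_field_derivative_iff
  proof (rule Lim_null_comparison[where g = "\<lambda>y. \<bar>2 * B * (V y - V x)\<bar>"])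
    have "\<bar>(P y - P x) / (y - x)\<bar> \<le> \<bar>2 * B * (V y - V x)\<bar>" if "y \<in> {a..b}" "y \<noteq> x" for y
    proof (cases "x \<le> y")
      case True
      have "\<bar>P y - P x\<bar> \<le> (y - x) * \<bar>2 * B * (V y - V x)\<bar>"
        using key[of x y] True x that by (smt (verit) mult_left_mono atLeastAtMost_iff)
      then show ?thesis using True that by (simp add: abs_divide field_simps)
    next
      case False
      have "\<bar>P x - P y\<bar> \<le> (x - y) * \<bar>2 * B * (V x - V y)\<bar>"
        using key[of y x] False x that by (smt (verit) mult_left_mono atLeastAtMost_iff)
      also have "\<bar>2 * B * (V x - V y)\<bar> = \<bar>2 * B * (V y - V x)\<bar>" by (simp add: abs_mult abs_minus_commute)
      finally have "\<bar>P y - P x\<bar> \<le> \<bar>2 * B * (V y - V x)\<bar> * \<bar>y - x\<bar>"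
        using False by (simp add: abs_minus_commute mult.commute)
      then show ?thesis using that by (simp add: abs_divide pos_divide_le_eq)
    qed
    then show "\<forall>\<^sub>F y in at x within {a..b}. norm ((P y - P x) / (y - x)) \<le> \<bar>2 * B * (V y - V x)\<bar>"
      by (auto simp: eventually_at_filter)
    have "(V \<longlongrightarrow> V x) (at x within {a..b})"
      using Vc x by (simp add: continuous_on_def)
    then have "((\<lambda>y. \<bar>2 * B * (V y - V x)\<bar>) \<longlongrightarrow> \<bar>2 * B * (V x - V x)\<bar>) (at x within {a..b})"
      by (intro tendsto_intros)
    then show "((\<lambda>y. \<bar>2 * B * (V y - V x)\<bar>) \<longlongrightarrow> 0) (at x within {a..b})" by simp
  qed
  obtain z where "\<And>x. x \<in> {a..b} \<Longrightarrow> P x = z"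
    using has_field_derivative_zero_constant[OF convex_real_interval(5) P'] by blast
  then have "P b = P a" using ab by simp
  then show ?thesis using Fgi dGi unfolding P_def by simp
qed

section \<open>Test functions\<close>

definition smooth :: "(real \<Rightarrow> real) \<Rightarrow> bool" where
  "smooth f \<longleftrightarrow> (\<forall>n x. ((deriv ^^ n) f) differentiable (at x))"

lemma real_derivative_imp_differentiable:
  "(f has_real_derivative D) (at x) \<Longrightarrow> f differentiable (at x)"
  by (auto simp: real_differentiable_def)

text \<open>Smoothness is shown by exhibiting a family closed under \<open>deriv\<close>, in place
  of a formula for the n-th derivative.\<close>

lemma smooth_coinduct:
  assumes "f \<in> S" "\<And>f x. f \<in> S \<Longrightarrow> f differentiable (at x)" "\<And>f. f \<in> S \<Longrightarrow> deriv f \<in> S"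
  shows "smooth f"
proof -
  have "(deriv ^^ n) f \<in> S" for n by (induction n) (use assms in auto)
  then show ?thesis using assms by (simp add: smooth_def)
qed

lemma smooth_imp_differentiable: "smooth f \<Longrightarrow> f differentiable (at x)"
  unfolding smooth_def by (metis funpow_0)

lemma smooth_deriv: "smooth f \<Longrightarrow> smooth (deriv f)"
  unfolding smooth_def by (metis funpow_Suc_right comp_apply)

lemma smooth_has_derivative: "smooth f \<Longrightarrow> (f has_real_derivative deriv f x) (at x)"
  using smooth_imp_differentiable DERIV_deriv_iff_real_differentiable by blast

lemma smooth_continuous: "smooth f \<Longrightarrow> continuous_on A f"
  using smooth_has_derivative by (meson DERIV_isCont continuous_at_imp_continuous_on)

lemma smoothI:
  assumes "\<And>x. (f has_real_derivative g x) (at x)" "smooth g"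
  shows "smooth f"
proof -
  have "deriv f = g" using assms(1) by (auto intro: DERIV_imp_deriv)
  then show ?thesis
    using assms by (intro smooth_coinduct[of f "insert f {g. smooth g}"])
      (auto intro: smooth_imp_differentiable smooth_deriv real_derivative_imp_differentiable)
qed

lemma smooth_const [simp]: "smooth (\<lambda>x. c)"
  by (rule smooth_coinduct[of _ "{f. \<exists>c. f = (\<lambda>x. c)}"]) auto

text \<open>Sums of products form a family closed under \<open>deriv\<close> by the product rule.
  With constant factors it also covers differences.\<close>

inductive_set smooth_prods :: "(real \<Rightarrow> real) set" where
  mult: "smooth f \<Longrightarrow> smooth g \<Longrightarrow> (\<lambda>x. f x * g x) \<in> smooth_prods"
| add: "f \<in> smooth_prods \<Longrightarrow> g \<in> smooth_prods \<Longrightarrow> (\<lambda>x. f x + g x) \<in> smooth_prods"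

lemma smooth_prods_deriv:
  "h \<in> smooth_prods \<Longrightarrow> \<exists>h'\<in>smooth_prods. \<forall>x. (h has_real_derivative h' x) (at x)"
proof (induction rule: smooth_prods.induct)
  case (mult f g)
  have "(\<lambda>x. deriv f x * g x + deriv g x * f x) \<in> smooth_prods"
    by (intro smooth_prods.intros smooth_deriv mult)
  moreover have "((\<lambda>x. f x * g x) has_real_derivative deriv f x * g x + deriv g x * f x) (at x)" for x
    by (intro DERIV_mult smooth_has_derivative mult)
  ultimately show ?case by (intro bexI allI)
next
  case (add f g)
  then obtain f' g' where *: "f' \<in> smooth_prods" "g' \<in> smooth_prods"
    "\<And>x. (f has_real_derivative f' x) (at x)" "\<And>x. (g has_real_derivative g' x) (at x)" by blast
  have "(\<lambda>x. f' x + g' x) \<in> smooth_prods" using * by (intro smooth_prods.intros)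
  moreover have "((\<lambda>x. f x + g x) has_real_derivative f' x + g' x) (at x)" for x
    using * by (intro DERIV_add)
  ultimately show ?case by (intro bexI allI)
qed

lemma smooth_prods_smooth: "h \<in> smooth_prods \<Longrightarrow> smooth h"
proof (rule smooth_coinduct[of h smooth_prods])
  fix h x assume "h \<in> smooth_prods"
  then obtain h' where h': "h' \<in> smooth_prods" "\<And>x. (h has_real_derivative h' x) (at x)"
    using smooth_prods_deriv by blast
  then show "h differentiable (at x)" by (auto intro: real_derivative_imp_differentiable)
  have "deriv h = h'" using h' by (auto intro: DERIV_imp_deriv)
  then show "deriv h \<in> smooth_prods" using h' by simp
qed

lemma smooth_mult: "smooth f \<Longrightarrow> smooth g \<Longrightarrow> smooth (\<lambda>x. f x * g x)"
  by (rule smooth_prods_smooth, rule smooth_prods.mult)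

lemma smooth_diff: "smooth f \<Longrightarrow> smooth g \<Longrightarrow> smooth (\<lambda>x. f x - g x)"
  using smooth_prods_smooth[OF smooth_prods.add[OF smooth_prods.mult smooth_prods.mult],
      of f "\<lambda>x. 1" "\<lambda>x. -1" g] by simp

text \<open>All functions \<open>c * f (\<alpha> * x + \<beta>)\<close> form a family closed under
  \<open>deriv\<close>: each differentiation multiplies \<open>c\<close> by
  \<open>\<alpha>\<close>.\<close>

lemma smooth_affine:
  assumes "smooth f" shows "smooth (\<lambda>x. f (\<alpha> * x + \<beta>))"
proof -
  have d: "((\<lambda>x. c * f (\<alpha> * x + \<beta>)) has_real_derivative (c * \<alpha>) * deriv f (\<alpha> * x + \<beta>)) (at x)"
    if "smooth f" for c f x
    by (rule derivative_eq_intros DERIV_chain2[OF smooth_has_derivative[OF that]] refl)+ simp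
  have "smooth (\<lambda>x. 1 * f (\<alpha> * x + \<beta>))"
  proof (rule smooth_coinduct[of _ "{h. \<exists>c f. smooth f \<and> h = (\<lambda>x. c * f (\<alpha> * x + \<beta>))}"])
    show "(\<lambda>x. 1 * f (\<alpha> * x + \<beta>)) \<in> {h. \<exists>c f. smooth f \<and> h = (\<lambda>x. c * f (\<alpha> * x + \<beta>))}"
      using assms by blast
  next
    fix h x assume "h \<in> {h. \<exists>c f. smooth f \<and> h = (\<lambda>x. c * f (\<alpha> * x + \<beta>))}"
    then obtain c f where f: "smooth f" "h = (\<lambda>x. c * f (\<alpha> * x + \<beta>))" by blast
    show "h differentiable (at x)" unfolding f using d[OF f(1)] by (rule real_derivative_imp_differentiable)
    have "deriv h = (\<lambda>x. (c * \<alpha>) * deriv f (\<alpha> * x + \<beta>))"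
      unfolding f using d[OF f(1)] by (auto intro!: DERIV_imp_deriv)
    then show "deriv h \<in> {h. \<exists>c f. smooth f \<and> h = (\<lambda>x. c * f (\<alpha> * x + \<beta>))}"
      using smooth_deriv[OF f(1)] by blast
  qed
  then show ?thesis by simp
qed

text \<open>\<open>flat 1\<close> is the standard smooth function that is flat at 0. The polynomial
  in \<open>1 / x\<close> makes the family closed under differentiation.\<close>

definition flat :: "real poly \<Rightarrow> real \<Rightarrow> real" where
  "flat p x = (if x > 0 then poly p (1 / x) * exp (- (1 / x)) else 0)"

lemma poly_times_exp_tendsto_0: "((\<lambda>t. poly p t * exp (- t)) \<longlongrightarrow> (0::real)) at_top"
proof -
  have "((\<lambda>t. \<Sum>i\<le>degree p. coeff p i * (t ^ i / exp t)) \<longlongrightarrow> (\<Sum>i\<le>degree p. coeff p i * 0)) at_top"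
    by (intro tendsto_intros tendsto_power_div_exp_0)
  moreover have "(\<lambda>t. \<Sum>i\<le>degree p. coeff p i * (t ^ i / exp t)) = (\<lambda>t. poly p t * exp (- t))"
    by (simp add: poly_altdef exp_minus divide_inverse sum_distrib_right mult.assoc)
  ultimately show ?thesis by simp
qed

lemma flat_tendsto_0: "((\<lambda>x. poly p (1 / x) * exp (- (1 / x))) \<longlongrightarrow> (0::real)) (at_right 0)"
  using filterlim_compose[OF poly_times_exp_tendsto_0[of p] filterlim_inverse_at_top_right]
  by (simp add: inverse_eq_divide)

text \<open>In the variable \<open>t = 1 / x\<close>, differentiation in \<open>x\<close> is
  \<open>- t^2\<close> times differentiation in \<open>t\<close>, which turns \<open>p\<close> into
  \<open>t^2 (p - p')\<close>. At 0 the decay of the exponential decides.\<close>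

lemma flat_has_derivative:
  "(flat p has_real_derivative flat ([:0, 0, 1:] * (p - pderiv p)) x) (at x)"
proof -
  consider "x < 0" | "x = 0" | "x > 0" by linarith
  then show ?thesis
  proof cases
    case 1
    have "((\<lambda>x. 0) has_real_derivative 0) (at x)" by simp
    then have "(flat p has_real_derivative 0) (at x)"
      by (rule has_field_derivative_transform_within_open[of _ _ _ "{..<0}"]) (use 1 in \<open>auto simp: flat_def\<close>)
    then show ?thesis using 1 by (simp add: flat_def)
  next
    case 3
    have "((\<lambda>x. poly p (1 / x) * exp (- (1 / x))) has_real_derivative
        poly (pderiv p) (1 / x) * (- 1 / x\<^sup>2) * exp (- (1 / x)) + exp (- (1 / x)) * (1 / x\<^sup>2) * poly p (1 / x)) (at x)"
      using 3 by (auto intro!: derivative_eq_intros simp: power2_eq_square)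
    then have "(flat p has_real_derivative
        poly (pderiv p) (1 / x) * (- 1 / x\<^sup>2) * exp (- (1 / x)) + exp (- (1 / x)) * (1 / x\<^sup>2) * poly p (1 / x)) (at x)"
      by (rule has_field_derivative_transform_within_open[of _ _ _ "{0<..}"]) (use 3 in \<open>auto simp: flat_def\<close>)
    moreover have "poly (pderiv p) (1 / x) * (- 1 / x\<^sup>2) * exp (- (1 / x)) + exp (- (1 / x)) * (1 / x\<^sup>2) * poly p (1 / x)
        = flat ([:0, 0, 1:] * (p - pderiv p)) x"
      using 3 by (simp add: flat_def power2_eq_square algebra_simps)
    ultimately show ?thesis by simp
  next
    case 2
    \<comment> \<open>Dividing by \<open>y\<close> multiplies the polynomial by its variable, so the
      difference quotient at 0 is again of the form \<open>flat\<close>.\<close>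
    have "((\<lambda>y. flat p y / y) \<longlongrightarrow> 0) (at_right 0)"
    proof (rule Lim_transform_eventually[OF flat_tendsto_0[of "[:0, 1:] * p"]])
      show "\<forall>\<^sub>F y in at_right 0. poly ([:0, 1:] * p) (1 / y) * exp (- (1 / y)) = flat p y / y"
        by (auto simp: eventually_at_filter flat_def)
    qed
    moreover have "((\<lambda>y. flat p y / y) \<longlongrightarrow> 0) (at_left 0)"
      by (rule Lim_transform_eventually[OF tendsto_const]) (auto simp: eventually_at_filter flat_def)
    ultimately have "((\<lambda>y. flat p y / y) \<longlongrightarrow> 0) (at 0)" by (simp add: filterlim_split_at)
    then show ?thesis using 2 by (simp add: has_field_derivative_iff flat_def)
  qed
qed

lemma smooth_flat: "smooth (flat p)"
proof (rule smooth_coinduct[of _ "range flat"])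
  fix f x assume "f \<in> range flat"
  then obtain p where f: "f = flat p" by blast
  show "f differentiable (at x)" unfolding f using flat_has_derivative by (rule real_derivative_imp_differentiable)
  have "deriv f = flat ([:0, 0, 1:] * (p - pderiv p))"
    unfolding f using flat_has_derivative by (auto intro!: DERIV_imp_deriv)
  then show "deriv f \<in> range flat" by blast
qed simp

definition bump :: "real \<Rightarrow> real" where "bump x = flat 1 x * flat 1 (- 1 * x + 1)"

lemma smooth_bump: "smooth bump"
  unfolding bump_def[abs_def] by (intro smooth_mult smooth_flat smooth_affine)

lemma bump_nonneg: "0 \<le> bump x" and bump_eq_0: "x \<notin> {0..1} \<Longrightarrow> bump x = 0" and bump_pos: "0 < bump (1 / 2)"
  by (auto simp: bump_def flat_def)

text \<open>The base point \<open>p - 1\<close> lies strictly to the left of the support. Therefore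
  \<open>p\<close> itself is interior to the interval of integration and has a two-sided
  derivative.\<close>

lemma antiderivative:
  fixes p q :: real
  assumes f: "smooth f" and z': "\<forall>x. x \<notin> {p..q} \<longrightarrow> f x = 0" and pq: "p \<le> q"
  defines "F \<equiv> \<lambda>x. integral {p - 1..x} f"
  shows "(F has_real_derivative f x) (at x)" "smooth F" "x \<le> p \<Longrightarrow> F x = 0" "q \<le> x \<Longrightarrow> F x = F q"
proof -
  have z: "f x = 0" if "x \<notin> {p..q}" for x using z' that by blast
  have c: "continuous_on A f" for A by (rule smooth_continuous[OF f])
  have i: "f integrable_on {s..t}" for s t by (rule integrable_continuous_real[OF c])
  have fp: "f p = 0"
  proof -
    have "(f \<longlongrightarrow> f p) (at_left p)" using c[of UNIV] by (simp add: continuous_on_def tendsto_within_subset[of f _ p UNIV])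
    moreover have "(f \<longlongrightarrow> 0) (at_left p)"
      by (rule Lim_transform_eventually[OF tendsto_const]) (auto simp: eventually_at_filter z)
    ultimately show ?thesis using tendsto_unique trivial_limit_at_left_real by blast
  qed
  have F0: "F x = 0" if "x \<le> p" for x
  proof -
    have "integral {p - 1..x} f = integral {p - 1..x} (\<lambda>_. 0)"
    proof (rule integral_cong)
      fix y assume "y \<in> {p - 1..x}"
      then show "f y = 0" using that z[of y] fp by (cases "y = p") auto
    qed
    then show ?thesis by (simp add: F_def)
  qed
  show d: "(F has_real_derivative f x) (at x)" for x
  proof (cases "x < p")
    case True
    have "((\<lambda>x. 0) has_real_derivative 0) (at x)" by simp
    then have "(F has_real_derivative 0) (at x)"
      by (rule has_field_derivative_transform_within_open[of _ _ _ "{..<p}"]) (use True F0 in auto)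
    then show ?thesis using True z[of x] by simp
  next
    case False
    have "(F has_real_derivative f x) (at x within {p - 1..x + 1})"
      unfolding F_def by (rule integral_has_real_derivative[OF c]) (use False in auto)
    then have "(F has_real_derivative f x) (at x within {p - 1<..<x + 1})"
      by (rule DERIV_subset) auto
    moreover have "at x within {p - 1<..<x + 1} = at x"
      by (rule at_within_open) (use False in auto)
    ultimately show ?thesis by simp
  qed
  show "smooth F" by (rule smoothI[OF d f])
  show "x \<le> p \<Longrightarrow> F x = 0" by (rule F0)
  assume qx: "q \<le> x"
  have "F x = F q + integral {q..x} f"
    unfolding F_def using pq qx i by (simp add: Henstock_Kurzweil_Integration.integral_combine)
  moreover have "integral {q..x} f = 0"
  proof -
    have "f q = 0"
    proof -
      have "(f \<longlongrightarrow> f q) (at_right q)" using c[of UNIV] by (simp add: continuous_on_def tendsto_within_subset[of f _ q UNIV])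
      moreover have "(f \<longlongrightarrow> 0) (at_right q)"
        by (rule Lim_transform_eventually[OF tendsto_const]) (auto simp: eventually_at_filter z)
      ultimately show ?thesis using tendsto_unique trivial_limit_at_right_real by blast
    qed
    note fq = this
    have "integral {q..x} f = integral {q..x} (\<lambda>_. 0)"
    proof (rule integral_cong)
      fix y assume "y \<in> {q..x}"
      then show "f y = 0" using z[of y] fq by (cases "y = q") auto
    qed
    then show ?thesis by simp
  qed
  ultimately show "F x = F q" by simp
qed

text \<open>The lower limit -1 is the base point \<open>p - 1\<close> of
  \<open>antiderivative\<close> for the support \<open>{0..1}\<close> of
  \<open>bump\<close>.\<close>

definition step :: "real \<Rightarrow> real" where "step x = integral {- 1..x} bump / integral {- 1..1} bump"

lemma step_props: "smooth step" "x \<le> 0 \<Longrightarrow> step x = 0" "1 \<le> x \<Longrightarrow> step x = 1" "0 \<le> step x" "step x \<le> 1"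
proof -
  let ?F = "\<lambda>x. integral {0 - 1..x} bump"
  have z: "\<forall>x. x \<notin> {0..1} \<longrightarrow> bump x = 0" using bump_eq_0 by blast
  note A = antiderivative[OF smooth_bump z, simplified]
  have c: "continuous_on A bump" for A by (rule smooth_continuous[OF smooth_bump])
  have mono: "integral {-1..x} bump \<le> integral {-1..y} bump" if "x \<le> y" for x y
  proof (rule integral_subset_le)
    show "bump integrable_on {- 1..x}" "bump integrable_on {- 1..y}"
      by (rule integrable_continuous_real[OF c])+
  qed (use that bump_nonneg in auto)
  have pos: "0 < integral {- 1..1} bump"
  proof -
    have "integral {- 1..1} bump \<noteq> 0"
      using bump_pos bump_nonneg c by (subst integral_eq_0_iff) (auto intro!: bexI[of _ "1/2"])
    moreover have "0 \<le> integral {- 1..1} bump"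
      using bump_nonneg by (intro integral_nonneg integrable_continuous_real c) auto
    ultimately show ?thesis by simp
  qed
  have "smooth (\<lambda>x. 1 / integral {- 1..1} bump * integral {- 1..x} bump)"
    by (intro smooth_mult smooth_const A)
  then show "smooth step" unfolding step_def[abs_def] by simp
  show "x \<le> 0 \<Longrightarrow> step x = 0" using A(3)[of x] by (simp add: step_def)
  show one: "1 \<le> x \<Longrightarrow> step x = 1" for x using A(4)[of x] pos by (simp add: step_def)
  show "0 \<le> step x"
    using pos bump_nonneg unfolding step_def
    by (intro divide_nonneg_nonneg integral_nonneg integrable_continuous_real c) auto
  have "step x \<le> step (max x 1)"
    unfolding step_def using pos mono[of x "max x 1"] by (intro divide_right_mono) auto
  then show "step x \<le> 1" using one[of "max x 1"] by simp
qed

section \<open>The fundamental lemma of the calculus of variations\<close>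

lemma test_function_iff:
  "test_function a b \<phi> \<longleftrightarrow> smooth \<phi> \<and> (\<exists>p q. a < p \<and> p \<le> q \<and> q < b \<and> (\<forall>x. x \<notin> {p..q} \<longrightarrow> \<phi> x = 0))"
  if ab: "a < b"
proof
  assume t: "test_function a b \<phi>"
  then obtain K where K: "compact K" "K \<subseteq> {a<..<b}" "\<And>x. x \<notin> K \<Longrightarrow> \<phi> x = 0"
    unfolding test_function_def by blast
  have "\<exists>p q. a < p \<and> p \<le> q \<and> q < b \<and> (\<forall>x. x \<notin> {p..q} \<longrightarrow> \<phi> x = 0)"
  proof (cases "K = {}")
    case True
    obtain p where "a < p" "p < b" using dense[OF ab] by blast
    then show ?thesis using K(3) True by auto
  next
    case False
    obtain p where p: "p \<in> K" "\<And>x. x \<in> K \<Longrightarrow> p \<le> x" using compact_attains_inf[OF K(1) False] by blast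
    obtain q where q: "q \<in> K" "\<And>x. x \<in> K \<Longrightarrow> x \<le> q" using compact_attains_sup[OF K(1) False] by blast
    have "a < p" "q < b" using p(1) q(1) K(2) by auto
    moreover have "p \<le> q" using p q by blast
    moreover have "\<phi> x = 0" if "x \<notin> {p..q}" for x
      using K(3)[of x] p(2)[of x] q(2)[of x] that by auto
    ultimately show ?thesis by blast
  qed
  then show "smooth \<phi> \<and> (\<exists>p q. a < p \<and> p \<le> q \<and> q < b \<and> (\<forall>x. x \<notin> {p..q} \<longrightarrow> \<phi> x = 0))"
    using t by (auto simp: test_function_def smooth_def)
next
  assume "smooth \<phi> \<and> (\<exists>p q. a < p \<and> p \<le> q \<and> q < b \<and> (\<forall>x. x \<notin> {p..q} \<longrightarrow> \<phi> x = 0))"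
  then obtain p q where "smooth \<phi>" "a < p" "p \<le> q" "q < b" "\<forall>x. x \<notin> {p..q} \<longrightarrow> \<phi> x = 0" by blast
  then show "test_function a b \<phi>"
    unfolding test_function_def smooth_def by (intro conjI exI[of _ "{p..q}"]) auto
qed

lemma test_function_continuous: "test_function a b \<phi> \<Longrightarrow> continuous_on A \<phi>"
  by (rule smooth_continuous) (simp add: test_function_def smooth_def)

lemma test_function_deriv:
  assumes "test_function a b \<phi>" shows "test_function a b (deriv \<phi>)"
proof (cases "a < b")
  case True
  then obtain p q where *: "smooth \<phi>" "a < p" "p \<le> q" "q < b" "\<And>x. x \<notin> {p..q} \<Longrightarrow> \<phi> x = 0"
    using assms test_function_iff by blast
  have "deriv \<phi> x = 0" if "x \<notin> {p..q}" for x
  proof (rule DERIV_imp_deriv)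
    have "((\<lambda>x. 0) has_real_derivative 0) (at x)" by simp
    then show "(\<phi> has_real_derivative 0) (at x)"
      by (rule has_field_derivative_transform_within_open[of _ _ _ "- {p..q}"])
        (use that * in \<open>auto intro: open_Compl\<close>)
  qed
  then show ?thesis using * smooth_deriv unfolding test_function_iff[OF True] by blast
next
  case False
  then have 0: "\<phi> x = 0" for x using assms unfolding test_function_def by force
  then have "\<phi> = (\<lambda>x. 0)" by auto
  then have "deriv \<phi> = \<phi>" by simp
  then show ?thesis using assms by simp
qed

text \<open>Test functions approximate the indicator of every inner interval boundedly and
  pointwise, so the integral of \<open>h\<close> over it vanishes. The indefinite integral
  \<open>H\<close> is then constant inside, and by continuity up to the endpoints.\<close>

lemma AE_eq_0_if_test_integrals_eq_0:
  assumes h: "integrable (leb a b) h" and ab: "a < b"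
    and z: "\<And>\<phi>. test_function a b \<phi> \<Longrightarrow> (LINT x|leb a b. h x * \<phi> x) = 0"
  shows "AE x in leb a b. h x = (0::real)"
proof -
  define H where "H x = (LINT s|leb a x. h s)" for x
  have inner: "(LINT x|leb p q. h x) = 0" if pq: "a < p" "p < q" "q < b" for p q
  proof -
    \<comment> \<open>Rises from 0 to 1 on \<open>[p, p + 1/n]\<close> and falls back on
      \<open>[q - 1/n, q]\<close>. Once \<open>n * (q - p) > 1\<close> the support lies in
      \<open>{p..q}\<close>.\<close>
    define cf where "cf n x = step (real n * x + - (real n * p)) - step (real n * x + (1 - real n * q))" for n x
    have "(\<lambda>n. LINT x|leb a b. h x * cf n x) \<longlonglongrightarrow> (LINT x|leb a b. (if x \<in> {p<..<q} then h x else 0))"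
    proof (rule integral_dominated_convergence[where w = "\<lambda>x. \<bar>h x\<bar>"])
      have m: "cf n \<in> borel_measurable (leb a b)" for n
      proof -
        have "continuous_on {a..b} (cf n)"
          unfolding cf_def by (intro smooth_continuous smooth_diff smooth_affine step_props)
        then show ?thesis using integrable_leb_continuous by auto
      qed
      show "(\<lambda>x. h x * cf n x) \<in> borel_measurable (leb a b)" for n
        using h m by (intro borel_measurable_times) auto
      show "(\<lambda>x. if x \<in> {p<..<q} then h x else 0) \<in> borel_measurable (leb a b)"
        using borel_measurable_integrable[OF h] by (intro measurable_If_set measurable_const)
          (auto simp: sets_restrict_space)
      show "integrable (leb a b) (\<lambda>x. \<bar>h x\<bar>)" using h by simp
      have "\<bar>cf n x\<bar> \<le> 1" for n x
        using step_props(4,5)[of "real n * x + - (real n * p)"] step_props(4,5)[of "real n * x + (1 - real n * q)"]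
        by (simp add: cf_def)
      then show "AE x in leb a b. norm (h x * cf n x) \<le> \<bar>h x\<bar>" for n
        by (intro AE_I2) (simp add: abs_mult mult_left_le)
      show "AE x in leb a b. (\<lambda>n. h x * cf n x) \<longlonglongrightarrow> (if x \<in> {p<..<q} then h x else 0)"
      proof (rule AE_I2)
        fix x
        obtain n0 :: nat where n0: "real n0 * (if x \<le> p then q - p else if q \<le> x then q - p else min (x - p) (q - x)) > 1"
          using pq by (atomize_elim, intro ex_less_of_nat_mult) (auto simp: min_def)
        have "cf n x = (if x \<in> {p<..<q} then 1 else 0)" if n: "n \<ge> n0" for n
        proof -
          have ge: "real n * y > 1" if "real n0 * y > 1" "y > 0" for y
            using that n by (smt (verit) mult_right_mono of_nat_mono)
          consider "x \<le> p" | "q \<le> x" | "p < x" "x < q" by linarith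
          then show ?thesis
          proof cases
            case 1
            have "real n * (q - p) > 1" using ge n0 1 pq by simp
            moreover have "real n * x \<le> real n * p" using 1 by (intro mult_left_mono) auto
            ultimately show ?thesis using 1 by (simp add: cf_def step_props(2) algebra_simps)
          next
            case 2
            have "real n * (q - p) > 1" using ge n0 2 pq by simp
            moreover have "real n * q \<le> real n * x" using 2 by (intro mult_left_mono) auto
            ultimately show ?thesis using 2 by (simp add: cf_def step_props(3) algebra_simps)
          next
            case 3
            have "real n0 * min (x - p) (q - x) > 1" using n0 3 by simp
            then have "real n * min (x - p) (q - x) > 1" using ge 3 by simp
            moreover have "real n * min (x - p) (q - x) \<le> real n * (x - p)"
              "real n * min (x - p) (q - x) \<le> real n * (q - x)" by (intro mult_left_mono; simp)+
            ultimately show ?thesis using 3 by (simp add: cf_def step_props(2,3) algebra_simps)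
          qed
        qed
        then have "\<forall>\<^sub>F n in sequentially. (if x \<in> {p<..<q} then h x else 0) = h x * cf n x"
          unfolding eventually_sequentially by (intro exI[of _ n0]) auto
        then show "(\<lambda>n. h x * cf n x) \<longlonglongrightarrow> (if x \<in> {p<..<q} then h x else 0)"
          by (rule Lim_transform_eventually[OF tendsto_const])
      qed
    qed
    moreover have "\<forall>\<^sub>F n in sequentially. (LINT x|leb a b. h x * cf n x) = 0"
    proof -
      obtain n0 :: nat where n0: "real n0 * (q - p) > 1"
        using pq by (atomize_elim, intro ex_less_of_nat_mult) auto
      have "test_function a b (cf n)" if "n \<ge> n0" for n
      proof -
        have n: "real n * (q - p) > 1"
          using n0 that pq by (smt (verit) mult_right_mono of_nat_mono)
        have "cf n x = 0" if "x \<notin> {p..q}" for x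
        proof (cases "x \<le> p")
          case True
          have "real n * x \<le> real n * p" using True by (intro mult_left_mono) auto
          then show ?thesis using n by (simp add: cf_def step_props(2) algebra_simps)
        next
          case False
          have "real n * q \<le> real n * x" using False that by (intro mult_left_mono) auto
          then show ?thesis using n by (simp add: cf_def step_props(3) algebra_simps)
        qed
        moreover have "smooth (cf n)" unfolding cf_def by (intro smooth_diff smooth_affine step_props)
        ultimately show ?thesis unfolding test_function_iff[OF ab] using pq less_imp_le by blast
      qed
      then show ?thesis unfolding eventually_sequentially using z by blast
    qed
    then have "(\<lambda>n. LINT x|leb a b. h x * cf n x) \<longlonglongrightarrow> 0"
      by (intro Lim_transform_eventually[OF tendsto_const]) (auto elim: eventually_mono)
    ultimately have "(LINT x|leb a b. (if x \<in> {p<..<q} then h x else 0)) = 0"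
      by (rule LIMSEQ_unique)
    moreover have "(LINT x|leb a b. (if x \<in> {p<..<q} then h x else 0)) = (LINT x|leb p q. h x)"
      by (rule Lebesgue_Measure.integral_restrict) (use pq in auto)
    ultimately show ?thesis by simp
  qed
  have Hdiff: "(LINT s|leb x y. h s) = H y - H x" if "a \<le> x" "x \<le> y" "y \<le> b" for x y
  proof -
    have "integrable (leb a y) h" using h that by (auto intro: integrable_leb_subinterval)
    then show ?thesis unfolding H_def using integral_leb_combine[of a y h x] that by simp
  qed
  have Hc: "continuous_on {a..b} H" unfolding H_def by (rule continuous_on_indefinite_leb[OF h])
  define c where "c = (a + b) / 2"
  have "H x = H c" if "x \<in> {a<..<b}" for x
  proof -
    have c: "a < c" "c < b" using ab by (auto simp: c_def)
    consider "x < c" | "x = c" | "c < x" by linarith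
    then show ?thesis
      using inner[of x c] inner[of c x] Hdiff[of x c] Hdiff[of c x] that c by cases auto
  qed
  then have "H x = H c" if "x \<in> {a..b}" for x
    using continuous_constant_on_closure[of "{a<..<b}" H "H c" x] Hc ab that by simp
  then show ?thesis
    using Hdiff by (intro AE_eq_0_if_interval_integrals_eq_0[OF h]) auto
qed

text \<open>By integration by parts, \<open>h\<close>, the difference of \<open>f\<close> and the
  indefinite integral of \<open>d\<close>, is orthogonal to all derivatives of test functions. Such
  derivatives are exactly the test functions of mean zero, so \<open>h\<close> minus a suitable
  constant is orthogonal to all test functions.\<close>

lemma du_Bois_Reymond:
  assumes f: "integrable (leb a b) f" and d: "integrable (leb a b) d" and ab: "a < b"
    and w: "\<And>\<phi>. test_function a b \<phi> \<Longrightarrow> (LINT x|leb a b. f x * deriv \<phi> x) = - (LINT x|leb a b. d x * \<phi> x)"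
  obtains c :: real where "AE x in leb a b. f x = c + (LINT s|leb a x. d s)"
proof -
  define F where "F x = (LINT s|leb a x. d s)" for x
  have Fc: "continuous_on {a..b} F" unfolding F_def by (rule continuous_on_indefinite_leb[OF d])
  define h where "h x = f x - F x" for x
  have hi: "integrable (leb a b) h"
    unfolding h_def using f integrable_leb_continuous[OF Fc] by simp
  have mult_i: "integrable (leb a b) (\<lambda>x. k x * \<phi> x)"
    if k: "integrable (leb a b) k" and "test_function a b \<phi>" for k \<phi> :: "real \<Rightarrow> real"
  proof -
    have c: "continuous_on {a..b} \<phi>" using that test_function_continuous by blast
    obtain B where B: "\<And>x. x \<in> {a..b} \<Longrightarrow> \<bar>\<phi> x\<bar> \<le> B"
      using compact_imp_bounded[OF compact_continuous_image[OF c compact_Icc]]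
      unfolding bounded_iff by (metis imageI real_norm_def)
    show ?thesis
    proof (rule Bochner_Integration.integrable_bound)
      show "integrable (leb a b) (\<lambda>x. B * k x)" using k by simp
      show "(\<lambda>x. k x * \<phi> x) \<in> borel_measurable (leb a b)"
        using k integrable_leb_continuous[OF c] by (intro borel_measurable_times) auto
      show "AE x in leb a b. norm (k x * \<phi> x) \<le> norm (B * k x)"
      proof (rule AE_I2)
        fix x assume "x \<in> space (leb a b)"
        then have "\<bar>\<phi> x\<bar> \<le> \<bar>B\<bar>" using B[of x] by auto
        then show "norm (k x * \<phi> x) \<le> norm (B * k x)"
          by (simp add: abs_mult mult.commute mult_right_mono)
      qed
    qed
  qed
  have h0: "(LINT x|leb a b. h x * deriv \<phi> x) = 0" if t: "test_function a b \<phi>" for \<phi>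
  proof -
    obtain p q where *: "smooth \<phi>" "a < p" "p \<le> q" "q < b" "\<And>x. x \<notin> {p..q} \<Longrightarrow> \<phi> x = 0"
      using t test_function_iff[OF ab] by blast
    have "(LINT x|leb a b. F x * deriv \<phi> x) + (LINT x|leb a b. d x * \<phi> x) = F b * \<phi> b - F a * \<phi> a"
    proof (rule integral_by_parts_AC[OF d])
      show "(\<phi> has_real_derivative deriv \<phi> x) (at x within {a..b})" for x
        using smooth_has_derivative[OF *(1)] by (rule DERIV_subset) simp
      show "continuous_on {a..b} (deriv \<phi>)" by (intro smooth_continuous smooth_deriv *)
    qed (use ab in \<open>auto simp: F_def\<close>)
    moreover have "\<phi> a = 0" "\<phi> b = 0" using * by auto
    ultimately show ?thesis
      using w[OF t] mult_i[OF f test_function_deriv[OF t]]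
        mult_i[OF integrable_leb_continuous[OF Fc] test_function_deriv[OF t]]
      by (simp add: h_def left_diff_distrib)
  qed
  define p where "p = a + (b - a) / 3"
  define q where "q = a + 2 * (b - a) / 3"
  have pq: "a < p" "p < q" "q < b" using ab by (auto simp: p_def q_def field_simps)
  define \<psi>0 where "\<psi>0 x = bump (1 / (q - p) * x + - p / (q - p))" for x
  have \<psi>0s: "smooth \<psi>0" unfolding \<psi>0_def by (intro smooth_affine smooth_bump)
  have \<psi>0z: "\<psi>0 x = 0" if "x \<notin> {p..q}" for x
    unfolding \<psi>0_def
  proof (rule bump_eq_0)
    have "1 / (q - p) * x + - p / (q - p) = (x - p) / (q - p)" by (simp add: diff_divide_distrib)
    then show "1 / (q - p) * x + - p / (q - p) \<notin> {0..1}" using that pq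
      by (auto simp: zero_le_divide_iff divide_le_eq_1)
  qed
  have \<psi>0m: "0 < \<psi>0 ((p + q) / 2)"
  proof -
    have "1 / (q - p) * y + - p / (q - p) = (y - p) / (q - p)" for y
      by (simp add: diff_divide_distrib)
    then have "1 / (q - p) * ((p + q) / 2) + - p / (q - p) = ((p + q) / 2 - p) / (q - p)" .
    also have "(p + q) / 2 - p = (q - p) / 2" by (simp add: field_simps)
    also have "(q - p) / 2 / (q - p) = 1 / 2" using pq by simp
    finally show ?thesis using bump_pos unfolding \<psi>0_def by metis
  qed
  have \<psi>0pos: "0 < integral {a..b} \<psi>0"
  proof -
    have c: "continuous_on {a..b} \<psi>0" by (rule smooth_continuous[OF \<psi>0s])
    have nn: "0 \<le> \<psi>0 x" for x by (simp add: \<psi>0_def bump_nonneg)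
    have "integral {a..b} \<psi>0 \<noteq> 0"
      using integral_eq_0_iff[OF c ab nn] \<psi>0m pq by (auto intro!: bexI[of _ "(p + q) / 2"])
    moreover have "0 \<le> integral {a..b} \<psi>0"
      using nn by (intro integral_nonneg integrable_continuous_real c) auto
    ultimately show ?thesis by simp
  qed
  \<comment> \<open>A fixed test function of integral 1. Subtracting its multiple by the mean makes
    any test function mean free, and \<open>c\<close> is the integral of \<open>h\<close> against
    it.\<close>
  define \<psi> where "\<psi> x = 1 / integral {a..b} \<psi>0 * \<psi>0 x" for x
  have \<psi>s: "smooth \<psi>" unfolding \<psi>_def by (intro smooth_mult smooth_const \<psi>0s)
  have \<psi>z: "\<psi> x = 0" if "x \<notin> {p..q}" for x using \<psi>0z[OF that] by (simp add: \<psi>_def)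
  have \<psi>t: "test_function a b \<psi>"
    unfolding test_function_iff[OF ab] using \<psi>s \<psi>z pq less_imp_le by blast
  have \<psi>1: "integral {a..b} \<psi> = 1" unfolding \<psi>_def using \<psi>0pos by simp
  define c where "c = (LINT x|leb a b. h x * \<psi> x)"
  have "AE x in leb a b. h x - c = 0"
  proof (rule AE_eq_0_if_test_integrals_eq_0[OF _ ab])
    show "integrable (leb a b) (\<lambda>x. h x - c)" using hi by simp
    fix cf assume t: "test_function a b cf"
    then obtain p' q' where *: "smooth cf" "a < p'" "p' \<le> q'" "q' < b" "\<And>x. x \<notin> {p'..q'} \<Longrightarrow> cf x = 0"
      using test_function_iff[OF ab] by blast
    define J where "J = integral {a..b} cf"
    \<comment> \<open>The mean of \<open>k\<close> is zero, so its antiderivative vanishes on both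
      sides of the support and is itself a test function.\<close>
    define k where "k x = cf x - J * \<psi> x" for x
    define P where "P = min p p'"
    define Q where "Q = max q q'"
    have PQ: "a < P" "P \<le> Q" "Q < b" using pq * by (auto simp: P_def Q_def)
    have ks: "smooth k" unfolding k_def by (intro smooth_diff smooth_mult smooth_const * \<psi>s)
    have kz: "\<forall>x. x \<notin> {P..Q} \<longrightarrow> k x = 0"
    proof (intro allI impI)
      fix x assume "x \<notin> {P..Q}"
      then have "x \<notin> {p..q}" "x \<notin> {p'..q'}" by (auto simp: P_def Q_def)
      then show "k x = 0" using *(5) \<psi>z by (simp add: k_def)
    qed
    let ?K = "\<lambda>x. integral {P - 1..x} k"
    note A = antiderivative[OF ks kz PQ(2)]
    have ci: "continuous_on S k" for S by (rule smooth_continuous[OF ks])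
    have "?K b - ?K a = integral {a..b} k"
    proof -
      have "(k has_integral (?K b - ?K a)) {a..b}"
        using ab A(1) by (intro fundamental_theorem_of_calculus)
          (auto simp: has_real_derivative_iff_has_vector_derivative[symmetric] intro: DERIV_subset)
      then show ?thesis by (simp add: integral_unique)
    qed
    moreover have "integral {a..b} k = 0"
      unfolding k_def using \<psi>1
      by (subst Henstock_Kurzweil_Integration.integral_diff)
        (auto intro!: integrable_continuous_real smooth_continuous smooth_mult * \<psi>s simp: J_def)
    moreover have "?K a = 0" using A(3)[of a] PQ by simp
    ultimately have "?K b = 0" by simp
    then have "?K x = 0" if "Q \<le> x" for x using A(4)[OF that] A(4)[of b] PQ by simp
    then have "?K x = 0" if "x \<notin> {P..Q}" for x using A(3)[of x] that by fastforce
    then have "test_function a b ?K"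
      unfolding test_function_iff[OF ab] using A(2) PQ by blast
    moreover have "deriv ?K = k" using A(1) by (intro ext DERIV_imp_deriv)
    ultimately have "(LINT x|leb a b. h x * k x) = 0" using h0[of ?K] by simp
    moreover have "h x * k x = h x * cf x - J * (h x * \<psi> x)" for x
      by (simp add: k_def algebra_simps)
    ultimately have "(LINT x|leb a b. h x * cf x) = J * c"
      using mult_i[OF hi t] mult_i[OF hi \<psi>t] by (simp add: c_def)
    moreover have "(LINT x|leb a b. cf x) = J"
      unfolding J_def by (intro integral_leb_eq_integral integrable_leb_continuous test_function_continuous[OF t])
    ultimately show "(LINT x|leb a b. (h x - c) * cf x) = 0"
      using mult_i[OF hi t] integrable_leb_continuous[OF test_function_continuous[OF t]]
      by (simp add: left_diff_distrib)
  qed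
  then have "AE x in leb a b. f x = c + (LINT s|leb a x. d s)"
    by (auto simp: h_def F_def elim: eventually_mono)
  then show thesis by (rule that)
qed

section \<open>Sobolev spaces on the unit interval\<close>

lemma L2_I_iff_sqint: "L2_I w \<longleftrightarrow> sqint 0 1 w"
  by (simp add: L2_I_def sqint_def)

lemma test_function_funpow_deriv: "test_function a b \<phi> \<Longrightarrow> test_function a b ((deriv ^^ j) \<phi>)"
  by (induction j) (auto intro: test_function_deriv)

lemma sqint_test_function: "test_function a b \<phi> \<Longrightarrow> sqint a b ((deriv ^^ j) \<phi>)"
  by (intro sqint_continuous test_function_continuous test_function_funpow_deriv)

lemma is_weak_deriv_unique:
  assumes "is_weak_deriv j w d" "is_weak_deriv j w e"
  shows "AE x in leb 0 1. d x = e x"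
proof -
  have sq: "sqint 0 1 d" "sqint 0 1 e" using assms by (auto simp: is_weak_deriv_def L2_I_iff_sqint)
  have "AE x in leb 0 1. d x - e x = 0"
  proof (rule AE_eq_0_if_test_integrals_eq_0)
    show "integrable (leb 0 1) (\<lambda>x. d x - e x)" by (intro sqint_integrable sqint_diff sq)
    fix \<phi> assume t: "test_function 0 1 \<phi>"
    have "(LINT x|leb 0 1. w x * (deriv ^^ j) \<phi> x) = (- 1) ^ j * (LINT x|leb 0 1. d x * \<phi> x)"
      "(LINT x|leb 0 1. w x * (deriv ^^ j) \<phi> x) = (- 1) ^ j * (LINT x|leb 0 1. e x * \<phi> x)"
      using assms t by (simp_all add: is_weak_deriv_def)
    then have "(LINT x|leb 0 1. d x * \<phi> x) = (LINT x|leb 0 1. e x * \<phi> x)" by simp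
    then show "(LINT x|leb 0 1. (d x - e x) * \<phi> x) = 0"
      using sq[THEN sqint_integrable_mult] sqint_test_function[OF t, of 0]
      by (simp add: left_diff_distrib)
  qed simp
  then show ?thesis by simp
qed

lemma is_weak_deriv_lin:
  assumes "is_weak_deriv j v d" "is_weak_deriv j w e"
  shows "is_weak_deriv j (\<lambda>x. \<alpha> * v x + \<beta> * w x) (\<lambda>x. \<alpha> * d x + \<beta> * e x)"
proof -
  have sq: "sqint 0 1 v" "sqint 0 1 d" "sqint 0 1 w" "sqint 0 1 e"
    using assms by (auto simp: is_weak_deriv_def L2_I_iff_sqint)
  have eq: "(LINT x|leb 0 1. (\<alpha> * f x + \<beta> * g x) * \<phi> x)
      = \<alpha> * (LINT x|leb 0 1. f x * \<phi> x) + \<beta> * (LINT x|leb 0 1. g x * \<phi> x)"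
    if "sqint 0 1 f" "sqint 0 1 g" "sqint 0 1 \<phi>" for f g \<phi>
    using sqint_integrable_mult[OF that(1,3)] sqint_integrable_mult[OF that(2,3)]
    by (simp add: distrib_right mult.assoc)
  show ?thesis
    unfolding is_weak_deriv_def L2_I_iff_sqint
  proof (intro conjI allI impI)
    show "sqint 0 1 (\<lambda>x. \<alpha> * v x + \<beta> * w x)" "sqint 0 1 (\<lambda>x. \<alpha> * d x + \<beta> * e x)"
      by (intro sqint_add sqint_scale sq)+
    fix \<phi> assume t: "test_function 0 1 \<phi>"
    show "(LINT x|leb 0 1. (\<alpha> * v x + \<beta> * w x) * (deriv ^^ j) \<phi> x)
       = (- 1) ^ j * (LINT x|leb 0 1. (\<alpha> * d x + \<beta> * e x) * \<phi> x)"
      using assms t eq[OF sq(1,3) sqint_test_function[OF t]] eq[OF sq(2,4) sqint_test_function[OF t, of 0]]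
      by (simp add: is_weak_deriv_def algebra_simps)
  qed
qed

lemma is_weak_deriv_weak_deriv: "in_H s w \<Longrightarrow> j \<le> s \<Longrightarrow> is_weak_deriv j w (weak_deriv j w)"
  unfolding in_H_def weak_deriv_def by (metis someI_ex)

lemma sqint_weak_deriv: "in_H s w \<Longrightarrow> j \<le> s \<Longrightarrow> sqint 0 1 (weak_deriv j w)"
  using is_weak_deriv_weak_deriv by (auto simp: is_weak_deriv_def L2_I_iff_sqint)

lemma sqint_in_H: "in_H s w \<Longrightarrow> sqint 0 1 w"
  using is_weak_deriv_weak_deriv[of s w 0] by (auto simp: is_weak_deriv_def L2_I_iff_sqint)

lemma in_H_lin: "in_H s v \<Longrightarrow> in_H s w \<Longrightarrow> in_H s (\<lambda>x. \<alpha> * v x + \<beta> * w x)"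
  unfolding in_H_def using is_weak_deriv_lin by blast

lemma weak_deriv_AE_eq: "in_H s w \<Longrightarrow> j \<le> s \<Longrightarrow> is_weak_deriv j w d \<Longrightarrow> AE x in leb 0 1. weak_deriv j w x = d x"
  using is_weak_deriv_unique is_weak_deriv_weak_deriv by blast

text \<open>\<open>weak_deriv\<close> is a choice, made separately for each function; it is linear
  only up to null sets.\<close>

lemma weak_deriv_lin_AE:
  assumes "in_H s v" "in_H s w" "j \<le> s"
  shows "AE x in leb 0 1. weak_deriv j (\<lambda>x. \<alpha> * v x + \<beta> * w x) x = \<alpha> * weak_deriv j v x + \<beta> * weak_deriv j w x"
  using assms by (intro weak_deriv_AE_eq[of s] in_H_lin is_weak_deriv_lin is_weak_deriv_weak_deriv)

lemma weak_deriv_0_AE: "in_H s w \<Longrightarrow> AE x in leb 0 1. weak_deriv 0 w x = w x"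
  by (rule weak_deriv_AE_eq) (auto simp: is_weak_deriv_def L2_I_iff_sqint sqint_in_H)

text \<open>The inner product behind \<open>H_norm\<close>. Pairing with a fixed \<open>y\<close>
  reduces integrals of Sobolev-valued functions to real ones, and taking for \<open>y\<close> the
  function in question recovers its norm.\<close>

definition H_inner :: "nat \<Rightarrow> (real \<Rightarrow> real) \<Rightarrow> (real \<Rightarrow> real) \<Rightarrow> real" where
  "H_inner s v w = (\<Sum>j\<le>s. LINT x|leb 0 1. weak_deriv j v x * weak_deriv j w x)"

lemma H_inner_commute: "H_inner s v w = H_inner s w v"
  by (simp add: H_inner_def mult.commute)

lemma H_inner_self: "H_inner s w w = (H_norm s w)\<^sup>2"
  by (simp add: H_inner_def H_norm_def power2_eq_square sum_nonneg)

lemma H_norm_nonneg [simp]: "0 \<le> H_norm s w"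
  by (simp add: H_norm_def sum_nonneg)

lemma integral_mult_AE_cong:
  assumes "sqint a b f" "sqint a b h" "AE x in leb a b. f x = g x"
  shows "(LINT x|leb a b. f x * h x) = (LINT x|leb a b. g x * h x)"
proof -
  have "sqint a b g" using assms sqint_AE_cong by blast
  then show ?thesis
    using assms sqint_integrable_mult[OF assms(1,2)] sqint_integrable_mult[of a b g h]
    by (intro integral_cong_AE) auto
qed

lemma H_inner_lin:
  assumes "in_H s v" "in_H s w" "in_H s y"
  shows "H_inner s (\<lambda>x. \<alpha> * v x + \<beta> * w x) y = \<alpha> * H_inner s v y + \<beta> * H_inner s w y"
proof -
  have "(LINT x|leb 0 1. weak_deriv j (\<lambda>x. \<alpha> * v x + \<beta> * w x) x * weak_deriv j y x)
     = \<alpha> * (LINT x|leb 0 1. weak_deriv j v x * weak_deriv j y x)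
       + \<beta> * (LINT x|leb 0 1. weak_deriv j w x * weak_deriv j y x)" if "j \<le> s" for j
  proof -
    note sq = assms[THEN sqint_weak_deriv, OF that]
    have "(LINT x|leb 0 1. weak_deriv j (\<lambda>x. \<alpha> * v x + \<beta> * w x) x * weak_deriv j y x)
      = (LINT x|leb 0 1. (\<alpha> * weak_deriv j v x + \<beta> * weak_deriv j w x) * weak_deriv j y x)"
      using assms that
      by (intro integral_mult_AE_cong sqint_weak_deriv[of s] in_H_lin weak_deriv_lin_AE)
    then show ?thesis
      using sqint_integrable_mult[OF sq(1,3)] sqint_integrable_mult[OF sq(2,3)]
      by (simp add: distrib_right mult.assoc)
  qed
  then show ?thesis
    unfolding H_inner_def sum_distrib_left sum.distrib[symmetric] by (intro sum.cong) auto
qed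

lemma H_inner_cauchy_schwarz:
  assumes "in_H s v" "in_H s w"
  shows "\<bar>H_inner s v w\<bar> \<le> H_norm s v * H_norm s w"
proof -
  have "(H_inner s v w)\<^sup>2 \<le> H_inner s v v * H_inner s w w"
  proof (rule quadratic_nonneg_imp)
    fix t
    let ?z = "\<lambda>x. t * v x + 1 * w x"
    have z: "in_H s ?z" by (intro in_H_lin assms)
    have "0 \<le> H_inner s ?z ?z" by (simp add: H_inner_self)
    also have "\<dots> = t * H_inner s v ?z + H_inner s w ?z"
      using H_inner_lin[OF assms z, of t 1] by simp
    also have "\<dots> = H_inner s v v * t\<^sup>2 + 2 * H_inner s v w * t + H_inner s w w"
      using H_inner_lin[OF assms assms(1), of t 1] H_inner_lin[OF assms assms(2), of t 1]
        H_inner_commute[of s v ?z] H_inner_commute[of s w ?z] H_inner_commute[of s w v]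
      by (simp add: power2_eq_square algebra_simps)
    finally show "0 \<le> H_inner s v v * t\<^sup>2 + 2 * H_inner s v w * t + H_inner s w w" .
  qed
  then have "(H_inner s v w)\<^sup>2 \<le> (H_norm s v * H_norm s w)\<^sup>2"
    by (simp add: H_inner_self power_mult_distrib)
  then have "sqrt ((H_inner s v w)\<^sup>2) \<le> sqrt ((H_norm s v * H_norm s w)\<^sup>2)" by (rule real_sqrt_le_mono)
  then show ?thesis by simp
qed

lemma H_norm_lin_le:
  assumes "in_H s v" "in_H s w"
  shows "H_norm s (\<lambda>x. \<alpha> * v x + \<beta> * w x) \<le> \<bar>\<alpha>\<bar> * H_norm s v + \<bar>\<beta>\<bar> * H_norm s w"
proof (cases "H_norm s (\<lambda>x. \<alpha> * v x + \<beta> * w x) = 0")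
  case True
  then show ?thesis by simp
next
  case False
  let ?z = "\<lambda>x. \<alpha> * v x + \<beta> * w x"
  have z: "in_H s ?z" by (intro in_H_lin assms)
  have "(H_norm s ?z)\<^sup>2 = \<alpha> * H_inner s v ?z + \<beta> * H_inner s w ?z"
    using H_inner_lin[OF assms z, of \<alpha> \<beta>] unfolding H_inner_self .
  also have "\<dots> \<le> \<bar>\<alpha>\<bar> * \<bar>H_inner s v ?z\<bar> + \<bar>\<beta>\<bar> * \<bar>H_inner s w ?z\<bar>"
    by (intro add_mono) (auto simp: abs_mult[symmetric])
  also have "\<dots> \<le> \<bar>\<alpha>\<bar> * (H_norm s v * H_norm s ?z) + \<bar>\<beta>\<bar> * (H_norm s w * H_norm s ?z)"
    by (intro add_mono mult_left_mono H_inner_cauchy_schwarz assms z) auto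
  also have "\<dots> = (\<bar>\<alpha>\<bar> * H_norm s v + \<bar>\<beta>\<bar> * H_norm s w) * H_norm s ?z"
    by (simp add: algebra_simps)
  finally show ?thesis
    using False H_norm_nonneg[of s ?z] by (simp add: power2_eq_square mult_le_cancel_right)
qed

lemma H_norm_diff_le: "in_H s v \<Longrightarrow> in_H s w \<Longrightarrow> H_norm s (\<lambda>x. v x - w x) \<le> H_norm s v + H_norm s w"
  using H_norm_lin_le[of s v w 1 "-1"] by simp

lemma in_H_diff: "in_H s v \<Longrightarrow> in_H s w \<Longrightarrow> in_H s (\<lambda>x. v x - w x)"
  using in_H_lin[of s v w 1 "-1"] by simp

lemma in_H_scale: "in_H s v \<Longrightarrow> in_H s (\<lambda>x. \<alpha> * v x)"
  using in_H_lin[of s v v \<alpha> 0] by simp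

lemma H_inner_diff:
  "in_H s v \<Longrightarrow> in_H s w \<Longrightarrow> in_H s y \<Longrightarrow> H_inner s (\<lambda>x. v x - w x) y = H_inner s v y - H_inner s w y"
  using H_inner_lin[of s v w y 1 "-1"] by simp

lemma H_inner_scale: "in_H s v \<Longrightarrow> in_H s y \<Longrightarrow> H_inner s (\<lambda>x. \<alpha> * v x) y = \<alpha> * H_inner s v y"
  using H_inner_lin[of s v v y \<alpha> 0] by simp

lemma integral_weak_deriv_sq_le: "j \<le> s \<Longrightarrow> (LINT x|leb 0 1. (weak_deriv j w x)\<^sup>2) \<le> (H_norm s w)\<^sup>2"
proof -
  assume "j \<le> s"
  then have "(LINT x|leb 0 1. (weak_deriv j w x)\<^sup>2) \<le> (\<Sum>j\<le>s. LINT x|leb 0 1. (weak_deriv j w x)\<^sup>2)"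
    by (intro member_le_sum[where f = "\<lambda>j. LINT x|leb 0 1. (weak_deriv j w x)\<^sup>2"]) auto
  then show ?thesis by (simp add: H_norm_def sum_nonneg)
qed

lemma integral_sq_le_H_norm:
  assumes "in_H s w" shows "(LINT x|leb 0 1. (w x)\<^sup>2) \<le> (H_norm s w)\<^sup>2"
proof -
  have "(LINT x|leb 0 1. (w x)\<^sup>2) = (LINT x|leb 0 1. (weak_deriv 0 w x)\<^sup>2)"
    using weak_deriv_0_AE[OF assms] sqint_in_H[OF assms] sqint_weak_deriv[OF assms, of 0]
    by (intro integral_cong_AE) (auto simp: sqint_def elim: eventually_mono)
  then show ?thesis using integral_weak_deriv_sq_le[of 0 s w] by simp
qed

text \<open>
  \<open>f 1\<close>, ..., \<open>f m\<close> are the weak derivatives of \<open>f 0\<close>; all but \<open>f m\<close> are the absolutely continuous representatives.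
\<close>

definition deriv_chain :: "nat \<Rightarrow> real \<Rightarrow> real \<Rightarrow> (nat \<Rightarrow> real \<Rightarrow> real) \<Rightarrow> bool" where
  "deriv_chain m a b f \<longleftrightarrow> (\<forall>j<m. \<forall>x\<in>{a..b}. f j x = f j a + (LINT s|leb a x. f (Suc j) s)) \<and>
     (\<forall>j\<le>m. sqint a b (f j))"

lemma deriv_chainD:
  assumes "deriv_chain m a b f"
  shows "j < m \<Longrightarrow> x \<in> {a..b} \<Longrightarrow> f j x = f j a + (LINT s|leb a x. f (Suc j) s)"
    and "j \<le> m \<Longrightarrow> sqint a b (f j)"
  using assms unfolding deriv_chain_def by blast+

lemma deriv_chain_continuous:
  assumes "deriv_chain m a b f" "j < m"
  shows "continuous_on {a..b} (f j)"
proof -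
  have "continuous_on {a..b} (\<lambda>x. f j a + (LINT s|leb a x. f (Suc j) s))"
    using deriv_chainD(2)[OF assms(1), of "Suc j"] assms(2)
    by (intro continuous_intros continuous_on_indefinite_leb sqint_integrable) auto
  then show ?thesis
    by (rule continuous_on_eq) (rule deriv_chainD(1)[OF assms, symmetric])
qed

lemma deriv_chain_diff:
  assumes "deriv_chain m a b f" "j < m" "a \<le> x" "x \<le> y" "y \<le> b"
  shows "f j y - f j x = (LINT s|leb x y. f (Suc j) s)"
proof -
  have "sqint a b (f (Suc j))" using deriv_chainD(2)[OF assms(1), of "Suc j"] assms(2) by simp
  then have "integrable (leb a y) (f (Suc j))"
    using assms(3-) by (intro sqint_integrable, elim sqint_subinterval) auto
  then show ?thesis
    using deriv_chainD(1)[OF assms(1,2), of x] deriv_chainD(1)[OF assms(1,2), of y] assms(3-)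
      integral_leb_combine[of a y "f (Suc j)" x] by simp
qed

lemma deriv_chain_subinterval:
  assumes "deriv_chain m a b f" "a \<le> c" "d \<le> b"
  shows "deriv_chain m c d f"
  unfolding deriv_chain_def
proof (intro conjI allI impI ballI)
  fix j x assume "j < m" "x \<in> {c..d}"
  then show "f j x = f j c + (LINT s|leb c x. f (Suc j) s)"
    using deriv_chain_diff[OF assms(1), of j c x] assms by simp
next
  fix j assume "j \<le> m"
  then show "sqint c d (f j)"
    by (rule sqint_subinterval[OF deriv_chainD(2)[OF assms(1)]]) (use assms in auto)
qed

lemma deriv_chain_has_derivative:
  assumes "deriv_chain m a b f" "Suc j < m" "x \<in> {a..b}"
  shows "(f j has_real_derivative f (Suc j) x) (at x within {a..b})"
proof -
  have "((\<lambda>x. f j a + (LINT s|leb a x. f (Suc j) s)) has_real_derivative 0 + f (Suc j) x) (at x within {a..b})"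
    using assms by (intro DERIV_add DERIV_const has_derivative_indefinite_leb deriv_chain_continuous)
  then have "((\<lambda>x. f j a + (LINT s|leb a x. f (Suc j) s)) has_real_derivative f (Suc j) x) (at x within {a..b})" by simp
  then show ?thesis
  proof (rule has_field_derivative_transform_within[where d = 1])
    show "f j a + (LINT s|leb a y. f (Suc j) s) = f j y" if "y \<in> {a..b}" for y
      using deriv_chainD(1)[OF assms(1) _ that, of j] assms(2) by simp
  qed (use assms in auto)
qed

lemma deriv_chain_shift:
  assumes "deriv_chain (m + i) a b f" shows "deriv_chain m a b (\<lambda>j. f (j + i))"
  unfolding deriv_chain_def
proof (intro conjI allI impI ballI)
  fix j x assume "j < m" "x \<in> {a..b}"
  then show "f (j + i) x = f (j + i) a + (LINT s|leb a x. f (Suc j + i) s)"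
    using deriv_chainD(1)[OF assms, of "j + i" x] by simp
qed (use deriv_chainD(2)[OF assms] in simp)

lemma deriv_chain_mono: "deriv_chain m a b f \<Longrightarrow> n \<le> m \<Longrightarrow> deriv_chain n a b f"
  unfolding deriv_chain_def by (meson less_le_trans le_trans)

lemma continuous_AE_eq:
  assumes f: "continuous_on {a..b} f" and g: "continuous_on {a..b} g" and ab: "a < b"
    and eq: "AE x in leb a b. f x = (g x :: real)" and x: "x \<in> {a..b}"
  shows "f x = g x"
proof -
  have c: "continuous_on {a..b} (\<lambda>x. \<bar>f x - g x\<bar>)"
    by (rule continuous_on_rabs[OF continuous_on_diff[OF f g]])
  have "integral {a..b} (\<lambda>x. \<bar>f x - g x\<bar>) = (LINT x|leb a b. \<bar>f x - g x\<bar>)"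
    by (rule integral_leb_eq_integral[symmetric]) (rule integrable_leb_continuous[OF c])
  also have "\<dots> = (LINT x|leb a b. 0)"
    using eq integrable_leb_continuous[OF c] by (intro integral_cong_AE) auto
  finally have "integral {a..b} (\<lambda>x. \<bar>f x - g x\<bar>) = 0" by simp
  then show ?thesis using integral_eq_0_iff[OF c ab] x by auto
qed

text \<open>The derivative of a test function is a test function, so consecutive weak derivatives of
  \<open>w\<close> are weak derivatives of each other and \<open>du_Bois_Reymond\<close> applies at
  each level.\<close>

lemma in_H_deriv_chain:
  assumes w: "in_H s w" and c: "continuous_on {0..1} w" and s: "0 < s"
  obtains f where "deriv_chain s 0 1 f" "f 0 = w"
    "\<And>j. j \<le> s \<Longrightarrow> AE x in leb 0 1. f j x = weak_deriv j w x"
proof -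
  let ?D = "\<lambda>j. weak_deriv j w"
  note D = is_weak_deriv_weak_deriv[OF w] and Dsq = sqint_weak_deriv[OF w]
  have "\<exists>c. AE x in leb 0 1. ?D j x = c + (LINT t|leb 0 x. ?D (Suc j) t)" if j: "j < s" for j
  proof -
    have parts: "(LINT x|leb 0 1. ?D j x * deriv \<phi> x) = - (LINT x|leb 0 1. ?D (Suc j) x * \<phi> x)"
      if t: "test_function 0 1 \<phi>" for \<phi>
    proof -
      have 1: "(LINT x|leb 0 1. w x * (deriv ^^ j) (deriv \<phi>) x) = (- 1) ^ j * (LINT x|leb 0 1. ?D j x * deriv \<phi> x)"
        using D[of j] j test_function_deriv[OF t] by (auto simp: is_weak_deriv_def)
      have 2: "(LINT x|leb 0 1. w x * (deriv ^^ Suc j) \<phi> x) = (- 1) ^ Suc j * (LINT x|leb 0 1. ?D (Suc j) x * \<phi> x)"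
        using D[of "Suc j"] j t by (auto simp: is_weak_deriv_def)
      have "(- 1) ^ j * (LINT x|leb 0 1. ?D j x * deriv \<phi> x) = (- 1) ^ Suc j * (LINT x|leb 0 1. ?D (Suc j) x * \<phi> x)"
        using 1 2 by (simp add: funpow_swap1)
      also have "\<dots> = (- 1) ^ j * (- (LINT x|leb 0 1. ?D (Suc j) x * \<phi> x))" by simp
      finally show ?thesis by (simp only: mult_cancel_left) simp
    qed
    have i: "integrable (leb 0 1) (?D j)" "integrable (leb 0 1) (?D (Suc j))"
      using j by (auto intro!: sqint_integrable Dsq)
    obtain c where "AE x in leb 0 1. ?D j x = c + (LINT t|leb 0 x. ?D (Suc j) t)"
      by (rule du_Bois_Reymond[OF i zero_less_one parts])
    then show ?thesis by blast
  qed
  then have "\<forall>j. \<exists>c. j < s \<longrightarrow> (AE x in leb 0 1. ?D j x = c + (LINT t|leb 0 x. ?D (Suc j) t))" by blast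
  from choice[OF this] obtain cst
    where cst: "\<And>j. j < s \<Longrightarrow> AE x in leb 0 1. ?D j x = cst j + (LINT t|leb 0 x. ?D (Suc j) t)" by blast
  \<comment> \<open>Level 0 is \<open>w\<close> itself, which the continuity of \<open>w\<close>
    permits. The intermediate levels are the absolutely continuous representatives, and the top
    level has none and stays as chosen.\<close>
  define f where "f j = (if j = 0 then w else if j < s then (\<lambda>x. cst j + (LINT t|leb 0 x. ?D (Suc j) t)) else ?D j)" for j
  have AE_f: "AE x in leb 0 1. f j x = ?D j x" if "j \<le> s" for j
    using weak_deriv_0_AE[OF w] cst[of j] by (auto simp: f_def elim: eventually_mono)
  have int_f: "(LINT t|leb 0 x. ?D (Suc j) t) = (LINT t|leb 0 x. f (Suc j) t)" if "j < s" "x \<in> {0..1}" for j x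
  proof -
    have "sqint 0 1 (f (Suc j))"
      using AE_f[of "Suc j"] that by (intro sqint_AE_cong[OF Dsq[of "Suc j"]]) (auto elim: eventually_mono)
    then have "sqint 0 x (f (Suc j))" "sqint 0 x (?D (Suc j))"
      using that Dsq[of "Suc j"] sqint_subinterval[of 0 1 _ 0 x] by auto
    moreover have "AE t in leb 0 x. f (Suc j) t = ?D (Suc j) t"
      using AE_leb_subinterval[OF AE_f[of "Suc j"], of 0 x] that by auto
    ultimately show ?thesis
      by (intro integral_cong_AE) (auto simp: sqint_def elim: eventually_mono)
  qed
  have ci: "continuous_on {0..1} (\<lambda>x. cst j + (LINT t|leb 0 x. ?D (Suc j) t))" if "j < s" for j
    using Dsq[of "Suc j"] that by (intro continuous_intros continuous_on_indefinite_leb sqint_integrable) auto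
  have w_eq: "w x = cst 0 + (LINT t|leb 0 x. ?D (Suc 0) t)" if "x \<in> {0..1}" for x
  proof (rule continuous_AE_eq[OF c ci[OF s] _ _ that])
    show "AE x in leb 0 1. w x = cst 0 + (LINT t|leb 0 x. ?D (Suc 0) t)"
      using weak_deriv_0_AE[OF w] cst[OF s] by eventually_elim simp
  qed simp
  have f_eq: "f j x = cst j + (LINT t|leb 0 x. f (Suc j) t)" if "j < s" "x \<in> {0..1}" for j x
    using int_f[OF that] w_eq[of x] that by (cases "j = 0") (auto simp: f_def)
  have "deriv_chain s 0 1 f"
    unfolding deriv_chain_def
  proof (intro conjI allI impI ballI)
    fix j x assume "j < s" "x \<in> {0..1::real}"
    then show "f j x = f j 0 + (LINT t|leb 0 x. f (Suc j) t)"
      using f_eq[of j x] f_eq[of j 0] by simp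
  next
    fix j assume "j \<le> s"
    then show "sqint 0 1 (f j)"
      using AE_f[of j] by (intro sqint_AE_cong[OF Dsq[of j]]) (auto elim: eventually_mono)
  qed
  then show thesis using AE_f by (intro that[of f]) (auto simp: f_def)
qed

text \<open>One-dimensional Sobolev embedding: \<open>\<bar>f j x\<bar>\<close> exceeds
  \<open>\<bar>f j y\<bar>\<close> by at most the L1 norm of the derivative; averaging over
  \<open>y\<close> gives two L1 norms, each at most \<open>A\<close> on an interval of length
  1.\<close>

lemma deriv_chain_sup_bound:
  assumes f: "deriv_chain m 0 1 f" and j: "j < m" and x: "x \<in> {0..1}" and A: "0 \<le> A"
    and b: "(LINT x|leb 0 1. (f j x)\<^sup>2) \<le> A\<^sup>2" "(LINT x|leb 0 1. (f (Suc j) x)\<^sup>2) \<le> A\<^sup>2"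
  shows "\<bar>f j x\<bar> \<le> 2 * A"
proof -
  have sq: "sqint 0 1 (f j)" "sqint 0 1 (f (Suc j))" using deriv_chainD(2)[OF f] j by auto
  have L1: "(LINT x|leb 0 1. \<bar>g x\<bar>) \<le> A" if "sqint 0 1 g" "(LINT x|leb 0 1. (g x)\<^sup>2) \<le> A\<^sup>2" for g
  proof (rule power2_le_imp_le[OF _ A])
    show "(LINT x|leb 0 1. \<bar>g x\<bar>)\<^sup>2 \<le> A\<^sup>2" using integral_abs_square_le[OF that(1)] that(2) by simp
  qed
  have le: "\<bar>f j x\<bar> \<le> \<bar>f j y\<bar> + A" if y: "y \<in> {0..1}" for y
  proof -
    have "\<bar>f j (max x y) - f j (min x y)\<bar> \<le> A"
    proof -
      have mm: "0 \<le> min x y" "min x y \<le> max x y" "max x y \<le> 1" "min x y \<le> 1" using x y by auto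
      have i: "integrable (leb 0 1) (\<lambda>t. \<bar>f (Suc j) t\<bar>)" using sqint_integrable[OF sq(2)] by simp
      have i1: "integrable (leb (min x y) 1) (\<lambda>t. \<bar>f (Suc j) t\<bar>)"
        by (rule integrable_leb_subinterval[OF i]) (use x y in auto)
      have "\<bar>f j (max x y) - f j (min x y)\<bar> = \<bar>LINT t|leb (min x y) (max x y). f (Suc j) t\<bar>"
        using deriv_chain_diff[OF f j, of "min x y" "max x y"] x y by simp
      also have "\<dots> \<le> (LINT t|leb (min x y) (max x y). \<bar>f (Suc j) t\<bar>)" by (rule integral_abs_bound)
      also have "\<dots> \<le> (LINT t|leb 0 (min x y). \<bar>f (Suc j) t\<bar>) + ((LINT t|leb (min x y) (max x y). \<bar>f (Suc j) t\<bar>)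
          + (LINT t|leb (max x y) 1. \<bar>f (Suc j) t\<bar>))" by simp
      also have "\<dots> = (LINT t|leb 0 1. \<bar>f (Suc j) t\<bar>)"
        using integral_leb_combine[OF i, of "min x y"] integral_leb_combine[OF i1, of "max x y"] mm by simp
      also have "\<dots> \<le> A" by (rule L1[OF sq(2) b(2)])
      finally show ?thesis .
    qed
    then show ?thesis by (cases "x \<le> y") (auto simp: max_def min_def)
  qed
  have "(LINT y|leb 0 1. \<bar>f j x\<bar>) \<le> (LINT y|leb 0 1. \<bar>f j y\<bar> + A)"
    using sqint_integrable[OF sq(1)] le by (intro integral_mono) auto
  then show ?thesis using sqint_integrable[OF sq(1)] L1[OF sq(1) b(1)] by simp
qed

section \<open>Time-dependent functions with values in a Sobolev space\<close>

lemma in_H_zero: "in_H s (\<lambda>x. 0)"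
  unfolding in_H_def is_weak_deriv_def L2_I_iff_sqint by (auto intro!: exI[of _ "\<lambda>x. 0"])

lemma H_inner_zero: "in_H s y \<Longrightarrow> H_inner s (\<lambda>x. 0) y = 0"
  using H_inner_scale[of s y y 0] by simp

lemma H_inner_sum:
  assumes "finite A" "\<And>w. w \<in> A \<Longrightarrow> in_H s w" "in_H s y"
  shows "in_H s (\<lambda>x. \<Sum>w\<in>A. c w * w x) \<and>
    H_inner s (\<lambda>x. \<Sum>w\<in>A. c w * w x) y = (\<Sum>w\<in>A. c w * H_inner s w y)"
  using assms
proof (induction A rule: finite_induct)
  case empty
  then show ?case by (simp add: in_H_zero H_inner_zero)
next
  case (insert v A)
  have IH: "in_H s (\<lambda>x. \<Sum>w\<in>A. c w * w x)"
    "H_inner s (\<lambda>x. \<Sum>w\<in>A. c w * w x) y = (\<Sum>w\<in>A. c w * H_inner s w y)"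
    using insert by auto
  have v: "in_H s v" using insert by simp
  have eq: "(\<lambda>x. \<Sum>w\<in>insert v A. c w * w x) = (\<lambda>x. c v * v x + 1 * (\<Sum>w\<in>A. c w * w x))"
    using insert by simp
  have "H_inner s (\<lambda>x. c v * v x + 1 * (\<Sum>w\<in>A. c w * w x)) y
      = c v * H_inner s v y + 1 * H_inner s (\<lambda>x. \<Sum>w\<in>A. c w * w x) y"
    by (rule H_inner_lin[OF v IH(1) insert.prems(2)])
  moreover have "in_H s (\<lambda>x. c v * v x + 1 * (\<Sum>w\<in>A. c w * w x))" by (rule in_H_lin[OF v IH(1)])
  ultimately show ?case unfolding eq using insert IH by simp
qed

lemma simple_function_real_measurable:
  "simple_function M g \<Longrightarrow> (g :: _ \<Rightarrow> real) \<in> borel_measurable M"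
  by (rule borel_measurable_simple_function)

lemma simple_function_real_integrable:
  assumes "simple_function (leb 0 T) g" shows "integrable (leb 0 T) (g :: real \<Rightarrow> real)"
proof -
  have f: "finite (g ` {0<..<T})" using simple_functionD(1)[OF assms] by simp
  define B where "B = (\<Sum>v\<in>g ` {0<..<T}. \<bar>v\<bar>)"
  show ?thesis
  proof (rule Bochner_Integration.integrable_bound)
    show "integrable (leb 0 T) (\<lambda>x. B)" by simp
    show "g \<in> borel_measurable (leb 0 T)" by (rule simple_function_real_measurable[OF assms])
    show "AE x in leb 0 T. norm (g x) \<le> norm B"
    proof (rule AE_I2)
      fix x assume "x \<in> space (leb 0 T)"
      then have "\<bar>g x\<bar> \<le> B" unfolding B_def
        using f by (intro member_le_sum[of "g x" _ "\<lambda>v. \<bar>v\<bar>"]) auto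
      then show "norm (g x) \<le> norm B" by simp
    qed
  qed
qed

text \<open>The elementary integral is a finite sum over the values of \<open>F\<close>. Pairing it
  with \<open>y\<close> gives the integral of a real step function.\<close>

lemma H_simple_scalar:
  assumes "H_simple T s F" "in_H s y"
  shows "in_H s (H_simple_integral T F)"
    and "simple_function (leb 0 T) (\<lambda>t. H_inner s (F t) y)"
    and "(LINT t|leb 0 T. H_inner s (F t) y) = H_inner s (H_simple_integral T F) y"
proof -
  have F: "simple_function (leb 0 T) F" "\<And>t. t \<in> {0<..<T} \<Longrightarrow> in_H s (F t)"
    using assms by (auto simp: H_simple_def)
  have fin: "finite (F ` {0<..<T})" using simple_functionD(1)[OF F(1)] by simp
  have sets: "{t \<in> {0<..<T}. F t = w} \<in> sets (leb 0 T)" for w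
  proof -
    have "{t \<in> {0<..<T}. F t = w} = F -` {w} \<inter> space (leb 0 T)" by auto
    then show ?thesis using simple_functionD(2)[OF F(1), of "{w}"] by simp
  qed
  have *: "in_H s (H_simple_integral T F)"
    "H_inner s (H_simple_integral T F) y
      = (\<Sum>w\<in>F ` {0<..<T}. measure lebesgue {t \<in> {0<..<T}. F t = w} * H_inner s w y)"
    using H_inner_sum[OF fin _ assms(2), of "\<lambda>w. measure lebesgue {t \<in> {0<..<T}. F t = w}"] F(2)
    unfolding H_simple_integral_def by blast+
  show "in_H s (H_simple_integral T F)" by (rule *)
  show "simple_function (leb 0 T) (\<lambda>t. H_inner s (F t) y)"
    using simple_function_compose[OF F(1), of "\<lambda>w. H_inner s w y"] by (simp add: comp_def)
  have "(LINT t|leb 0 T. H_inner s (F t) y)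
      = (LINT t|leb 0 T. (\<Sum>w\<in>F ` {0<..<T}. indicator {t \<in> {0<..<T}. F t = w} t * H_inner s w y))"
  proof (rule Bochner_Integration.integral_cong)
    fix t assume "t \<in> space (leb 0 T)"
    then have t: "t \<in> {0<..<T}" by simp
    have "(\<Sum>w\<in>F ` {0<..<T}. indicator {t \<in> {0<..<T}. F t = w} t * H_inner s w y)
       = (\<Sum>w\<in>F ` {0<..<T}. if w = F t then H_inner s w y else 0)"
      using t by (intro sum.cong) auto
    also have "\<dots> = H_inner s (F t) y" using t fin by (simp add: sum.delta')
    finally show "H_inner s (F t) y
      = (\<Sum>w\<in>F ` {0<..<T}. indicator {t \<in> {0<..<T}. F t = w} t * H_inner s w y)" by simp
  qed simp
  also have "\<dots> = (\<Sum>w\<in>F ` {0<..<T}. LINT t|leb 0 T. indicator {t \<in> {0<..<T}. F t = w} t * H_inner s w y)"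
  proof (rule Bochner_Integration.integral_sum)
    fix w
    have "finite_measure (leb 0 T)" using emeasure_leb_finite[of 0 T] by (intro finite_measureI) auto
    then have "integrable (leb 0 T) (indicator {t \<in> {0<..<T}. F t = w} :: real \<Rightarrow> real)"
      using sets[of w] finite_measure.emeasure_finite[of "leb 0 T"]
      by (intro integrable_real_indicator) (auto simp: top.not_eq_extremum)
    then show "integrable (leb 0 T) (\<lambda>t. indicator {t \<in> {0<..<T}. F t = w} t * H_inner s w y)" by simp
  qed
  also have "\<dots> = (\<Sum>w\<in>F ` {0<..<T}. measure lebesgue {t \<in> {0<..<T}. F t = w} * H_inner s w y)"
  proof (rule sum.cong)
    fix w
    have m: "measure (leb 0 T) {t \<in> {0<..<T}. F t = w} = measure lebesgue {t \<in> {0<..<T}. F t = w}"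
      by (rule measure_restrict_space) auto
    show "(LINT t|leb 0 T. indicator {t \<in> {0<..<T}. F t = w} t * H_inner s w y)
       = measure lebesgue {t \<in> {0<..<T}. F t = w} * H_inner s w y"
    proof -
      have "{t. 0 < t \<and> t < T \<and> F t = w} \<inter> {0<..<T} = {t. 0 < t \<and> t < T \<and> F t = w}" by auto
      then show ?thesis using sets[of w] m by simp
    qed
  qed simp
  finally show "(LINT t|leb 0 T. H_inner s (F t) y) = H_inner s (H_simple_integral T F) y"
    using * by simp
qed

lemma borel_measurable_leb_LIMSEQ_AE:
  assumes "\<And>n. g n \<in> borel_measurable (leb a b)" "AE t in leb a b. (\<lambda>n. g n t) \<longlonglongrightarrow> (f t :: real)"
  shows "f \<in> borel_measurable (leb a b)"
proof (rule borel_measurable_leb_AE)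
  show "(\<lambda>t. lim (\<lambda>n. g n t)) \<in> borel_measurable (leb a b)"
    by (rule borel_measurable_lim_metric) (rule assms)
  show "AE t in leb a b. lim (\<lambda>n. g n t) = f t"
    using assms(2) by eventually_elim (rule limI)
qed

lemma H_inner_tendsto:
  assumes "\<And>n. in_H s (F n)" "in_H s f" "in_H s y" "(\<lambda>n. H_norm s (\<lambda>x. F n x - f x)) \<longlonglongrightarrow> 0"
  shows "(\<lambda>n. H_inner s (F n) y) \<longlonglongrightarrow> H_inner s f y"
proof (rule LIM_zero_cancel, rule Lim_null_comparison)
  have "\<bar>H_inner s (F n) y - H_inner s f y\<bar> \<le> H_norm s (\<lambda>x. F n x - f x) * H_norm s y" for n
    using H_inner_cauchy_schwarz[OF in_H_diff[OF assms(1)[of n] assms(2)] assms(3)]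
      H_inner_diff[OF assms(1)[of n] assms(2,3)] by simp
  then show "\<forall>\<^sub>F n in sequentially. norm (H_inner s (F n) y - H_inner s f y)
      \<le> H_norm s (\<lambda>x. F n x - f x) * H_norm s y" by simp
  show "(\<lambda>n. H_norm s (\<lambda>x. F n x - f x) * H_norm s y) \<longlonglongrightarrow> 0"
    using tendsto_mult_right[OF assms(4), of "H_norm s y"] by simp
qed

text \<open>Justifies taking a constant factor out of the nonnegative integral of this distance. The
  distances between two simple functions are simple, and they converge by the reverse triangle
  inequality.\<close>

lemma H_norm_measurable_diff:
  assumes f: "H_strongly_measurable T s f" and G: "H_simple T s G"
  shows "(\<lambda>t. H_norm s (\<lambda>x. f t x - G t x)) \<in> borel_measurable (leb 0 T)"
proof -
  obtain F where F: "\<And>n. H_simple T s (F n)" "AE t in leb 0 T. (\<lambda>n. H_norm s (\<lambda>x. F n t x - f t x)) \<longlonglongrightarrow> 0"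
    and fH: "AE t in leb 0 T. in_H s (f t)"
    using f unfolding H_strongly_measurable_def by blast
  have Fs: "simple_function (leb 0 T) (F n)" "t \<in> {0<..<T} \<Longrightarrow> in_H s (F n t)" for n t
    using F(1)[of n] by (auto simp: H_simple_def)
  have Gs: "simple_function (leb 0 T) G" "t \<in> {0<..<T} \<Longrightarrow> in_H s (G t)" for t
    using G by (auto simp: H_simple_def)
  show ?thesis
  proof (rule borel_measurable_leb_LIMSEQ_AE)
    show "(\<lambda>t. H_norm s (\<lambda>x. F n t x - G t x)) \<in> borel_measurable (leb 0 T)" for n
      by (intro simple_function_real_measurable
          simple_function_compose2[where h = "\<lambda>v w. H_norm s (\<lambda>x. v x - w x)"] Fs Gs)
    have "AE t in leb 0 T. t \<in> {0<..<T}" by (rule AE_I2) simp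
    then show "AE t in leb 0 T. (\<lambda>n. H_norm s (\<lambda>x. F n t x - G t x)) \<longlonglongrightarrow> H_norm s (\<lambda>x. f t x - G t x)"
      using F(2) fH
    proof eventually_elim
      case (elim t)
      have H: "in_H s (F n t)" "in_H s (G t)" "in_H s (f t)" for n using elim Fs Gs by auto
      show ?case
      proof (rule LIM_zero_cancel, rule Lim_null_comparison[OF _ elim(2)])
        have "\<bar>H_norm s (\<lambda>x. F n t x - G t x) - H_norm s (\<lambda>x. f t x - G t x)\<bar>
           \<le> H_norm s (\<lambda>x. F n t x - f t x)" for n
        proof -
          have 1: "H_norm s (\<lambda>x. F n t x - G t x) \<le> H_norm s (\<lambda>x. F n t x - f t x) + H_norm s (\<lambda>x. f t x - G t x)"
            using H_norm_lin_le[OF in_H_diff[OF H(1)[of n] H(3)] in_H_diff[OF H(3,2)], of 1 1] by simp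
          have 2: "H_norm s (\<lambda>x. f t x - G t x) \<le> H_norm s (\<lambda>x. F n t x - G t x) + H_norm s (\<lambda>x. F n t x - f t x)"
            using H_norm_diff_le[OF in_H_diff[OF H(1)[of n] H(2)] in_H_diff[OF H(1)[of n] H(3)]] by simp
          show ?thesis using 1 2 by linarith
        qed
        then show "\<forall>\<^sub>F n in sequentially. norm (H_norm s (\<lambda>x. F n t x - G t x) - H_norm s (\<lambda>x. f t x - G t x))
           \<le> H_norm s (\<lambda>x. F n t x - f t x)" by simp
      qed
    qed
  qed
qed

lemma H_inner_measurable:
  assumes f: "H_strongly_measurable T s f" and y: "in_H s y"
  shows "(\<lambda>t. H_inner s (f t) y) \<in> borel_measurable (leb 0 T)"
proof -
  obtain F where F: "\<And>n. H_simple T s (F n)" "AE t in leb 0 T. (\<lambda>n. H_norm s (\<lambda>x. F n t x - f t x)) \<longlonglongrightarrow> 0"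
    and fH: "AE t in leb 0 T. in_H s (f t)"
    using f unfolding H_strongly_measurable_def by blast
  show ?thesis
  proof (rule borel_measurable_leb_LIMSEQ_AE)
    show "(\<lambda>t. H_inner s (F n t) y) \<in> borel_measurable (leb 0 T)" for n
      by (intro simple_function_real_measurable H_simple_scalar[OF F(1) y])
    have "AE t in leb 0 T. t \<in> {0<..<T}" by (rule AE_I2) simp
    then show "AE t in leb 0 T. (\<lambda>n. H_inner s (F n t) y) \<longlonglongrightarrow> H_inner s (f t) y"
      using F(2) fH
      by eventually_elim (intro H_inner_tendsto y; use F(1) in \<open>auto simp: H_simple_def\<close>)
  qed
qed

text \<open>By Cauchy-Schwarz the paired simple functions converge in L1 to the paired
  \<open>f\<close>. On one side their integrals converge to that of the limit, on the other to the
  pairing with \<open>z\<close>.\<close>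

lemma has_H_integral_scalar:
  assumes f: "has_H_integral T s f z" and y: "in_H s y"
  shows "integrable (leb 0 T) (\<lambda>t. H_inner s (f t) y)" "(LINT t|leb 0 T. H_inner s (f t) y) = H_inner s z y"
proof -
  have fm: "H_strongly_measurable T s f" and z: "in_H s z" using f by (auto simp: has_H_integral_def)
  obtain F where F: "\<And>n. H_simple T s (F n)"
    "(\<lambda>n. \<integral>\<^sup>+ t. ennreal (H_norm s (\<lambda>x. f t x - F n t x)) \<partial>leb 0 T) \<longlonglongrightarrow> 0"
    "(\<lambda>n. H_norm s (\<lambda>x. H_simple_integral T (F n) x - z x)) \<longlonglongrightarrow> 0"
    using f unfolding has_H_integral_def by blast
  have fH: "AE t in leb 0 T. in_H s (f t)" using fm by (simp add: H_strongly_measurable_def)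
  define g where "g t = H_inner s (f t) y" for t
  define G where "G n t = H_inner s (F n t) y" for n t
  have gm: "g \<in> borel_measurable (leb 0 T)" unfolding g_def by (rule H_inner_measurable[OF fm y])
  have Gi: "integrable (leb 0 T) (G n)" for n
    unfolding G_def by (intro simple_function_real_integrable H_simple_scalar[OF F(1) y])
  have le: "(\<integral>\<^sup>+ t. ennreal (norm (G n t - g t)) \<partial>leb 0 T)
      \<le> ennreal (H_norm s y) * (\<integral>\<^sup>+ t. ennreal (H_norm s (\<lambda>x. f t x - F n t x)) \<partial>leb 0 T)" for n
  proof -
    have "AE t in leb 0 T. t \<in> {0<..<T}" by (rule AE_I2) simp
    then have "AE t in leb 0 T. ennreal (norm (G n t - g t))
        \<le> ennreal (H_norm s y) * ennreal (H_norm s (\<lambda>x. f t x - F n t x))"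
      using fH
    proof eventually_elim
      case (elim t)
      have H: "in_H s (F n t)" "in_H s (f t)" using elim F(1)[of n] by (auto simp: H_simple_def)
      have "\<bar>G n t - g t\<bar> \<le> H_norm s y * H_norm s (\<lambda>x. f t x - F n t x)"
        using H_inner_cauchy_schwarz[OF in_H_diff[OF H(2,1)] y] H_inner_diff[OF H(2,1) y]
        by (simp add: g_def G_def abs_minus_commute mult.commute)
      then show ?case by (simp add: ennreal_mult[symmetric] ennreal_leI)
    qed
    then have "(\<integral>\<^sup>+ t. ennreal (norm (G n t - g t)) \<partial>leb 0 T)
        \<le> (\<integral>\<^sup>+ t. ennreal (H_norm s y) * ennreal (H_norm s (\<lambda>x. f t x - F n t x)) \<partial>leb 0 T)"
      by (rule nn_integral_mono_AE)
    also have "\<dots> = ennreal (H_norm s y) * (\<integral>\<^sup>+ t. ennreal (H_norm s (\<lambda>x. f t x - F n t x)) \<partial>leb 0 T)"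
      using H_norm_measurable_diff[OF fm F(1)] by (intro nn_integral_cmult) simp
    finally show ?thesis .
  qed
  have lim: "(\<lambda>n. \<integral>\<^sup>+ t. ennreal (norm (G n t - g t)) \<partial>leb 0 T) \<longlonglongrightarrow> 0"
  proof (rule tendsto_sandwich[OF _ _ tendsto_const])
    have "(\<lambda>n. ennreal (H_norm s y) * (\<integral>\<^sup>+ t. ennreal (H_norm s (\<lambda>x. f t x - F n t x)) \<partial>leb 0 T))
        \<longlonglongrightarrow> ennreal (H_norm s y) * 0"
      by (intro ennreal_tendsto_cmult F) simp
    then show "(\<lambda>n. ennreal (H_norm s y) * (\<integral>\<^sup>+ t. ennreal (H_norm s (\<lambda>x. f t x - F n t x)) \<partial>leb 0 T)) \<longlonglongrightarrow> 0"
      by simp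
  qed (use le in auto)
  have gi: "integrable (leb 0 T) g"
  proof -
    \<comment> \<open>One integrable approximant at finite L1 distance already makes
      \<open>g\<close> integrable.\<close>
    have "\<forall>\<^sub>F n in sequentially. (\<integral>\<^sup>+ t. ennreal (norm (G n t - g t)) \<partial>leb 0 T) < 1"
      using order_tendstoD(2)[OF lim, of 1] by simp
    then obtain n where "(\<integral>\<^sup>+ t. ennreal (norm (G n t - g t)) \<partial>leb 0 T) < 1"
      by (auto simp: eventually_sequentially)
    then have "(\<integral>\<^sup>+ t. ennreal (norm (G n t - g t)) \<partial>leb 0 T) < \<infinity>" by (rule less_trans) simp
    then have "integrable (leb 0 T) (\<lambda>t. G n t - g t)"
      using gm Gi[of n] by (intro integrableI_bounded borel_measurable_diff) auto
    from Bochner_Integration.integrable_diff[OF Gi[of n] this] show ?thesis by simp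
  qed
  then show "integrable (leb 0 T) (\<lambda>t. H_inner s (f t) y)" unfolding g_def .
  have "(\<lambda>n. LINT t|leb 0 T. G n t) \<longlonglongrightarrow> (LINT t|leb 0 T. g t)"
    by (rule tendsto_L1_int[OF Gi gi lim])
  moreover have "(\<lambda>n. LINT t|leb 0 T. G n t) \<longlonglongrightarrow> H_inner s z y"
    unfolding G_def using H_simple_scalar[OF F(1) y] F(3) z y
    by (simp add: H_inner_tendsto)
  ultimately show "(LINT t|leb 0 T. H_inner s (f t) y) = H_inner s z y"
    unfolding g_def by (rule LIMSEQ_unique)
qed

lemma L2_time_H_norm:
  assumes "L2_time_H T s f"
  shows "sqint 0 T (\<lambda>t. H_norm s (f t))"
proof -
  have "integrable (leb 0 T) (\<lambda>t. (H_norm s (f t))\<^sup>2)" using assms by (simp add: L2_time_H_def)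
  moreover have "(\<lambda>t. sqrt ((H_norm s (f t))\<^sup>2)) \<in> borel_measurable (leb 0 T)"
    using borel_measurable_integrable[OF calculation] by measurable
  ultimately show ?thesis by (simp add: sqint_def)
qed

lemma L2_time_H_inner_integrable:
  assumes f: "L2_time_H T s f" and y: "in_H s y"
  shows "integrable (leb 0 T) (\<lambda>t. H_inner s (f t) y)"
proof (rule Bochner_Integration.integrable_bound)
  show "integrable (leb 0 T) (\<lambda>t. H_norm s (f t) * H_norm s y)"
    using sqint_integrable[OF L2_time_H_norm[OF f]] by simp
  show "(\<lambda>t. H_inner s (f t) y) \<in> borel_measurable (leb 0 T)"
    using f y by (intro H_inner_measurable) (auto simp: L2_time_H_def)
  have "AE t in leb 0 T. in_H s (f t)" using f by (simp add: L2_time_H_def H_strongly_measurable_def)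
  then show "AE t in leb 0 T. norm (H_inner s (f t) y) \<le> norm (H_norm s (f t) * H_norm s y)"
  proof eventually_elim
    case (elim t)
    then show ?case using H_inner_cauchy_schwarz[OF elim y] by simp
  qed
qed

lemma H_continuous_inner:
  assumes f: "H_continuous T s f" and y: "in_H s y"
  shows "continuous_on {0..T} (\<lambda>t. H_inner s (f t) y)"
  unfolding continuous_on_def
proof
  fix t assume t: "t \<in> {0..T}"
  have ft: "in_H s (f t)" and lim: "((\<lambda>t'. H_norm s (\<lambda>x. f t' x - f t x)) \<longlongrightarrow> 0) (at t within {0..T})"
    using f t by (auto simp: H_continuous_def)
  show "((\<lambda>t. H_inner s (f t) y) \<longlongrightarrow> H_inner s (f t) y) (at t within {0..T})"
  proof (rule LIM_zero_cancel, rule Lim_null_comparison)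
    show "((\<lambda>t'. H_norm s (\<lambda>x. f t' x - f t x) * H_norm s y) \<longlongrightarrow> 0) (at t within {0..T})"
      using tendsto_mult_right[OF lim, of "H_norm s y"] by simp
    have "norm (H_inner s (f t') y - H_inner s (f t) y) \<le> H_norm s (\<lambda>x. f t' x - f t x) * H_norm s y"
      if "t' \<in> {0..T}" for t'
    proof -
      have ft': "in_H s (f t')" using f that by (auto simp: H_continuous_def)
      show ?thesis
        using H_inner_cauchy_schwarz[OF in_H_diff[OF ft' ft] y] H_inner_diff[OF ft' ft y] by simp
    qed
    then show "\<forall>\<^sub>F t' in at t within {0..T}. norm (H_inner s (f t') y - H_inner s (f t) y)
        \<le> H_norm s (\<lambda>x. f t' x - f t x) * H_norm s y"
      by (auto simp: eventually_at_filter)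
  qed
qed

lemma H_continuous_norm_bounded:
  assumes f: "H_continuous T s f"
  obtains B where "0 < B" "\<And>t. t \<in> {0..T} \<Longrightarrow> H_norm s (f t) \<le> B"
proof -
  have "continuous_on {0..T} (\<lambda>t. H_norm s (f t))"
    unfolding continuous_on_def
  proof
    fix t assume t: "t \<in> {0..T}"
    have ft: "in_H s (f t)" and lim: "((\<lambda>t'. H_norm s (\<lambda>x. f t' x - f t x)) \<longlongrightarrow> 0) (at t within {0..T})"
      using f t by (auto simp: H_continuous_def)
    have "norm (H_norm s (f t') - H_norm s (f t)) \<le> H_norm s (\<lambda>x. f t' x - f t x)" if "t' \<in> {0..T}" for t'
    proof -
      have ft': "in_H s (f t')" using f that by (auto simp: H_continuous_def)
      show ?thesis
        using H_norm_lin_le[OF in_H_diff[OF ft' ft] ft, of 1 1]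
          H_norm_lin_le[OF ft' in_H_diff[OF ft' ft], of 1 "-1"] by simp
    qed
    then show "((\<lambda>t. H_norm s (f t)) \<longlongrightarrow> H_norm s (f t)) (at t within {0..T})"
      by - (rule LIM_zero_cancel, rule Lim_null_comparison[OF _ lim], auto simp: eventually_at_filter)
  qed
  then have "bounded ((\<lambda>t. H_norm s (f t)) ` {0..T})"
    by (intro compact_imp_bounded compact_continuous_image) auto
  then obtain B where "0 < B" "\<And>v. v \<in> (\<lambda>t. H_norm s (f t)) ` {0..T} \<Longrightarrow> norm v \<le> B"
    unfolding bounded_pos by blast
  then show thesis by (intro that[of B]) fastforce+
qed

text \<open>Paired with \<open>y\<close>, the weak time derivative becomes a scalar weak derivative,
  so \<open>du_Bois_Reymond\<close> applies; continuity in time removes the exceptional null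
  set.\<close>

lemma time_deriv_FTC:
  assumes d: "is_time_deriv T s f f'" and c: "H_continuous T s f" and y: "in_H s y"
    and pq: "0 \<le> p" "p \<le> q" "q \<le> T" and T: "0 < T"
  shows "H_inner s (f q) y - H_inner s (f p) y = (LINT t|leb p q. H_inner s (f' t) y)"
proof -
  have L2: "L2_time_H T s f" "L2_time_H T s f'" using d by (auto simp: is_time_deriv_def)
  note fi = L2_time_H_inner_integrable[OF L2(1) y] and f'i = L2_time_H_inner_integrable[OF L2(2) y]
  have fH: "AE t in leb 0 T. in_H s (f t)" "AE t in leb 0 T. in_H s (f' t)"
    using L2 by (auto simp: L2_time_H_def H_strongly_measurable_def)
  have "(LINT t|leb 0 T. H_inner s (f t) y * deriv \<phi> t) = - (LINT t|leb 0 T. H_inner s (f' t) y * \<phi> t)"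
    if t: "test_function 0 T \<phi>" for \<phi>
  proof -
    obtain z where z: "has_H_integral T s (\<lambda>t x. deriv \<phi> t * f t x) z"
      "has_H_integral T s (\<lambda>t x. \<phi> t * f' t x) (\<lambda>x. - z x)"
      using d t unfolding is_time_deriv_def by blast
    have zH: "in_H s z" using z(1) by (simp add: has_H_integral_def)
    note 1 = has_H_integral_scalar[OF z(1) y] and 2 = has_H_integral_scalar[OF z(2) y]
    have eq: "(LINT t|leb 0 T. H_inner s (\<lambda>x. \<psi> t * h t x) y) = (LINT t|leb 0 T. H_inner s (h t) y * \<psi> t)"
      if "integrable (leb 0 T) (\<lambda>t. H_inner s (\<lambda>x. \<psi> t * h t x) y)" "AE t in leb 0 T. in_H s (h t)"
      for \<psi> :: "real \<Rightarrow> real" and h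
    proof -
      have ae: "AE t in leb 0 T. H_inner s (\<lambda>x. \<psi> t * h t x) y = H_inner s (h t) y * \<psi> t"
        using that(2) by eventually_elim (simp add: H_inner_scale y mult.commute)
      then show ?thesis
        using borel_measurable_leb_AE[OF borel_measurable_integrable[OF that(1)] ae] that(1)
        by (intro integral_cong_AE) auto
    qed
    have "H_inner s (\<lambda>x. - z x) y = - H_inner s z y"
      using H_inner_scale[OF zH y, of "-1"] by simp
    then show ?thesis
      using 1(2) 2(2) eq[OF 1(1) fH(1)] eq[OF 2(1) fH(2)] by simp
  qed
  then obtain k where k: "AE t in leb 0 T. H_inner s (f t) y = k + (LINT r|leb 0 t. H_inner s (f' r) y)"
    by (rule du_Bois_Reymond[OF fi f'i T])
  have "H_inner s (f t) y = k + (LINT r|leb 0 t. H_inner s (f' r) y)" if "t \<in> {0..T}" for t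
    by (rule continuous_AE_eq[OF H_continuous_inner[OF c y] _ T k that])
      (intro continuous_on_add continuous_on_const continuous_on_indefinite_leb f'i)
  then have "H_inner s (f q) y - H_inner s (f p) y
     = (LINT r|leb 0 q. H_inner s (f' r) y) - (LINT r|leb 0 p. H_inner s (f' r) y)"
    using pq by simp
  then show ?thesis
    using integral_leb_combine[OF integrable_leb_subinterval[OF f'i], of 0 q p] pq by simp
qed

text \<open>The remainder is paired with itself, which leaves one factor of its own norm to cancel.
  The point \<open>r\<close> may lie anywhere in the interval, because any two values of
  \<open>f'\<close> there differ by at most the integral of the norm of \<open>f''\<close>.\<close>

lemma time_taylor_le:
  assumes d: "is_time_deriv T s f f'" "is_time_deriv T s f' f''"
    and c: "H_continuous T s f" "H_continuous T s f'"
    and pq: "0 \<le> p" "p \<le> q" "q \<le> T" and T: "0 < T" and r: "r \<in> {p..q}"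
  shows "H_norm s (\<lambda>x. (f q x - f p x) - (q - p) * f' r x) \<le> (q - p) * (LINT t|leb p q. H_norm s (f'' t))"
proof (cases "H_norm s (\<lambda>x. (f q x - f p x) - (q - p) * f' r x) = 0")
  case True
  have "0 \<le> (LINT t|leb p q. H_norm s (f'' t))" by simp
  then show ?thesis using True pq by simp
next
  case False
  let ?y = "\<lambda>x. (f q x - f p x) - (q - p) * f' r x"
  let ?J = "LINT t|leb p q. H_norm s (f'' t)"
  have fH: "in_H s (f q)" "in_H s (f p)" and f'H: "\<And>t. t \<in> {0..T} \<Longrightarrow> in_H s (f' t)"
    using c pq by (auto simp: H_continuous_def)
  have rT: "r \<in> {0..T}" using r pq by auto
  have y: "in_H s ?y" by (intro in_H_diff in_H_scale fH f'H rT)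
  have L2: "L2_time_H T s f'" "L2_time_H T s f''" using d by (auto simp: is_time_deriv_def)
  have i: "integrable (leb p q) (\<lambda>t. H_inner s (f' t) ?y)"
    by (rule integrable_leb_subinterval[OF L2_time_H_inner_integrable[OF L2(1) y]]) (use pq in auto)
  have i2: "integrable (leb p q) (\<lambda>t. H_norm s (f'' t))"
    by (rule integrable_leb_subinterval[OF sqint_integrable[OF L2_time_H_norm[OF L2(2)]]]) (use pq in auto)
  have f''H: "AE t in leb 0 T. in_H s (f'' t)"
    using L2(2) by (auto simp: L2_time_H_def H_strongly_measurable_def)
  have key: "\<bar>H_inner s (f' t2) ?y - H_inner s (f' t1) ?y\<bar> \<le> ?J * H_norm s ?y"
    if t12: "p \<le> t1" "t1 \<le> t2" "t2 \<le> q" for t1 t2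
  proof -
    have i2': "integrable (leb t1 t2) (\<lambda>t. H_norm s (f'' t))" "integrable (leb t1 q) (\<lambda>t. H_norm s (f'' t))"
      using t12 by (auto intro: integrable_leb_subinterval[OF i2])
    have i3: "integrable (leb t1 t2) (\<lambda>t. H_inner s (f'' t) ?y)"
      by (rule integrable_leb_subinterval[OF L2_time_H_inner_integrable[OF L2(2) y]]) (use t12 pq in auto)
    have "\<bar>H_inner s (f' t2) ?y - H_inner s (f' t1) ?y\<bar> = \<bar>LINT t|leb t1 t2. H_inner s (f'' t) ?y\<bar>"
      using time_deriv_FTC[OF d(2) c(2) y _ t12(2) _ T] t12 pq by simp
    also have "\<dots> \<le> (LINT t|leb t1 t2. \<bar>H_inner s (f'' t) ?y\<bar>)" by (rule integral_abs_bound)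
    also have "\<dots> \<le> (LINT t|leb t1 t2. H_norm s (f'' t) * H_norm s ?y)"
    proof (rule integral_mono_AE)
      have "AE t in leb t1 t2. in_H s (f'' t)"
        by (rule AE_leb_subinterval[OF f''H]) (use t12 pq in auto)
      then show "AE t in leb t1 t2. \<bar>H_inner s (f'' t) ?y\<bar> \<le> H_norm s (f'' t) * H_norm s ?y"
        by eventually_elim (rule H_inner_cauchy_schwarz[OF _ y])
    qed (use i2' i3 in auto)
    also have "\<dots> = (LINT t|leb t1 t2. H_norm s (f'' t)) * H_norm s ?y" by simp
    also have "(LINT t|leb t1 t2. H_norm s (f'' t)) \<le> ?J"
    proof -
      have "(LINT t|leb t1 t2. H_norm s (f'' t)) \<le> (LINT t|leb p t1. H_norm s (f'' t))
          + ((LINT t|leb t1 t2. H_norm s (f'' t)) + (LINT t|leb t2 q. H_norm s (f'' t)))"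
        by simp
      also have "\<dots> = ?J"
        using integral_leb_combine[OF i2, of t1] integral_leb_combine[OF i2'(2), of t2] t12 by simp
      finally show ?thesis .
    qed
    finally show ?thesis by (simp add: mult_right_mono)
  qed
  have "(H_norm s ?y)\<^sup>2 = (H_inner s (f q) ?y - H_inner s (f p) ?y) - (q - p) * H_inner s (f' r) ?y"
    using H_inner_diff[OF in_H_diff[OF fH] in_H_scale[OF f'H[OF rT]] y, of "q - p"]
      H_inner_diff[OF fH y] H_inner_scale[OF f'H[OF rT] y]
    by (simp add: H_inner_self)
  also have "\<dots> = (LINT t|leb p q. H_inner s (f' t) ?y - H_inner s (f' r) ?y)"
    using time_deriv_FTC[OF d(1) c(1) y pq T] i pq by simp
  also have "\<dots> \<le> (LINT t|leb p q. ?J * H_norm s ?y)"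
  proof (rule integral_mono)
    show "integrable (leb p q) (\<lambda>t. H_inner s (f' t) ?y - H_inner s (f' r) ?y)" using i by simp
    fix t assume "t \<in> space (leb p q)"
    then show "H_inner s (f' t) ?y - H_inner s (f' r) ?y \<le> ?J * H_norm s ?y"
      using key[of t r] key[of r t] r by (cases "t \<le> r") (auto simp: abs_le_iff)
  qed simp
  also have "\<dots> = (q - p) * ?J * H_norm s ?y" using pq by simp
  finally show ?thesis
    using False H_norm_nonneg[of s ?y] by (simp add: power2_eq_square mult_le_cancel_right)
qed

section \<open>An abstract Galerkin scheme\<close>

text \<open>The weight multiplies the new value, as in an implicit scheme. For
  \<open>w \<le> 1 / 2\<close> one has \<open>1 \<le> exp (2 * w) * (1 - w)\<close>, which allows
  solving for it.\<close>

lemma discrete_gronwall: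
  fixes A w f :: "nat \<Rightarrow> real"
  assumes "\<And>n. n \<in> {1..N} \<Longrightarrow> A n \<le> A (n - 1) + w n * A n + f n"
    and "\<And>n. n \<in> {1..N} \<Longrightarrow> 0 \<le> w n \<and> w n \<le> 1 / 2 \<and> 0 \<le> f n"
    and "\<And>n. n \<le> N \<Longrightarrow> 0 \<le> A n"
  shows "A N \<le> exp (2 * (\<Sum>n=1..N. w n)) * (A 0 + (\<Sum>n=1..N. f n))"
  using assms
proof (induction N)
  case 0
  then show ?case by simp
next
  case (Suc N)
  let ?W = "\<Sum>n=1..N. w n" and ?F = "\<Sum>n=1..N. f n"
  have IH: "A N \<le> exp (2 * ?W) * (A 0 + ?F)"
    using Suc.prems by (intro Suc.IH) auto
  have w: "0 \<le> w (Suc N)" "w (Suc N) \<le> 1 / 2" "0 \<le> f (Suc N)" using Suc.prems(2)[of "Suc N"] by auto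
  have W0: "0 \<le> ?W" using Suc.prems(2) by (intro sum_nonneg) auto
  have step: "A (Suc N) * (1 - w (Suc N)) \<le> A N + f (Suc N)"
    using Suc.prems(1)[of "Suc N"] by (simp add: algebra_simps)
  have "1 \<le> (1 + 2 * w (Suc N)) * (1 - w (Suc N))"
    using mult_nonneg_nonneg[of "w (Suc N)" "1 - 2 * w (Suc N)"] w by (simp add: algebra_simps)
  also have "\<dots> \<le> exp (2 * w (Suc N)) * (1 - w (Suc N))"
    using exp_ge_add_one_self[of "2 * w (Suc N)"] w by (intro mult_right_mono) auto
  finally have e: "1 \<le> exp (2 * w (Suc N)) * (1 - w (Suc N))" .
  have "A (Suc N) \<le> A (Suc N) * (exp (2 * w (Suc N)) * (1 - w (Suc N)))"
    using mult_left_mono[OF e, of "A (Suc N)"] Suc.prems(3)[of "Suc N"] by simp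
  also have "\<dots> = exp (2 * w (Suc N)) * (A (Suc N) * (1 - w (Suc N)))" by simp
  also have "\<dots> \<le> exp (2 * w (Suc N)) * (A N + f (Suc N))"
    using step by (intro mult_left_mono) auto
  also have "\<dots> \<le> exp (2 * w (Suc N)) * (exp (2 * ?W) * (A 0 + ?F) + exp (2 * ?W) * f (Suc N))"
  proof -
    have "1 * f (Suc N) \<le> exp (2 * ?W) * f (Suc N)"
      using w W0 by (intro mult_right_mono) auto
    then show ?thesis using IH by (intro mult_left_mono) auto
  qed
  also have "\<dots> = exp (2 * (?W + w (Suc N))) * (A 0 + ?F + f (Suc N))"
    by (simp add: algebra_simps exp_add)
  finally show ?case by (simp add: add.assoc)
qed

lemma young: "(\<epsilon>::real) > 0 \<Longrightarrow> x * y \<le> \<epsilon> * x\<^sup>2 + y\<^sup>2 / (4 * \<epsilon>)"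
proof -
  assume e: "\<epsilon> > 0"
  have "0 \<le> (2 * \<epsilon> * x - y)\<^sup>2 / (4 * \<epsilon>)" using e by simp
  also have "\<dots> = \<epsilon> * x\<^sup>2 + y\<^sup>2 / (4 * \<epsilon>) - x * y"
    using e by (simp add: power2_eq_square field_simps)
  finally show ?thesis by simp
qed

text \<open>Semidefinite forms are included: the form later used for \<open>m\<close> sees only the
  interior parts of weak functions and not their nodal values.\<close>

lemma quadratic_form_cauchy_schwarz:
  fixes m :: "'a::real_vector \<Rightarrow> 'a \<Rightarrow> real"
  assumes "bilinear m" "\<And>x y. m x y = m y x" "\<And>x. 0 \<le> m x x"
  shows "\<bar>m x y\<bar> \<le> sqrt (m x x) * sqrt (m y y)"
proof -
  interpret l: linear "m z" for z using assms(1) by (simp add: bilinear_def)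
  have lin: "m (x + y) z = m x z + m y z" "m (c *\<^sub>R x) z = c * m x z" for x y z c
    using assms(2)[of _ z] by (simp_all add: l.add l.scale)
  have q: "0 \<le> m y y + 2 * s * m x y + s\<^sup>2 * m x x" for s
  proof -
    have "0 \<le> m (s *\<^sub>R x + y) (s *\<^sub>R x + y)" by (rule assms)
    also have "\<dots> = m y y + 2 * s * m x y + s\<^sup>2 * m x x"
      by (simp add: l.add l.scale lin power2_eq_square algebra_simps assms(2)[of y x])
    finally show ?thesis .
  qed
  have "(m x y)\<^sup>2 \<le> m x x * m y y"
  proof (cases "m x x = 0")
    case True
    have "m x y = 0"
    proof (rule ccontr)
      assume "m x y \<noteq> 0"
      then have "2 * (- (m y y + 1) / (2 * m x y)) * m x y = - (m y y + 1)" by simp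
      then show False using q[of "- (m y y + 1) / (2 * m x y)"] True by simp
    qed
    then show ?thesis using True by simp
  next
    case False
    then have p: "m x x > 0" using assms(3)[of x] by simp
    have "0 \<le> m x x * (m y y + 2 * (- m x y / m x x) * m x y + (- m x y / m x x)\<^sup>2 * m x x)"
      using q[of "- m x y / m x x"] p by (intro mult_nonneg_nonneg) auto
    also have "\<dots> = m x x * m y y - (m x y)\<^sup>2"
      using p by (simp add: power2_eq_square field_simps)
    finally show ?thesis by simp
  qed
  then have "sqrt ((m x y)\<^sup>2) \<le> sqrt (m x x * m y y)" by (rule real_sqrt_le_mono)
  then show ?thesis by (simp add: real_sqrt_mult)
qed

text \<open>
  \<open>m x y\<close>, \<open>a x y\<close> and \<open>c x y z\<close> stand for \<open>(x\<^sup>0, y\<^sup>0)\<^sub>h\<close>, \<open>(d x, d y)\<^sub>h\<close> and \<open>(x\<^sup>0 d y, z\<^sup>0)\<^sub>h / 3\<close>.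
\<close>

locale galerkin =
  fixes m a :: "'a::real_vector \<Rightarrow> 'a \<Rightarrow> real" and c :: "'a \<Rightarrow> 'a \<Rightarrow> 'a \<Rightarrow> real" and \<beta> P :: real
  assumes m_bil: "bilinear m" and m_sym: "m x y = m y x" and m_pos: "0 \<le> m x x"
    and a_bil: "bilinear a" and a_sym: "a x y = a y x" and a_pos: "0 \<le> a x x"
    and c_bil: "bilinear (c z)" and c_sym: "c x y z = c z y x"
    and \<beta>_pos: "0 < \<beta>" and P_pos: "0 < P"
    and c_le: "\<bar>c x y z\<bar> \<le> \<beta> * sqrt (m x x) * sqrt (a y y) * sqrt (a z z)"
    and m_le_a: "m x x \<le> P\<^sup>2 * a x x"
begin

definition nm where "nm x = sqrt (m x x)"
definition na where "na x = sqrt (a x x)"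

lemma nm_nonneg [simp]: "0 \<le> nm x" and na_nonneg [simp]: "0 \<le> na x"
  by (simp_all add: nm_def na_def m_pos a_pos)

lemma nm_sq: "(nm x)\<^sup>2 = m x x" and na_sq: "(na x)\<^sup>2 = a x x"
  by (simp_all add: nm_def na_def m_pos a_pos)

lemma m_lin: "m (x + y) z = m x z + m y z" "m (x - y) z = m x z - m y z" "m (r *\<^sub>R x) z = r * m x z"
  "m z (x + y) = m z x + m z y" "m z (x - y) = m z x - m z y" "m z (r *\<^sub>R x) = r * m z x"
  "m 0 x = 0" "m x 0 = 0"
  using m_bil by (simp_all add: bilinear_ladd bilinear_lsub bilinear_lmul bilinear_radd bilinear_rsub
      bilinear_rmul bilinear_lzero bilinear_rzero)

lemma a_lin: "a (x + y) z = a x z + a y z" "a (x - y) z = a x z - a y z" "a (r *\<^sub>R x) z = r * a x z"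
  "a z (x + y) = a z x + a z y" "a z (x - y) = a z x - a z y" "a z (r *\<^sub>R x) = r * a z x"
  "a 0 x = 0" "a x 0 = 0"
  using a_bil by (simp_all add: bilinear_ladd bilinear_lsub bilinear_lmul bilinear_radd bilinear_rsub
      bilinear_rmul bilinear_lzero bilinear_rzero)

lemma c_lin23: "c w (x + y) z = c w x z + c w y z" "c w (x - y) z = c w x z - c w y z"
  "c w z (x + y) = c w z x + c w z y" "c w z (x - y) = c w z x - c w z y"
  "c w 0 x = 0" "c w x 0 = 0"
  using c_bil[of w] by (simp_all add: bilinear_ladd bilinear_lsub bilinear_lmul bilinear_radd bilinear_rsub
      bilinear_rmul bilinear_lzero bilinear_rzero)

lemma c_lin1: "c (x + y) w z = c x w z + c y w z" "c (x - y) w z = c x w z - c y w z" "c 0 w z = 0"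
  by (simp_all add: c_sym[of _ w z] c_lin23)

lemmas lin = m_lin a_lin c_lin23 c_lin1

lemma m_cs: "\<bar>m x y\<bar> \<le> nm x * nm y"
  unfolding nm_def by (rule quadratic_form_cauchy_schwarz[OF m_bil m_sym m_pos])

lemma a_cs: "\<bar>a x y\<bar> \<le> na x * na y"
  unfolding na_def by (rule quadratic_form_cauchy_schwarz[OF a_bil a_sym a_pos])

lemma c_le1: "\<bar>c x y z\<bar> \<le> \<beta> * nm x * na y * na z"
  using c_le unfolding nm_def na_def .

text \<open>By \<open>c_sym\<close> the weak norm may sit on the last entry instead of the first.
  The middle entry is the differentiated one and always takes the gradient norm.\<close>

lemma c_le3: "\<bar>c x y z\<bar> \<le> \<beta> * na x * na y * nm z"
  using c_le1[of z y x] c_sym[of x y z] by (simp add: mult_ac)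

lemma c_le3': "na x \<le> K \<Longrightarrow> \<bar>c x y z\<bar> \<le> \<beta> * K * na y * nm z"
  by (rule order.trans[OF c_le3]) (use \<beta>_pos in \<open>intro mult_left_mono mult_right_mono, auto\<close>)

lemma c_le1': "nm x \<le> K \<Longrightarrow> \<bar>c x y z\<bar> \<le> \<beta> * K * na y * na z"
  by (rule order.trans[OF c_le1]) (use \<beta>_pos in \<open>intro mult_left_mono mult_right_mono, auto\<close>)

lemma nm_le: "nm x \<le> P * na x"
  using real_sqrt_le_mono[OF m_le_a[of x]] P_pos by (simp add: nm_def na_def real_sqrt_mult)

lemma na_triangle: "na (x - y) \<le> na x + na y"
proof (rule power2_le_imp_le)
  have "(na (x - y))\<^sup>2 = (na x)\<^sup>2 + (na y)\<^sup>2 - 2 * a x y"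
    by (simp add: na_sq lin a_sym[of y x])
  also have "\<dots> \<le> (na x + na y)\<^sup>2"
    using a_cs[of x y] by (simp add: power2_sum)
  finally show "(na (x - y))\<^sup>2 \<le> (na x + na y)\<^sup>2" .
qed simp

lemma nm_triangle: "nm (x - y) \<le> nm x + nm y"
proof (rule power2_le_imp_le)
  have "(nm (x - y))\<^sup>2 = (nm x)\<^sup>2 + (nm y)\<^sup>2 - 2 * m x y"
    by (simp add: nm_sq lin m_sym[of y x])
  also have "\<dots> \<le> (nm x + nm y)\<^sup>2"
    using m_cs[of x y] by (simp add: power2_sum)
  finally show "(nm (x - y))\<^sup>2 \<le> (nm x + nm y)\<^sup>2" .
qed simp

end

text \<open>The Gronwall rate of the L2 estimate: absorbing the convection terms into half of the
  viscosity costs the fraction, and the load \<open>\<rho>\<close> costs the 1.\<close>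

definition rate_const :: "real \<Rightarrow> real \<Rightarrow> real \<Rightarrow> real" where
  "rate_const \<beta> \<nu> K = 8 * \<beta>\<^sup>2 * K\<^sup>2 / \<nu> + 1"

text \<open>Factor of the squared gradients in \<open>gradient_step\<close>: the first summand is
  convection by \<open>W\<close>, the second the motion of \<open>W\<close> in time, and the 1 the
  variation of \<open>S\<close>.\<close>

definition drift_const :: "real \<Rightarrow> real \<Rightarrow> real \<Rightarrow> real" where
  "drift_const \<beta> K K' = 12 * \<beta>\<^sup>2 * K\<^sup>2 + 2 * \<beta> * K' + 1"

text \<open>The Gronwall factor of the L2 estimate times the contributions of \<open>\<rho>\<close>
  (the 1) and of \<open>S\<close>, when each load is bounded by the same \<open>F\<close>.\<close>

definition energy_const :: "real \<Rightarrow> real \<Rightarrow> real \<Rightarrow> real \<Rightarrow> real" where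
  "energy_const \<beta> \<nu> K T = exp (2 * rate_const \<beta> \<nu> K * T) * (1 + 2 / \<nu> * T)"

text \<open>Everything in the summed gradient inequality that is linear in \<open>F\<close>: the
  final value of \<open>\<Phi>\<close>, the drift terms bounded by the L2 estimate, and
  \<open>3 = 2 + 1\<close> for \<open>\<alpha>\<close> and \<open>s'\<close>.\<close>

definition load_const :: "real \<Rightarrow> real \<Rightarrow> real \<Rightarrow> real \<Rightarrow> real \<Rightarrow> real \<Rightarrow> real" where
  "load_const \<beta> \<nu> K K' T K1 = (16 * \<beta>\<^sup>2 * K\<^sup>2 / \<nu> + K1) * energy_const \<beta> \<nu> K T + 4 / \<nu>
     + 2 * drift_const \<beta> K K' * (energy_const \<beta> \<nu> K T / \<nu>) + 3"

text \<open>The exponent is the sum of the Gronwall weights, bounded by the L2 estimate. The number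
  56 is the coefficient 14 of \<open>gradient_load\<close> times 4, since that estimate has
  \<open>\<nu> / 4\<close> on its left.\<close>

definition gradient_const :: "real \<Rightarrow> real \<Rightarrow> real \<Rightarrow> real \<Rightarrow> real \<Rightarrow> real \<Rightarrow> real \<Rightarrow> real" where
  "gradient_const \<beta> \<nu> K K' T K1 F =
     exp (2 * (56 * \<beta>\<^sup>2 / \<nu> * (energy_const \<beta> \<nu> K T * F / \<nu>))) * (4 / \<nu> * load_const \<beta> \<nu> K K' T K1)"

text \<open>
  \<open>W\<close> is the projected exact solution. Its consistency error is \<open>\<rho>\<close>, which is bounded in the weak norm,
  plus \<open>S\<close>, which is not and is therefore required to vary slowly with \<open>n\<close>.
\<close>

locale galerkin_scheme = galerkin m a c \<beta> P
  for m a :: "'a::real_vector \<Rightarrow> 'a \<Rightarrow> real" and c :: "'a \<Rightarrow> 'a \<Rightarrow> 'a \<Rightarrow> real" and \<beta> P :: real +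
  fixes \<nu> \<tau> K K' :: real and M :: nat and U W :: "nat \<Rightarrow> 'a"
    and \<rho> S :: "nat \<Rightarrow> 'a \<Rightarrow> real" and \<alpha> s s' :: "nat \<Rightarrow> real"
  assumes \<nu>_pos: "0 < \<nu>" and \<tau>_pos: "0 < \<tau>" and K_pos: "0 < K" and K'_pos: "0 < K'"
    and scheme: "n \<in> {1..M} \<Longrightarrow>
      m (U n - U (n - 1)) v / \<tau> + \<nu> * a (U n) v + c (U n) (U n) v - c (U n) v (U n) = 0"
    and consistency: "n \<in> {1..M} \<Longrightarrow>
      m (W n - W (n - 1)) v / \<tau> + \<nu> * a (W n) v + c (W n) (W n) v - c (W n) v (W n) = \<rho> n v + S n v"
    and init: "W 0 = U 0"
    and \<rho>_le: "n \<in> {1..M} \<Longrightarrow> \<bar>\<rho> n v\<bar> \<le> \<alpha> n * nm v"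
    and S_le: "n \<in> {1..M} \<Longrightarrow> \<bar>S n v\<bar> \<le> s n * na v"
    and S_lin: "linear (S n)"
    and S_diff: "n \<in> {2..M} \<Longrightarrow> \<bar>S n v - S (n - 1) v\<bar> \<le> \<tau> * s' n * na v"
    and W_le: "n \<le> M \<Longrightarrow> na (W n) \<le> K"
    and W_diff: "n \<in> {1..M} \<Longrightarrow> nm (W n - W (n - 1)) \<le> \<tau> * K'"
    and s_pos: "0 \<le> \<alpha> n" "0 \<le> s n" "0 \<le> s' n"
begin

section \<open>The error in the weak norm and in the gradient norm\<close>

definition e where "e n = W n - U n"

lemma e_0 [simp]: "e 0 = 0" by (simp add: e_def init)

text \<open>Both quadratic terms are expanded around \<open>W\<close>, so the coefficients of the
  linear part involve the bounded \<open>W\<close> only; symmetry merges two of the mixed terms into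
  \<open>2 * c (W n) v (e n)\<close>.\<close>

lemma error_eq:
  assumes "n \<in> {1..M}"
  shows "m (e n - e (n - 1)) v / \<tau> + \<nu> * a (e n) v + c (W n) (e n) v + c (e n) (W n) v - c (e n) (e n) v
    - 2 * c (W n) v (e n) + c (e n) v (e n) = \<rho> n v + S n v"
proof -
  have "c (e n) v (W n) = c (W n) v (e n)" by (rule c_sym)
  moreover have "c (U n) v (W n) = c (W n) v (U n)" by (rule c_sym)
  ultimately show ?thesis
    using scheme[OF assms, of v] consistency[OF assms, of v]
    unfolding e_def lin diff_divide_distrib right_diff_distrib by linarith
qed

abbreviation c1 where "c1 \<equiv> rate_const \<beta> \<nu> K"

lemma c1_pos: "0 < c1" using \<nu>_pos by (simp add: rate_const_def add_nonneg_pos)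

text \<open>For \<open>v = e n\<close> the cubic terms cancel, and what is left of convection
  carries a factor \<open>W\<close>. This is why the estimate closes without a bound for the
  gradient of \<open>U\<close>.\<close>

lemma energy_step:
  assumes n: "n \<in> {1..M}"
  shows "(nm (e n))\<^sup>2 + \<tau> * \<nu> * (na (e n))\<^sup>2
    \<le> (nm (e (n - 1)))\<^sup>2 + \<tau> * c1 * (nm (e n))\<^sup>2 + \<tau> * ((\<alpha> n)\<^sup>2 + 2 / \<nu> * (s n)\<^sup>2)"
proof -
  let ?e = "e n" and ?e' = "e (n - 1)"
  have eq: "m (?e - ?e') ?e / \<tau> + \<nu> * (na ?e)\<^sup>2 + c ?e (W n) ?e - c (W n) ?e ?e = \<rho> n ?e + S n ?e"
    using error_eq[OF n, of ?e] by (simp add: na_sq)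
  have m1: "2 * m (?e - ?e') ?e = (nm ?e)\<^sup>2 - (nm ?e')\<^sup>2 + (nm (?e - ?e'))\<^sup>2"
    using m_sym[of ?e' ?e] by (simp add: nm_sq lin)
  have Wp: "na (W n) \<le> K" using W_le n by simp
  have b1: "\<bar>c ?e (W n) ?e\<bar> \<le> \<beta> * K * (nm ?e * na ?e)"
    by (rule order.trans[OF c_le1])
      (use mult_left_mono[OF Wp, of "\<beta> * nm ?e * na ?e"] \<beta>_pos in \<open>simp add: mult_ac\<close>)
  have b2: "\<bar>c (W n) ?e ?e\<bar> \<le> \<beta> * K * (nm ?e * na ?e)"
    using c_le3'[OF Wp, of ?e ?e] by (simp add: mult_ac)
  have y1: "4 * (\<beta> * K * (nm ?e * na ?e)) \<le> \<nu> / 2 * (na ?e)\<^sup>2 + 8 * \<beta>\<^sup>2 * K\<^sup>2 / \<nu> * (nm ?e)\<^sup>2"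
    using young[of "\<nu> / 2" "na ?e" "4 * \<beta> * K * nm ?e"] \<nu>_pos
    by (simp add: power_mult_distrib field_simps)
  have y2: "2 * \<rho> n ?e \<le> (\<alpha> n)\<^sup>2 + (nm ?e)\<^sup>2"
    using \<rho>_le[OF n, of ?e] sum_squares_bound[of "\<alpha> n" "nm ?e"] by (simp add: abs_le_iff)
  have y3: "2 * S n ?e \<le> \<nu> / 2 * (na ?e)\<^sup>2 + 2 / \<nu> * (s n)\<^sup>2"
  proof -
    have "2 * S n ?e \<le> na ?e * (2 * s n)" using S_le[OF n, of ?e] by (simp add: abs_le_iff mult_ac)
    also have "\<dots> \<le> \<nu> / 2 * (na ?e)\<^sup>2 + (2 * s n)\<^sup>2 / (4 * (\<nu> / 2))"
      using \<nu>_pos by (intro young) auto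
    finally show ?thesis using \<nu>_pos by (simp add: power_mult_distrib)
  qed
  have "(nm ?e)\<^sup>2 - (nm ?e')\<^sup>2 \<le> 2 * m (?e - ?e') ?e" using m1 by simp
  also have "\<dots> = \<tau> * (2 * (m (?e - ?e') ?e / \<tau>))" using \<tau>_pos by simp
  also have "\<dots> \<le> \<tau> * (c1 * (nm ?e)\<^sup>2 + ((\<alpha> n)\<^sup>2 + 2 / \<nu> * (s n)\<^sup>2) - \<nu> * (na ?e)\<^sup>2)"
    using eq b1 b2 y1 y2 y3 \<tau>_pos
    by (intro mult_left_mono) (auto simp: rate_const_def algebra_simps abs_le_iff)
  finally show ?thesis by (simp add: algebra_simps)
qed

lemma energy_estimate:
  assumes \<tau>: "\<tau> * c1 \<le> 1 / 2" and N: "N \<le> M"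
  shows "(nm (e N))\<^sup>2 + \<tau> * \<nu> * (\<Sum>j=1..N. (na (e j))\<^sup>2)
    \<le> exp (2 * c1 * (\<tau> * N)) * (\<tau> * (\<Sum>j=1..N. (\<alpha> j)\<^sup>2 + 2 / \<nu> * (s j)\<^sup>2))"
proof -
  define A where "A n = (nm (e n))\<^sup>2 + \<tau> * \<nu> * (\<Sum>j=1..n. (na (e j))\<^sup>2)" for n
  have "A N \<le> exp (2 * (\<Sum>n=1..N. \<tau> * c1)) * (A 0 + (\<Sum>n=1..N. \<tau> * ((\<alpha> n)\<^sup>2 + 2 / \<nu> * (s n)\<^sup>2)))"
  proof (rule discrete_gronwall)
    fix n assume n: "n \<in> {1..N}"
    then obtain n' where n': "n = Suc n'" by (cases n) auto
    have "A n \<le> A (n - 1) + \<tau> * c1 * (nm (e n))\<^sup>2 + \<tau> * ((\<alpha> n)\<^sup>2 + 2 / \<nu> * (s n)\<^sup>2)"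
      using energy_step[of n] n N unfolding A_def n' by (simp add: algebra_simps)
    moreover have "\<tau> * c1 * (nm (e n))\<^sup>2 \<le> \<tau> * c1 * A n"
      using \<tau>_pos \<nu>_pos c1_pos
      by (intro mult_left_mono) (auto simp: A_def intro!: mult_nonneg_nonneg sum_nonneg)
    ultimately show "A n \<le> A (n - 1) + \<tau> * c1 * A n + \<tau> * ((\<alpha> n)\<^sup>2 + 2 / \<nu> * (s n)\<^sup>2)"
      by linarith
    show "0 \<le> \<tau> * c1 \<and> \<tau> * c1 \<le> 1 / 2 \<and> 0 \<le> \<tau> * ((\<alpha> n)\<^sup>2 + 2 / \<nu> * (s n)\<^sup>2)"
      using \<tau>_pos c1_pos \<tau> \<nu>_pos by simp
  next
    fix n show "0 \<le> A n"
      using \<tau>_pos \<nu>_pos by (auto simp: A_def intro!: mult_nonneg_nonneg add_nonneg_nonneg sum_nonneg)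
  qed
  moreover have "A 0 = 0" by (simp add: A_def nm_def lin)
  ultimately show ?thesis by (simp add: A_def sum_distrib_left mult_ac)
qed

text \<open>A discrete primitive: the terms in which an increment \<open>d\<close> of the error
  stands under a derivative, \<open>2 * c (W n) d (e n) - c (e n) d (e n) + S n d\<close>, are the
  time difference of \<open>\<Phi>\<close> up to terms that contain \<open>d\<close> in the weak
  norm only or a time difference of \<open>W\<close> or \<open>S\<close>.\<close>

definition \<Phi> where "\<Phi> n = 2 * c (W n) (e n) (e n) - c (e n) (e n) (e n) + S n (e n)"

abbreviation c2 where "c2 \<equiv> drift_const \<beta> K K'"

text \<open>The error equation is tested with \<open>d = e n - e (n - 1)\<close>. After
  \<open>\<Phi>\<close> has taken up the dangerous terms, every other occurrence of \<open>d\<close>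
  is measured by \<open>nm d\<close> and absorbed into \<open>(nm d)^2 / \<tau>\<close>.\<close>

lemma gradient_step:
  assumes n: "n \<in> {1..M}"
  shows "(nm (e n - e (n - 1)))\<^sup>2 / (2 * \<tau>) + \<nu> / 2 * ((na (e n))\<^sup>2 - (na (e (n - 1)))\<^sup>2)
    \<le> \<Phi> n - \<Phi> (n - 1) + \<tau> * (c2 * ((na (e n))\<^sup>2 + (na (e (n - 1)))\<^sup>2)
        + 7 * \<beta>\<^sup>2 * (((na (e n))\<^sup>2)\<^sup>2 + ((na (e (n - 1)))\<^sup>2)\<^sup>2) + 2 * (\<alpha> n)\<^sup>2 + (s' n)\<^sup>2)"
proof -
  interpret S: linear "S k" for k by (rule S_lin)
  let ?e = "e n" and ?f = "e (n - 1)" and ?W = "W n" and ?W' = "W (n - 1)"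
  define d where "d = ?e - ?f"
  have ed: "?e = ?f + d" by (simp add: d_def)
  define p where "p = na ?e"
  define q where "q = na ?f"
  define \<delta> where "\<delta> = nm d"
  have pos: "0 \<le> p" "0 \<le> q" "0 \<le> \<delta>" by (simp_all add: p_def q_def \<delta>_def)
  have eq: "\<delta>\<^sup>2 / \<tau> + \<nu> * a ?e d + c ?W ?e d + c ?e ?W d - c ?e ?e d - 2 * c ?W d ?e + c ?e d ?e
     = \<rho> n d + S n d"
    using error_eq[OF n, of d] by (simp add: nm_sq d_def \<delta>_def)
  have a1: "2 * a ?e d = p\<^sup>2 - q\<^sup>2 + (na d)\<^sup>2"
    using a_sym[of ?f ?e] by (simp add: p_def q_def na_sq lin d_def)
  have Wp: "na ?W \<le> K" using W_le n by simp
  have t1: "\<bar>c ?W ?e d\<bar> \<le> \<beta> * K * p * \<delta>"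
    using c_le3'[OF Wp] unfolding p_def \<delta>_def .
  have t2: "\<bar>c ?e ?W d\<bar> \<le> \<beta> * p * K * \<delta>"
    unfolding p_def \<delta>_def
    by (rule order.trans[OF c_le3])
      (use mult_left_mono[OF Wp, of "\<beta> * na ?e * nm d"] \<beta>_pos in \<open>simp add: mult_ac\<close>)
  have t3: "\<bar>c ?e ?e d\<bar> \<le> \<beta> * p * p * \<delta>"
    using c_le3[of ?e ?e d] unfolding p_def \<delta>_def .
  have t4: "\<bar>c ?W ?f d\<bar> \<le> \<beta> * K * q * \<delta>"
    using c_le3'[OF Wp] unfolding q_def \<delta>_def .
  have t5: "\<bar>c (?W - ?W') ?f ?f\<bar> \<le> \<beta> * (\<tau> * K') * q * q"
    using c_le1'[OF W_diff[OF n]] unfolding q_def .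
  have t6: "\<bar>c d ?f ?e\<bar> \<le> \<beta> * \<delta> * q * p"
    using c_le1[of d ?f ?e] unfolding p_def q_def \<delta>_def .
  have t7: "\<bar>c d ?f ?f\<bar> \<le> \<beta> * \<delta> * q * q"
    using c_le1[of d ?f ?f] unfolding q_def \<delta>_def .
  have t8: "\<bar>S n ?f - S (n - 1) ?f\<bar> \<le> \<tau> * s' n * q"
  \<comment> \<open>\<open>S_diff\<close> starts at \<open>n = 2\<close>, since nothing is known
    about the size of \<open>S 0\<close>; for \<open>n = 1\<close> both values vanish because
    \<open>e 0 = 0\<close>.\<close>
  proof (cases "n = 1")
    case True
    then show ?thesis using \<tau>_pos s_pos pos by (simp add: S.zero)
  next
    case False
    then show ?thesis using S_diff[of n ?f] n by (simp add: q_def)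
  qed
  have t9: "\<bar>\<rho> n d\<bar> \<le> \<alpha> n * \<delta>" using \<rho>_le[OF n, of d] by (simp add: \<delta>_def)
  \<comment> \<open>Summation by parts in time for one step: in the bracket the derivative falls on
    \<open>e (n - 1)\<close> instead of \<open>d\<close>.\<close>
  have phi: "\<Phi> n - \<Phi> (n - 1) = 2 * c ?W d ?e - c ?e d ?e + S n d
     + (2 * c ?W ?f d + 2 * c (?W - ?W') ?f ?f - c d ?f ?e - c d ?f ?f + (S n ?f - S (n - 1) ?f))"
  proof -
    have h1: "c ?f ?f d = c d ?f ?f" by (rule c_sym)
    have h2: "c ?f d d = c d d ?f" by (rule c_sym)
    have h3: "\<Phi> n = 2 * c ?W (?f + d) (?f + d) - c (?f + d) (?f + d) (?f + d) + S n (?f + d)"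
      unfolding \<Phi>_def ed by (rule refl)
    have h4: "c ?e d ?e = c (?f + d) d (?f + d)" unfolding ed by (rule refl)
    have h5: "c ?W d ?e = c ?W d (?f + d)" unfolding ed by (rule refl)
    have h6: "c d ?f ?e = c d ?f (?f + d)" unfolding ed by (rule refl)
    show ?thesis unfolding h3 h4 h5 h6 \<Phi>_def[of "n - 1"] lin S.add using h1 h2 c_sym[of ?W ?f d] by argo
  qed
  \<comment> \<open>The dissipation \<open>(na d)^2\<close> of the implicit step is dropped.\<close>
  have "\<delta>\<^sup>2 / \<tau> + \<nu> / 2 * (p\<^sup>2 - q\<^sup>2) \<le> \<delta>\<^sup>2 / \<tau> + \<nu> * a ?e d"
    using a1 mult_left_mono[of "p\<^sup>2 - q\<^sup>2" "2 * a ?e d" "\<nu> / 2"] \<nu>_pos zero_le_power2[of "na d"]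
    by (simp add: mult.commute)
  also have "\<dots> = \<Phi> n - \<Phi> (n - 1) + (\<rho> n d - c ?W ?e d - c ?e ?W d + c ?e ?e d)
     - (2 * c ?W ?f d + 2 * c (?W - ?W') ?f ?f - c d ?f ?e - c d ?f ?f + (S n ?f - S (n - 1) ?f))"
    using eq phi by simp
  also have "\<dots> \<le> \<Phi> n - \<Phi> (n - 1)
     + (\<alpha> n * \<delta> + \<beta> * K * p * \<delta> + \<beta> * p * K * \<delta> + \<beta> * p * p * \<delta>)
     + (2 * (\<beta> * K * q * \<delta>) + 2 * (\<beta> * (\<tau> * K') * q * q) + \<beta> * \<delta> * q * p + \<beta> * \<delta> * q * q + \<tau> * s' n * q)"
    using t1 t2 t3 t4 t5 t6 t7 t8 t9 unfolding abs_le_iff by linarith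
  also have "\<dots> = \<Phi> n - \<Phi> (n - 1) + \<delta> * (\<alpha> n + \<beta> * (2 * K * (p + q) + (p * p + p * q + q * q)))
     + \<tau> * (2 * \<beta> * K' * q\<^sup>2 + s' n * q)"
    by (simp add: algebra_simps power2_eq_square)
  finally have i1: "\<delta>\<^sup>2 / \<tau> + \<nu> / 2 * (p\<^sup>2 - q\<^sup>2) \<le> \<Phi> n - \<Phi> (n - 1)
     + \<delta> * (\<alpha> n + \<beta> * (2 * K * (p + q) + (p * p + p * q + q * q))) + \<tau> * (2 * \<beta> * K' * q\<^sup>2 + s' n * q)" .
  \<comment> \<open>Half of \<open>\<delta>^2 / \<tau>\<close> is spent here; the other half remains
    on the left and later controls the increments.\<close>
  have i2: "\<delta> * (\<alpha> n + \<beta> * (2 * K * (p + q) + (p * p + p * q + q * q)))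
      \<le> \<delta>\<^sup>2 / (2 * \<tau>) + \<tau> / 2 * (\<alpha> n + \<beta> * (2 * K * (p + q) + (p * p + p * q + q * q)))\<^sup>2"
    using young[of "1 / (2 * \<tau>)" \<delta> "\<alpha> n + \<beta> * (2 * K * (p + q) + (p * p + p * q + q * q))"] \<tau>_pos
    by (simp add: mult.commute[of \<tau>])
  have i3: "(\<alpha> n + \<beta> * (2 * K * (p + q) + (p * p + p * q + q * q)))\<^sup>2 \<le>
     3 * ((\<alpha> n)\<^sup>2 + 8 * \<beta>\<^sup>2 * K\<^sup>2 * (p\<^sup>2 + q\<^sup>2) + 9 / 2 * \<beta>\<^sup>2 * ((p\<^sup>2)\<^sup>2 + (q\<^sup>2)\<^sup>2))"
  proof -
    have sq3: "(x + y + z)\<^sup>2 \<le> 3 * (x\<^sup>2 + y\<^sup>2 + z\<^sup>2)" for x y z :: real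
      using zero_le_power2[of "x - y"] zero_le_power2[of "y - z"] zero_le_power2[of "x - z"]
      by (simp add: power2_eq_square algebra_simps)
    have sq2: "(x + y)\<^sup>2 \<le> 2 * (x\<^sup>2 + y\<^sup>2)" for x y :: real
      using zero_le_power2[of "x - y"] by (simp add: power2_eq_square algebra_simps)
    have h1: "(\<beta> * (2 * K * (p + q)))\<^sup>2 \<le> 8 * \<beta>\<^sup>2 * K\<^sup>2 * (p\<^sup>2 + q\<^sup>2)"
    proof -
      have "(\<beta> * (2 * K * (p + q)))\<^sup>2 = 4 * \<beta>\<^sup>2 * K\<^sup>2 * (p + q)\<^sup>2"
        by (simp only: power_mult_distrib) simp
      also have "\<dots> \<le> 4 * \<beta>\<^sup>2 * K\<^sup>2 * (2 * (p\<^sup>2 + q\<^sup>2))" by (intro mult_left_mono sq2) auto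
      finally show ?thesis by (simp add: algebra_simps)
    qed
    have h2: "(\<beta> * (p * p + p * q + q * q))\<^sup>2 \<le> 9 / 2 * \<beta>\<^sup>2 * ((p\<^sup>2)\<^sup>2 + (q\<^sup>2)\<^sup>2)"
    proof -
      have "p * p + p * q + q * q \<le> 3 / 2 * (p\<^sup>2 + q\<^sup>2)"
        using zero_le_power2[of "p - q"] by (simp add: power2_eq_square algebra_simps)
      then have "(p * p + p * q + q * q)\<^sup>2 \<le> (3 / 2 * (p\<^sup>2 + q\<^sup>2))\<^sup>2"
        using pos by (intro power_mono) auto
      also have "\<dots> = 9 / 4 * (p\<^sup>2 + q\<^sup>2)\<^sup>2" by (simp add: power2_eq_square algebra_simps)
      also have "\<dots> \<le> 9 / 4 * (2 * ((p\<^sup>2)\<^sup>2 + (q\<^sup>2)\<^sup>2))" by (intro mult_left_mono sq2) auto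
      finally have "\<beta>\<^sup>2 * (p * p + p * q + q * q)\<^sup>2 \<le> \<beta>\<^sup>2 * (9 / 4 * (2 * ((p\<^sup>2)\<^sup>2 + (q\<^sup>2)\<^sup>2)))"
        by (intro mult_left_mono) auto
      then show ?thesis unfolding power_mult_distrib[of \<beta>] by argo
    qed
    show ?thesis
      using sq3[of "\<alpha> n" "\<beta> * (2 * K * (p + q))" "\<beta> * (p * p + p * q + q * q)"] h1 h2
      by (simp add: distrib_left add.assoc)
  qed
  have i4: "s' n * q \<le> (s' n)\<^sup>2 + q\<^sup>2"
    using sum_squares_bound[of "s' n" q] zero_le_power2[of "s' n"] zero_le_power2[of q] by linarith
  have "\<delta>\<^sup>2 / \<tau> + \<nu> / 2 * (p\<^sup>2 - q\<^sup>2) \<le> \<Phi> n - \<Phi> (n - 1) + (\<delta>\<^sup>2 / (2 * \<tau>) + \<tau> / 2 * (3 * ((\<alpha> n)\<^sup>2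
      + 8 * \<beta>\<^sup>2 * K\<^sup>2 * (p\<^sup>2 + q\<^sup>2) + 9 / 2 * \<beta>\<^sup>2 * ((p\<^sup>2)\<^sup>2 + (q\<^sup>2)\<^sup>2))))
      + \<tau> * (2 * \<beta> * K' * q\<^sup>2 + ((s' n)\<^sup>2 + q\<^sup>2))"
  proof -
    have "\<tau> / 2 * (\<alpha> n + \<beta> * (2 * K * (p + q) + (p * p + p * q + q * q)))\<^sup>2 \<le> \<tau> / 2 * (3 * ((\<alpha> n)\<^sup>2
      + 8 * \<beta>\<^sup>2 * K\<^sup>2 * (p\<^sup>2 + q\<^sup>2) + 9 / 2 * \<beta>\<^sup>2 * ((p\<^sup>2)\<^sup>2 + (q\<^sup>2)\<^sup>2)))"
      using \<tau>_pos by (intro mult_left_mono i3) auto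
    moreover have "\<tau> * (2 * \<beta> * K' * q\<^sup>2 + s' n * q) \<le> \<tau> * (2 * \<beta> * K' * q\<^sup>2 + ((s' n)\<^sup>2 + q\<^sup>2))"
      using \<tau>_pos i4 by (intro mult_left_mono) auto
    ultimately show ?thesis using i1 i2 by linarith
  qed
  also have "\<dots> = \<Phi> n - \<Phi> (n - 1) + \<delta>\<^sup>2 / (2 * \<tau>) + \<tau> * (3 / 2 * (\<alpha> n)\<^sup>2
      + 12 * \<beta>\<^sup>2 * K\<^sup>2 * (p\<^sup>2 + q\<^sup>2) + 27 / 4 * \<beta>\<^sup>2 * ((p\<^sup>2)\<^sup>2 + (q\<^sup>2)\<^sup>2) + 2 * \<beta> * K' * q\<^sup>2 + (s' n)\<^sup>2 + q\<^sup>2)"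
    by (simp add: algebra_simps)
  also have "\<dots> \<le> \<Phi> n - \<Phi> (n - 1) + \<delta>\<^sup>2 / (2 * \<tau>) + \<tau> * (c2 * (p\<^sup>2 + q\<^sup>2)
        + 7 * \<beta>\<^sup>2 * ((p\<^sup>2)\<^sup>2 + (q\<^sup>2)\<^sup>2) + 2 * (\<alpha> n)\<^sup>2 + (s' n)\<^sup>2)"
  proof -
    have "27 / 4 * \<beta>\<^sup>2 * ((p\<^sup>2)\<^sup>2 + (q\<^sup>2)\<^sup>2) \<le> 7 * \<beta>\<^sup>2 * ((p\<^sup>2)\<^sup>2 + (q\<^sup>2)\<^sup>2)"
      by (intro mult_right_mono) auto
    moreover have "2 * \<beta> * K' * q\<^sup>2 \<le> 2 * \<beta> * K' * (p\<^sup>2 + q\<^sup>2)"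
      using \<beta>_pos K'_pos by (intro mult_left_mono) auto
    moreover have "c2 * (p\<^sup>2 + q\<^sup>2)
        = 12 * \<beta>\<^sup>2 * K\<^sup>2 * (p\<^sup>2 + q\<^sup>2) + 2 * \<beta> * K' * (p\<^sup>2 + q\<^sup>2) + (p\<^sup>2 + q\<^sup>2)"
      by (simp add: drift_const_def algebra_simps)
    moreover have "0 \<le> p\<^sup>2" "0 \<le> (\<alpha> n)\<^sup>2" by simp_all
    ultimately have "3 / 2 * (\<alpha> n)\<^sup>2 + 12 * \<beta>\<^sup>2 * K\<^sup>2 * (p\<^sup>2 + q\<^sup>2)
        + 27 / 4 * \<beta>\<^sup>2 * ((p\<^sup>2)\<^sup>2 + (q\<^sup>2)\<^sup>2) + 2 * \<beta> * K' * q\<^sup>2 + (s' n)\<^sup>2 + q\<^sup>2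
      \<le> c2 * (p\<^sup>2 + q\<^sup>2) + 7 * \<beta>\<^sup>2 * ((p\<^sup>2)\<^sup>2 + (q\<^sup>2)\<^sup>2) + 2 * (\<alpha> n)\<^sup>2 + (s' n)\<^sup>2"
      by linarith
    then show ?thesis using mult_left_mono[OF _ less_imp_le[OF \<tau>_pos]] by (intro add_left_mono) blast
  qed
  finally have "\<delta>\<^sup>2 / \<tau> - \<delta>\<^sup>2 / (2 * \<tau>) + \<nu> / 2 * (p\<^sup>2 - q\<^sup>2) \<le> \<Phi> n - \<Phi> (n - 1) + \<tau> * (c2 * (p\<^sup>2 + q\<^sup>2)
        + 7 * \<beta>\<^sup>2 * ((p\<^sup>2)\<^sup>2 + (q\<^sup>2)\<^sup>2) + 2 * (\<alpha> n)\<^sup>2 + (s' n)\<^sup>2)" by linarith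
  moreover have "\<delta>\<^sup>2 / \<tau> - \<delta>\<^sup>2 / (2 * \<tau>) = \<delta>\<^sup>2 / (2 * \<tau>)" using \<tau>_pos by (simp add: field_simps)
  ultimately show ?thesis by (simp add: p_def q_def \<delta>_def d_def)
qed

text \<open>Each \<open>na (e n)\<close> occurs in the steps \<open>n\<close> and
  \<open>n + 1\<close>, which doubles the coefficients. The last level occurs only once; the
  subtracted term records this and makes the induction work.\<close>

lemma gradient_sum:
  assumes "N \<le> M"
  shows "(\<Sum>n=1..N. (nm (e n - e (n - 1)))\<^sup>2 / (2 * \<tau>)) + \<nu> / 2 * (na (e N))\<^sup>2
    \<le> \<Phi> N + \<tau> * (\<Sum>n=1..N. 2 * c2 * (na (e n))\<^sup>2 + 14 * \<beta>\<^sup>2 * ((na (e n))\<^sup>2)\<^sup>2 + 2 * (\<alpha> n)\<^sup>2 + (s' n)\<^sup>2)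
      - \<tau> * (c2 * (na (e N))\<^sup>2 + 7 * \<beta>\<^sup>2 * ((na (e N))\<^sup>2)\<^sup>2)"
  using assms
proof (induction N)
  case 0
  interpret S: linear "S k" for k by (rule S_lin)
  show ?case by (simp add: \<Phi>_def lin S.zero na_def)
next
  case (Suc N)
  show ?case
    using Suc.IH Suc.prems gradient_step[of "Suc N"] by (simp add: algebra_simps)
qed

text \<open>The bound for the cubic term is left as a hypothesis with a parameter, because it is met
  in two ways: with \<open>K1 = 0\<close> where the L2 error is small, and with a positive
  \<open>K1\<close> where the gradient of the error is bounded.\<close>

lemma \<Phi>_le:
  assumes n: "n \<in> {1..M}"
    and cubic: "\<bar>c (e n) (e n) (e n)\<bar> \<le> \<nu> / 16 * (na (e n))\<^sup>2 + K1 * (nm (e n))\<^sup>2"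
  shows "\<Phi> n \<le> 3 * \<nu> / 16 * (na (e n))\<^sup>2 + (16 * \<beta>\<^sup>2 * K\<^sup>2 / \<nu> + K1) * (nm (e n))\<^sup>2 + 4 / \<nu> * (s n)\<^sup>2"
proof -
  have Wp: "na (W n) \<le> K" using W_le n by simp
  have "2 * c (W n) (e n) (e n) \<le> na (e n) * (2 * \<beta> * K * nm (e n))"
    using c_le3'[OF Wp, of "e n" "e n"] by (simp add: abs_le_iff mult_ac)
  also have "\<dots> \<le> \<nu> / 16 * (na (e n))\<^sup>2 + (2 * \<beta> * K * nm (e n))\<^sup>2 / (4 * (\<nu> / 16))"
    using \<nu>_pos by (intro young) auto
  also have "(2 * \<beta> * K * nm (e n))\<^sup>2 / (4 * (\<nu> / 16)) = 16 * \<beta>\<^sup>2 * K\<^sup>2 / \<nu> * (nm (e n))\<^sup>2"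
    by (simp add: power_mult_distrib)
  finally have 1: "2 * c (W n) (e n) (e n)
      \<le> \<nu> / 16 * (na (e n))\<^sup>2 + 16 * \<beta>\<^sup>2 * K\<^sup>2 / \<nu> * (nm (e n))\<^sup>2" .
  have "S n (e n) \<le> na (e n) * s n" using S_le[OF n, of "e n"] by (simp add: abs_le_iff mult_ac)
  also have "\<dots> \<le> \<nu> / 16 * (na (e n))\<^sup>2 + (s n)\<^sup>2 / (4 * (\<nu> / 16))"
    using \<nu>_pos by (intro young) auto
  finally have 2: "S n (e n) \<le> \<nu> / 16 * (na (e n))\<^sup>2 + 4 / \<nu> * (s n)\<^sup>2" by simp
  show ?thesis using 1 2 cubic unfolding \<Phi>_def distrib_right by linarith
qed

lemma energy_estimate':
  assumes \<tau>: "\<tau> * c1 \<le> 1 / 2" and N: "N \<le> M" and T: "\<tau> * M \<le> T"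
    and F: "\<And>j. j \<in> {1..N} \<Longrightarrow> (s j)\<^sup>2 \<le> F" "\<tau> * (\<Sum>j=1..N. (\<alpha> j)\<^sup>2) \<le> F" "0 \<le> F"
  shows "(nm (e N))\<^sup>2 + \<tau> * \<nu> * (\<Sum>j=1..N. (na (e j))\<^sup>2) \<le> energy_const \<beta> \<nu> K T * F"
proof -
  have \<tau>N: "\<tau> * N \<le> T" using N \<tau>_pos by (intro order.trans[OF _ T]) simp
  have "(\<Sum>j=1..N. (s j)\<^sup>2) \<le> (\<Sum>j=1..N. F)" using F by (intro sum_mono) auto
  then have "\<tau> * (\<Sum>j=1..N. (s j)\<^sup>2) \<le> \<tau> * (N * F)" using \<tau>_pos by (intro mult_left_mono) auto
  also have "\<dots> \<le> T * F" using mult_right_mono[OF \<tau>N F(3)] by (simp add: mult_ac)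
  finally have s1: "\<tau> * (\<Sum>j=1..N. (s j)\<^sup>2) \<le> T * F" .
  have "\<tau> * (\<Sum>j=1..N. (\<alpha> j)\<^sup>2 + 2 / \<nu> * (s j)\<^sup>2)
      = \<tau> * (\<Sum>j=1..N. (\<alpha> j)\<^sup>2) + 2 / \<nu> * (\<tau> * (\<Sum>j=1..N. (s j)\<^sup>2))"
    by (simp add: sum.distrib sum_distrib_left algebra_simps)
  also have "\<dots> \<le> F + 2 / \<nu> * (T * F)"
    using s1 F \<nu>_pos by (intro add_mono mult_left_mono) auto
  finally have 1: "\<tau> * (\<Sum>j=1..N. (\<alpha> j)\<^sup>2 + 2 / \<nu> * (s j)\<^sup>2) \<le> F + 2 / \<nu> * (T * F)" .
  have "(nm (e N))\<^sup>2 + \<tau> * \<nu> * (\<Sum>j=1..N. (na (e j))\<^sup>2)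
    \<le> exp (2 * c1 * (\<tau> * N)) * (\<tau> * (\<Sum>j=1..N. (\<alpha> j)\<^sup>2 + 2 / \<nu> * (s j)\<^sup>2))"
    by (rule energy_estimate[OF \<tau> N])
  also have "\<dots> \<le> exp (2 * c1 * T) * (F + 2 / \<nu> * (T * F))"
    using \<tau>N c1_pos \<tau>_pos \<nu>_pos 1
    by (intro mult_mono) (auto intro!: mult_nonneg_nonneg sum_nonneg)
  finally show ?thesis by (simp add: energy_const_def algebra_simps)
qed

lemma energy_const_pos: "0 \<le> T \<Longrightarrow> 0 < energy_const \<beta> \<nu> K T"
  using \<nu>_pos by (auto simp: energy_const_def intro!: mult_pos_pos add_pos_nonneg)

lemma drift_const_pos: "0 < c2"
  using \<beta>_pos K'_pos by (auto simp: drift_const_def intro!: add_nonneg_pos)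

lemma load_const_pos: "0 \<le> T \<Longrightarrow> 0 \<le> K1 \<Longrightarrow> 0 < load_const \<beta> \<nu> K K' T K1"
  using \<nu>_pos energy_const_pos[of T] drift_const_pos unfolding load_const_def
  by (intro add_nonneg_pos add_nonneg_nonneg mult_nonneg_nonneg divide_nonneg_nonneg) auto

lemma gradient_const_pos: "0 \<le> T \<Longrightarrow> 0 \<le> K1 \<Longrightarrow> 0 < gradient_const \<beta> \<nu> K K' T K1 F"
  using \<nu>_pos load_const_pos[of T K1] by (simp add: gradient_const_def)

section \<open>Gradient estimate under bounds for the cubic term and for the Gronwall
  weights\<close>

context
  fixes T K1 F :: real and N :: nat
  assumes \<tau>c1: "\<tau> * c1 \<le> 1 / 2" and N: "N \<le> M" and T: "\<tau> * M \<le> T" and K1: "0 \<le> K1"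
    and Fs: "\<And>j. j \<in> {1..N} \<Longrightarrow> (s j)\<^sup>2 \<le> F" and F\<alpha>: "\<tau> * (\<Sum>j=1..N. (\<alpha> j)\<^sup>2) \<le> F"
    and Fs': "\<tau> * (\<Sum>j=1..N. (s' j)\<^sup>2) \<le> F" and F0: "0 \<le> F"
    and cubic: "\<And>j. j \<in> {1..N} \<Longrightarrow>
      \<bar>c (e j) (e j) (e j)\<bar> \<le> \<nu> / 16 * (na (e j))\<^sup>2 + K1 * (nm (e j))\<^sup>2"
    and weights: "\<And>j. j \<in> {1..N} \<Longrightarrow> 56 * \<beta>\<^sup>2 / \<nu> * (\<tau> * (na (e j))\<^sup>2) \<le> 1 / 2"
begin

lemma T_nonneg: "0 \<le> T"
  by (rule order.trans[OF _ T]) (use \<tau>_pos in simp)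

lemma sum_F_le:
  assumes "n \<le> N"
  shows "\<tau> * (\<Sum>j=1..n. (\<alpha> j)\<^sup>2) \<le> F" "\<tau> * (\<Sum>j=1..n. (s' j)\<^sup>2) \<le> F"
    "(nm (e n))\<^sup>2 \<le> energy_const \<beta> \<nu> K T * F"
    "\<tau> * (\<Sum>j=1..n. (na (e j))\<^sup>2) \<le> energy_const \<beta> \<nu> K T * F / \<nu>"
proof -
  have "(\<Sum>j=1..n. (\<alpha> j)\<^sup>2) \<le> (\<Sum>j=1..N. (\<alpha> j)\<^sup>2)" using assms by (intro sum_mono2) auto
  then show 1: "\<tau> * (\<Sum>j=1..n. (\<alpha> j)\<^sup>2) \<le> F"
    using \<tau>_pos by (intro order.trans[OF _ F\<alpha>] mult_left_mono) auto
  have "(\<Sum>j=1..n. (s' j)\<^sup>2) \<le> (\<Sum>j=1..N. (s' j)\<^sup>2)" using assms by (intro sum_mono2) auto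
  then show "\<tau> * (\<Sum>j=1..n. (s' j)\<^sup>2) \<le> F"
    using \<tau>_pos by (intro order.trans[OF _ Fs'] mult_left_mono) auto
  have *: "(nm (e n))\<^sup>2 + \<tau> * \<nu> * (\<Sum>j=1..n. (na (e j))\<^sup>2) \<le> energy_const \<beta> \<nu> K T * F"
    using assms N 1 Fs F0 by (intro energy_estimate' \<tau>c1 T) auto
  have **: "0 \<le> \<tau> * \<nu> * (\<Sum>j=1..n. (na (e j))\<^sup>2)"
    using \<tau>_pos \<nu>_pos by (intro mult_nonneg_nonneg sum_nonneg) auto
  show "(nm (e n))\<^sup>2 \<le> energy_const \<beta> \<nu> K T * F" using * ** by linarith
  have "\<tau> * \<nu> * (\<Sum>j=1..n. (na (e j))\<^sup>2) \<le> energy_const \<beta> \<nu> K T * F"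
    using * zero_le_power2[of "nm (e n)"] by linarith
  then show "\<tau> * (\<Sum>j=1..n. (na (e j))\<^sup>2) \<le> energy_const \<beta> \<nu> K T * F / \<nu>"
    using \<nu>_pos by (simp add: pos_le_divide_eq mult_ac)
qed

text \<open>\<open>\<Phi>\<close> takes \<open>3 * \<nu> / 16\<close> of the available
  \<open>\<nu> / 2\<close>, so more than \<open>\<nu> / 4\<close> is left. The quartic sum is the
  only remaining term that is not linear in \<open>F\<close>.\<close>

lemma gradient_load:
  assumes n: "n \<le> N"
  shows "(\<Sum>j=1..n. (nm (e j - e (j - 1)))\<^sup>2 / (2 * \<tau>)) + \<nu> / 4 * (na (e n))\<^sup>2
    \<le> load_const \<beta> \<nu> K K' T K1 * F + 14 * \<beta>\<^sup>2 * (\<tau> * (\<Sum>j=1..n. ((na (e j))\<^sup>2)\<^sup>2))"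
proof (cases "n = 0")
  case True
  then show ?thesis using load_const_pos[OF T_nonneg K1] F0 by (simp add: na_def lin)
next
  case False
  then have n': "n \<in> {1..M}" using n N by auto
  let ?E = "energy_const \<beta> \<nu> K T"
  have c: "0 \<le> \<tau> * (c2 * (na (e n))\<^sup>2 + 7 * \<beta>\<^sup>2 * ((na (e n))\<^sup>2)\<^sup>2)"
    using \<tau>_pos drift_const_pos by (intro mult_nonneg_nonneg add_nonneg_nonneg) auto
  have i1: "(\<Sum>j=1..n. (nm (e j - e (j - 1)))\<^sup>2 / (2 * \<tau>)) + \<nu> / 2 * (na (e n))\<^sup>2
     \<le> \<Phi> n + \<tau> * (\<Sum>j=1..n. 2 * c2 * (na (e j))\<^sup>2 + 14 * \<beta>\<^sup>2 * ((na (e j))\<^sup>2)\<^sup>2 + 2 * (\<alpha> j)\<^sup>2 + (s' j)\<^sup>2)"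
    using gradient_sum[of n] n' c by simp
  have i2: "\<tau> * (\<Sum>j=1..n. 2 * c2 * (na (e j))\<^sup>2 + 14 * \<beta>\<^sup>2 * ((na (e j))\<^sup>2)\<^sup>2 + 2 * (\<alpha> j)\<^sup>2 + (s' j)\<^sup>2)
    = 2 * c2 * (\<tau> * (\<Sum>j=1..n. (na (e j))\<^sup>2)) + 14 * \<beta>\<^sup>2 * (\<tau> * (\<Sum>j=1..n. ((na (e j))\<^sup>2)\<^sup>2))
      + 2 * (\<tau> * (\<Sum>j=1..n. (\<alpha> j)\<^sup>2)) + \<tau> * (\<Sum>j=1..n. (s' j)\<^sup>2)"
    by (simp add: sum.distrib sum_distrib_left algebra_simps)
  have i3: "2 * c2 * (\<tau> * (\<Sum>j=1..n. (na (e j))\<^sup>2)) \<le> 2 * c2 * (?E * F / \<nu>)"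
    using sum_F_le(4)[OF n] drift_const_pos by (intro mult_left_mono) auto
  have i4: "\<Phi> n \<le> 3 * \<nu> / 16 * (na (e n))\<^sup>2 + (16 * \<beta>\<^sup>2 * K\<^sup>2 / \<nu> + K1) * (?E * F) + 4 / \<nu> * F"
  proof -
    have "(16 * \<beta>\<^sup>2 * K\<^sup>2 / \<nu> + K1) * (nm (e n))\<^sup>2 \<le> (16 * \<beta>\<^sup>2 * K\<^sup>2 / \<nu> + K1) * (?E * F)"
      using sum_F_le(3)[OF n] K1 \<nu>_pos by (intro mult_left_mono) auto
    moreover have "4 / \<nu> * (s n)\<^sup>2 \<le> 4 / \<nu> * F"
      using Fs[of n] False n \<nu>_pos by (intro mult_left_mono) auto
    ultimately show ?thesis
      using \<Phi>_le[OF n' cubic] False n by fastforce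
  qed
  have "(\<Sum>j=1..n. (nm (e j - e (j - 1)))\<^sup>2 / (2 * \<tau>)) + \<nu> / 2 * (na (e n))\<^sup>2
    \<le> 3 * \<nu> / 16 * (na (e n))\<^sup>2 + (16 * \<beta>\<^sup>2 * K\<^sup>2 / \<nu> + K1) * (?E * F) + 4 / \<nu> * F
      + (2 * c2 * (?E * F / \<nu>) + 14 * \<beta>\<^sup>2 * (\<tau> * (\<Sum>j=1..n. ((na (e j))\<^sup>2)\<^sup>2)) + 2 * F + F)"
    using i1 i2 i3 i4 sum_F_le(1,2)[OF n] by linarith
  also have "\<dots> = 3 * \<nu> / 16 * (na (e n))\<^sup>2 + (load_const \<beta> \<nu> K K' T K1 * F
      + 14 * \<beta>\<^sup>2 * (\<tau> * (\<Sum>j=1..n. ((na (e j))\<^sup>2)\<^sup>2)))"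
    by (simp add: load_const_def algebra_simps)
  finally have "(\<Sum>j=1..n. (nm (e j - e (j - 1)))\<^sup>2 / (2 * \<tau>)) + 5 * \<nu> / 16 * (na (e n))\<^sup>2
    \<le> load_const \<beta> \<nu> K K' T K1 * F + 14 * \<beta>\<^sup>2 * (\<tau> * (\<Sum>j=1..n. ((na (e j))\<^sup>2)\<^sup>2))"
    by (simp add: field_simps)
  moreover have "\<nu> / 4 * (na (e n))\<^sup>2 \<le> 5 * \<nu> / 16 * (na (e n))\<^sup>2"
    using \<nu>_pos by (intro mult_right_mono) auto
  ultimately show ?thesis by linarith
qed

text \<open>The quartic sum is read as a weighted sum of \<open>(na (e j))^2\<close> with weights
  proportional to \<open>\<tau> * (na (e j))^2\<close>, whose total is bounded by the L2
  estimate.\<close>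

lemma gradient_estimate:
  assumes n: "n \<le> N"
  shows "(na (e n))\<^sup>2 \<le> gradient_const \<beta> \<nu> K K' T K1 F * F"
proof -
  define A where "A k = 4 / \<nu> * load_const \<beta> \<nu> K K' T K1 * F
    + (\<Sum>j=1..k. 56 * \<beta>\<^sup>2 / \<nu> * (\<tau> * (na (e j))\<^sup>2) * (na (e j))\<^sup>2)" for k
  have w: "0 \<le> 56 * \<beta>\<^sup>2 / \<nu> * (\<tau> * (na (e j))\<^sup>2)" for j
    using \<nu>_pos \<tau>_pos by (intro mult_nonneg_nonneg) auto
  have A0: "0 \<le> A 0"
    using load_const_pos[OF T_nonneg K1] F0 \<nu>_pos by (simp add: A_def)
  have y: "(na (e k))\<^sup>2 \<le> A k" if "k \<le> N" for k
  proof -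
    have "0 \<le> (\<Sum>j=1..k. (nm (e j - e (j - 1)))\<^sup>2 / (2 * \<tau>))" using \<tau>_pos by (intro sum_nonneg) auto
    then have "\<nu> / 4 * (na (e k))\<^sup>2 \<le> load_const \<beta> \<nu> K K' T K1 * F + 14 * \<beta>\<^sup>2 * (\<tau> * (\<Sum>j=1..k. ((na (e j))\<^sup>2)\<^sup>2))"
      using gradient_load[OF that] by linarith
    then have "4 / \<nu> * (\<nu> / 4 * (na (e k))\<^sup>2) \<le>
      4 / \<nu> * (load_const \<beta> \<nu> K K' T K1 * F + 14 * \<beta>\<^sup>2 * (\<tau> * (\<Sum>j=1..k. ((na (e j))\<^sup>2)\<^sup>2)))"
      using \<nu>_pos by (intro mult_left_mono) auto
    also have "\<dots> = A k"
      by (simp add: A_def sum_distrib_left power2_eq_square algebra_simps)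
    finally show ?thesis using \<nu>_pos by simp
  qed
  have A_Suc: "A k = A (k - 1) + 56 * \<beta>\<^sup>2 / \<nu> * (\<tau> * (na (e k))\<^sup>2) * (na (e k))\<^sup>2" if "k \<ge> 1" for k
    using that by (cases k) (auto simp: A_def)
  have "A n \<le> exp (2 * (\<Sum>j=1..n. 56 * \<beta>\<^sup>2 / \<nu> * (\<tau> * (na (e j))\<^sup>2))) * (A 0 + (\<Sum>j=1..n. 0))"
  proof (rule discrete_gronwall)
    fix k assume "k \<in> {1..n}"
    then show "A k \<le> A (k - 1) + 56 * \<beta>\<^sup>2 / \<nu> * (\<tau> * (na (e k))\<^sup>2) * A k + 0"
      using y[of k] n A_Suc[of k] mult_left_mono[OF y[of k] w[of k]] by simp
    show "0 \<le> 56 * \<beta>\<^sup>2 / \<nu> * (\<tau> * (na (e k))\<^sup>2) \<and> 56 * \<beta>\<^sup>2 / \<nu> * (\<tau> * (na (e k))\<^sup>2) \<le> 1 / 2 \<and> 0 \<le> (0::real)"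
      using weights[of k] w[of k] \<open>k \<in> {1..n}\<close> n by auto
  next
    fix k assume "k \<le> n"
    then show "0 \<le> A k" using y[of k] n zero_le_power2[of "na (e k)"] by linarith
  qed
  also have "(\<Sum>j=1..n. 56 * \<beta>\<^sup>2 / \<nu> * (\<tau> * (na (e j))\<^sup>2)) = 56 * \<beta>\<^sup>2 / \<nu> * (\<tau> * (\<Sum>j=1..n. (na (e j))\<^sup>2))"
    by (simp add: sum_distrib_left)
  also have "exp (2 * (56 * \<beta>\<^sup>2 / \<nu> * (\<tau> * (\<Sum>j=1..n. (na (e j))\<^sup>2)))) * (A 0 + (\<Sum>j=1..n. 0))
     \<le> exp (2 * (56 * \<beta>\<^sup>2 / \<nu> * (energy_const \<beta> \<nu> K T * F / \<nu>))) * (A 0 + (\<Sum>j=1..n. 0))"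
  proof -
    have "56 * \<beta>\<^sup>2 / \<nu> * (\<tau> * (\<Sum>j=1..n. (na (e j))\<^sup>2)) \<le> 56 * \<beta>\<^sup>2 / \<nu> * (energy_const \<beta> \<nu> K T * F / \<nu>)"
      using sum_F_le(4)[OF n] \<nu>_pos by (intro mult_left_mono) auto
    then show ?thesis using A0 by (intro mult_right_mono) auto
  qed
  also have "\<dots> = gradient_const \<beta> \<nu> K K' T K1 F * F"
    by (simp add: gradient_const_def A_def)
  finally show ?thesis using y[OF n] by linarith
qed

text \<open>Uses the other term on the left of \<open>gradient_load\<close>. It serves to find a
  time step at which the difference quotient of the error is bounded independently of
  \<open>\<tau>\<close>.\<close>

lemma increments_estimate:
  shows "(\<Sum>j=1..N. (nm (e j - e (j - 1)))\<^sup>2 / (2 * \<tau>)) \<le> load_const \<beta> \<nu> K K' T K1 * F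
    + 14 * \<beta>\<^sup>2 * (gradient_const \<beta> \<nu> K K' T K1 F * F * (energy_const \<beta> \<nu> K T * F / \<nu>))"
proof -
  let ?Y = "gradient_const \<beta> \<nu> K K' T K1 F * F"
  have Y0: "0 \<le> ?Y" using gradient_const_pos[OF T_nonneg K1, of F] F0 by simp
  have sq: "((na (e j))\<^sup>2)\<^sup>2 \<le> ?Y * (na (e j))\<^sup>2" if "j \<in> {1..N}" for j
    using mult_right_mono[OF gradient_estimate[of j] zero_le_power2[of "na (e j)"]] that
    by (metis atLeastAtMost_iff power2_eq_square)
  have "\<tau> * (\<Sum>j=1..N. ((na (e j))\<^sup>2)\<^sup>2) \<le> \<tau> * (\<Sum>j=1..N. ?Y * (na (e j))\<^sup>2)"
    using \<tau>_pos by (intro mult_left_mono sum_mono sq) auto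
  also have "\<dots> = ?Y * (\<tau> * (\<Sum>j=1..N. (na (e j))\<^sup>2))"
    by (simp add: sum_distrib_left mult_ac)
  also have "\<dots> \<le> ?Y * (energy_const \<beta> \<nu> K T * F / \<nu>)"
    using sum_F_le(4)[of N] Y0 by (intro mult_left_mono) auto
  finally have "14 * \<beta>\<^sup>2 * (\<tau> * (\<Sum>j=1..N. ((na (e j))\<^sup>2)\<^sup>2)) \<le> 14 * \<beta>\<^sup>2 * (?Y * (energy_const \<beta> \<nu> K T * F / \<nu>))"
    by (intro mult_left_mono) auto
  moreover have "0 \<le> \<nu> / 4 * (na (e N))\<^sup>2" using \<nu>_pos by simp
  ultimately show ?thesis using gradient_load[of N] by linarith
qed

end

section \<open>A priori bounds for the discrete solution\<close>

lemma U_energy_step: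
  assumes n: "n \<in> {1..M}"
  shows "(nm (U n))\<^sup>2 + 2 * \<tau> * \<nu> * (na (U n))\<^sup>2 \<le> (nm (U (n - 1)))\<^sup>2"
proof -
  let ?u = "U n" and ?w = "U (n - 1)"
  have "m (?u - ?w) ?u / \<tau> = - \<nu> * (na ?u)\<^sup>2" using scheme[OF n, of ?u] by (simp add: na_sq)
  then have eq: "m (?u - ?w) ?u = - \<tau> * \<nu> * (na ?u)\<^sup>2" using \<tau>_pos by (simp add: field_simps)
  have "2 * m (?u - ?w) ?u = (nm ?u)\<^sup>2 - (nm ?w)\<^sup>2 + (nm (?u - ?w))\<^sup>2"
    using m_sym[of ?w ?u] by (simp add: nm_sq lin)
  then show ?thesis using eq zero_le_power2[of "nm (?u - ?w)"] by linarith
qed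

lemma U_energy:
  "N \<le> M \<Longrightarrow> (nm (U N))\<^sup>2 + 2 * \<tau> * \<nu> * (\<Sum>j=1..N. (na (U j))\<^sup>2) \<le> (nm (U 0))\<^sup>2"
proof (induction N)
  case (Suc N)
  then show ?case using U_energy_step[of "Suc N"] by (simp add: algebra_simps)
qed simp

lemma nm_U_le: "N \<le> M \<Longrightarrow> nm (U N) \<le> nm (U 0)"
proof (rule power2_le_imp_le)
  assume "N \<le> M"
  moreover have "0 \<le> 2 * \<tau> * \<nu> * (\<Sum>j=1..N. (na (U j))\<^sup>2)"
    using \<tau>_pos \<nu>_pos by (intro mult_nonneg_nonneg sum_nonneg) auto
  ultimately show "(nm (U N))\<^sup>2 \<le> (nm (U 0))\<^sup>2" using U_energy[of N] by linarith
qed simp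

text \<open>Two consecutive equations are subtracted and tested with the increment \<open>d\<close>.
  The terms cubic in \<open>d\<close> cancel, and the rest contains \<open>U (n - 1)\<close>, whose
  squared gradients are summable by \<open>U_energy\<close>.\<close>

lemma increment_step:
  assumes n: "n \<in> {2..M}"
  shows "(nm (U n - U (n - 1)))\<^sup>2 \<le> (nm (U (n - 1) - U (n - 2)))\<^sup>2
    + 2 * \<beta>\<^sup>2 / \<nu> * (\<tau> * (na (U (n - 1)))\<^sup>2) * (nm (U n - U (n - 1)))\<^sup>2"
proof -
  let ?v = "U (n - 1)"
  define d where "d = U n - ?v"
  define d' where "d' = ?v - U (n - 2)"
  have ud: "U n = ?v + d" by (simp add: d_def)
  have n1: "n \<in> {1..M}" "n - 1 \<in> {1..M}" "n - 1 - 1 = n - 2" using n by auto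
  have e1: "m d d / \<tau> + \<nu> * a (?v + d) d + c (?v + d) (?v + d) d - c (?v + d) d (?v + d) = 0"
    using scheme[OF n1(1), of d] unfolding d_def[symmetric] ud[symmetric] .
  have e2: "m d' d / \<tau> + \<nu> * a ?v d + c ?v ?v d - c ?v d ?v = 0"
    using scheme[OF n1(2), of d] unfolding n1(3) d'_def[symmetric] .
  have e3: "m (d - d') d / \<tau> + \<nu> * a d d + c d ?v d - c d d ?v = 0"
    using e1 e2 c_sym[of ?v d d] unfolding lin diff_divide_distrib distrib_left by linarith
  have m1: "2 * m (d - d') d = (nm d)\<^sup>2 - (nm d')\<^sup>2 + (nm (d - d'))\<^sup>2"
    using m_sym[of d' d] by (simp add: nm_sq lin)
  have b1: "\<bar>c d ?v d\<bar> \<le> \<beta> * nm d * na ?v * na d" by (rule c_le1)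
  have b2: "\<bar>c d d ?v\<bar> \<le> \<beta> * nm d * na d * na ?v" by (rule c_le1)
  have y: "na d * (4 * \<beta> * nm d * na ?v) \<le> 2 * \<nu> * (na d)\<^sup>2 + (4 * \<beta> * nm d * na ?v)\<^sup>2 / (4 * (2 * \<nu>))"
    using \<nu>_pos by (intro young) auto
  have y2: "(4 * \<beta> * nm d * na ?v)\<^sup>2 / (4 * (2 * \<nu>)) = 2 * \<beta>\<^sup>2 / \<nu> * (na ?v)\<^sup>2 * (nm d)\<^sup>2"
    by (simp add: power_mult_distrib)
  have "2 * (m (d - d') d / \<tau>) \<le> 2 * \<beta>\<^sup>2 / \<nu> * (na ?v)\<^sup>2 * (nm d)\<^sup>2"
  proof -
    have "2 * (m (d - d') d / \<tau>) = - 2 * \<nu> * (na d)\<^sup>2 - 2 * c d ?v d + 2 * c d d ?v"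
      using e3 by (simp add: na_sq)
    also have "\<dots> \<le> - 2 * \<nu> * (na d)\<^sup>2 + na d * (4 * \<beta> * nm d * na ?v)"
      using b1 b2 by (simp add: abs_le_iff mult_ac)
    finally show ?thesis using y y2 by linarith
  qed
  then have "\<tau> * (2 * (m (d - d') d / \<tau>)) \<le> \<tau> * (2 * \<beta>\<^sup>2 / \<nu> * (na ?v)\<^sup>2 * (nm d)\<^sup>2)"
    using \<tau>_pos by (intro mult_left_mono) auto
  then have "2 * m (d - d') d \<le> 2 * \<beta>\<^sup>2 / \<nu> * (\<tau> * (na ?v)\<^sup>2) * (nm d)\<^sup>2"
    using \<tau>_pos by (simp add: mult_ac)
  then show ?thesis using m1 zero_le_power2[of "nm (d - d')"] unfolding d_def d'_def by linarith
qed

text \<open>Tested with \<open>U n\<close>, the scheme trades the gradient for the difference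
  quotient in time.\<close>

lemma na_U_le:
  assumes n: "n \<in> {1..M}"
  shows "\<nu> * (na (U n))\<^sup>2 \<le> nm (U n - U (n - 1)) / \<tau> * nm (U 0)"
proof -
  have "\<nu> * (na (U n))\<^sup>2 = - (m (U n - U (n - 1)) (U n)) / \<tau>"
    using scheme[OF n, of "U n"] by (simp add: na_sq)
  also have "\<dots> \<le> nm (U n - U (n - 1)) * nm (U n) / \<tau>"
    using m_cs[of "U n - U (n - 1)" "U n"] \<tau>_pos by (intro divide_right_mono) (auto simp: abs_le_iff)
  also have "\<dots> \<le> nm (U n - U (n - 1)) * nm (U 0) / \<tau>"
    using nm_U_le[of n] n \<tau>_pos by (intro divide_right_mono mult_left_mono) auto
  finally show ?thesis by simp
qed

text \<open>Gronwall needs weights at most 1/2, hence gradient bounds for all earlier levels, and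
  these follow by \<open>na_U_le\<close> from the bound being proved: a strong induction. The bound
  does not deteriorate, because the sum of the weights is limited by the energy of \<open>U\<close>
  and \<open>\<kappa>\<close> is fixed beforehand.\<close>

lemma increment_bound:
  assumes n0: "n0 \<in> {1..M}" and \<kappa>0: "nm (U n0 - U (n0 - 1)) \<le> \<tau> * \<kappa>0" "0 \<le> \<kappa>0"
    and R: "nm (U 0) \<le> R"
    and \<kappa>: "\<kappa> = exp (\<beta>\<^sup>2 * R\<^sup>2 / \<nu>\<^sup>2) * \<kappa>0"
    and small: "2 * \<beta>\<^sup>2 / \<nu> * (\<tau> * (\<kappa> * R / \<nu>)) \<le> 1 / 2"
    and n: "n0 \<le> n" "n \<le> M"
  shows "nm (U n - U (n - 1)) \<le> \<tau> * \<kappa>"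
  using n
proof (induction n rule: less_induct)
  case (less n)
  have \<kappa>_nonneg: "0 \<le> \<kappa>" using \<kappa> \<kappa>0 by simp
  have R0: "0 \<le> R" using R nm_nonneg[of "U 0"] by linarith
  define w where "w j = 2 * \<beta>\<^sup>2 / \<nu> * (\<tau> * (na (U j))\<^sup>2)" for j
  have w0: "0 \<le> w j" for j using \<nu>_pos \<tau>_pos by (simp add: w_def)
  have w1: "w j \<le> 1 / 2" if "n0 \<le> j" "j < n" for j
  proof -
    have j: "j \<in> {1..M}" using that less.prems n0 by auto
    have "nm (U j - U (j - 1)) / \<tau> \<le> \<kappa>"
      using less.IH[of j] that less.prems \<tau>_pos by (simp add: pos_divide_le_eq mult.commute)
    then have "nm (U j - U (j - 1)) / \<tau> * nm (U 0) \<le> \<kappa> * R"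
      using R \<kappa>_nonneg by (intro mult_mono) auto
    then have "\<nu> * (na (U j))\<^sup>2 \<le> \<kappa> * R" using na_U_le[OF j] by linarith
    then have "(na (U j))\<^sup>2 \<le> \<kappa> * R / \<nu>" using \<nu>_pos by (simp add: pos_le_divide_eq mult.commute)
    then have "w j \<le> 2 * \<beta>\<^sup>2 / \<nu> * (\<tau> * (\<kappa> * R / \<nu>))"
      unfolding w_def using \<nu>_pos \<tau>_pos by (intro mult_left_mono) auto
    then show ?thesis using small by linarith
  qed
  define A where "A i = (nm (U (n0 + i) - U (n0 + i - 1)))\<^sup>2" for i
  \<comment> \<open>The weight in step \<open>n0 + i\<close> belongs to the preceding level, which
    the induction hypothesis covers.\<close>
  have "A (n - n0) \<le> exp (2 * (\<Sum>i=1..n - n0. w (n0 + i - 1))) * (A 0 + (\<Sum>i=1..n - n0. 0))"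
  proof (rule discrete_gronwall)
    fix i assume i: "i \<in> {1..n - n0}"
    then have "n0 + i \<in> {2..M}" "n0 + i - 2 = n0 + (i - 1) - 1" "n0 + i - 1 = n0 + (i - 1)"
      using less.prems n0 by auto
    then show "A i \<le> A (i - 1) + w (n0 + i - 1) * A i + 0"
      using increment_step[of "n0 + i"] unfolding A_def w_def by simp
    have "n0 \<le> n0 + i - 1" "n0 + i - 1 < n" using i by auto
    then show "0 \<le> w (n0 + i - 1) \<and> w (n0 + i - 1) \<le> 1 / 2 \<and> 0 \<le> (0::real)"
      using w0 w1 by simp
  qed (simp add: A_def)
  also have "(\<Sum>i=1..n - n0. w (n0 + i - 1)) = (\<Sum>j=n0..<n. w j)"
    using less.prems by (intro sum.reindex_bij_witness[of _ "\<lambda>j. j + 1 - n0" "\<lambda>i. n0 + i - 1"]) auto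
  finally have 1: "A (n - n0) \<le> exp (2 * (\<Sum>j=n0..<n. w j)) * A 0" by simp
  have "(\<Sum>j=n0..<n. w j) \<le> (\<Sum>j=1..M. w j)"
    using less.prems n0 w0 by (intro sum_mono2) auto
  also have "\<dots> = \<beta>\<^sup>2 / \<nu>\<^sup>2 * (2 * \<tau> * \<nu> * (\<Sum>j=1..M. (na (U j))\<^sup>2))"
    using \<nu>_pos by (simp add: w_def sum_distrib_left power2_eq_square mult_ac)
  also have "\<dots> \<le> \<beta>\<^sup>2 / \<nu>\<^sup>2 * R\<^sup>2"
  proof -
    have "(nm (U 0))\<^sup>2 \<le> R\<^sup>2" using R by (intro power_mono) auto
    then have "2 * \<tau> * \<nu> * (\<Sum>j=1..M. (na (U j))\<^sup>2) \<le> R\<^sup>2"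
      using U_energy[of M] zero_le_power2[of "nm (U M)"] by linarith
    then show ?thesis by (intro mult_left_mono) auto
  qed
  \<comment> \<open>Gronwall is applied to squared increments, so its factor is the square of the
    one in \<open>\<kappa>\<close>.\<close>
  finally have "exp (2 * (\<Sum>j=n0..<n. w j)) \<le> exp (2 * (\<beta>\<^sup>2 * R\<^sup>2 / \<nu>\<^sup>2))" by simp
  then have 2: "exp (2 * (\<Sum>j=n0..<n. w j)) \<le> (exp (\<beta>\<^sup>2 * R\<^sup>2 / \<nu>\<^sup>2))\<^sup>2"
    unfolding exp_double .
  have 3: "A 0 \<le> (\<tau> * \<kappa>0)\<^sup>2" unfolding A_def using \<kappa>0 by (intro power_mono) auto
  have "A (n - n0) \<le> (exp (\<beta>\<^sup>2 * R\<^sup>2 / \<nu>\<^sup>2))\<^sup>2 * (\<tau> * \<kappa>0)\<^sup>2"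
    by (rule order.trans[OF 1]) (use 2 3 in \<open>intro mult_mono, auto simp: A_def\<close>)
  also have "\<dots> = (\<tau> * \<kappa>)\<^sup>2" by (simp add: \<kappa> power_mult_distrib mult_ac)
  finally have "(nm (U n - U (n - 1)))\<^sup>2 \<le> (\<tau> * \<kappa>)\<^sup>2" using less.prems by (simp add: A_def)
  then show ?case by (rule power2_le_imp_le) (use \<tau>_pos \<kappa>_nonneg in simp)
qed

end

text \<open>\<open>F\<close> enters through the exponent. Monotonicity replaces it there by a fixed
  bound, so that the final constant does not depend on \<open>F\<close>.\<close>

lemma gradient_const_mono:
  assumes "0 < \<nu>" "0 \<le> T" "0 < K'" "0 < \<beta>" "0 \<le> K1" "F \<le> F'"
  shows "gradient_const \<beta> \<nu> K K' T K1 F \<le> gradient_const \<beta> \<nu> K K' T K1 F'"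
proof -
  have E: "0 < energy_const \<beta> \<nu> K T"
    using assms by (auto simp: energy_const_def intro!: mult_pos_pos add_pos_nonneg)
  have D: "0 < drift_const \<beta> K K'"
    using assms by (auto simp: drift_const_def intro!: add_nonneg_pos)
  have L: "0 \<le> 4 / \<nu> * load_const \<beta> \<nu> K K' T K1"
    using assms E D unfolding load_const_def
    by (intro add_nonneg_nonneg mult_nonneg_nonneg divide_nonneg_nonneg) auto
  have "56 * \<beta>\<^sup>2 / \<nu> * (energy_const \<beta> \<nu> K T * F / \<nu>) \<le> 56 * \<beta>\<^sup>2 / \<nu> * (energy_const \<beta> \<nu> K T * F' / \<nu>)"
    using assms E by (intro mult_left_mono divide_right_mono) auto
  then show ?thesis
    unfolding gradient_const_def using L by (intro mult_right_mono) auto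
qed

text \<open>\<open>gradient_estimate\<close> is applied twice: up to the time \<open>ts\<close> with
  the crude load \<open>F1\<close>, merely to bound the gradient and to find a good difference
  quotient, and afterwards on all levels up to \<open>n\<close> with the actual load.\<close>

theorem galerkin_error:
  fixes \<beta> P \<nu> K K' T B :: real
  assumes pos: "0 < \<beta>" "0 < P" "0 < \<nu>" "0 < K" "0 < K'" "0 < T" "0 < B"
  obtains C \<tau>0 where "0 \<le> C" "0 < \<tau>0"
    "\<And>m a c \<tau> M U W \<rho> S \<alpha> s s' n F.
      galerkin_scheme (m :: 'a::real_vector \<Rightarrow> 'a \<Rightarrow> real) a c \<beta> P \<nu> \<tau> K K' M U W \<rho> S \<alpha> s s' \<Longrightarrow>
      \<tau> * real M = T \<Longrightarrow> \<tau> \<le> \<tau>0 \<Longrightarrow>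
      (\<And>j. j \<in> {1..M} \<Longrightarrow> \<alpha> j \<le> B \<and> s j \<le> B \<and> s' j \<le> B) \<Longrightarrow>
      n \<in> {1..M} \<Longrightarrow> 0 \<le> F \<Longrightarrow> (\<And>j. j \<in> {1..n} \<Longrightarrow> (s j)\<^sup>2 \<le> F) \<Longrightarrow>
      \<tau> * (\<Sum>j=1..n. (\<alpha> j)\<^sup>2) \<le> F \<Longrightarrow> \<tau> * (\<Sum>j=1..n. (s' j)\<^sup>2) \<le> F \<Longrightarrow>
      a (W n - U n) (W n - U n) \<le> C * F"
proof -
  define c1 where "c1 = rate_const \<beta> \<nu> K"
  have c1: "0 < c1" using pos by (simp add: c1_def rate_const_def add_nonneg_pos)
  \<comment> \<open>\<open>E1 * ts\<close> will bound the squared L2 error, together with the summed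
    squared gradients, up to time \<open>ts\<close>.\<close>
  define E1 where "E1 = exp (2 * c1 * T) * ((1 + 2 / \<nu>) * B\<^sup>2)"
  have E1: "0 < E1" using pos by (auto simp: E1_def intro!: mult_pos_pos add_pos_nonneg)
  \<comment> \<open>The second entry makes the L2 error at most
    \<open>\<nu> / (16 * \<beta>)\<close>, which absorbs the cubic term; the third makes the
    Gronwall weights at most 1/2.\<close>
  define ts where "ts = min T (min ((\<nu> / (16 * \<beta>))\<^sup>2 / E1) (\<nu>\<^sup>2 / (112 * \<beta>\<^sup>2 * E1)))"
  have ts: "0 < ts" "ts \<le> T" "E1 * ts \<le> (\<nu> / (16 * \<beta>))\<^sup>2" "E1 * ts \<le> \<nu>\<^sup>2 / (112 * \<beta>\<^sup>2)"
  proof -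
    show "0 < ts" "ts \<le> T" using pos E1 by (auto simp: ts_def)
    have "E1 * ts \<le> E1 * ((\<nu> / (16 * \<beta>))\<^sup>2 / E1)" using E1 by (intro mult_left_mono) (auto simp: ts_def)
    then show "E1 * ts \<le> (\<nu> / (16 * \<beta>))\<^sup>2" using E1 by simp
    have "E1 * ts \<le> E1 * (\<nu>\<^sup>2 / (112 * \<beta>\<^sup>2 * E1))" using E1 by (intro mult_left_mono) (auto simp: ts_def)
    then show "E1 * ts \<le> \<nu>\<^sup>2 / (112 * \<beta>\<^sup>2)" using E1 by simp
  qed
  \<comment> \<open>Dominates all loads at once, the pointwise ones by \<open>B^2\<close> and the
    time-summed ones by \<open>T * B^2\<close>.\<close>
  define F1 where "F1 = B\<^sup>2 * (1 + T)"
  have F1: "0 < F1" using pos by (simp add: F1_def)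
  define Y1 where "Y1 = gradient_const \<beta> \<nu> K K' T 0 F1 * F1"
  define Q where "Q = load_const \<beta> \<nu> K K' T 0 * F1 + 14 * \<beta>\<^sup>2 * (Y1 * (energy_const \<beta> \<nu> K T * F1 / \<nu>))"
  \<comment> \<open>Bounds one difference quotient of \<open>U\<close>: \<open>K'\<close> for
    \<open>W\<close>, and for the error the mean of the increments over the time \<open>ts\<close>,
    with \<open>Q\<close> as the bound for their sum.\<close>
  define \<kappa>0 where "\<kappa>0 = K' + sqrt (4 * \<bar>Q\<bar> / ts)"
  have \<kappa>0: "0 < \<kappa>0" using pos ts by (simp add: \<kappa>0_def add_pos_nonneg)
  define R where "R = P * K"
  have R: "0 < R" using pos by (simp add: R_def)
  define \<kappa> where "\<kappa> = exp (\<beta>\<^sup>2 * R\<^sup>2 / \<nu>\<^sup>2) * \<kappa>0"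
  have \<kappa>: "0 < \<kappa>" using \<kappa>0 by (simp add: \<kappa>_def)
  \<comment> \<open>Gradient bound for the error on all levels: \<open>Y1\<close> serves the short
    times, \<open>K\<close> and \<open>sqrt (\<kappa> * R / \<nu>)\<close> bound \<open>W\<close>
    and \<open>U\<close> later.\<close>
  define K2 where "K2 = K + sqrt \<bar>Y1\<bar> + sqrt (\<kappa> * R / \<nu>)"
  have K2: "0 < K2" using pos \<kappa> R by (simp add: K2_def add_pos_nonneg)
  \<comment> \<open>Young's inequality with \<open>\<nu> / 16\<close> for the cubic term, one of
    whose gradients is bounded by \<open>K2\<close>.\<close>
  define K1 where "K1 = 4 * \<beta>\<^sup>2 * K2\<^sup>2 / \<nu>"
  have K1: "0 \<le> K1" using pos by (simp add: K1_def)
  \<comment> \<open>In this order: the rate condition of the L2 estimate, at least two steps before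
    \<open>ts\<close>, the smallness in \<open>increment_bound\<close>, and weights at most 1/2 on
    the whole interval.\<close>
  define \<tau>0 where "\<tau>0 = min (1 / (2 * c1)) (min (ts / 2) (min (\<nu>\<^sup>2 / (4 * \<beta>\<^sup>2 * (\<kappa> * R))) (\<nu> / (112 * \<beta>\<^sup>2 * K2\<^sup>2))))"
  define C where "C = \<bar>gradient_const \<beta> \<nu> K K' T K1 F1\<bar>"
  have \<tau>0: "0 < \<tau>0" using c1 ts pos \<kappa> R K2 by (auto simp: \<tau>0_def)
  show thesis
  proof (rule that[of C \<tau>0])
    show "0 \<le> C" by (simp add: C_def)
    show "0 < \<tau>0" by (rule \<tau>0)
    fix m a :: "'a \<Rightarrow> 'a \<Rightarrow> real" and c \<tau> M U W \<rho> S \<alpha> s s' n F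
    assume "galerkin_scheme m a c \<beta> P \<nu> \<tau> K K' M U W \<rho> S \<alpha> s s'"
    then interpret galerkin_scheme m a c \<beta> P \<nu> \<tau> K K' M U W \<rho> S \<alpha> s s' .
    assume T: "\<tau> * real M = T" and small: "\<tau> \<le> \<tau>0"
      and B: "\<And>j. j \<in> {1..M} \<Longrightarrow> \<alpha> j \<le> B \<and> s j \<le> B \<and> s' j \<le> B"
      and n: "n \<in> {1..M}" and F0: "0 \<le> F" and Fs: "\<And>j. j \<in> {1..n} \<Longrightarrow> (s j)\<^sup>2 \<le> F"
      and F\<alpha>: "\<tau> * (\<Sum>j=1..n. (\<alpha> j)\<^sup>2) \<le> F" and Fs': "\<tau> * (\<Sum>j=1..n. (s' j)\<^sup>2) \<le> F"
    have sq: "(\<alpha> j)\<^sup>2 \<le> B\<^sup>2" "(s j)\<^sup>2 \<le> B\<^sup>2" "(s' j)\<^sup>2 \<le> B\<^sup>2" if "j \<in> {1..M}" for j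
      using B[OF that] s_pos[of j] by (auto intro!: power_mono)
    have \<tau>c1: "\<tau> * c1 \<le> 1 / 2"
    proof -
      have "\<tau> \<le> 1 / (2 * c1)" using small by (simp add: \<tau>0_def)
      then show ?thesis using c1 by (simp add: field_simps)
    qed
    have T': "\<tau> * real M \<le> T" using T by simp
    have sumB: "\<tau> * (\<Sum>j=1..N. (x j)\<^sup>2) \<le> F1"
      if "N \<le> M" "\<And>j. j \<in> {1..M} \<Longrightarrow> (x j)\<^sup>2 \<le> B\<^sup>2" for N and x :: "nat \<Rightarrow> real"
    proof -
      have "(\<Sum>j=1..N. (x j)\<^sup>2) \<le> (\<Sum>j=1..N. B\<^sup>2)" using that by (intro sum_mono) auto
      then have "\<tau> * (\<Sum>j=1..N. (x j)\<^sup>2) \<le> \<tau> * (N * B\<^sup>2)" using \<tau>_pos by (intro mult_left_mono) auto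
      also have "\<dots> \<le> \<tau> * (M * B\<^sup>2)" using that \<tau>_pos by (intro mult_left_mono mult_right_mono) auto
      also have "\<dots> = T * B\<^sup>2" using T by (simp add: mult_ac)
      also have "\<dots> \<le> F1" by (simp add: F1_def algebra_simps)
      finally show ?thesis .
    qed
    have sF1: "(s j)\<^sup>2 \<le> F1" if "j \<in> {1..M}" for j
    proof -
      have "B\<^sup>2 \<le> F1" using pos by (simp add: F1_def algebra_simps)
      then show ?thesis using sq(2)[OF that] by linarith
    qed
    text \<open>For short times the \<open>L\<^sup>2\<close> error is so small that it controls the cubic terms.\<close>
    define N where "N = nat \<lfloor>ts / \<tau>\<rfloor>"
    have "\<tau> \<le> ts / 2" using small by (simp add: \<tau>0_def)
    then have tsq: "2 \<le> ts / \<tau>" using \<tau>_pos by (simp add: field_simps)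
    have Nle: "real N \<le> ts / \<tau>" using tsq by (simp add: N_def)
    have Nge: "ts / \<tau> - 1 \<le> real N" using tsq by (simp add: N_def)
    have N\<tau>: "\<tau> * real N \<le> ts" using Nle \<tau>_pos by (simp add: field_simps)
    have N\<tau>2: "ts / 2 \<le> \<tau> * real N"
    proof -
      have "\<tau> * (ts / \<tau> - 1) \<le> \<tau> * real N" using Nge \<tau>_pos by (intro mult_left_mono) auto
      then show ?thesis using \<open>\<tau> \<le> ts / 2\<close> \<tau>_pos by (simp add: right_diff_distrib)
    qed
    have N1: "1 \<le> N" using Nge tsq by linarith
    have NM: "N \<le> M"
    proof -
      have "\<tau> * real N \<le> \<tau> * real M" using N\<tau> ts T by simp
      then show ?thesis using \<tau>_pos by simp
    qed
    have short: "(nm (e j))\<^sup>2 + \<tau> * \<nu> * (\<Sum>i=1..j. (na (e i))\<^sup>2) \<le> E1 * ts" if "j \<le> N" for j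
    proof -
      have jM: "j \<le> M" using that NM by simp
      have j\<tau>: "\<tau> * real j \<le> ts" using that N\<tau> \<tau>_pos by (smt (verit) mult_left_mono of_nat_mono)
      have "(\<Sum>i=1..j. (\<alpha> i)\<^sup>2 + 2 / \<nu> * (s i)\<^sup>2) \<le> (\<Sum>i=1..j. B\<^sup>2 + 2 / \<nu> * B\<^sup>2)"
        using sq jM pos by (intro sum_mono add_mono mult_left_mono) auto
      then have "\<tau> * (\<Sum>i=1..j. (\<alpha> i)\<^sup>2 + 2 / \<nu> * (s i)\<^sup>2) \<le> \<tau> * (\<Sum>i=1..j. B\<^sup>2 + 2 / \<nu> * B\<^sup>2)"
        using \<tau>_pos by (intro mult_left_mono) auto
      also have "\<dots> = (\<tau> * real j) * ((1 + 2 / \<nu>) * B\<^sup>2)" by (simp add: algebra_simps)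
      also have "\<dots> \<le> ts * ((1 + 2 / \<nu>) * B\<^sup>2)" using j\<tau> pos by (intro mult_right_mono) auto
      finally have 1: "\<tau> * (\<Sum>i=1..j. (\<alpha> i)\<^sup>2 + 2 / \<nu> * (s i)\<^sup>2) \<le> ts * ((1 + 2 / \<nu>) * B\<^sup>2)" .
      have "(nm (e j))\<^sup>2 + \<tau> * \<nu> * (\<Sum>i=1..j. (na (e i))\<^sup>2)
        \<le> exp (2 * c1 * (\<tau> * j)) * (\<tau> * (\<Sum>i=1..j. (\<alpha> i)\<^sup>2 + 2 / \<nu> * (s i)\<^sup>2))"
        unfolding c1_def by (rule energy_estimate[OF \<tau>c1[unfolded c1_def] jM])
      also have "\<dots> \<le> exp (2 * c1 * T) * (ts * ((1 + 2 / \<nu>) * B\<^sup>2))"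
        using j\<tau> ts c1 \<tau>_pos pos
        by (intro mult_mono 1) (auto intro!: mult_nonneg_nonneg sum_nonneg)
      finally show ?thesis by (simp add: E1_def mult_ac)
    qed
    have cubic0: "\<bar>c (e j) (e j) (e j)\<bar> \<le> \<nu> / 16 * (na (e j))\<^sup>2 + 0 * (nm (e j))\<^sup>2" if "j \<le> N" for j
    proof -
      have "0 \<le> \<tau> * \<nu> * (\<Sum>i=1..j. (na (e i))\<^sup>2)" using \<tau>_pos pos by (intro mult_nonneg_nonneg sum_nonneg) auto
      then have "(nm (e j))\<^sup>2 \<le> (\<nu> / (16 * \<beta>))\<^sup>2" using short[OF that] ts by linarith
      then have nmj: "nm (e j) \<le> \<nu> / (16 * \<beta>)" by (rule power2_le_imp_le) (use pos in simp)
      have "\<bar>c (e j) (e j) (e j)\<bar> \<le> \<beta> * (\<nu> / (16 * \<beta>)) * na (e j) * na (e j)"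
        by (rule c_le1'[OF nmj])
      then show ?thesis using pos by (simp add: power2_eq_square)
    qed
    have weights0: "56 * \<beta>\<^sup>2 / \<nu> * (\<tau> * (na (e j))\<^sup>2) \<le> 1 / 2" if "j \<in> {1..N}" for j
    proof -
      have "(na (e j))\<^sup>2 \<le> (\<Sum>i=1..j. (na (e i))\<^sup>2)" using that by (intro member_le_sum) auto
      then have "\<tau> * \<nu> * (na (e j))\<^sup>2 \<le> \<tau> * \<nu> * (\<Sum>i=1..j. (na (e i))\<^sup>2)"
        using \<tau>_pos pos by (intro mult_left_mono) auto
      then have "\<tau> * \<nu> * (na (e j))\<^sup>2 \<le> \<nu>\<^sup>2 / (112 * \<beta>\<^sup>2)"
        using short[of j] that ts zero_le_power2[of "nm (e j)"] by (simp; linarith)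
      then have "56 * \<beta>\<^sup>2 / \<nu>\<^sup>2 * (\<tau> * \<nu> * (na (e j))\<^sup>2) \<le> 56 * \<beta>\<^sup>2 / \<nu>\<^sup>2 * (\<nu>\<^sup>2 / (112 * \<beta>\<^sup>2))"
        by (intro mult_left_mono) auto
      then show ?thesis using pos by (simp add: power2_eq_square mult_ac)
    qed
    note estimates = sF1 sumB[OF NM sq(1)] sumB[OF NM sq(3)] less_imp_le[OF F1] cubic0 weights0
    have short_grad: "(na (e j))\<^sup>2 \<le> Y1" if "j \<le> N" for j
      unfolding Y1_def
      by (rule gradient_estimate[of N T 0 F1])
        (use \<tau>c1 NM T' estimates that in \<open>auto simp: c1_def\<close>)
    have incr: "(\<Sum>j=1..N. (nm (e j - e (j - 1)))\<^sup>2 / (2 * \<tau>)) \<le> Q"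
      unfolding Q_def Y1_def
      by (rule increments_estimate[of N T 0 F1])
        (use \<tau>c1 NM T' estimates in \<open>auto simp: c1_def\<close>)
    have Q0: "0 \<le> Q"
      by (rule order.trans[OF _ incr]) (use \<tau>_pos in \<open>auto intro!: sum_nonneg\<close>)
    \<comment> \<open>Some increment does not exceed the average over the first \<open>N\<close>
      steps.\<close>
    obtain n0 where n0: "n0 \<in> {1..N}" "(nm (e n0 - e (n0 - 1)))\<^sup>2 / (2 * \<tau>) \<le> Q / real N"
    proof -
      have "\<exists>j\<in>{1..N}. (nm (e j - e (j - 1)))\<^sup>2 / (2 * \<tau>) \<le> Q / real N"
      proof (rule ccontr)
        assume "\<not> ?thesis"
        then have "(\<Sum>j=1..N. Q / real N) < (\<Sum>j=1..N. (nm (e j - e (j - 1)))\<^sup>2 / (2 * \<tau>))"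
          using N1 by (intro sum_strict_mono) (auto simp: not_le)
        then show False using incr N1 by simp
      qed
      then show thesis using that by blast
    qed
    have n0M: "n0 \<in> {1..M}" using n0 NM by auto
    have "nm (U n0 - U (n0 - 1)) \<le> \<tau> * \<kappa>0"
    proof -
      have "(nm (e n0 - e (n0 - 1)))\<^sup>2 \<le> 2 * \<tau> * (Q / real N)"
        using n0(2) \<tau>_pos by (simp add: field_simps)
      also have "\<dots> = 2 * \<tau>\<^sup>2 * Q / (\<tau> * real N)"
        using \<tau>_pos by (simp add: power2_eq_square)
      also have "\<dots> \<le> 2 * \<tau>\<^sup>2 * Q / (ts / 2)"
        using N\<tau>2 ts Q0 \<tau>_pos N1 by (intro divide_left_mono mult_pos_pos) auto
      also have "\<dots> = (\<tau> * sqrt (4 * \<bar>Q\<bar> / ts))\<^sup>2"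
        using Q0 ts by (simp add: power_mult_distrib)
      finally have "nm (e n0 - e (n0 - 1)) \<le> \<tau> * sqrt (4 * \<bar>Q\<bar> / ts)"
        by (rule power2_le_imp_le) (use \<tau>_pos ts in simp)
      moreover have "U n0 - U (n0 - 1) = (W n0 - W (n0 - 1)) - (e n0 - e (n0 - 1))"
        by (simp add: e_def)
      ultimately show ?thesis
        using nm_triangle[of "W n0 - W (n0 - 1)" "e n0 - e (n0 - 1)"] W_diff[OF n0M]
        by (simp add: \<kappa>0_def distrib_left)
    qed
    note n0_small = this
    have R0: "nm (U 0) \<le> R"
      using order.trans[OF nm_le[of "W 0"] mult_left_mono[OF W_le[of 0], of P]] pos
      by (simp add: init R_def)
    have \<tau>\<kappa>: "2 * \<beta>\<^sup>2 / \<nu> * (\<tau> * (\<kappa> * R / \<nu>)) \<le> 1 / 2"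
    proof -
      have "\<tau> \<le> \<nu>\<^sup>2 / (4 * \<beta>\<^sup>2 * (\<kappa> * R))" using small by (simp add: \<tau>0_def)
      then have "\<tau> * (4 * \<beta>\<^sup>2 * (\<kappa> * R)) \<le> \<nu>\<^sup>2"
        using pos \<kappa> R by (simp add: pos_le_divide_eq)
      then have "(\<tau> * (4 * \<beta>\<^sup>2 * (\<kappa> * R))) / \<nu>\<^sup>2 \<le> 1" using pos by simp
      then show ?thesis by (simp add: power2_eq_square mult_ac)
    qed
    have eK2: "na (e j) \<le> K2" if "j \<in> {1..M}" for j
    proof (cases "j \<le> N")
      case True
      have "na (e j) \<le> sqrt Y1"
        using real_sqrt_le_mono[OF short_grad[OF True]] by simp
      also have "\<dots> \<le> sqrt \<bar>Y1\<bar>" by simp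
      finally have "na (e j) \<le> sqrt \<bar>Y1\<bar>" .
      moreover have "0 \<le> sqrt (\<kappa> * R / \<nu>)" using \<kappa> R pos by simp
      ultimately show ?thesis using pos(4) unfolding K2_def by linarith
    next
      case False
      then have j: "n0 \<le> j" "j \<le> M" using that n0 by auto
      have "nm (U j - U (j - 1)) / \<tau> \<le> \<kappa>"
        using increment_bound[OF n0M n0_small less_imp_le[OF \<kappa>0] R0 \<kappa>_def \<tau>\<kappa> j] \<tau>_pos
        by (simp add: pos_divide_le_eq mult.commute)
      then have "nm (U j - U (j - 1)) / \<tau> * nm (U 0) \<le> \<kappa> * R"
        using R0 \<kappa> by (intro mult_mono) auto
      then have "\<nu> * (na (U j))\<^sup>2 \<le> \<kappa> * R" using na_U_le[OF that] by linarith
      then have "(na (U j))\<^sup>2 \<le> \<kappa> * R / \<nu>" using pos by (simp add: pos_le_divide_eq mult.commute)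
      then have "na (U j) \<le> sqrt (\<kappa> * R / \<nu>)" using real_sqrt_le_mono by fastforce
      then have "na (e j) \<le> K + sqrt (\<kappa> * R / \<nu>)"
        unfolding e_def using na_triangle[of "W j" "U j"] W_le[of j] j by simp
      moreover have "0 \<le> sqrt \<bar>Y1\<bar>" by simp
      ultimately show ?thesis unfolding K2_def by linarith
    qed
    have cubic: "\<bar>c (e j) (e j) (e j)\<bar> \<le> \<nu> / 16 * (na (e j))\<^sup>2 + K1 * (nm (e j))\<^sup>2" if "j \<in> {1..M}" for j
    proof -
      have "\<bar>c (e j) (e j) (e j)\<bar> \<le> \<beta> * K2 * na (e j) * nm (e j)"
        by (rule c_le3'[OF eK2[OF that]])
      also have "\<dots> = na (e j) * (\<beta> * K2 * nm (e j))" by simp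
      also have "\<dots> \<le> \<nu> / 16 * (na (e j))\<^sup>2 + (\<beta> * K2 * nm (e j))\<^sup>2 / (4 * (\<nu> / 16))"
        using pos by (intro young) auto
      finally show ?thesis by (simp add: K1_def power_mult_distrib)
    qed
    have weights: "56 * \<beta>\<^sup>2 / \<nu> * (\<tau> * (na (e j))\<^sup>2) \<le> 1 / 2" if "j \<in> {1..M}" for j
    proof -
      have "\<tau> \<le> \<nu> / (112 * \<beta>\<^sup>2 * K2\<^sup>2)" using small by (simp add: \<tau>0_def)
      then have 1: "\<tau> * (112 * \<beta>\<^sup>2 * K2\<^sup>2) \<le> \<nu>" using pos K2 by (simp add: pos_le_divide_eq)
      have "(na (e j))\<^sup>2 \<le> K2\<^sup>2" using eK2[OF that] by (intro power_mono) auto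
      then have "56 * \<beta>\<^sup>2 / \<nu> * (\<tau> * (na (e j))\<^sup>2) \<le> 56 * \<beta>\<^sup>2 / \<nu> * (\<tau> * K2\<^sup>2)"
        using pos \<tau>_pos by (intro mult_left_mono) auto
      also have "\<dots> = (\<tau> * (112 * \<beta>\<^sup>2 * K2\<^sup>2)) / (2 * \<nu>)" by simp
      also have "\<dots> \<le> \<nu> / (2 * \<nu>)" using 1 pos by (intro divide_right_mono) auto
      finally show ?thesis using pos by simp
    qed
    \<comment> \<open>A large \<open>F\<close> would enter the exponent. All loads are also at most
      \<open>F1\<close>, so the minimum is admissible.\<close>
    define F' where "F' = min F F1"
    have nM: "n \<le> M" using n by simp
    have "(na (e n))\<^sup>2 \<le> gradient_const \<beta> \<nu> K K' T K1 F' * F'"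
      by (rule gradient_estimate[of n T K1 F'])
        (use \<tau>c1 nM T' K1 sF1 sumB[OF nM sq(1)] sumB[OF nM sq(3)] Fs F\<alpha> Fs' F0 F1 cubic weights
         in \<open>auto simp: c1_def F'_def\<close>)
    also have "\<dots> \<le> C * F'"
      using gradient_const_mono[of \<nu> T K' \<beta> K1 F' F1 K] pos K1 F0 F1
      by (intro mult_right_mono) (auto simp: C_def F'_def)
    also have "\<dots> \<le> C * F" by (intro mult_left_mono) (auto simp: F'_def C_def)
    finally show "a (W n - U n) (W n - U n) \<le> C * F" by (simp add: na_sq e_def)
  qed
qed

section \<open>Polynomials on an interval\<close>

lemma poly_antiderivative:
  obtains q :: "real poly" where "pderiv q = p" "degree q \<le> Suc (degree p)" "poly q a = c"
proof -
  define Q where "Q = (\<Sum>i\<le>degree p. monom (coeff p i / (of_nat i + 1)) (Suc i))"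
  have "pderiv Q = (\<Sum>i\<le>degree p. monom (coeff p i) i)"
    by (auto simp: Q_def higher_pderiv_sum[of 1, simplified] pderiv_monom add.commute intro!: sum.cong)
  then have "pderiv Q = p" by (simp add: poly_as_sum_of_monoms)
  moreover have "degree Q \<le> Suc (degree p)"
    unfolding Q_def by (rule degree_sum_le) (auto intro: order.trans[OF degree_monom_le])
  ultimately show thesis
    by (intro that[of "Q + [:c - poly Q a:]"]) (auto simp: pderiv_add pderiv_pCons intro!: degree_add_le)
qed

lemma integral_pderiv: "a \<le> b \<Longrightarrow> (LINT x|leb a b. poly (pderiv p) x) = poly p b - poly p a"
  by (rule integral_leb_FTC) (auto intro!: DERIV_subset[OF poly_DERIV] sqint_integrable)

lemma integral_leb_poly_affine:
  assumes "0 < L"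
  shows "(LINT x|leb a (a + L). poly p x) = L * (LINT x|leb 0 1. poly (p \<circ>\<^sub>p [:a, L:]) x)"
proof -
  obtain q where q: "pderiv q = p" by (rule poly_antiderivative)
  have "(LINT x|leb a (a + L). poly p x) = poly q (a + L) - poly q a"
    using integral_pderiv[of a "a + L" q] assms q by simp
  moreover have "(LINT x|leb 0 1. poly (pderiv (q \<circ>\<^sub>p [:a, L:])) x) = poly q (a + L) - poly q a"
    using integral_pderiv[of 0 1 "q \<circ>\<^sub>p [:a, L:]"] by (simp add: poly_pcompose)
  moreover have "pderiv (q \<circ>\<^sub>p [:a, L:]) = smult L (p \<circ>\<^sub>p [:a, L:])"
    by (simp add: pderiv_pcompose q pderiv_pCons)
  ultimately show ?thesis by simp
qed

lemma integrable_poly_mult [simp]: "integrable (leb a b) (\<lambda>x. poly p x * poly q x)"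
  by (intro integrable_leb_continuous continuous_intros)

lemma integral_poly_sq_eq_0:
  assumes "a < b" "(LINT x|leb a b. poly p x * poly p x) = 0"
  shows "p = 0"
proof -
  have c: "continuous_on {a..b} (\<lambda>x. poly p x * poly p x)" by (intro continuous_intros)
  have "integral {a..b} (\<lambda>x. poly p x * poly p x) = 0"
    using assms(2) by (simp add: integral_leb_eq_integral)
  then have "\<forall>x\<in>{a..b}. poly p x * poly p x = 0"
    using integral_eq_0_iff[OF c assms(1)] by simp
  then have "{a..b} \<subseteq> {x. poly p x = 0}" by auto
  then have "infinite {x. poly p x = 0}"
    using assms(1) by (meson infinite_Icc infinite_super)
  then show ?thesis using poly_roots_finite by blast
qed

definition poly_functional :: "nat \<Rightarrow> (real poly \<Rightarrow> real) \<Rightarrow> bool" where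
  "poly_functional n l \<longleftrightarrow> (\<forall>p q. degree p < n \<longrightarrow> degree q < n \<longrightarrow> l (p + q) = l p + l q) \<and>
     (\<forall>c p. degree p < n \<longrightarrow> l (smult c p) = c * l p)"

lemma degree_less_Suc_split:
  fixes q :: "real poly"
  assumes "degree q < Suc n"
  obtains c q' where "q = smult c (monom 1 n) + q'" "q' = 0 \<or> degree q' < n"
proof (rule that)
  let ?q = "q - smult (coeff q n) (monom 1 n)"
  show "?q = 0 \<or> degree ?q < n"
  proof (cases "?q = 0")
    case False
    have le: "degree ?q \<le> n" using assms by (intro degree_diff_le) (auto intro: order.trans[OF degree_smult_le] simp: degree_monom_eq)
    have "coeff ?q n = 0" by simp
    then have "degree ?q \<noteq> n" using False leading_coeff_0_iff[of ?q] by metis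
    then show ?thesis using le by simp
  qed simp
qed simp

text \<open>Stated with \<open>degree p < n\<close> so that the induction starts from the zero space.\<close>

lemma poly_riesz_less:
  assumes "a < b" "poly_functional n l" "l 0 = 0"
  shows "\<exists>p. (p = 0 \<or> degree p < n) \<and> (\<forall>q. q = 0 \<or> degree q < n \<longrightarrow> (LINT x|leb a b. poly p x * poly q x) = l q)"
  using assms(2,3)
proof (induction n arbitrary: l)
  case 0
  then show ?case by (auto intro!: exI[of _ 0])
next
  case (Suc n)
  have l: "poly_functional n l" using Suc.prems(1) unfolding poly_functional_def by (simp add: less_Suc_eq)
  have lin: "poly_functional n (\<lambda>q. LINT x|leb a b. poly (monom 1 n) x * poly q x)"
    unfolding poly_functional_def by (simp add: distrib_left mult.left_commute)
  obtain r where r: "r = 0 \<or> degree r < n"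
    "\<And>q. q = 0 \<or> degree q < n \<Longrightarrow> (LINT x|leb a b. poly r x * poly q x) = (LINT x|leb a b. poly (monom 1 n) x * poly q x)"
    using Suc.IH[OF lin] by force
  obtain p where p: "p = 0 \<or> degree p < n"
    "\<And>q. q = 0 \<or> degree q < n \<Longrightarrow> (LINT x|leb a b. poly p x * poly q x) = l q"
    using Suc.IH[OF l Suc.prems(2)] by force
  \<comment> \<open>Gram-Schmidt: the new monomial minus its projection \<open>r\<close>, hence
    orthogonal to all lower degrees.\<close>
  define e where "e = monom 1 n - r"
  have de: "degree e < Suc n" unfolding e_def less_Suc_eq_le
    using r(1) by (intro degree_diff_le) (auto simp: degree_monom_eq)
  have "coeff e n = 1" using r(1) coeff_eq_0[of r n] by (auto simp: e_def)
  then have "e \<noteq> 0" by auto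
  then have ee: "(LINT x|leb a b. poly e x * poly e x) \<noteq> 0" using integral_poly_sq_eq_0[OF assms(1)] by blast
  have eq: "(LINT x|leb a b. poly e x * poly q x) = 0" if "q = 0 \<or> degree q < n" for q
    using r(2)[OF that] by (simp add: e_def left_diff_distrib)
  define P where "P = p + smult (l e / (LINT x|leb a b. poly e x * poly e x)) e"
  have "(LINT x|leb a b. poly P x * poly q x) = l q" if q: "q = 0 \<or> degree q < Suc n" for q
  proof (cases "q = 0")
    case False
    then obtain c q' where q': "q = smult c (monom 1 n) + q'" "q' = 0 \<or> degree q' < n"
      using degree_less_Suc_split q by blast
    define q'' where "q'' = q' + smult c r"
    have q'': "q'' = 0 \<or> degree q'' < n"
    proof (cases "n = 0")
      case False
      then show ?thesis using q'(2) r(1) unfolding q''_def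
        by (intro disjI2 degree_add_less) (auto intro: le_less_trans[OF degree_smult_le])
    qed (use q'(2) r(1) in \<open>auto simp: q''_def\<close>)
    have qe: "q = smult c e + q''" by (simp add: q'(1) q''_def e_def smult_diff_right)
    have 1: "l q = c * l e + l q''"
    proof -
      have "degree q'' < Suc n" "degree (smult c e) < Suc n"
        using q'' de degree_smult_le[of c e] by auto
      then show ?thesis using Suc.prems(1) de unfolding poly_functional_def qe by metis
    qed
    have pe: "(LINT x|leb a b. poly p x * poly e x) = 0"
      using eq[OF p(1)] by (simp add: mult.commute)
    have "(LINT x|leb a b. poly P x * poly q x) = (LINT x|leb a b. c * (poly p x * poly e x) + poly p x * poly q'' x
       + (l e / (LINT x|leb a b. poly e x * poly e x)) * (c * (poly e x * poly e x) + poly e x * poly q'' x))"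
      by (simp add: P_def qe algebra_simps)
    also have "\<dots> = l q" using 1 pe p(2)[OF q''] eq[OF q''] ee by simp
    finally show ?thesis .
  qed (simp add: Suc.prems)
  moreover have "degree P < Suc n" unfolding P_def
    using p(1) de by (intro degree_add_less) (auto intro: le_less_trans[OF degree_smult_le])
  ultimately show ?case by blast
qed

lemma poly_riesz:
  assumes "a < b"
    and "\<And>p q. degree p \<le> n \<Longrightarrow> degree q \<le> n \<Longrightarrow> l (p + q) = l p + l q"
    and "\<And>c p. degree p \<le> n \<Longrightarrow> l (smult c p) = c * l p"
  shows "\<exists>!p. degree p \<le> n \<and> (\<forall>q. degree q \<le> n \<longrightarrow> (LINT x|leb a b. poly p x * poly q x) = l q)"
proof (rule ex_ex1I)
  have "l 0 = 0" using assms(3)[of 0 0] by simp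
  moreover have "poly_functional (Suc n) l" using assms(2,3) by (auto simp: poly_functional_def less_Suc_eq_le)
  ultimately obtain p where "p = 0 \<or> degree p < Suc n"
    "\<forall>q. q = 0 \<or> degree q < Suc n \<longrightarrow> (LINT x|leb a b. poly p x * poly q x) = l q"
    using poly_riesz_less[OF assms(1)] by blast
  then show "\<exists>p. degree p \<le> n \<and> (\<forall>q. degree q \<le> n \<longrightarrow> (LINT x|leb a b. poly p x * poly q x) = l q)"
    by (intro exI[of _ p]) (auto simp: less_Suc_eq_le)
next
  fix p p'
  assume p: "degree p \<le> n \<and> (\<forall>q. degree q \<le> n \<longrightarrow> (LINT x|leb a b. poly p x * poly q x) = l q)"
    and p': "degree p' \<le> n \<and> (\<forall>q. degree q \<le> n \<longrightarrow> (LINT x|leb a b. poly p' x * poly q x) = l q)"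
  have "degree (p - p') \<le> n" using p p' by (intro degree_diff_le) auto
  then have "(LINT x|leb a b. poly (p - p') x * poly (p - p') x) = 0"
    using p p' by (subst poly_diff) (simp add: left_diff_distrib del: poly_diff)
  then show "p = p'" using integral_poly_sq_eq_0[OF assms(1)] by fastforce
qed

text \<open>
  On the unit interval the coefficients are bounded by the \<open>L\<^sup>2\<close> norm via their Riesz representatives;
  affine maps preserve the degree.
\<close>

lemma poly_inverse_inequality:
  obtains C where "0 < C"
    "\<And>a b (p :: real poly) x. a < b \<Longrightarrow> degree p \<le> k \<Longrightarrow> x \<in> {a..b} \<Longrightarrow>
       (b - a) * (poly p x)\<^sup>2 \<le> C * (LINT y|leb a b. (poly p y)\<^sup>2)"
proof -
  have "\<exists>r. \<forall>q. degree q \<le> k \<longrightarrow> (LINT x|leb 0 1. poly r x * poly q x) = coeff q j" for j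
    using poly_riesz[of 0 1 k "\<lambda>q. coeff q j"] by auto
  then obtain R where R: "\<And>j q. degree q \<le> k \<Longrightarrow> (LINT x|leb 0 1. poly (R j) x * poly q x) = coeff q j"
    by metis
  define N where "N j = sqrt (LINT y|leb 0 1. (poly (R j) y)\<^sup>2)" for j
  define S where "S = (\<Sum>j\<le>k. N j)"
  have S: "0 \<le> S" by (auto simp: S_def N_def intro!: sum_nonneg)
  have unit: "(poly q x)\<^sup>2 \<le> S\<^sup>2 * (LINT y|leb 0 1. (poly q y)\<^sup>2)" if q: "degree q \<le> k" and x: "x \<in> {0..1}" for q x
  proof -
    let ?n = "sqrt (LINT y|leb 0 1. (poly q y)\<^sup>2)"
    have c: "\<bar>coeff q j\<bar> \<le> N j * ?n" for j
    proof (rule power2_le_imp_le)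
      show "\<bar>coeff q j\<bar>\<^sup>2 \<le> (N j * ?n)\<^sup>2"
        using integral_cauchy_schwarz[of 0 1 "poly (R j)" "poly q"] R[OF q, of j] by (simp add: N_def power_mult_distrib)
    qed (simp add: N_def)
    have "\<bar>poly q x\<bar> = \<bar>\<Sum>j\<le>k. coeff q j * x ^ j\<bar>" using q by (subst poly_as_sum_of_monoms'[OF q, symmetric]) (simp add: poly_sum poly_monom)
    also have "\<dots> \<le> (\<Sum>j\<le>k. \<bar>coeff q j * x ^ j\<bar>)" by (rule sum_abs)
    also have "\<dots> \<le> (\<Sum>j\<le>k. N j * ?n)"
    proof (rule sum_mono)
      fix j
      have "\<bar>coeff q j * x ^ j\<bar> \<le> \<bar>coeff q j\<bar> * 1"
        unfolding abs_mult using x by (intro mult_left_mono) (auto simp: power_le_one)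
      then show "\<bar>coeff q j * x ^ j\<bar> \<le> N j * ?n" using c[of j] by simp
    qed
    also have "\<dots> = S * ?n" by (simp add: S_def sum_distrib_right)
    finally have "\<bar>poly q x\<bar>\<^sup>2 \<le> (S * ?n)\<^sup>2" by (intro power_mono) auto
    then show ?thesis by (simp add: power_mult_distrib)
  qed
  show thesis
  proof (rule that[of "S\<^sup>2 + 1"])
    show "0 < S\<^sup>2 + 1" by (simp add: add_nonneg_pos)
    fix a b x :: real and p :: "real poly" assume ab: "a < b" and p: "degree p \<le> k" and x: "x \<in> {a..b}"
    let ?q = "p \<circ>\<^sub>p [:a, b - a:]"
    have "degree ?q \<le> k" using p ab by (simp add: degree_pcompose)
    moreover have "(x - a) / (b - a) \<in> {0..1}" using x ab by auto
    ultimately have "(poly ?q ((x - a) / (b - a)))\<^sup>2 \<le> S\<^sup>2 * (LINT y|leb 0 1. (poly ?q y)\<^sup>2)" by (rule unit)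
    then have "(poly p x)\<^sup>2 \<le> S\<^sup>2 * (LINT y|leb 0 1. (poly ?q y)\<^sup>2)" using ab by (simp add: poly_pcompose)
    then have "(b - a) * (poly p x)\<^sup>2 \<le> (b - a) * (S\<^sup>2 * (LINT y|leb 0 1. (poly ?q y)\<^sup>2))"
      using ab by (intro mult_left_mono) auto
    also have "\<dots> = S\<^sup>2 * (LINT y|leb a b. (poly p y)\<^sup>2)"
      using integral_leb_poly_affine[of "b - a" a "p * p"] ab by (simp add: pcompose_mult power2_eq_square)
    also have "\<dots> \<le> (S\<^sup>2 + 1) * (LINT y|leb a b. (poly p y)\<^sup>2)" by (intro mult_right_mono) auto
    finally show "(b - a) * (poly p x)\<^sup>2 \<le> (S\<^sup>2 + 1) * (LINT y|leb a b. (poly p y)\<^sup>2)" .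
  qed
qed

text \<open>The difference vanishes at \<open>a\<close>, so it is the integral of its derivative and
  Cauchy-Schwarz applies.\<close>

lemma deriv_chain_poincare:
  assumes f: "deriv_chain m a b f" and m: "1 \<le> m" and ab: "a < b" and p: "poly p a = f 0 a"
  shows "(LINT x|leb a b. (f 0 x - poly p x)\<^sup>2) \<le> (b - a)\<^sup>2 * (LINT x|leb a b. (f 1 x - poly (pderiv p) x)\<^sup>2)"
proof -
  have sq: "sqint a b (\<lambda>x. f 1 x - poly (pderiv p) x)"
    using deriv_chainD(2)[OF f m] by (intro sqint_diff) auto
  let ?E = "LINT x|leb a b. (f 1 x - poly (pderiv p) x)\<^sup>2"
  have "(f 0 x - poly p x)\<^sup>2 \<le> (b - a) * ?E" if x: "x \<in> {a<..<b}" for x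
  proof -
    have i: "integrable (leb a x) (f 1)" "integrable (leb a x) (poly (pderiv p))"
      using deriv_chainD(2)[OF f m] x
      by (auto intro!: sqint_integrable elim: sqint_subinterval)
    have "f 0 x - poly p x = (LINT s|leb a x. f 1 s) - (LINT s|leb a x. poly (pderiv p) s)"
      using deriv_chainD(1)[OF f, of 0 x] integral_pderiv[of a x p] p x m by simp
    then have "(f 0 x - poly p x)\<^sup>2 = (LINT s|leb a x. f 1 s - poly (pderiv p) s)\<^sup>2" using i by simp
    also have "\<dots> \<le> (LINT s|leb a b. \<bar>f 1 s - poly (pderiv p) s\<bar>)\<^sup>2"
    proof -
      have ii: "integrable (leb a b) (\<lambda>s. \<bar>f 1 s - poly (pderiv p) s\<bar>)" by (intro sqint_integrable sqint_abs sq)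
      have "\<bar>LINT s|leb a x. f 1 s - poly (pderiv p) s\<bar> \<le> (LINT s|leb a x. \<bar>f 1 s - poly (pderiv p) s\<bar>)" by (rule integral_abs_bound)
      also have "\<dots> \<le> (LINT s|leb a x. \<bar>f 1 s - poly (pderiv p) s\<bar>) + (LINT s|leb x b. \<bar>f 1 s - poly (pderiv p) s\<bar>)" by simp
      also have "\<dots> = (LINT s|leb a b. \<bar>f 1 s - poly (pderiv p) s\<bar>)" using integral_leb_combine[OF ii, of x] x by simp
      finally have "\<bar>LINT s|leb a x. f 1 s - poly (pderiv p) s\<bar>\<^sup>2 \<le> (LINT s|leb a b. \<bar>f 1 s - poly (pderiv p) s\<bar>)\<^sup>2"
        by (intro power_mono) auto
      then show ?thesis by simp
    qed
    also have "\<dots> \<le> (b - a) * ?E" by (rule integral_abs_square_le[OF sq]) (use ab in simp)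
    finally show ?thesis .
  qed
  then have "(LINT x|leb a b. (f 0 x - poly p x)\<^sup>2) \<le> (LINT x|leb a b. (b - a) * ?E)"
    using sqint_diff[OF deriv_chainD(2)[OF f, of 0] sqint_poly'[of a b p]]
    by (intro integral_mono) (auto simp: sqint_def)
  also have "\<dots> = (b - a)\<^sup>2 * ?E" using ab by (simp add: power2_eq_square)
  finally show ?thesis .
qed

lemma deriv_chain_poly_approx:
  assumes "deriv_chain m a b f" "a < b"
  shows "\<exists>p. (p = 0 \<or> degree p < m) \<and>
    (LINT x|leb a b. (f 0 x - poly p x)\<^sup>2) \<le> (b - a) ^ (2 * m) * (LINT x|leb a b. (f m x)\<^sup>2)"
  using assms(1)
proof (induction m arbitrary: f)
  case 0
  show ?case by (rule exI[of _ 0]) simp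
next
  case (Suc m)
  have c: "deriv_chain m a b (\<lambda>j. f (j + 1))" by (rule deriv_chain_shift) (use Suc.prems in simp)
  obtain q where q: "q = 0 \<or> degree q < m"
    "(LINT x|leb a b. (f 1 x - poly q x)\<^sup>2) \<le> (b - a) ^ (2 * m) * (LINT x|leb a b. (f (Suc m) x)\<^sup>2)"
    using Suc.IH[OF c] by auto
  obtain p where p: "pderiv p = q" "degree p \<le> Suc (degree q)" "poly p a = f 0 a"
    by (rule poly_antiderivative)
  have "(LINT x|leb a b. (f 0 x - poly p x)\<^sup>2) \<le> (b - a)\<^sup>2 * (LINT x|leb a b. (f 1 x - poly q x)\<^sup>2)"
    using deriv_chain_poincare[OF Suc.prems _ assms(2) p(3)] p(1) by simp
  also have "\<dots> \<le> (b - a)\<^sup>2 * ((b - a) ^ (2 * m) * (LINT x|leb a b. (f (Suc m) x)\<^sup>2))"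
    using q(2) by (intro mult_left_mono) auto
  also have "\<dots> = (b - a) ^ (2 * Suc m) * (LINT x|leb a b. (f (Suc m) x)\<^sup>2)" by (simp add: power2_eq_square)
  finally have "(LINT x|leb a b. (f 0 x - poly p x)\<^sup>2) \<le> (b - a) ^ (2 * Suc m) * (LINT x|leb a b. (f (Suc m) x)\<^sup>2)" .
  moreover have "degree p < Suc m \<or> p = 0"
  proof (cases "q = 0")
    case True
    then have "degree p = 0" using p(1) pderiv_eq_0_iff by blast
    then show ?thesis by simp
  qed (use q(1) p(2) in auto)
  ultimately show ?case by (intro exI[of _ p] conjI) auto
qed

lemma deriv_chain_SucI:
  assumes "deriv_chain m a b (\<lambda>j. f (Suc j))" "sqint a b (f 0)"
    and "\<And>x. x \<in> {a..b} \<Longrightarrow> f 0 x = f 0 a + (LINT s|leb a x. f (Suc 0) s)"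
  shows "deriv_chain (Suc m) a b f"
  unfolding deriv_chain_def
proof (intro conjI allI impI ballI)
  fix j x assume jx: "j < Suc m" "x \<in> {a..b}"
  show "f j x = f j a + (LINT s|leb a x. f (Suc j) s)"
  proof (cases j)
    case 0
    show ?thesis unfolding 0 by (rule assms(3)[OF jx(2)])
  next
    case (Suc i)
    show ?thesis unfolding Suc by (rule deriv_chainD(1)[OF assms(1)]) (use jx Suc in auto)
  qed
next
  fix j assume j: "j \<le> Suc m"
  show "sqint a b (f j)"
  proof (cases j)
    case 0
    show ?thesis unfolding 0 by (rule assms(2))
  next
    case (Suc i)
    show ?thesis unfolding Suc by (rule deriv_chainD(2)[OF assms(1)]) (use j Suc in auto)
  qed
qed

lemma deriv_chain_add:
  assumes "deriv_chain m a b f" "deriv_chain m a b g"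
  shows "deriv_chain m a b (\<lambda>j x. f j x + g j x)"
  unfolding deriv_chain_def
proof (intro conjI allI impI ballI)
  fix j x assume jx: "j < m" "x \<in> {a..b}"
  have "integrable (leb a x) (f (Suc j))" "integrable (leb a x) (g (Suc j))"
    using jx assms[THEN deriv_chainD(2), of "Suc j"] by (auto intro!: sqint_integrable elim: sqint_subinterval)
  then show "f j x + g j x = f j a + g j a + (LINT s|leb a x. f (Suc j) s + g (Suc j) s)"
    using assms[THEN deriv_chainD(1), OF jx] by simp
qed (use assms[THEN deriv_chainD(2)] in \<open>auto intro: sqint_add\<close>)

text \<open>
  Instead of Leibniz' formula, the derivatives of a product are obtained recursively from those of
  \<open>f' g\<close> and \<open>f g'\<close>.
\<close>

lemma deriv_chain_prod:
  assumes "deriv_chain m a b f" "deriv_chain m a b g"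
    and "\<And>j. j \<le> m \<Longrightarrow> continuous_on {a..b} (f j)" "\<And>j. j \<le> m \<Longrightarrow> continuous_on {a..b} (g j)"
    and "\<And>j x. j \<le> m \<Longrightarrow> x \<in> {a..b} \<Longrightarrow> \<bar>f j x\<bar> \<le> F" "\<And>j x. j \<le> m \<Longrightarrow> x \<in> {a..b} \<Longrightarrow> \<bar>g j x\<bar> \<le> G"
  shows "\<exists>p. deriv_chain m a b p \<and> p 0 = (\<lambda>x. f 0 x * g 0 x) \<and>
    (0 < m \<longrightarrow> p 1 = (\<lambda>x. f 1 x * g 0 x + f 0 x * g 1 x)) \<and> (\<forall>j\<le>m. \<forall>x\<in>{a..b}. \<bar>p j x\<bar> \<le> 2 ^ j * (F * G))"
  using assms
proof (induction m arbitrary: f g)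
  case 0
  then show ?case
    by (intro exI[of _ "\<lambda>j x. f 0 x * g 0 x"])
      (auto simp: deriv_chain_def abs_mult intro!: sqint_continuous continuous_intros mult_mono' order.trans[OF abs_ge_zero])
next
  case (Suc m)
  note cf = Suc.prems(1) and cg = Suc.prems(2)
  have shift: "deriv_chain m a b (\<lambda>j. f (Suc j))" "deriv_chain m a b (\<lambda>j. g (Suc j))"
    using deriv_chain_shift[of m 1 a b f] deriv_chain_shift[of m 1 a b g] cf cg by simp_all
  obtain q where q: "deriv_chain m a b q" "q 0 = (\<lambda>x. f (Suc 0) x * g 0 x)"
    "\<forall>j\<le>m. \<forall>x\<in>{a..b}. \<bar>q j x\<bar> \<le> 2 ^ j * (F * G)"
    using Suc.IH[of "\<lambda>j. f (Suc j)" g, OF shift(1) deriv_chain_mono[OF cg]] Suc.prems(3-) by auto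
  obtain q' where q': "deriv_chain m a b q'" "q' 0 = (\<lambda>x. f 0 x * g (Suc 0) x)"
    "\<forall>j\<le>m. \<forall>x\<in>{a..b}. \<bar>q' j x\<bar> \<le> 2 ^ j * (F * G)"
    using Suc.IH[of f "\<lambda>j. g (Suc j)", OF deriv_chain_mono[OF cf] shift(2)] Suc.prems(3-) by auto
  \<comment> \<open>Above level 0 the chain is the sum of the chains of \<open>f' g\<close> and
    \<open>f g'\<close>, so the bound doubles from each level to the next.\<close>
  define p where "p j = (case j of 0 \<Rightarrow> \<lambda>x. f 0 x * g 0 x | Suc j \<Rightarrow> \<lambda>x. q j x + q' j x)" for j
  have c0: "continuous_on {a..b} (f 0)" "continuous_on {a..b} (g 0)"
    "continuous_on {a..b} (f (Suc 0))" "continuous_on {a..b} (g (Suc 0))" using Suc.prems(3,4) by auto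
  have "deriv_chain (Suc m) a b p"
  proof (rule deriv_chain_SucI)
    show "deriv_chain m a b (\<lambda>j. p (Suc j))" using deriv_chain_add[OF q(1) q'(1)] by (simp add: p_def)
    show "sqint a b (p 0)" using c0 by (auto simp: p_def intro!: sqint_continuous continuous_intros)
    fix x assume x: "x \<in> {a..b}"
    have sub: "continuous_on {a..x} (f 0)" "continuous_on {a..x} (g 0)"
      "continuous_on {a..x} (f (Suc 0))" "continuous_on {a..x} (g (Suc 0))"
      using x by (auto intro: continuous_on_subset[OF c0(1)] continuous_on_subset[OF c0(2)]
          continuous_on_subset[OF c0(3)] continuous_on_subset[OF c0(4)])
    have d: "(h 0 has_real_derivative h (Suc 0) y) (at y within {a..b})"
      if "deriv_chain (Suc m) a b h" "continuous_on {a..b} (h (Suc 0))" "y \<in> {a..b}" for h y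
    proof -
      have "((\<lambda>x. h 0 a + (LINT s|leb a x. h (Suc 0) s)) has_real_derivative 0 + h (Suc 0) y) (at y within {a..b})"
        using that by (intro DERIV_add DERIV_const has_derivative_indefinite_leb)
      then have "((\<lambda>x. h 0 a + (LINT s|leb a x. h (Suc 0) s)) has_real_derivative h (Suc 0) y) (at y within {a..b})" by simp
      then show ?thesis
      proof (rule has_field_derivative_transform_within[where d = 1])
        show "h 0 a + (LINT s|leb a z. h (Suc 0) s) = h 0 z" if "z \<in> {a..b}" for z
          using deriv_chainD(1)[OF \<open>deriv_chain (Suc m) a b h\<close> _ that, of 0] by simp
      qed (use that in auto)
    qed
    have "(LINT s|leb a x. f (Suc 0) s * g 0 s + f 0 s * g (Suc 0) s) = f 0 x * g 0 x - f 0 a * g 0 a"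
    proof (rule integral_leb_FTC)
      fix y assume y: "y \<in> {a..x}"
      then have y': "y \<in> {a..b}" using x by auto
      have "((\<lambda>x. f 0 x * g 0 x) has_real_derivative f (Suc 0) y * g 0 y + g (Suc 0) y * f 0 y) (at y within {a..b})"
        by (intro DERIV_mult d cf cg c0 y')
      then have "((\<lambda>x. f 0 x * g 0 x) has_real_derivative f (Suc 0) y * g 0 y + g (Suc 0) y * f 0 y) (at y within {a..x})"
        by (rule has_field_derivative_subset) (use x in auto)
      then show "((\<lambda>x. f 0 x * g 0 x) has_real_derivative f (Suc 0) y * g 0 y + f 0 y * g (Suc 0) y) (at y within {a..x})"
        by (simp only: mult.commute[of "f 0 y"])
    next
      show "integrable (leb a x) (\<lambda>s. f (Suc 0) s * g 0 s + f 0 s * g (Suc 0) s)"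
        by (intro integrable_leb_continuous continuous_on_add continuous_on_mult sub)
    qed (use x in simp)
    then show "p 0 x = p 0 a + (LINT s|leb a x. p (Suc 0) s)" by (simp add: p_def q q')
  qed
  moreover have "\<bar>p j x\<bar> \<le> 2 ^ j * (F * G)" if "j \<le> Suc m" "x \<in> {a..b}" for j x
  proof (cases j)
    case 0
    have "\<bar>f 0 x\<bar> \<le> F" "\<bar>g 0 x\<bar> \<le> G" using Suc.prems(5,6)[of 0 x] that by auto
    then show ?thesis using 0 by (auto simp: p_def abs_mult intro!: mult_mono')
  next
    case (Suc i)
    then have "\<bar>q i x\<bar> \<le> 2 ^ i * (F * G)" "\<bar>q' i x\<bar> \<le> 2 ^ i * (F * G)" using q(3) q'(3) that by auto
    then show ?thesis using Suc abs_triangle_ineq[of "q i x" "q' i x"] by (simp add: p_def)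
  qed
  ultimately show ?case by (intro exI[of _ p]) (simp add: p_def[of 0] p_def[of "Suc 0"] q(2) q'(2))
qed

section \<open>Projection and weak derivative on one element\<close>

lemma integral_poly_mult_left_integrable [simp]:
  "sqint a b w \<Longrightarrow> integrable (leb a b) (\<lambda>x. w x * poly q x)"
  by (rule sqint_integrable_mult) auto

lemma poly_eq_if_orthogonal:
  assumes "a < b" "degree p \<le> n" "degree p' \<le> n"
    and "\<And>q. degree q \<le> n \<Longrightarrow> (LINT x|leb a b. poly p x * poly q x) = (LINT x|leb a b. poly p' x * poly q x)"
  shows "p = p'"
proof -
  have "(LINT x|leb a b. poly (p - p') x * poly (p - p') x)
      = (LINT x|leb a b. poly p x * poly (p - p') x) - (LINT x|leb a b. poly p' x * poly (p - p') x)"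
    by (subst poly_diff) (simp add: left_diff_distrib del: poly_diff)
  also have "\<dots> = 0" using assms(4)[of "p - p'"] assms(2,3) degree_diff_le by auto
  finally show ?thesis using integral_poly_sq_eq_0[OF assms(1)] by fastforce
qed

text \<open>\<open>L2_proj\<close> on a single interval, detached from the partition.\<close>

definition elt_proj :: "real \<Rightarrow> real \<Rightarrow> nat \<Rightarrow> (real \<Rightarrow> real) \<Rightarrow> real poly" where
  "elt_proj a b k w = (THE p. degree p \<le> k \<and>
     (\<forall>q. degree q \<le> k \<longrightarrow> (LINT x|leb a b. poly p x * poly q x) = (LINT x|leb a b. w x * poly q x)))"

lemma elt_proj:
  assumes "a < b" "sqint a b w"
  shows "degree (elt_proj a b k w) \<le> k"
    and "degree q \<le> k \<Longrightarrow> (LINT x|leb a b. poly (elt_proj a b k w) x * poly q x) = (LINT x|leb a b. w x * poly q x)"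
proof -
  have "\<exists>!p. degree p \<le> k \<and> (\<forall>q. degree q \<le> k \<longrightarrow>
      (LINT x|leb a b. poly p x * poly q x) = (LINT x|leb a b. w x * poly q x))"
    by (rule poly_riesz[OF assms(1)]) (use assms(2) in \<open>auto simp: distrib_left mult.left_commute\<close>)
  note * = theI'[OF this, folded elt_proj_def]
  show "degree (elt_proj a b k w) \<le> k" using * by blast
  show "degree q \<le> k \<Longrightarrow> (LINT x|leb a b. poly (elt_proj a b k w) x * poly q x) = (LINT x|leb a b. w x * poly q x)"
    using * by blast
qed

lemma elt_proj_eqI:
  assumes "a < b" "sqint a b w" "degree p \<le> k"
    and "\<And>q. degree q \<le> k \<Longrightarrow> (LINT x|leb a b. poly p x * poly q x) = (LINT x|leb a b. w x * poly q x)"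
  shows "elt_proj a b k w = p"
  by (rule poly_eq_if_orthogonal[OF assms(1) elt_proj(1)[OF assms(1,2)] assms(3)])
    (use assms elt_proj(2)[OF assms(1,2)] in auto)

lemma elt_proj_lin:
  assumes "a < b" "sqint a b v" "sqint a b w"
  shows "elt_proj a b k (\<lambda>x. \<alpha> * v x + \<beta> * w x) = smult \<alpha> (elt_proj a b k v) + smult \<beta> (elt_proj a b k w)"
proof (rule elt_proj_eqI[OF assms(1)])
  show "sqint a b (\<lambda>x. \<alpha> * v x + \<beta> * w x)" using assms by (intro sqint_add sqint_scale)
  show "degree (smult \<alpha> (elt_proj a b k v) + smult \<beta> (elt_proj a b k w)) \<le> k"
    using elt_proj(1)[OF assms(1,2)] elt_proj(1)[OF assms(1,3)]
    by (intro degree_add_le order.trans[OF degree_smult_le])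
  fix q :: "real poly" assume q: "degree q \<le> k"
  let ?v = "elt_proj a b k v" and ?w = "elt_proj a b k w"
  have "(LINT x|leb a b. poly (smult \<alpha> ?v + smult \<beta> ?w) x * poly q x)
      = (LINT x|leb a b. \<alpha> * (poly ?v x * poly q x) + \<beta> * (poly ?w x * poly q x))"
    by (simp add: algebra_simps)
  also have "\<dots> = \<alpha> * (LINT x|leb a b. poly ?v x * poly q x) + \<beta> * (LINT x|leb a b. poly ?w x * poly q x)" by simp
  also have "\<dots> = \<alpha> * (LINT x|leb a b. v x * poly q x) + \<beta> * (LINT x|leb a b. w x * poly q x)"
    using q assms by (simp add: elt_proj(2))
  also have "\<dots> = (LINT x|leb a b. \<alpha> * (v x * poly q x) + \<beta> * (w x * poly q x))" using assms by simp
  finally show "(LINT x|leb a b. poly (smult \<alpha> ?v + smult \<beta> ?w) x * poly q x)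
      = (LINT x|leb a b. (\<alpha> * v x + \<beta> * w x) * poly q x)" by (simp add: algebra_simps)
qed

lemma elt_proj_diff:
  assumes "a < b" "sqint a b v" "sqint a b w"
  shows "elt_proj a b k (\<lambda>x. v x - w x) = elt_proj a b k v - elt_proj a b k w"
  using elt_proj_lin[OF assms, of k 1 "-1"] by simp

lemma elt_proj_cong:
  assumes "a < b" "sqint a b v" "sqint a b w" "AE x in leb a b. v x = w x"
  shows "elt_proj a b k v = elt_proj a b k w"
proof (rule elt_proj_eqI[OF assms(1,2) elt_proj(1)[OF assms(1,3)]])
  fix q :: "real poly" assume "degree q \<le> k"
  then have "(LINT x|leb a b. poly (elt_proj a b k w) x * poly q x) = (LINT x|leb a b. w x * poly q x)"
    by (rule elt_proj(2)[OF assms(1,3)])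
  also have "\<dots> = (LINT x|leb a b. v x * poly q x)"
    using assms(4) borel_measurable_integrable[OF integral_poly_mult_left_integrable[OF assms(2)]]
      borel_measurable_integrable[OF integral_poly_mult_left_integrable[OF assms(3)]]
    by (intro integral_cong_AE) (auto elim: eventually_mono)
  finally show "(LINT x|leb a b. poly (elt_proj a b k w) x * poly q x) = (LINT x|leb a b. v x * poly q x)" .
qed

lemma elt_proj_pythagoras:
  assumes "a < b" "sqint a b w" "degree q \<le> k"
  shows "(LINT x|leb a b. (w x - poly q x)\<^sup>2) = (LINT x|leb a b. (w x - poly (elt_proj a b k w) x)\<^sup>2)
    + (LINT x|leb a b. (poly (elt_proj a b k w - q) x)\<^sup>2)"
proof -
  let ?p = "elt_proj a b k w" and ?d = "elt_proj a b k w - q"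
  have d: "degree ?d \<le> k" using elt_proj(1)[OF assms(1,2)] assms(3) by (intro degree_diff_le)
  have i: "integrable (leb a b) (\<lambda>x. (w x - poly ?p x)\<^sup>2)" "integrable (leb a b) (\<lambda>x. (poly ?d x)\<^sup>2)"
    using sqint_diff[OF assms(2) sqint_poly'[of a b ?p]] sqint_poly[of a b ?d] by (auto simp: sqint_def)
  have j: "integrable (leb a b) (\<lambda>x. w x * poly ?d x)" "integrable (leb a b) (\<lambda>x. poly ?p x * poly ?d x)"
    using assms(2) by (auto simp del: poly_diff)
  have "(LINT x|leb a b. (w x - poly q x)\<^sup>2) = (LINT x|leb a b. (w x - poly ?p x)\<^sup>2 + (poly ?d x)\<^sup>2
      + 2 * (w x * poly ?d x - poly ?p x * poly ?d x))"
    by (rule Bochner_Integration.integral_cong) (auto simp: power2_eq_square algebra_simps)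
  also have "\<dots> = (LINT x|leb a b. (w x - poly ?p x)\<^sup>2) + (LINT x|leb a b. (poly ?d x)\<^sup>2)
      + 2 * ((LINT x|leb a b. w x * poly ?d x) - (LINT x|leb a b. poly ?p x * poly ?d x))"
    using i j by (simp del: poly_diff)
  finally show ?thesis using elt_proj(2)[OF assms(1,2) d] by simp
qed

lemma elt_proj_norm_le:
  assumes "a < b" "sqint a b w"
  shows "(LINT x|leb a b. (poly (elt_proj a b k w) x)\<^sup>2) \<le> (LINT x|leb a b. (w x)\<^sup>2)"
  using elt_proj_pythagoras[OF assms, of 0 k] by simp

lemma elt_proj_error:
  assumes "a < b" "deriv_chain m a b f" "m \<le> Suc k"
  shows "(LINT x|leb a b. (f 0 x - poly (elt_proj a b k (f 0)) x)\<^sup>2) \<le> (b - a) ^ (2 * m) * (LINT x|leb a b. (f m x)\<^sup>2)"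
proof -
  obtain p where p: "p = 0 \<or> degree p < m"
    "(LINT x|leb a b. (f 0 x - poly p x)\<^sup>2) \<le> (b - a) ^ (2 * m) * (LINT x|leb a b. (f m x)\<^sup>2)"
    using deriv_chain_poly_approx[OF assms(2,1)] by blast
  have "sqint a b (f 0)" using deriv_chainD(2)[OF assms(2)] by simp
  moreover have "degree p \<le> k" using p(1) assms(3) by auto
  moreover have "0 \<le> (LINT x|leb a b. (poly (elt_proj a b k (f 0) - p) x)\<^sup>2)" by simp
  ultimately show ?thesis using elt_proj_pythagoras[OF assms(1), of "f 0" p k] p(2) by linarith
qed

text \<open>The inverse inequality loses a factor \<open>(b - a)^(-1/2)\<close>, and the L2 norm of
  a bounded function gains \<open>(b - a)^(1/2)\<close>. The length cancels, which makes the bound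
  uniform over arbitrary partitions.\<close>

lemma elt_proj_sup:
  assumes inv: "\<And>p x. degree p \<le> k \<Longrightarrow> x \<in> {a..b} \<Longrightarrow> (b - a) * (poly p x)\<^sup>2 \<le> C\<^sup>2 * (LINT y|leb a b. (poly p y)\<^sup>2)"
    and "a < b" "sqint a b w" "\<And>x. x \<in> {a<..<b} \<Longrightarrow> \<bar>w x\<bar> \<le> B" "0 \<le> B" "0 \<le> C" "x \<in> {a..b}"
  shows "\<bar>poly (elt_proj a b k w) x\<bar> \<le> C * B"
proof -
  have "(b - a) * (poly (elt_proj a b k w) x)\<^sup>2 \<le> C\<^sup>2 * (LINT y|leb a b. (poly (elt_proj a b k w) y)\<^sup>2)"
    by (rule inv[OF elt_proj(1)[OF assms(2,3)] assms(7)])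
  also have "\<dots> \<le> C\<^sup>2 * (LINT y|leb a b. (w y)\<^sup>2)" by (intro mult_left_mono elt_proj_norm_le assms) auto
  also have "\<dots> \<le> C\<^sup>2 * (LINT y|leb a b. B\<^sup>2)"
  proof (intro mult_left_mono integral_mono)
    show "integrable (leb a b) (\<lambda>y. (w y)\<^sup>2)" using assms(3) by (simp add: sqint_def)
    fix y assume "y \<in> space (leb a b)"
    then show "(w y)\<^sup>2 \<le> B\<^sup>2" using power_mono[OF assms(4)[of y], of 2] by simp
  qed auto
  also have "\<dots> = (b - a) * (C * B)\<^sup>2" using assms(2) by (simp add: power_mult_distrib)
  finally have "(poly (elt_proj a b k w) x)\<^sup>2 \<le> (C * B)\<^sup>2" using assms(2) by simp
  then show ?thesis using assms(5,6) abs_le_square_iff[of _ "C * B"] by simp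
qed

text \<open>This polynomial also agrees with \<open>f 0\<close> at \<open>b\<close>, because projections preserve the mean of \<open>f 1\<close>.\<close>

definition elt_interp :: "real \<Rightarrow> real \<Rightarrow> nat \<Rightarrow> (nat \<Rightarrow> real \<Rightarrow> real) \<Rightarrow> real poly" where
  "elt_interp a b k f = (SOME s. pderiv s = elt_proj a b k (f 1) \<and> degree s \<le> Suc k \<and> poly s a = f 0 a)"

lemma elt_interp:
  assumes "a < b" "deriv_chain m a b f" "1 \<le> m"
  shows "pderiv (elt_interp a b k f) = elt_proj a b k (f 1)" "degree (elt_interp a b k f) \<le> Suc k"
    "poly (elt_interp a b k f) a = f 0 a" "poly (elt_interp a b k f) b = f 0 b"
proof -
  have sq: "sqint a b (f 1)" using deriv_chainD(2)[OF assms(2)] assms(3) by simp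
  obtain s where "pderiv s = elt_proj a b k (f 1)" "degree s \<le> Suc (degree (elt_proj a b k (f 1)))" "poly s a = f 0 a"
    by (rule poly_antiderivative)
  then have ex: "\<exists>s. pderiv s = elt_proj a b k (f 1) \<and> degree s \<le> Suc k \<and> poly s a = f 0 a"
    using elt_proj(1)[OF assms(1) sq, of k] by (intro exI[of _ s]) simp
  note * = someI_ex[OF ex, folded elt_interp_def]
  from * show 1: "pderiv (elt_interp a b k f) = elt_proj a b k (f 1)" and "degree (elt_interp a b k f) \<le> Suc k"
    and 3: "poly (elt_interp a b k f) a = f 0 a" by blast+
  have "poly (elt_interp a b k f) b - f 0 a = (LINT x|leb a b. poly (elt_proj a b k (f 1)) x * poly 1 x)"
    using integral_pderiv[of a b "elt_interp a b k f"] assms(1) 1 3 by simp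
  also have "\<dots> = (LINT x|leb a b. f 1 x * poly 1 x)" by (rule elt_proj(2)[OF assms(1) sq]) simp
  also have "\<dots> = f 0 b - f 0 a" using deriv_chainD(1)[OF assms(2), of 0 b] assms by simp
  finally show "poly (elt_interp a b k f) b = f 0 b" by simp
qed

text \<open>The derivative of the interpolant is the projection of \<open>f 1\<close>, so the
  Poincare estimate adds one power of the length to the projection error.\<close>

lemma elt_interp_error:
  assumes "a < b" "deriv_chain (Suc m) a b f" "m \<le> Suc k"
  shows "(LINT x|leb a b. (f 0 x - poly (elt_interp a b k f) x)\<^sup>2) \<le> (b - a) ^ (2 * Suc m) * (LINT x|leb a b. (f (Suc m) x)\<^sup>2)"
proof -
  let ?s = "elt_interp a b k f" and ?g = "\<lambda>x. f 1 x - poly (elt_proj a b k (f 1)) x"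
  have 1: "(LINT x|leb a b. (f 0 x - poly ?s x)\<^sup>2) \<le> (b - a)\<^sup>2 * (LINT x|leb a b. (?g x)\<^sup>2)"
    using deriv_chain_poincare[OF assms(2) _ assms(1), of ?s] elt_interp[OF assms(1,2), of k] by simp
  have "deriv_chain m a b (\<lambda>j. f (j + 1))" by (rule deriv_chain_shift) (use assms(2) in simp)
  from elt_proj_error[OF assms(1) this assms(3)]
  have "(LINT x|leb a b. (?g x)\<^sup>2) \<le> (b - a) ^ (2 * m) * (LINT x|leb a b. (f (Suc m) x)\<^sup>2)" by simp
  then have "(b - a)\<^sup>2 * (LINT x|leb a b. (?g x)\<^sup>2) \<le> (b - a)\<^sup>2 * ((b - a) ^ (2 * m) * (LINT x|leb a b. (f (Suc m) x)\<^sup>2))"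
    by (intro mult_left_mono) auto
  then show ?thesis using 1 by (simp add: power2_eq_square mult.assoc)
qed

text \<open>The discrete weak derivative on one element, for an interior polynomial \<open>p\<close> and nodal values \<open>l\<close>, \<open>l'\<close>.\<close>

definition elt_diff :: "real \<Rightarrow> real \<Rightarrow> nat \<Rightarrow> real poly \<Rightarrow> real \<Rightarrow> real \<Rightarrow> real poly" where
  "elt_diff a b r p l l' = (THE d. degree d \<le> r \<and> (\<forall>q. degree q \<le> r \<longrightarrow>
     (LINT y|leb a b. poly d y * poly q y) = - (LINT y|leb a b. poly p y * poly (pderiv q) y) + l' * poly q b - l * poly q a))"

lemma elt_diff:
  assumes "a < b"
  shows "degree (elt_diff a b r p l l') \<le> r"
    and "degree q \<le> r \<Longrightarrow> (LINT y|leb a b. poly (elt_diff a b r p l l') y * poly q y)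
      = - (LINT y|leb a b. poly p y * poly (pderiv q) y) + l' * poly q b - l * poly q a"
proof -
  have "\<exists>!d. degree d \<le> r \<and> (\<forall>q. degree q \<le> r \<longrightarrow> (LINT y|leb a b. poly d y * poly q y)
      = - (LINT y|leb a b. poly p y * poly (pderiv q) y) + l' * poly q b - l * poly q a)"
    by (rule poly_riesz[OF assms(1)]) (simp_all add: pderiv_add pderiv_smult algebra_simps)
  note * = theI'[OF this, folded elt_diff_def]
  show "degree (elt_diff a b r p l l') \<le> r" using * by blast
  show "degree q \<le> r \<Longrightarrow> (LINT y|leb a b. poly (elt_diff a b r p l l') y * poly q y)
      = - (LINT y|leb a b. poly p y * poly (pderiv q) y) + l' * poly q b - l * poly q a"
    using * by blast
qed

lemma elt_diff_eqI:
  assumes "a < b" "degree d \<le> r"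
    and "\<And>q. degree q \<le> r \<Longrightarrow> (LINT y|leb a b. poly d y * poly q y)
      = - (LINT y|leb a b. poly p y * poly (pderiv q) y) + l' * poly q b - l * poly q a"
  shows "elt_diff a b r p l l' = d"
  by (rule poly_eq_if_orthogonal[OF assms(1) elt_diff(1)[OF assms(1)] assms(2)])
    (simp add: elt_diff(2)[OF assms(1)] assms(3))

lemma elt_diff_lin:
  assumes "a < b"
  shows "elt_diff a b r (smult \<alpha> p + smult \<beta> q) (\<alpha> * l + \<beta> * m) (\<alpha> * l' + \<beta> * m')
    = smult \<alpha> (elt_diff a b r p l l') + smult \<beta> (elt_diff a b r q m m')"
proof (rule elt_diff_eqI[OF assms])
  let ?v = "elt_diff a b r p l l'" and ?w = "elt_diff a b r q m m'"
  show "degree (smult \<alpha> ?v + smult \<beta> ?w) \<le> r"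
    using elt_diff(1)[OF assms] by (intro degree_add_le order.trans[OF degree_smult_le])
  fix e :: "real poly" assume e: "degree e \<le> r"
  have "(LINT x|leb a b. poly (smult \<alpha> ?v + smult \<beta> ?w) x * poly e x)
      = (LINT x|leb a b. \<alpha> * (poly ?v x * poly e x) + \<beta> * (poly ?w x * poly e x))"
    by (simp add: algebra_simps)
  also have "\<dots> = \<alpha> * (LINT x|leb a b. poly ?v x * poly e x) + \<beta> * (LINT x|leb a b. poly ?w x * poly e x)" by simp
  also have "\<dots> = - (\<alpha> * (LINT x|leb a b. poly p x * poly (pderiv e) x) + \<beta> * (LINT x|leb a b. poly q x * poly (pderiv e) x))
      + (\<alpha> * l' + \<beta> * m') * poly e b - (\<alpha> * l + \<beta> * m) * poly e a"
    unfolding elt_diff(2)[OF assms e] by (simp add: algebra_simps)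
  also have "\<alpha> * (LINT x|leb a b. poly p x * poly (pderiv e) x) + \<beta> * (LINT x|leb a b. poly q x * poly (pderiv e) x)
      = (LINT x|leb a b. \<alpha> * (poly p x * poly (pderiv e) x) + \<beta> * (poly q x * poly (pderiv e) x))" by simp
  also have "\<dots> = (LINT x|leb a b. poly (smult \<alpha> p + smult \<beta> q) x * poly (pderiv e) x)" by (simp add: algebra_simps)
  finally show "(LINT x|leb a b. poly (smult \<alpha> ?v + smult \<beta> ?w) x * poly e x)
      = - (LINT x|leb a b. poly (smult \<alpha> p + smult \<beta> q) x * poly (pderiv e) x)
      + (\<alpha> * l' + \<beta> * m') * poly e b - (\<alpha> * l + \<beta> * m) * poly e a" .
qed

text \<open>
  A weak function is the projection of an antiderivative of its weak derivative, so that it is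
  controlled by that derivative.
\<close>

lemma elt_diff_antiderivative:
  assumes ab: "a < b" and p: "degree p \<le> k" and z: "pderiv z = elt_diff a b (Suc k) p l l'" "poly z a = l"
  shows "poly z b = l'" "elt_proj a b k (poly z) = p"
proof -
  \<comment> \<open>Testing with the constant 1 shows that the mean of the weak derivative is the
    jump \<open>l' - l\<close> between the nodal values.\<close>
  have "poly z b - poly z a = (LINT x|leb a b. poly (elt_diff a b (Suc k) p l l') x * poly 1 x)"
    using integral_pderiv[of a b z] ab z by simp
  also have "\<dots> = l' - l" using elt_diff(2)[OF ab, of 1 "Suc k" p l l'] by simp
  finally show zb: "poly z b = l'" using z(2) by simp
  show "elt_proj a b k (poly z) = p"
  proof (rule elt_proj_eqI[OF ab _ p])
    fix q :: "real poly" assume q: "degree q \<le> k"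
    \<comment> \<open>The antiderivative of \<open>q\<close> has degree at most \<open>k + 1\<close>
      and is thus admissible in the definition of the weak derivative. This is where the degree
      \<open>Suc k\<close> is used.\<close>
    obtain e where e: "pderiv e = q" "degree e \<le> Suc (degree q)" by (rule poly_antiderivative)
    have "(LINT x|leb a b. poly (pderiv (z * e)) x) = l' * poly e b - l * poly e a"
      using integral_pderiv[of a b "z * e"] ab zb z(2) by simp
    moreover have "(LINT x|leb a b. poly (pderiv (z * e)) x)
        = (LINT x|leb a b. poly z x * poly q x) + (LINT x|leb a b. poly (pderiv z) x * poly e x)"
      by (simp add: pderiv_mult e(1) mult.commute[of "poly e _"])
    moreover have "(LINT x|leb a b. poly (pderiv z) x * poly e x)
        = - (LINT x|leb a b. poly p x * poly q x) + l' * poly e b - l * poly e a"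
      using elt_diff(2)[OF ab, of e "Suc k" p l l'] e q by (simp add: z(1))
    ultimately show "(LINT x|leb a b. poly p x * poly q x) = (LINT x|leb a b. poly z x * poly q x)" by simp
  qed simp
qed

text \<open>For \<open>q\<close> of degree at most \<open>k + 1\<close> the derivative
  \<open>pderiv q\<close> has degree at most \<open>k\<close>, so the projection in the interior
  term drops out. Integration by parts does the rest.\<close>

lemma elt_diff_elt_proj:
  assumes ab: "a < b" and f: "deriv_chain m a b f" and m: "1 \<le> m"
  shows "elt_diff a b (Suc k) (elt_proj a b k (f 0)) (f 0 a) (f 0 b) = elt_proj a b (Suc k) (f 1)"
proof (rule elt_diff_eqI[OF ab])
  have sq: "sqint a b (f 0)" "sqint a b (f 1)" using deriv_chainD(2)[OF f] m by auto
  show "degree (elt_proj a b (Suc k) (f 1)) \<le> Suc k" by (rule elt_proj(1)[OF ab sq(2)])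
  fix q :: "real poly" assume q: "degree q \<le> Suc k"
  have dq: "degree (pderiv q) \<le> k" using q by (simp add: degree_pderiv)
  have "(LINT x|leb a b. f 0 x * poly (pderiv q) x) + (LINT x|leb a b. f 1 x * poly q x) = f 0 b * poly q b - f 0 a * poly q a"
  proof (rule integral_by_parts_AC)
    show "f 0 x = f 0 a + (LINT s|leb a x. f 1 s)" if "x \<in> {a..b}" for x
      using deriv_chainD(1)[OF f _ that, of 0] m by simp
  qed (use ab sq sqint_integrable in \<open>auto intro!: continuous_intros DERIV_subset[OF poly_DERIV]\<close>)
  then show "(LINT y|leb a b. poly (elt_proj a b (Suc k) (f 1)) y * poly q y)
      = - (LINT y|leb a b. poly (elt_proj a b k (f 0)) y * poly (pderiv q) y) + f 0 b * poly q b - f 0 a * poly q a"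
    unfolding elt_proj(2)[OF ab sq(1) dq] elt_proj(2)[OF ab sq(2) q] by simp
qed

text \<open>The interpolant is admissible as a test polynomial. Its derivative is a projection,
  which paired with \<open>p\<close> of degree at most \<open>k\<close> gives back
  \<open>f 1\<close>, and its endpoint values are exact.\<close>

lemma elt_diff_elt_interp:
  assumes ab: "a < b" and f: "deriv_chain m a b f" and m: "1 \<le> m" and p: "degree p \<le> k"
  shows "(LINT y|leb a b. poly (elt_diff a b (Suc k) p l l') y * poly (elt_interp a b k f) y)
    = - (LINT y|leb a b. f 1 y * poly p y) + l' * f 0 b - l * f 0 a"
proof -
  have sq: "sqint a b (f 1)" using deriv_chainD(2)[OF f] m by auto
  show ?thesis
    unfolding elt_diff(2)[OF ab elt_interp(2)[OF ab f m]] elt_interp[OF ab f m]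
      elt_proj(2)[OF ab sq p, symmetric] by (simp only: mult.commute)
qed

section \<open>Broken functions on a partition\<close>

text \<open>The inverse inequality is assumed with a given \<open>K\<close>, so that this constant
  can be fixed before any partition. It later bounds the projections, the interior parts and the
  convection form alike.\<close>

locale mesh =
  fixes X :: "nat \<Rightarrow> real" and N k :: nat and K :: real
  assumes part: "is_partition X N" and K_ge: "1 \<le> K"
    and inverse_ineq: "\<And>a b p x. a < b \<Longrightarrow> degree p \<le> k \<Longrightarrow> x \<in> {a..b} \<Longrightarrow>
      (b - a) * (poly p x)\<^sup>2 \<le> K\<^sup>2 * (LINT y|leb a b. (poly p y)\<^sup>2)"
begin

abbreviation "h \<equiv> mesh_size X N"
abbreviation "E i \<equiv> leb (X i) (X (Suc i))"
abbreviation "ih \<equiv> inner_h X N"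
abbreviation "nh \<equiv> norm_h X N"

lemma X_less: "i \<in> {1..<N} \<Longrightarrow> X i < X (Suc i)"
  using part by (auto simp: is_partition_def)

lemma X_mono: "1 \<le> i \<Longrightarrow> i \<le> j \<Longrightarrow> j \<le> N \<Longrightarrow> X i \<le> X j"
proof (induction j)
  case (Suc j)
  show ?case
  proof (cases "i = Suc j")
    case False
    then have "X i \<le> X j" "X j < X (Suc j)" using Suc X_less[of j] by auto
    then show ?thesis by simp
  qed simp
qed simp

lemma X_1 [simp]: "X 1 = 0" "X (Suc 0) = 0" and X_N [simp]: "X N = 1" and N_ge: "2 \<le> N"
  using part by (auto simp: is_partition_def)

lemma X_range: "i \<in> {1..N} \<Longrightarrow> 0 \<le> X i \<and> X i \<le> 1"
  using X_mono[of 1 i] X_mono[of i N] by simp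

lemma X_sub: "i \<in> {1..<N} \<Longrightarrow> 0 \<le> X i \<and> X (Suc i) \<le> 1"
  using X_range[of i] X_range[of "Suc i"] by simp

lemma h_ge: "i \<in> {1..<N} \<Longrightarrow> X (Suc i) - X i \<le> h"
  unfolding mesh_size_def by (intro Max_ge) auto

lemma h_nonneg: "0 \<le> h" and h_le_1: "h \<le> 1"
proof -
  show "0 \<le> h" using h_ge[of 1] X_less[of 1] N_ge by simp
  show "h \<le> 1" unfolding mesh_size_def
    using N_ge X_sub by (subst Max_le_iff) fastforce+
qed

lemma telescope: "(\<Sum>i\<in>{1..<N}. g (Suc i) - g i) = g N - (g 1 :: real)"
  using sum_Suc_diff'[of 1 N g] N_ge by simp

lemma sum_elements:
  fixes f :: "real \<Rightarrow> real"
  assumes "integrable (leb 0 1) f"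
  shows "(\<Sum>i\<in>{1..<N}. LINT y|E i. f y) = (LINT y|leb 0 1. f y)"
proof -
  have "(LINT y|E i. f y) = (LINT y|leb 0 (X (Suc i)). f y) - (LINT y|leb 0 (X i). f y)" if i: "i \<in> {1..<N}" for i
  proof -
    have "integrable (leb 0 (X (Suc i))) f"
      by (rule integrable_leb_subinterval[OF assms]) (use X_sub[OF i] in auto)
    from integral_leb_combine[OF this, of "X i"] show ?thesis using X_sub[OF i] X_less[OF i] by simp
  qed
  then show ?thesis using telescope[of "\<lambda>i. LINT y|leb 0 (X i). f y"] by simp
qed

definition bsq :: "(nat \<Rightarrow> real \<Rightarrow> real) \<Rightarrow> bool" where
  "bsq f \<longleftrightarrow> (\<forall>i\<in>{1..<N}. sqint (X i) (X (Suc i)) (f i))"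

lemma bsq_poly [simp]: "bsq (\<lambda>i. poly (p i))" "bsq (\<lambda>i x. poly (p i) x)"
  by (simp_all add: bsq_def)

lemma bsq_global: "sqint 0 1 g \<Longrightarrow> bsq (\<lambda>i. g)"
  unfolding bsq_def using X_sub by (auto elim: sqint_subinterval)

lemma bsq_lin: "bsq f \<Longrightarrow> bsq g \<Longrightarrow> bsq (\<lambda>i x. \<alpha> * f i x + \<beta> * g i x)"
  unfolding bsq_def by (auto intro!: sqint_add sqint_scale)

lemma bsq_diff: "bsq f \<Longrightarrow> bsq g \<Longrightarrow> bsq (\<lambda>i x. f i x - g i x)"
  unfolding bsq_def by (auto intro!: sqint_diff)

lemma bsq_add: "bsq f \<Longrightarrow> bsq g \<Longrightarrow> bsq (\<lambda>i x. f i x + g i x)"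
  unfolding bsq_def by (auto intro!: sqint_add)

lemma ih_eq: "ih f g = (\<Sum>i\<in>{1..<N}. LINT y|E i. f i y * g i y)"
  by (simp add: inner_h_def elt_def)

lemma nh_sq: "(nh f)\<^sup>2 = ih f f" and nh_sq': "(nh f)\<^sup>2 = (\<Sum>i\<in>{1..<N}. LINT y|E i. (f i y)\<^sup>2)"
proof -
  have "0 \<le> ih f f" unfolding ih_eq by (intro sum_nonneg) simp
  then show "(nh f)\<^sup>2 = ih f f" by (simp add: norm_h_def)
  then show "(nh f)\<^sup>2 = (\<Sum>i\<in>{1..<N}. LINT y|E i. (f i y)\<^sup>2)" by (simp add: ih_eq power2_eq_square)
qed

lemma nh_nonneg [simp]: "0 \<le> nh f"
  unfolding norm_h_def ih_eq by (intro real_sqrt_ge_zero sum_nonneg) simp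

lemma ih_commute: "ih f g = ih g f"
  by (simp add: ih_eq mult.commute)

lemma ih_lin:
  assumes "bsq f" "bsq g" "bsq e"
  shows "ih (\<lambda>i x. \<alpha> * f i x + \<beta> * g i x) e = \<alpha> * ih f e + \<beta> * ih g e"
proof -
  have "(LINT y|E i. (\<alpha> * f i y + \<beta> * g i y) * e i y) = \<alpha> * (LINT y|E i. f i y * e i y) + \<beta> * (LINT y|E i. g i y * e i y)"
    if i: "i \<in> {1..<N}" for i
  proof -
    have j: "integrable (E i) (\<lambda>y. f i y * e i y)" "integrable (E i) (\<lambda>y. g i y * e i y)"
      using assms i by (auto simp: bsq_def intro: sqint_integrable_mult)
    have "(LINT y|E i. (\<alpha> * f i y + \<beta> * g i y) * e i y) = (LINT y|E i. \<alpha> * (f i y * e i y) + \<beta> * (g i y * e i y))"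
      by (simp add: algebra_simps)
    then show ?thesis using j by simp
  qed
  then show ?thesis by (simp add: ih_eq sum.distrib sum_distrib_left)
qed

lemma ih_add: "bsq f \<Longrightarrow> bsq g \<Longrightarrow> bsq e \<Longrightarrow> ih (\<lambda>i x. f i x + g i x) e = ih f e + ih g e"
  using ih_lin[of f g e 1 1] by simp

lemma ih_diff: "bsq f \<Longrightarrow> bsq g \<Longrightarrow> bsq e \<Longrightarrow> ih (\<lambda>i x. f i x - g i x) e = ih f e - ih g e"
  using ih_lin[of f g e 1 "-1"] by simp

lemma ih_cong:
  assumes "\<And>i. i \<in> {1..<N} \<Longrightarrow> (LINT y|E i. f i y * e i y) = (LINT y|E i. g i y * e i y)"
  shows "ih f e = ih g e"
  unfolding ih_eq using assms by (intro sum.cong) auto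

lemma ih_AE_cong:
  assumes "bsq f" "bsq g" "bsq e" "\<And>i. i \<in> {1..<N} \<Longrightarrow> AE y in E i. f i y = g i y"
  shows "ih f e = ih g e"
proof (rule ih_cong)
  fix i assume i: "i \<in> {1..<N}"
  have "integrable (E i) (\<lambda>y. f i y * e i y)" "integrable (E i) (\<lambda>y. g i y * e i y)"
    using assms(1-3) i by (auto simp: bsq_def intro: sqint_integrable_mult)
  then show "(LINT y|E i. f i y * e i y) = (LINT y|E i. g i y * e i y)"
    using assms(4)[OF i] by (intro integral_cong_AE) (auto elim: eventually_mono)
qed

lemma ih_cs:
  assumes "bsq f" "bsq g"
  shows "\<bar>ih f g\<bar> \<le> nh f * nh g"
proof -
  have "(ih f g)\<^sup>2 \<le> ih f f * ih g g"
  proof (rule quadratic_nonneg_imp)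
    fix s
    let ?e = "\<lambda>i x. s * f i x + 1 * g i x"
    have e: "bsq ?e" by (rule bsq_lin[OF assms])
    have "0 \<le> ih ?e ?e" using nh_sq[of ?e] zero_le_power2[of "nh ?e"] by simp
    also have "\<dots> = s * (s * ih f f + ih g f) + (s * ih f g + ih g g)"
      using ih_lin[OF assms e, of s 1] ih_lin[OF assms assms(1), of s 1] ih_lin[OF assms assms(2), of s 1]
        ih_commute[of f ?e] ih_commute[of g ?e] by simp
    finally show "0 \<le> ih f f * s\<^sup>2 + 2 * ih f g * s + ih g g"
      by (simp add: ih_commute[of g f] power2_eq_square algebra_simps)
  qed
  then have "\<bar>ih f g\<bar>\<^sup>2 \<le> (nh f * nh g)\<^sup>2" by (simp add: power_mult_distrib nh_sq)
  then show ?thesis by (rule power2_le_imp_le) simp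
qed

lemma nh_triangle:
  assumes "bsq f" "bsq g"
  shows "nh (\<lambda>i x. f i x + g i x) \<le> nh f + nh g"
proof (rule power2_le_imp_le)
  let ?e = "\<lambda>i x. f i x + g i x"
  have "bsq ?e" by (rule bsq_add[OF assms])
  then have "(nh ?e)\<^sup>2 = (nh f)\<^sup>2 + 2 * ih f g + (nh g)\<^sup>2"
    using ih_add[OF assms, of ?e] ih_add[OF assms assms(1)] ih_add[OF assms assms(2)]
      ih_commute[of f ?e] ih_commute[of g ?e] ih_commute[of f g] by (simp add: nh_sq)
  also have "\<dots> \<le> (nh f + nh g)\<^sup>2" using ih_cs[OF assms] by (simp add: power2_sum)
  finally show "(nh ?e)\<^sup>2 \<le> (nh f + nh g)\<^sup>2" .
qed simp

lemma nh_minus: "nh (\<lambda>i x. f i x - g i x) = nh (\<lambda>i x. g i x - f i x)"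
  unfolding norm_h_def ih_eq by (simp add: algebra_simps)

lemma nh_triangle_diff:
  assumes "bsq f" "bsq g" "bsq e"
  shows "nh (\<lambda>i x. f i x - e i x) \<le> nh (\<lambda>i x. f i x - g i x) + nh (\<lambda>i x. g i x - e i x)"
  using nh_triangle[OF bsq_diff[OF assms(1,2)] bsq_diff[OF assms(2,3)]] by simp

lemma nh_mult_le:
  assumes f: "bsq f" and B: "0 \<le> B" "\<And>i x. i \<in> {1..<N} \<Longrightarrow> x \<in> {X i<..<X (Suc i)} \<Longrightarrow> \<bar>g i x\<bar> \<le> B"
  shows "nh (\<lambda>i x. g i x * f i x) \<le> B * nh f"
proof (rule power2_le_imp_le)
  have "(LINT y|E i. (g i y * f i y)\<^sup>2) \<le> (LINT y|E i. B\<^sup>2 * (f i y)\<^sup>2)" if i: "i \<in> {1..<N}" for i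
  proof (cases "integrable (E i) (\<lambda>y. (g i y * f i y)\<^sup>2)")
    case True
    then show ?thesis
    proof (rule integral_mono)
      show "integrable (E i) (\<lambda>y. B\<^sup>2 * (f i y)\<^sup>2)" using f i by (auto simp: bsq_def sqint_def)
      fix y assume "y \<in> space (E i)"
      then have "\<bar>g i y\<bar>\<^sup>2 \<le> B\<^sup>2" by (intro power_mono B(2) i) auto
      then show "(g i y * f i y)\<^sup>2 \<le> B\<^sup>2 * (f i y)\<^sup>2"
        unfolding power_mult_distrib by (intro mult_right_mono) auto
    qed
  \<comment> \<open>An integral that does not exist is 0, which is below the right-hand
    side.\<close>
  qed (simp add: not_integrable_integral_eq)
  then have "(nh (\<lambda>i x. g i x * f i x))\<^sup>2 \<le> (\<Sum>i\<in>{1..<N}. LINT y|E i. B\<^sup>2 * (f i y)\<^sup>2)"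
    unfolding nh_sq' by (rule sum_mono)
  then show "(nh (\<lambda>i x. g i x * f i x))\<^sup>2 \<le> (B * nh f)\<^sup>2"
    by (simp add: power_mult_distrib nh_sq' sum_distrib_left)
qed (use B in simp)

lemma nh_le_mesh:
  assumes "\<And>i. i \<in> {1..<N} \<Longrightarrow> (LINT y|E i. (e i y)\<^sup>2) \<le> (X (Suc i) - X i) ^ (2 * m) * (LINT y|E i. (g y)\<^sup>2)"
    and "sqint 0 1 g" "(LINT y|leb 0 1. (g y)\<^sup>2) \<le> A\<^sup>2" "0 \<le> A"
  shows "nh e \<le> h ^ m * A"
proof (rule power2_le_imp_le)
  have "(LINT y|E i. (e i y)\<^sup>2) \<le> h ^ (2 * m) * (LINT y|E i. (g y)\<^sup>2)" if i: "i \<in> {1..<N}" for i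
    by (rule order.trans[OF assms(1)[OF i]], intro mult_right_mono power_mono h_ge i)
      (use X_less[OF i] in auto)
  then have "(nh e)\<^sup>2 \<le> (\<Sum>i\<in>{1..<N}. h ^ (2 * m) * (LINT y|E i. (g y)\<^sup>2))"
    unfolding nh_sq' by (rule sum_mono)
  also have "\<dots> = h ^ (2 * m) * (LINT y|leb 0 1. (g y)\<^sup>2)"
    using sum_elements[of "\<lambda>y. (g y)\<^sup>2"] assms(2) by (simp add: sum_distrib_left[symmetric] sqint_def)
  also have "\<dots> \<le> h ^ (2 * m) * A\<^sup>2" using h_nonneg assms(3) by (intro mult_left_mono) auto
  finally show "(nh e)\<^sup>2 \<le> (h ^ m * A)\<^sup>2" by (simp add: power_mult_distrib power_mult mult.commute)
qed (use h_nonneg assms(4) in simp)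

lemma nh_global:
  assumes "sqint 0 1 g" "(LINT y|leb 0 1. (g y)\<^sup>2) \<le> A\<^sup>2" "0 \<le> A"
  shows "nh (\<lambda>i. g) \<le> A"
  using nh_le_mesh[of "\<lambda>i. g" 0 g A] assms by simp

lemma ih_global:
  assumes "sqint 0 1 f" "sqint 0 1 g"
  shows "ih (\<lambda>i. f) (\<lambda>i. g) = (LINT y|leb 0 1. f y * g y)"
  unfolding ih_eq by (rule sum_elements[OF sqint_integrable_mult[OF assms]])

section \<open>Weak functions\<close>

abbreviation "P w i \<equiv> elt_proj (X i) (X (Suc i)) k w"
abbreviation "R w i \<equiv> elt_proj (X i) (X (Suc i)) (Suc k) w"
abbreviation "Ip f i \<equiv> elt_interp (X i) (X (Suc i)) k f"
abbreviation "D v \<equiv> weak_diff_fun X (Suc k) v"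

lemma weak_diff_eq: "weak_diff X r v i = elt_diff (X i) (X (Suc i)) r (inner_part v i) (node_val v i) (node_val v (Suc i))"
  by (simp add: weak_diff_def elt_diff_def elt_def)

lemma L2_proj_eq: "L2_proj X r w i = elt_proj (X i) (X (Suc i)) r w"
  by (simp add: L2_proj_def elt_proj_def elt_def)

lemma S_h0D:
  assumes "v \<in> S_h0 N k"
  shows "i \<in> {1..<N} \<Longrightarrow> degree (inner_part v i) \<le> k" "node_val v 1 = 0" "node_val v N = 0"
  using assms by (auto simp: S_h0_def S_h_def)

lemma sqint_elt: "sqint 0 1 w \<Longrightarrow> i \<in> {1..<N} \<Longrightarrow> sqint (X i) (X (Suc i)) w"
  using bsq_global[of w] by (simp add: bsq_def)

lemma P_sup:
  assumes i: "i \<in> {1..<N}"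
    and "sqint (X i) (X (Suc i)) w" "\<And>x. x \<in> {X i<..<X (Suc i)} \<Longrightarrow> \<bar>w x\<bar> \<le> B" "0 \<le> B" "x \<in> {X i..X (Suc i)}"
  shows "\<bar>poly (P w i) x\<bar> \<le> K * B"
proof (rule elt_proj_sup)
  show "(X (Suc i) - X i) * (poly p x)\<^sup>2 \<le> K\<^sup>2 * (LINT y|E i. (poly p y)\<^sup>2)"
    if "degree p \<le> k" "x \<in> {X i..X (Suc i)}" for p x
    by (rule inverse_ineq[OF X_less[OF i] that])
qed (use assms X_less[OF i] K_ge in auto)

lemma nh_1: "nh (\<lambda>i x. 1) = 1"
  using telescope[of X] X_less by (simp add: norm_h_def ih_eq less_imp_le)

text \<open>The elementwise antiderivatives \<open>z\<close> match the nodal values at both ends.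
  Starting from the value 0 at the left boundary, they grow by at most the L1 norm of
  \<open>D v\<close>, which is at most \<open>nh (D v)\<close> on an interval of length 1. The
  projection back to degree \<open>k\<close> costs the factor \<open>K\<close>.\<close>

lemma abs_inner_fun_le:
  assumes v: "v \<in> S_h0 N k" and i: "i \<in> {1..<N}" and x: "x \<in> {X i..X (Suc i)}"
  shows "\<bar>inner_fun v i x\<bar> \<le> K * nh (D v)"
proof -
  define d where "d j = weak_diff X (Suc k) v j" for j
  define l where "l j = (LINT y|E j. \<bar>poly (d j) y\<bar>)" for j
  have l0: "0 \<le> l j" for j by (simp add: l_def)
  have abs_sq: "bsq (\<lambda>j y. \<bar>poly (d j) y\<bar>)" unfolding bsq_def by (auto intro: sqint_abs)
  have iint: "integrable (E j) (\<lambda>y. \<bar>poly (d j) y\<bar>)" for j by (intro sqint_integrable sqint_abs) simp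
  have total: "(\<Sum>j\<in>{1..<N}. l j) \<le> nh (D v)"
  proof -
    have "(\<Sum>j\<in>{1..<N}. l j) = ih (\<lambda>j y. \<bar>poly (d j) y\<bar>) (\<lambda>j y. 1)" by (simp add: ih_eq l_def)
    also have "\<dots> \<le> nh (\<lambda>j y. \<bar>poly (d j) y\<bar>) * nh (\<lambda>j y. 1)"
      using ih_cs[OF abs_sq, of "\<lambda>j y. 1"] by (simp add: bsq_def abs_le_iff)
    also have "nh (\<lambda>j y. \<bar>poly (d j) y\<bar>) = nh (D v)" by (simp add: norm_h_def ih_eq d_def)
    finally show ?thesis by (simp add: nh_1)
  qed
  have "\<exists>z. pderiv z = d j \<and> poly z (X j) = node_val v j" for j
    by (rule poly_antiderivative[of "d j" "X j" "node_val v j"]) blast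
  then obtain z where z: "\<And>j. pderiv (z j) = d j" "\<And>j. poly (z j) (X j) = node_val v j" by metis
  have step: "\<bar>poly (z j) y\<bar> \<le> \<bar>node_val v j\<bar> + l j" if j: "j \<in> {1..<N}" and y: "y \<in> {X j..X (Suc j)}" for j y
  proof -
    have "\<bar>poly (z j) y - node_val v j\<bar> = \<bar>LINT s|leb (X j) y. poly (d j) s\<bar>"
      using integral_pderiv[of "X j" y "z j"] y z by simp
    also have "\<dots> \<le> (LINT s|leb (X j) y. \<bar>poly (d j) s\<bar>)" by (rule integral_abs_bound)
    also have "\<dots> \<le> (LINT s|leb (X j) y. \<bar>poly (d j) s\<bar>) + (LINT s|leb y (X (Suc j)). \<bar>poly (d j) s\<bar>)" by simp
    also have "\<dots> = l j" using integral_leb_combine[OF iint, of j y] y by (simp add: l_def)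
    finally show ?thesis by linarith
  qed
  have node: "\<bar>node_val v j\<bar> \<le> (\<Sum>i\<in>{1..<j}. l i)" if "1 \<le> j" "j \<le> N" for j
    using that
  proof (induction j rule: dec_induct)
    case base
    then show ?case using S_h0D(2)[OF v] by simp
  next
    case (step j)
    then have j: "j \<in> {1..<N}" by simp
    have "node_val v (Suc j) = poly (z j) (X (Suc j))"
      using elt_diff_antiderivative(1)[OF X_less[OF j] S_h0D(1)[OF v j] _ z(2)] z(1) by (simp add: d_def weak_diff_eq)
    then have "\<bar>node_val v (Suc j)\<bar> \<le> \<bar>node_val v j\<bar> + l j"
      using \<open>\<And>y j. j \<in> {1..<N} \<Longrightarrow> y \<in> {X j..X (Suc j)} \<Longrightarrow> \<bar>poly (z j) y\<bar> \<le> \<bar>node_val v j\<bar> + l j\<close>[OF j] X_less[OF j] by simp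
    then show ?case using step by simp
  qed
  have zb: "\<bar>poly (z i) y\<bar> \<le> nh (D v)" if y: "y \<in> {X i..X (Suc i)}" for y
  proof -
    have "\<bar>poly (z i) y\<bar> \<le> (\<Sum>j\<in>{1..<Suc i}. l j)" using step[OF i y] node[of i] i by simp
    also have "\<dots> \<le> (\<Sum>j\<in>{1..<N}. l j)" using i l0 by (intro sum_mono2) auto
    finally show ?thesis using total by simp
  qed
  have "elt_proj (X i) (X (Suc i)) k (poly (z i)) = inner_part v i"
    using elt_diff_antiderivative(2)[OF X_less[OF i] S_h0D(1)[OF v i] _ z(2)] z(1) by (simp add: d_def weak_diff_eq)
  then show ?thesis using P_sup[OF i _ _ _ x, of "poly (z i)" "nh (D v)"] zb by simp
qed

lemma nh_inner_fun_le:
  assumes v: "v \<in> S_h0 N k"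
  shows "nh (inner_fun v) \<le> K * nh (D v)"
proof -
  have "nh (\<lambda>i x. inner_fun v i x * 1) \<le> K * nh (D v) * nh (\<lambda>i x. 1)"
    by (rule nh_mult_le) (use abs_inner_fun_le[OF v] K_ge in \<open>auto simp: bsq_def\<close>)
  then show ?thesis by (simp add: nh_1)
qed

text \<open>The sup norm is taken of \<open>v\<close>, at the price of its gradient norm; thus
  \<open>w\<close> remains undifferentiated.\<close>

lemma convection_le:
  assumes "v \<in> S_h0 N k"
  shows "\<bar>ih (\<lambda>i x. inner_fun w i x * D y i x) (inner_fun v)\<bar> \<le> K * nh (inner_fun w) * nh (D y) * nh (D v)"
proof -
  have "ih (\<lambda>i x. inner_fun w i x * D y i x) (inner_fun v) = ih (\<lambda>i x. inner_fun v i x * inner_fun w i x) (D y)"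
    by (simp add: ih_eq mult_ac)
  moreover have "bsq (\<lambda>i x. inner_fun v i x * inner_fun w i x)"
    using bsq_poly(2)[of "\<lambda>i. inner_part v i * inner_part w i"] by simp
  ultimately have "\<bar>ih (\<lambda>i x. inner_fun w i x * D y i x) (inner_fun v)\<bar> \<le> nh (\<lambda>i x. inner_fun v i x * inner_fun w i x) * nh (D y)"
    using ih_cs[of "\<lambda>i x. inner_fun v i x * inner_fun w i x" "D y"] by simp
  also have "\<dots> \<le> K * nh (D v) * nh (inner_fun w) * nh (D y)"
    by (intro mult_right_mono nh_mult_le) (use abs_inner_fun_le[OF assms] K_ge in \<open>auto intro: mult_nonneg_nonneg\<close>)
  finally show ?thesis by (simp add: mult_ac)
qed

end

section \<open>Consistency of the projection\<close>

text \<open>\<open>A\<close> is an upper bound for all levels rather than the norm, so that sums and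
  time increments of chains come with explicit bounds.\<close>

definition sobolev_chain :: "nat \<Rightarrow> real \<Rightarrow> (nat \<Rightarrow> real \<Rightarrow> real) \<Rightarrow> bool" where
  "sobolev_chain m A f \<longleftrightarrow> deriv_chain m 0 1 f \<and> 0 \<le> A \<and> (\<forall>j\<le>m. (LINT x|leb 0 1. (f j x)\<^sup>2) \<le> A\<^sup>2)"

lemma sobolev_chainD:
  assumes "sobolev_chain m A f"
  shows "deriv_chain m 0 1 f" "0 \<le> A" "j \<le> m \<Longrightarrow> (LINT x|leb 0 1. (f j x)\<^sup>2) \<le> A\<^sup>2"
    and "j \<le> m \<Longrightarrow> sqint 0 1 (f j)" "j < m \<Longrightarrow> continuous_on {0..1} (f j)"
    and "j < m \<Longrightarrow> x \<in> {0..1} \<Longrightarrow> \<bar>f j x\<bar> \<le> 2 * A"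
  using assms deriv_chainD(2)[of m 0 1 f j] deriv_chain_continuous[of m 0 1 f j]
    deriv_chain_sup_bound[of m f j x A] by (auto simp: sobolev_chain_def)

context mesh
begin

lemma deriv_chain_elt: "deriv_chain m 0 1 f \<Longrightarrow> i \<in> {1..<N} \<Longrightarrow> deriv_chain m (X i) (X (Suc i)) f"
  using X_sub by (auto intro: deriv_chain_subinterval)

lemma P_error:
  assumes f: "sobolev_chain (k + 2) A f"
  shows "nh (\<lambda>i x. f 0 x - poly (P (f 0) i) x) \<le> h ^ (k + 1) * A"
proof (rule nh_le_mesh[OF _ sobolev_chainD(4,3)[OF f, of "k + 1"] sobolev_chainD(2)[OF f]])
  fix i assume i: "i \<in> {1..<N}"
  have "deriv_chain (k + 1) (X i) (X (Suc i)) f"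
    by (rule deriv_chain_mono[OF deriv_chain_elt[OF sobolev_chainD(1)[OF f] i]]) simp
  then show "(LINT x|E i. (f 0 x - poly (P (f 0) i) x)\<^sup>2) \<le> (X (Suc i) - X i) ^ (2 * (k + 1)) * (LINT x|E i. (f (k + 1) x)\<^sup>2)"
    by (rule elt_proj_error[OF X_less[OF i]]) simp
qed auto

text \<open>\<open>f 1\<close> has \<open>k + 1\<close> derivatives in the chain, so this is the
  order that the projection onto degree \<open>k + 1\<close> delivers here.\<close>

lemma R_error:
  assumes f: "sobolev_chain (k + 2) A f"
  shows "nh (\<lambda>i x. f 1 x - poly (R (f 1) i) x) \<le> h ^ (k + 1) * A"
proof (rule nh_le_mesh[OF _ sobolev_chainD(4,3)[OF f, of "k + 2"] sobolev_chainD(2)[OF f]])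
  fix i assume i: "i \<in> {1..<N}"
  have "deriv_chain (k + 1 + 1) (X i) (X (Suc i)) f"
    using deriv_chain_elt[OF sobolev_chainD(1)[OF f] i] by simp
  from deriv_chain_shift[OF this]
  show "(LINT x|E i. (f 1 x - poly (R (f 1) i) x)\<^sup>2) \<le> (X (Suc i) - X i) ^ (2 * (k + 1)) * (LINT x|E i. (f (k + 2) x)\<^sup>2)"
    using elt_proj_error[OF X_less[OF i], of "k + 1" "\<lambda>j. f (j + 1)" "Suc k"] by simp
qed auto

lemma Ip_error:
  assumes f: "deriv_chain (k + 1) 0 1 f" and A: "(LINT x|leb 0 1. (f (k + 1) x)\<^sup>2) \<le> A\<^sup>2" "0 \<le> A"
  shows "nh (\<lambda>i x. f 0 x - poly (Ip f i) x) \<le> h ^ (k + 1) * A"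
proof (rule nh_le_mesh[OF _ _ A])
  fix i assume i: "i \<in> {1..<N}"
  have "deriv_chain (Suc k) (X i) (X (Suc i)) f" using deriv_chain_elt[OF f i] by simp
  from elt_interp_error[OF X_less[OF i] this, of k]
  show "(LINT x|E i. (f 0 x - poly (Ip f i) x)\<^sup>2) \<le> (X (Suc i) - X i) ^ (2 * (k + 1)) * (LINT x|E i. (f (k + 1) x)\<^sup>2)" by simp
qed (use deriv_chainD(2)[OF f] in simp)

lemma nh_P_le: "sqint 0 1 w \<Longrightarrow> (LINT x|leb 0 1. (w x)\<^sup>2) \<le> A\<^sup>2 \<Longrightarrow> 0 \<le> A \<Longrightarrow> nh (\<lambda>i. poly (elt_proj (X i) (X (Suc i)) r w)) \<le> A"
  using nh_le_mesh[of "\<lambda>i. poly (elt_proj (X i) (X (Suc i)) r w)" 0 w A] elt_proj_norm_le[OF X_less sqint_elt] by simp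

text \<open>The nodal terms telescope because test functions vanish at the boundary.\<close>

lemma ih_interp:
  assumes f: "deriv_chain m 0 1 f" "1 \<le> m" and v: "v \<in> S_h0 N k"
  shows "ih (\<lambda>i. poly (Ip f i)) (D v) = - ih (\<lambda>i. f 1) (inner_fun v)"
proof -
  have "(LINT y|E i. poly (Ip f i) y * D v i y) = - (LINT y|E i. f 1 y * inner_fun v i y)
      + (node_val v (Suc i) * f 0 (X (Suc i)) - node_val v i * f 0 (X i))" if i: "i \<in> {1..<N}" for i
    using elt_diff_elt_interp[OF X_less[OF i] deriv_chain_elt[OF f(1) i] f(2) S_h0D(1)[OF v i]]
    by (simp add: weak_diff_eq mult.commute)
  then have "ih (\<lambda>i. poly (Ip f i)) (D v) = - ih (\<lambda>i. f 1) (inner_fun v)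
      + (\<Sum>i\<in>{1..<N}. node_val v (Suc i) * f 0 (X (Suc i)) - node_val v i * f 0 (X i))"
    by (simp add: ih_eq sum_subtractf)
  then show ?thesis using telescope[of "\<lambda>i. node_val v i * f 0 (X i)"] S_h0D(2,3)[OF v] by simp
qed

text \<open>Consistency error of the viscous term: the weak derivative of the projection against the
  strong second derivative.\<close>

definition diff_residual :: "(nat \<Rightarrow> real \<Rightarrow> real) \<Rightarrow> weak_fun \<Rightarrow> real" where
  "diff_residual f v = ih (\<lambda>i. poly (R (f 1) i)) (D v) + ih (\<lambda>i. f 2) (inner_fun v)"

text \<open>By \<open>ih_interp\<close> the term with \<open>f 2\<close> is minus the pairing of
  \<open>D v\<close> with an interpolant of \<open>f 1\<close>. The residual thus pairs
  \<open>D v\<close> with the difference of two approximations of \<open>f 1\<close>.\<close>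

lemma diff_residual_le:
  assumes f: "sobolev_chain (k + 2) A f" and v: "v \<in> S_h0 N k"
  shows "\<bar>diff_residual f v\<bar> \<le> 2 * h ^ (k + 1) * A * nh (D v)"
proof -
  let ?f = "\<lambda>j. f (j + 1)"
  have c: "deriv_chain (k + 1) 0 1 ?f" by (rule deriv_chain_shift) (use sobolev_chainD(1)[OF f] in simp)
  have b1: "bsq (\<lambda>i. f 1)" by (rule bsq_global[OF sobolev_chainD(4)[OF f]]) simp
  have "ih (\<lambda>i. poly (Ip ?f i)) (D v) = - ih (\<lambda>i. f 2) (inner_fun v)"
    using ih_interp[OF c _ v] by (simp add: numeral_2_eq_2)
  then have "diff_residual f v = ih (\<lambda>i x. poly (R (f 1) i) x - poly (Ip ?f i) x) (D v)"
    using ih_diff[of "\<lambda>i. poly (R (f 1) i)" "\<lambda>i. poly (Ip ?f i)" "D v"] by (simp add: diff_residual_def)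
  then have "\<bar>diff_residual f v\<bar> \<le> nh (\<lambda>i x. poly (R (f 1) i) x - poly (Ip ?f i) x) * nh (D v)"
    using ih_cs[OF bsq_diff[OF bsq_poly(1)[of "\<lambda>i. R (f 1) i"] bsq_poly(1)[of "\<lambda>i. Ip ?f i"]], of "D v"] by simp
  also have "\<dots> \<le> (h ^ (k + 1) * A + h ^ (k + 1) * A) * nh (D v)"
  proof (rule mult_right_mono)
    have "nh (\<lambda>i x. poly (R (f 1) i) x - poly (Ip ?f i) x)
        \<le> nh (\<lambda>i x. poly (R (f 1) i) x - f 1 x) + nh (\<lambda>i x. f 1 x - poly (Ip ?f i) x)"
      by (rule nh_triangle_diff[OF bsq_poly(1) b1 bsq_poly(1)])
    then show "nh (\<lambda>i x. poly (R (f 1) i) x - poly (Ip ?f i) x) \<le> h ^ (k + 1) * A + h ^ (k + 1) * A"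
      using R_error[OF f] Ip_error[OF c, of A] sobolev_chainD(2)[OF f] sobolev_chainD(3)[OF f, of "k + 2"]
      by (simp add: nh_minus[of "\<lambda>i. poly (R (f (Suc 0)) i)" "\<lambda>i. f (Suc 0)"] mult_ac)
  qed simp
  finally show ?thesis by (simp add: algebra_simps)
qed

text \<open>Consistency error of the conservative part of convection, made bilinear in
  \<open>f\<close> and \<open>g\<close> so that a difference of squares can be factored.\<close>

definition conv_residual :: "(nat \<Rightarrow> real \<Rightarrow> real) \<Rightarrow> (nat \<Rightarrow> real \<Rightarrow> real) \<Rightarrow> weak_fun \<Rightarrow> real" where
  "conv_residual f g v = - ih (\<lambda>i x. poly (P (f 0) i) x * poly (P (g 0) i) x) (D v)
     - ih (\<lambda>i x. f 1 x * g 0 x + f 0 x * g 1 x) (inner_fun v)"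

lemma P_le:
  assumes f: "sobolev_chain (k + 2) A f" and i: "i \<in> {1..<N}" and x: "x \<in> {X i<..<X (Suc i)}"
  shows "\<bar>poly (P (f 0) i) x\<bar> \<le> K * (2 * A)"
  by (rule P_sup[OF i])
    (use sobolev_chainD(2,6)[OF f] sqint_elt[OF sobolev_chainD(4)[OF f] i] X_sub[OF i] x in auto)

lemma chain_le: "sobolev_chain (k + 2) A f \<Longrightarrow> j < k + 2 \<Longrightarrow> i \<in> {1..<N} \<Longrightarrow> x \<in> {X i<..<X (Suc i)} \<Longrightarrow> \<bar>f j x\<bar> \<le> 2 * A"
  using sobolev_chainD(6)[of "k + 2" A f j x] X_sub[of i] by simp

lemma bsq_poly_mult: "bsq (\<lambda>i x. poly (p i) x * poly (q i) x)"
  using bsq_poly(2)[of "\<lambda>i. p i * q i"] by simp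

lemma bsq_mult_poly:
  assumes "bsq f" shows "bsq (\<lambda>i x. poly (p i) x * f i x)"
  using assms unfolding bsq_def by (auto intro!: sqint_mult_bounded continuous_intros)

lemma bsq_mult_global:
  assumes "bsq f" "continuous_on {0..1} g" shows "bsq (\<lambda>i x. g x * f i x)"
  unfolding bsq_def
proof
  fix i assume i: "i \<in> {1..<N}"
  have "continuous_on {X i..X (Suc i)} g" using X_sub[OF i] by (intro continuous_on_subset[OF assms(2)]) auto
  then show "sqint (X i) (X (Suc i)) (\<lambda>x. g x * f i x)" using assms(1) i by (auto simp: bsq_def intro: sqint_mult_bounded)
qed

text \<open>Interpolating the product chain turns the second term into a pairing with
  \<open>D v\<close>. The constant adds \<open>8 * 2 ^ k\<close> for the top level of that chain to
  \<open>2\<close> and \<open>2 * K\<close> for changing the two factors. The chain stops at level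
  \<open>k + 1\<close>, up to which the factors are continuous.\<close>

lemma conv_residual_le:
  assumes f: "sobolev_chain (k + 2) A f" and g: "sobolev_chain (k + 2) B g" and v: "v \<in> S_h0 N k"
  shows "\<bar>conv_residual f g v\<bar> \<le> (8 * 2 ^ k + 2 + 2 * K) * h ^ (k + 1) * A * B * nh (D v)"
proof -
  have cf: "deriv_chain (k + 1) 0 1 f" and cg: "deriv_chain (k + 1) 0 1 g"
    using sobolev_chainD(1)[OF f] sobolev_chainD(1)[OF g] by (auto elim: deriv_chain_mono)
  have A: "0 \<le> A" "0 \<le> B" using sobolev_chainD(2)[OF f] sobolev_chainD(2)[OF g] by auto
  have "\<exists>p. deriv_chain (k + 1) 0 1 p \<and> p 0 = (\<lambda>x. f 0 x * g 0 x) \<and>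
    (0 < k + 1 \<longrightarrow> p 1 = (\<lambda>x. f 1 x * g 0 x + f 0 x * g 1 x)) \<and>
    (\<forall>j\<le>k + 1. \<forall>x\<in>{0..1}. \<bar>p j x\<bar> \<le> 2 ^ j * ((2 * A) * (2 * B)))"
    by (rule deriv_chain_prod[OF cf cg]) (use sobolev_chainD(5,6)[OF f] sobolev_chainD(5,6)[OF g] in auto)
  then obtain p where p: "deriv_chain (k + 1) 0 1 p" "p 0 = (\<lambda>x. f 0 x * g 0 x)"
    "p 1 = (\<lambda>x. f 1 x * g 0 x + f 0 x * g 1 x)"
    "\<And>j x. j \<le> k + 1 \<Longrightarrow> x \<in> {0..1} \<Longrightarrow> \<bar>p j x\<bar> \<le> 2 ^ j * ((2 * A) * (2 * B))" by auto
  define C where "C = 2 ^ (k + 1) * ((2 * A) * (2 * B))"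
  have C: "0 \<le> C" using A by (simp add: C_def)
  have pint: "(LINT x|leb 0 1. (p (k + 1) x)\<^sup>2) \<le> C\<^sup>2"
  proof -
    have "(LINT x|leb 0 1. (p (k + 1) x)\<^sup>2) \<le> (LINT x|leb 0 1. C\<^sup>2)"
    proof (rule integral_mono)
      show "integrable (leb 0 1) (\<lambda>x. (p (k + 1) x)\<^sup>2)" using deriv_chainD(2)[OF p(1)] by (simp add: sqint_def)
      fix x :: real assume "x \<in> space (leb 0 1)"
      then have "\<bar>p (k + 1) x\<bar>\<^sup>2 \<le> C\<^sup>2" unfolding C_def by (intro power_mono p(4)) auto
      then show "(p (k + 1) x)\<^sup>2 \<le> C\<^sup>2" by simp
    qed simp
    then show ?thesis by simp
  qed
  let ?P = "\<lambda>i x. poly (P (f 0) i) x * poly (P (g 0) i) x" and ?I = "\<lambda>i x. poly (Ip p i) x"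
  have bp: "bsq (\<lambda>i. p 0)" using deriv_chainD(2)[OF p(1)] by (intro bsq_global) simp
  have bf: "bsq (\<lambda>i. f 0)" "bsq (\<lambda>i. g 0)"
    using sobolev_chainD(4)[OF f] sobolev_chainD(4)[OF g] by (auto intro: bsq_global)
  have "conv_residual f g v = ih ?I (D v) - ih ?P (D v)"
    unfolding conv_residual_def p(3)[symmetric] using ih_interp[OF p(1) _ v] by simp
  also have "\<dots> = ih (\<lambda>i x. ?I i x - ?P i x) (D v)" by (intro ih_diff[symmetric] bsq_poly_mult) auto
  finally have "\<bar>conv_residual f g v\<bar> \<le> nh (\<lambda>i x. ?I i x - ?P i x) * nh (D v)"
    using ih_cs[OF bsq_diff[OF bsq_poly(2)[of "\<lambda>i. Ip p i"] bsq_poly_mult[of "\<lambda>i. P (f 0) i" "\<lambda>i. P (g 0) i"]], of "D v"] by simp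
  also have "\<dots> \<le> ((8 * 2 ^ k + 2 + 2 * K) * h ^ (k + 1) * A * B) * nh (D v)"
  proof (rule mult_right_mono)
    \<comment> \<open>An intermediate product with only one factor projected.\<close>
    have mid: "bsq (\<lambda>i x. poly (P (f 0) i) x * g 0 x)" by (rule bsq_mult_poly[OF bf(2)])
    have 1: "nh (\<lambda>i x. ?I i x - ?P i x) \<le> nh (\<lambda>i x. ?I i x - p 0 x) + nh (\<lambda>i x. p 0 x - ?P i x)"
      by (rule nh_triangle_diff[OF bsq_poly(2) bp bsq_poly_mult])
    have 2: "nh (\<lambda>i x. ?I i x - p 0 x) \<le> h ^ (k + 1) * C"
      unfolding nh_minus[of ?I] by (rule Ip_error[OF p(1) pint C])
    have 3: "nh (\<lambda>i x. p 0 x - ?P i x) \<le> nh (\<lambda>i x. p 0 x - poly (P (f 0) i) x * g 0 x)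
        + nh (\<lambda>i x. poly (P (f 0) i) x * g 0 x - ?P i x)"
      by (rule nh_triangle_diff[OF bp mid bsq_poly_mult])
    have 4: "nh (\<lambda>i x. p 0 x - poly (P (f 0) i) x * g 0 x) \<le> 2 * B * (h ^ (k + 1) * A)"
    proof -
      have "nh (\<lambda>i x. g 0 x * (f 0 x - poly (P (f 0) i) x)) \<le> 2 * B * nh (\<lambda>i x. f 0 x - poly (P (f 0) i) x)"
        by (rule nh_mult_le[OF bsq_diff[OF bf(1) bsq_poly(2)]]) (use A chain_le[OF g] in auto)
      also have "\<dots> \<le> 2 * B * (h ^ (k + 1) * A)" using P_error[OF f] A by (intro mult_left_mono) auto
      finally show ?thesis by (simp add: p(2) algebra_simps)
    qed
    have 5: "nh (\<lambda>i x. poly (P (f 0) i) x * g 0 x - ?P i x) \<le> K * (2 * A) * (h ^ (k + 1) * B)"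
    proof -
      have "nh (\<lambda>i x. poly (P (f 0) i) x * (g 0 x - poly (P (g 0) i) x)) \<le> K * (2 * A) * nh (\<lambda>i x. g 0 x - poly (P (g 0) i) x)"
        by (rule nh_mult_le[OF bsq_diff[OF bf(2) bsq_poly(2)]]) (use A K_ge P_le[OF f] in auto)
      also have "\<dots> \<le> K * (2 * A) * (h ^ (k + 1) * B)" using P_error[OF g] A K_ge by (intro mult_left_mono) auto
      finally show ?thesis by (simp add: algebra_simps)
    qed
    have "nh (\<lambda>i x. ?I i x - ?P i x) \<le> h ^ (k + 1) * C + (2 * B * (h ^ (k + 1) * A) + K * (2 * A) * (h ^ (k + 1) * B))"
      using 1 2 3 4 5 by linarith
    then show "nh (\<lambda>i x. ?I i x - ?P i x) \<le> (8 * 2 ^ k + 2 + 2 * K) * h ^ (k + 1) * A * B"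
      by (simp add: C_def algebra_simps)
  qed simp
  finally show ?thesis .
qed

text \<open>The nonconservative part is tested with \<open>v\<close> itself, so its residual is
  bounded by the weak norm and can join the load.\<close>

lemma flux_residual_le:
  assumes f: "sobolev_chain (k + 2) A f" and v: "v \<in> S_h0 N k"
  shows "\<bar>ih (\<lambda>i x. poly (P (f 0) i) x * poly (R (f 1) i) x - f 0 x * f 1 x) (inner_fun v)\<bar>
    \<le> (2 + 2 * K) * h ^ (k + 1) * A\<^sup>2 * nh (inner_fun v)"
proof -
  have A: "0 \<le> A" using sobolev_chainD(2)[OF f] by auto
  have bf: "bsq (\<lambda>i. f 0)" "bsq (\<lambda>i. f 1)" using sobolev_chainD(4)[OF f] by (auto intro: bsq_global)
  have cf: "continuous_on {0..1} (f 0)" "continuous_on {0..1} (f 1)" using sobolev_chainD(5)[OF f] by auto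
  let ?P = "\<lambda>i x. poly (P (f 0) i) x * poly (R (f 1) i) x" and ?m = "\<lambda>i x. poly (P (f 0) i) x * f 1 x"
    and ?f = "\<lambda>(i::nat) x. f 0 x * f 1 x"
  have b: "bsq ?m" "bsq ?f"
    by (rule bsq_mult_poly[OF bf(2)]) (rule bsq_mult_global[OF bf(2) cf(1)])
  have "nh (\<lambda>i x. ?P i x - ?f i x) \<le> nh (\<lambda>i x. ?P i x - ?m i x) + nh (\<lambda>i x. ?m i x - ?f i x)"
    by (rule nh_triangle_diff[OF bsq_poly_mult b])
  moreover have "nh (\<lambda>i x. ?P i x - ?m i x) \<le> K * (2 * A) * (h ^ (k + 1) * A)"
  proof -
    have "nh (\<lambda>i x. poly (P (f 0) i) x * (poly (R (f 1) i) x - f 1 x)) \<le> K * (2 * A) * nh (\<lambda>i x. poly (R (f 1) i) x - f 1 x)"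
      by (rule nh_mult_le[OF bsq_diff[OF bsq_poly(2) bf(2)]]) (use A K_ge P_le[OF f] in auto)
    also have "\<dots> \<le> K * (2 * A) * (h ^ (k + 1) * A)"
      using R_error[OF f] A K_ge by (intro mult_left_mono) (auto simp: nh_minus[of "\<lambda>i. poly (R (f (Suc 0)) i)"])
    finally show ?thesis by (simp add: algebra_simps)
  qed
  moreover have "nh (\<lambda>i x. ?m i x - ?f i x) \<le> 2 * A * (h ^ (k + 1) * A)"
  proof -
    have "nh (\<lambda>i x. f 1 x * (poly (P (f 0) i) x - f 0 x)) \<le> 2 * A * nh (\<lambda>i x. poly (P (f 0) i) x - f 0 x)"
      by (rule nh_mult_le[OF bsq_diff[OF bsq_poly(2) bf(1)]]) (use A chain_le[OF f] in auto)
    also have "\<dots> \<le> 2 * A * (h ^ (k + 1) * A)"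
      using P_error[OF f] A by (intro mult_left_mono) (auto simp: nh_minus[of "\<lambda>i. poly (P (f 0) i)"])
    finally show ?thesis by (simp add: algebra_simps)
  qed
  ultimately have "nh (\<lambda>i x. ?P i x - ?f i x) \<le> (2 + 2 * K) * h ^ (k + 1) * A\<^sup>2"
    by (simp add: power2_eq_square algebra_simps)
  then have "nh (\<lambda>i x. ?P i x - ?f i x) * nh (inner_fun v) \<le> ((2 + 2 * K) * h ^ (k + 1) * A\<^sup>2) * nh (inner_fun v)"
    by (intro mult_right_mono) auto
  then show ?thesis
    using ih_cs[OF bsq_diff[OF bsq_poly_mult b(2)] bsq_poly(1)[of "inner_part v"],
        of "\<lambda>i. P (f 0) i" "\<lambda>i. R (f 1) i"] by linarith
qed

end

section \<open>The discrete scheme\<close>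

instantiation weak_fun :: real_vector
begin

definition "0 = Weak_Fun (\<lambda>_. 0) (\<lambda>_. 0)"
definition "v + w = Weak_Fun (\<lambda>i. inner_part v i + inner_part w i) (\<lambda>i. node_val v i + node_val w i)"
definition "v - w = Weak_Fun (\<lambda>i. inner_part v i - inner_part w i) (\<lambda>i. node_val v i - node_val w i)"
definition "- v = Weak_Fun (\<lambda>i. - inner_part v i) (\<lambda>i. - node_val v i)"
definition "c *\<^sub>R v = Weak_Fun (\<lambda>i. smult c (inner_part v i)) (\<lambda>i. c * node_val v i)"

instance
  by standard
    (auto simp: zero_weak_fun_def plus_weak_fun_def minus_weak_fun_def uminus_weak_fun_def scaleR_weak_fun_def
      algebra_simps smult_add_right smult_add_left)

end

lemma weak_fun_sel [simp]:
  "inner_part (v + w) i = inner_part v i + inner_part w i" "node_val (v + w) i = node_val v i + node_val w i"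
  "inner_part (v - w) i = inner_part v i - inner_part w i" "node_val (v - w) i = node_val v i - node_val w i"
  "inner_part (c *\<^sub>R v) i = smult c (inner_part v i)" "node_val (c *\<^sub>R v) i = c * node_val v i"
  by (simp_all add: plus_weak_fun_def minus_weak_fun_def scaleR_weak_fun_def)

text \<open>
  A linear projection onto \<open>S_h0\<close>. Composing the forms with it makes them total on the type,
  so that the abstract result applies without reference to subspaces.
\<close>

definition restr :: "nat \<Rightarrow> nat \<Rightarrow> weak_fun \<Rightarrow> weak_fun" where
  "restr N k v = Weak_Fun (\<lambda>i. if i \<in> {1..<N} then poly_cutoff (Suc k) (inner_part v i) else 0)
     (\<lambda>i. if i \<in> {2..<N} then node_val v i else 0)"

lemma restr_in_S_h0: "restr N k v \<in> S_h0 N k"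
proof -
  have "degree (poly_cutoff (Suc k) p) \<le> k" for p :: "real poly"
    by (rule degree_le) (simp add: coeff_poly_cutoff)
  then show ?thesis by (auto simp: restr_def S_h0_def S_h_def)
qed

lemma restr_id:
  assumes "v \<in> S_h0 N k"
  shows "restr N k v = v"
proof -
  have "poly_cutoff (Suc k) (inner_part v i) = inner_part v i" if "i \<in> {1..<N}" for i
  proof (rule poly_eqI)
    have "degree (inner_part v i) \<le> k" using assms that by (simp add: S_h0_def S_h_def)
    then show "coeff (poly_cutoff (Suc k) (inner_part v i)) n = coeff (inner_part v i) n" for n
      by (simp add: coeff_poly_cutoff coeff_eq_0)
  qed
  moreover have "node_val v i = 0" if "i \<notin> {2..<N}" for i
  proof -
    have "i = 1 \<or> i = N \<or> i \<notin> {1..N}" using that by auto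
    then show ?thesis using assms by (auto simp: S_h0_def S_h_def)
  qed
  ultimately show ?thesis
    using assms by (cases v) (auto simp: restr_def S_h0_def S_h_def fun_eq_iff)
qed

lemma restr_lin: "restr N k (v + w) = restr N k v + restr N k w" "restr N k (v - w) = restr N k v - restr N k w"
  "restr N k (c *\<^sub>R v) = c *\<^sub>R restr N k v"
  by (auto simp: restr_def plus_weak_fun_def minus_weak_fun_def scaleR_weak_fun_def fun_eq_iff poly_eq_iff coeff_poly_cutoff)

text \<open>Supplies the chain of the sum in the factorization of a difference of squares.\<close>

lemma sobolev_chain_add:
  assumes f: "sobolev_chain m A f" and g: "sobolev_chain m B g"
  shows "sobolev_chain m (A + B) (\<lambda>j x. f j x + g j x)"
  unfolding sobolev_chain_def
proof (intro conjI allI impI)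
  show "deriv_chain m 0 1 (\<lambda>j x. f j x + g j x)" by (intro deriv_chain_add sobolev_chainD(1)[OF f] sobolev_chainD(1)[OF g])
  show "0 \<le> A + B" using sobolev_chainD(2)[OF f] sobolev_chainD(2)[OF g] by simp
  fix j assume j: "j \<le> m"
  note sq = sobolev_chainD(4)[OF f j] sobolev_chainD(4)[OF g j]
  note le = sobolev_chainD(3)[OF f j] sobolev_chainD(3)[OF g j]
  have "(LINT x|leb 0 1. f j x * g j x)\<^sup>2 \<le> (A * B)\<^sup>2"
    unfolding power_mult_distrib using integral_cauchy_schwarz[OF sq] mult_mono[OF le] by simp
  then have "\<bar>LINT x|leb 0 1. f j x * g j x\<bar> \<le> A * B"
    using sobolev_chainD(2)[OF f] sobolev_chainD(2)[OF g] abs_le_square_iff[of _ "A * B"] by simp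
  moreover have "(LINT x|leb 0 1. (f j x + g j x)\<^sup>2)
      = (LINT x|leb 0 1. (f j x)\<^sup>2 + 2 * (f j x * g j x) + (g j x)\<^sup>2)"
    by (simp add: power2_eq_square algebra_simps)
  moreover have "\<dots> = (LINT x|leb 0 1. (f j x)\<^sup>2) + 2 * (LINT x|leb 0 1. f j x * g j x) + (LINT x|leb 0 1. (g j x)\<^sup>2)"
    using sq sqint_integrable_mult[OF sq] by (simp add: sqint_def)
  ultimately show "(LINT x|leb 0 1. (f j x + g j x)\<^sup>2) \<le> (A + B)\<^sup>2"
    using le by (simp add: power2_sum)
qed

context mesh
begin

lemma S_h0_Q_h:
  assumes f: "sqint 0 1 f" and bd: "f 0 = 0" "f 1 = 0"
  shows "Q_h X N k f \<in> S_h0 N k"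
  using elt_proj(1)[OF X_less sqint_elt[OF f]] bd N_ge
  by (auto simp: Q_h_def S_h0_def S_h_def L2_proj_eq)

lemma Q_h_sel:
  assumes "i \<in> {1..<N}"
  shows "inner_part (Q_h X N k w) i = P w i" "node_val (Q_h X N k w) i = w (X i)" "node_val (Q_h X N k w) (Suc i) = w (X (Suc i))"
  using assms by (auto simp: Q_h_def L2_proj_eq)

lemma weak_diff_Q_h:
  assumes f: "deriv_chain m 0 1 f" "1 \<le> m" and i: "i \<in> {1..<N}"
  shows "weak_diff X (Suc k) (Q_h X N k (f 0)) i = R (f 1) i"
  unfolding weak_diff_eq Q_h_sel[OF i]
  by (rule elt_diff_elt_proj[OF X_less[OF i] deriv_chain_elt[OF f(1) i] f(2)])

lemma weak_diff_lin:
  assumes "i \<in> {1..<N}"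
  shows "weak_diff X r (v + w) i = weak_diff X r v i + weak_diff X r w i"
    "weak_diff X r (v - w) i = weak_diff X r v i - weak_diff X r w i"
    "weak_diff X r (c *\<^sub>R v) i = smult c (weak_diff X r v i)"
  using elt_diff_lin[OF X_less[OF assms], of r 1 "inner_part v i" 1 "inner_part w i" "node_val v i" "node_val w i" "node_val v (Suc i)" "node_val w (Suc i)"]
    elt_diff_lin[OF X_less[OF assms], of r 1 "inner_part v i" "-1" "inner_part w i" "node_val v i" "node_val w i" "node_val v (Suc i)" "node_val w (Suc i)"]
    elt_diff_lin[OF X_less[OF assms], of r c "inner_part v i" 0 "inner_part w i" "node_val v i" "node_val w i" "node_val v (Suc i)" "node_val w (Suc i)"]
  by (simp_all add: weak_diff_eq)

lemma ih_fun_cong: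
  assumes "\<And>i. i \<in> {1..<N} \<Longrightarrow> f i = f' i" "\<And>i. i \<in> {1..<N} \<Longrightarrow> g i = g' i"
  shows "ih f g = ih f' g'"
  unfolding ih_eq using assms by (intro sum.cong) auto

lemma linear_ih:
  assumes F: "\<And>x y i. i \<in> {1..<N} \<Longrightarrow> F (x + y) i = F x i + F y i" "\<And>c x i. i \<in> {1..<N} \<Longrightarrow> F (c *\<^sub>R x) i = smult c (F x i)"
    and e: "bsq e"
  shows "linear (\<lambda>x :: 'b :: real_vector. ih (\<lambda>i. poly (F x i)) e)"
proof (rule linearI)
  fix x y
  have "ih (\<lambda>i. poly (F (x + y) i)) e = ih (\<lambda>i s. poly (F x i) s + poly (F y i) s) e"
    by (rule ih_fun_cong) (auto simp: F)
  then show "ih (\<lambda>i. poly (F (x + y) i)) e = ih (\<lambda>i. poly (F x i)) e + ih (\<lambda>i. poly (F y i)) e"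
    using ih_add[OF bsq_poly(1)[of "F x"] bsq_poly(1)[of "F y"] e] by simp
next
  fix c x
  have "ih (\<lambda>i. poly (F (c *\<^sub>R x) i)) e = ih (\<lambda>i s. c * poly (F x i) s + 0 * poly (F x i) s) e"
    by (rule ih_fun_cong) (auto simp: F)
  then show "ih (\<lambda>i. poly (F (c *\<^sub>R x) i)) e = c *\<^sub>R ih (\<lambda>i. poly (F x i)) e"
    using ih_lin[OF bsq_poly(1)[of "F x"] bsq_poly(1)[of "F x"] e, of c 0] by simp
qed

lemma bilinear_ih:
  assumes F: "\<And>x y i. i \<in> {1..<N} \<Longrightarrow> F (x + y) i = F x i + F y i" "\<And>c x i. i \<in> {1..<N} \<Longrightarrow> F (c *\<^sub>R x) i = smult c (F x i)"
    and G: "\<And>x y i. i \<in> {1..<N} \<Longrightarrow> G (x + y) i = G x i + G y i" "\<And>c x i. i \<in> {1..<N} \<Longrightarrow> G (c *\<^sub>R x) i = smult c (G x i)"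
  shows "bilinear (\<lambda>(x :: 'b :: real_vector) (y :: 'c :: real_vector). ih (\<lambda>i. poly (F x i)) (\<lambda>i. poly (G y i)))"
  unfolding bilinear_def
proof (intro conjI allI)
  show "linear (\<lambda>x. ih (\<lambda>i. poly (F x i)) (\<lambda>i. poly (G y i)))" for y by (rule linear_ih[OF F]) auto
  show "linear (\<lambda>y. ih (\<lambda>i. poly (F x i)) (\<lambda>i. poly (G y i)))" for x
    unfolding ih_commute[of "\<lambda>i. poly (F x i)"] by (rule linear_ih[OF G]) auto
qed

section \<open>The forms of the scheme and the splitting of the consistency error\<close>

abbreviation "V v i \<equiv> inner_part (restr N k v) i"
abbreviation "DV v i \<equiv> weak_diff X (Suc k) (restr N k v) i"

definition mass :: "weak_fun \<Rightarrow> weak_fun \<Rightarrow> real" where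
  "mass v w = ih (\<lambda>i. poly (V v i)) (\<lambda>i. poly (V w i))"

definition stiff :: "weak_fun \<Rightarrow> weak_fun \<Rightarrow> real" where
  "stiff v w = ih (\<lambda>i. poly (DV v i)) (\<lambda>i. poly (DV w i))"

definition conv :: "weak_fun \<Rightarrow> weak_fun \<Rightarrow> weak_fun \<Rightarrow> real" where
  "conv u v w = 1 / 3 * ih (\<lambda>i s. poly (V u i) s * poly (DV v i) s) (\<lambda>i. poly (V w i))"

lemma mass_eq: "sqrt (mass v v) = nh (inner_fun (restr N k v))" and stiff_eq: "sqrt (stiff v v) = nh (D (restr N k v))"
  by (simp_all add: mass_def stiff_def norm_h_def)

lemma galerkin_mesh: "galerkin mass stiff conv K K"
proof (rule galerkin.intro)
  note [simp] = weak_diff_lin restr_lin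
  show "bilinear mass" unfolding mass_def by (rule bilinear_ih) auto
  show "bilinear stiff" unfolding stiff_def by (rule bilinear_ih) auto
  show "bilinear (conv z)" for z
  proof -
    have "conv z = (\<lambda>x y. ih (\<lambda>i. poly (smult (1/3) (V z i * DV x i))) (\<lambda>i. poly (V y i)))"
      by (auto simp: conv_def ih_eq fun_eq_iff sum_divide_distrib)
    then show ?thesis by (simp only:) (rule bilinear_ih, auto simp: algebra_simps smult_add_right)
  qed
  show "mass x y = mass y x" "stiff x y = stiff y x" for x y by (simp_all add: mass_def stiff_def ih_commute)
  show "0 \<le> mass x x" "0 \<le> stiff x x" for x using zero_le_power2 nh_sq unfolding mass_def stiff_def by metis+
  show "conv x y z = conv z y x" for x y z by (simp add: conv_def ih_eq mult_ac)
  show "\<bar>conv x y z\<bar> \<le> K * sqrt (mass x x) * sqrt (stiff y y) * sqrt (stiff z z)" for x y z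
    using convection_le[OF restr_in_S_h0, of "restr N k x" "restr N k y" z] unfolding mass_eq stiff_eq conv_def
    by (simp add: abs_mult)
  show "mass x x \<le> K\<^sup>2 * stiff x x" for x
    using power_mono[OF nh_inner_fun_le[OF restr_in_S_h0, of x], of 2]
    by (simp add: power_mult_distrib nh_sq mass_def stiff_def)
qed (use K_ge in auto)

text \<open>The convection term \<open>u u'\<close> is split as \<open>(u u' + (u^2)') / 3\<close>.
  The first part gives the flux residual here, the second gives \<open>conv_residual\<close>;
  \<open>e\<close> is the truncation error in time.\<close>

definition mesh_load :: "(nat \<Rightarrow> real \<Rightarrow> real) \<Rightarrow> (real \<Rightarrow> real) \<Rightarrow> weak_fun \<Rightarrow> real" where
  "mesh_load f e v = ih (\<lambda>i. e) (inner_fun (restr N k v))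
     + 1 / 3 * ih (\<lambda>i x. poly (P (f 0) i) x * poly (R (f 1) i) x - f 0 x * f 1 x) (inner_fun (restr N k v))"

text \<open>The residuals that can be bounded only by the gradient of \<open>v\<close>; this is the
  functional \<open>S\<close> of the abstract scheme.\<close>

definition mesh_stress :: "real \<Rightarrow> (nat \<Rightarrow> real \<Rightarrow> real) \<Rightarrow> weak_fun \<Rightarrow> real" where
  "mesh_stress \<nu> f v = \<nu> * diff_residual f (restr N k v) + 1 / 3 * conv_residual f f (restr N k v)"

lemma linear_mesh_stress:
  assumes f: "sobolev_chain (k + 2) A f"
  shows "linear (mesh_stress \<nu> f)"
proof -
  note [simp] = weak_diff_lin restr_lin
  have b: "bsq (\<lambda>i. f 2)" by (rule bsq_global[OF sobolev_chainD(4)[OF f]]) simp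
  have b1: "bsq (\<lambda>i. f 0)" "bsq (\<lambda>i. f 1)" using sobolev_chainD(4)[OF f] by (auto intro: bsq_global)
  have b2: "bsq (\<lambda>i x. f 1 x * f 0 x + f 0 x * f 1 x)"
    using bsq_mult_global[OF b1(2), of "f 0"] bsq_mult_global[OF b1(1), of "f 1"] sobolev_chainD(5)[OF f]
    by (intro bsq_add) auto
  have l1: "linear (\<lambda>v. ih e (\<lambda>i. poly (V v i)))" if "bsq e" for e
    unfolding ih_commute[of e] by (rule linear_ih[OF _ _ that]) auto
  have l2: "linear (\<lambda>v. ih e (\<lambda>i. poly (DV v i)))" if "bsq e" for e
    unfolding ih_commute[of e] by (rule linear_ih[OF _ _ that]) auto
  note l = l2[OF bsq_poly(1)[of "\<lambda>i. R (f 1) i"]] l1[OF b] l2[OF bsq_poly_mult[of "\<lambda>i. P (f 0) i" "\<lambda>i. P (f 0) i"]] l1[OF b2]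
  have eq: "mesh_stress \<nu> f = (\<lambda>v. \<nu> *\<^sub>R (ih (\<lambda>i. poly (R (f 1) i)) (\<lambda>i. poly (DV v i)) + ih (\<lambda>i. f 2) (\<lambda>i. poly (V v i)))
     + (1 / 3) *\<^sub>R (- ih (\<lambda>i x. poly (P (f 0) i) x * poly (P (f 0) i) x) (\<lambda>i. poly (DV v i))
       - ih (\<lambda>i x. f 1 x * f 0 x + f 0 x * f 1 x) (\<lambda>i. poly (V v i))))"
    by (simp add: mesh_stress_def diff_residual_def conv_residual_def fun_eq_iff)
  show ?thesis unfolding eq
    by (rule linear_compose_add[OF linear_compose_scale_right[OF linear_compose_add[OF l(1,2)]]
          linear_compose_scale_right[OF linear_compose_sub[OF linear_compose_neg[OF l(3)] l(4)]]])
qed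

end

context mesh
begin

lemma ih_Q_h:
  assumes w: "sqint 0 1 w" and v: "v \<in> S_h0 N k"
  shows "ih (\<lambda>i. poly (P w i)) (inner_fun v) = ih (\<lambda>i. w) (inner_fun v)"
  by (rule ih_cong) (rule elt_proj(2)[OF X_less sqint_elt[OF w] S_h0D(1)[OF v]])

lemma conv_Q_h:
  assumes f: "sobolev_chain (k + 2) A f" and bd: "f 0 0 = 0" "f 0 1 = 0"
  shows "conv (Q_h X N k (f 0)) (Q_h X N k (f 0)) v = 1 / 3 * ih (\<lambda>i x. poly (P (f 0) i) x * poly (R (f 1) i) x) (inner_fun (restr N k v))"
    and "conv (Q_h X N k (f 0)) v (Q_h X N k (f 0)) = 1 / 3 * ih (\<lambda>i x. poly (P (f 0) i) x * poly (P (f 0) i) x) (D (restr N k v))"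
    and "stiff (Q_h X N k (f 0)) v = ih (\<lambda>i. poly (R (f 1) i)) (D (restr N k v))"
    and "stiff (Q_h X N k (f 0)) (Q_h X N k (f 0)) \<le> A\<^sup>2"
proof -
  note c = sobolev_chainD(1)[OF f]
  have r: "restr N k (Q_h X N k (f 0)) = Q_h X N k (f 0)"
    by (rule restr_id[OF S_h0_Q_h[OF _ bd]]) (use sobolev_chainD(4)[OF f] in simp)
  have W: "weak_diff X (Suc k) (Q_h X N k (f 0)) i = R (f 1) i" if "i \<in> {1..<N}" for i
    by (rule weak_diff_Q_h[OF c _ that]) simp
  show "conv (Q_h X N k (f 0)) (Q_h X N k (f 0)) v = 1 / 3 * ih (\<lambda>i x. poly (P (f 0) i) x * poly (R (f 1) i) x) (inner_fun (restr N k v))"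
    unfolding conv_def r ih_eq by (intro arg_cong[where f = "(*) (1 / 3)"] sum.cong refl) (simp add: W Q_h_sel)
  show "conv (Q_h X N k (f 0)) v (Q_h X N k (f 0)) = 1 / 3 * ih (\<lambda>i x. poly (P (f 0) i) x * poly (P (f 0) i) x) (D (restr N k v))"
    unfolding conv_def r ih_eq by (intro arg_cong[where f = "(*) (1 / 3)"] sum.cong refl) (simp add: Q_h_sel mult_ac)
  show "stiff (Q_h X N k (f 0)) v = ih (\<lambda>i. poly (R (f 1) i)) (D (restr N k v))"
    unfolding stiff_def r by (rule ih_fun_cong) (auto simp: W)
  have "stiff (Q_h X N k (f 0)) (Q_h X N k (f 0)) = (nh (\<lambda>i. poly (R (f 1) i)))\<^sup>2"
    unfolding stiff_def r nh_sq by (rule ih_fun_cong) (auto simp: W)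
  also have "\<dots> \<le> A\<^sup>2"
    using nh_P_le[of "f 1" A "Suc k"] sobolev_chainD(2)[OF f] sobolev_chainD(3,4)[OF f, of 1] by (intro power_mono) auto
  finally show "stiff (Q_h X N k (f 0)) (Q_h X N k (f 0)) \<le> A\<^sup>2" .
qed

lemma mesh_load_le:
  assumes f: "sobolev_chain (k + 2) A f" and e: "sqint 0 1 e" "(LINT x|leb 0 1. (e x)\<^sup>2) \<le> a\<^sup>2" "0 \<le> a"
  shows "\<bar>mesh_load f e v\<bar> \<le> (a + (1 + K) * h ^ (k + 1) * A\<^sup>2) * sqrt (mass v v)"
proof -
  let ?v = "restr N k v"
  let ?F = "h ^ (k + 1) * A\<^sup>2 * nh (inner_fun ?v)"
  have "\<bar>ih (\<lambda>i. e) (inner_fun ?v)\<bar> \<le> nh (\<lambda>i. e) * nh (inner_fun ?v)"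
    by (rule ih_cs[OF bsq_global[OF e(1)] bsq_poly(1)])
  also have "\<dots> \<le> a * nh (inner_fun ?v)" by (intro mult_right_mono nh_global e) simp
  finally have 1: "\<bar>ih (\<lambda>i. e) (inner_fun ?v)\<bar> \<le> a * nh (inner_fun ?v)" .
  have 2: "\<bar>ih (\<lambda>i x. poly (P (f 0) i) x * poly (R (f 1) i) x - f 0 x * f 1 x) (inner_fun ?v)\<bar> \<le> (2 + 2 * K) * ?F"
    using flux_residual_le[OF f restr_in_S_h0] by (simp add: mult.assoc)
  have "0 \<le> ?F" using h_nonneg by simp
  then have "0 \<le> (1 + K) * ?F" using K_ge by simp
  moreover have "(2 + 2 * K) * ?F = 2 * ((1 + K) * ?F)" by (simp add: algebra_simps)
  ultimately have "\<bar>mesh_load f e v\<bar> \<le> a * nh (inner_fun ?v) + (1 + K) * ?F"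
    using 1 2 unfolding mesh_load_def abs_le_iff by linarith
  then show ?thesis unfolding mass_eq by (simp add: algebra_simps)
qed

abbreviation "C1 \<equiv> 8 * 2 ^ k + 2 + 2 * K"

lemma stress_le:
  assumes f: "sobolev_chain (k + 2) A f" and g: "sobolev_chain (k + 2) B g" and e: "sobolev_chain (k + 2) F e" and "0 < \<nu>"
  shows "\<bar>\<nu> * diff_residual f (restr N k v) + 1 / 3 * conv_residual g e (restr N k v)\<bar>
    \<le> (2 * \<nu> * A + C1 * B * F) * h ^ (k + 1) * sqrt (stiff v v)"
proof -
  let ?H = "h ^ (k + 1) * nh (D (restr N k v))"
  have "\<bar>\<nu> * diff_residual f (restr N k v)\<bar> \<le> \<nu> * (2 * h ^ (k + 1) * A * nh (D (restr N k v)))"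
    using diff_residual_le[OF f restr_in_S_h0, of v] assms(4) by (simp add: abs_mult)
  moreover have 2: "\<bar>conv_residual g e (restr N k v)\<bar> \<le> C1 * B * F * ?H"
    using conv_residual_le[OF g e restr_in_S_h0, of v] by (simp add: mult_ac)
  moreover have "0 \<le> C1 * B * F * ?H"
    using order.trans[OF abs_ge_zero 2] .
  moreover have "\<nu> * (2 * h ^ (k + 1) * A * nh (D (restr N k v))) + C1 * B * F * ?H
      = (2 * \<nu> * A + C1 * B * F) * h ^ (k + 1) * nh (D (restr N k v))" by (simp add: algebra_simps)
  ultimately show ?thesis unfolding stiff_eq by linarith
qed

text \<open>\<open>diff_residual\<close> is linear in the chain, and for
  \<open>conv_residual\<close> the factorization of \<open>f^2 - g^2\<close> applies. With
  \<open>f\<close> and \<open>g\<close> at consecutive time levels, the factor \<open>f - g\<close>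
  supplies the power of \<open>\<tau>\<close>.\<close>

lemma mesh_stress_diff:
  assumes f: "sobolev_chain (k + 2) A f" and g: "sobolev_chain (k + 2) B g"
  shows "mesh_stress \<nu> f v - mesh_stress \<nu> g v = \<nu> * diff_residual (\<lambda>j x. f j x - g j x) (restr N k v)
    + 1 / 3 * conv_residual (\<lambda>j x. f j x - g j x) (\<lambda>j x. f j x + g j x) (restr N k v)"
proof -
  let ?v = "restr N k v" and ?d = "\<lambda>j x. f j x - g j x" and ?s = "\<lambda>j x. f j x + g j x"
  have sq: "sqint 0 1 (f j)" "sqint 0 1 (g j)" if "j \<le> 2" for j
    using that sobolev_chainD(4)[OF f] sobolev_chainD(4)[OF g] by auto
  have c0: "continuous_on {0..1} (f 0)" "continuous_on {0..1} (g 0)" "continuous_on {0..1} (f 1)" "continuous_on {0..1} (g 1)"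
    using sobolev_chainD(5)[OF f] sobolev_chainD(5)[OF g] by auto
  have pj: "elt_proj (X i) (X (Suc i)) r (\<lambda>x. f j x - g j x) = elt_proj (X i) (X (Suc i)) r (f j) - elt_proj (X i) (X (Suc i)) r (g j)"
    "elt_proj (X i) (X (Suc i)) r (\<lambda>x. f j x + g j x) = elt_proj (X i) (X (Suc i)) r (f j) + elt_proj (X i) (X (Suc i)) r (g j)"
    if "i \<in> {1..<N}" "j \<le> 2" for i r j
    using elt_proj_lin[OF X_less[OF that(1)] sqint_elt[OF sq(1)[OF that(2)] that(1)] sqint_elt[OF sq(2)[OF that(2)] that(1)], of r 1 1]
      elt_proj_diff[OF X_less[OF that(1)] sqint_elt[OF sq(1)[OF that(2)] that(1)] sqint_elt[OF sq(2)[OF that(2)] that(1)], of r]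
    by simp_all
  have b: "bsq (\<lambda>i. f 2)" "bsq (\<lambda>i. g 2)" using sq by (auto intro: bsq_global)
  have bp: "bsq (\<lambda>i x. p x * q x + r x * s x)"
    if "continuous_on {0..1} p" "continuous_on {0..1} q" "continuous_on {0..1} r" "continuous_on {0..1} s" for p q r s
    using that by (intro bsq_global sqint_continuous continuous_intros)
  have "ih (\<lambda>i. poly (R (?d 1) i)) (D ?v) = ih (\<lambda>i x. poly (R (f 1) i) x - poly (R (g 1) i) x) (D ?v)"
    by (rule ih_fun_cong) (auto simp: pj)
  also have "\<dots> = ih (\<lambda>i. poly (R (f 1) i)) (D ?v) - ih (\<lambda>i. poly (R (g 1) i)) (D ?v)"
    using ih_diff[OF bsq_poly(1)[of "\<lambda>i. R (f 1) i"] bsq_poly(1)[of "\<lambda>i. R (g 1) i"]] by simp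
  finally have 1: "diff_residual ?d ?v = diff_residual f ?v - diff_residual g ?v"
    using ih_diff[OF b, of "inner_fun ?v"] by (simp add: diff_residual_def)
  have "ih (\<lambda>i x. poly (P (?d 0) i) x * poly (P (?s 0) i) x) (D ?v)
      = ih (\<lambda>i x. poly (P (f 0) i) x * poly (P (f 0) i) x - poly (P (g 0) i) x * poly (P (g 0) i) x) (D ?v)"
    by (rule ih_fun_cong) (auto simp: pj algebra_simps fun_eq_iff)
  also have "\<dots> = ih (\<lambda>i x. poly (P (f 0) i) x * poly (P (f 0) i) x) (D ?v) - ih (\<lambda>i x. poly (P (g 0) i) x * poly (P (g 0) i) x) (D ?v)"
    by (intro ih_diff bsq_poly_mult bsq_poly)
  finally have 2: "ih (\<lambda>i x. poly (P (?d 0) i) x * poly (P (?s 0) i) x) (D ?v) = \<dots>" .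
  have "ih (\<lambda>i x. ?d 1 x * ?s 0 x + ?d 0 x * ?s 1 x) (inner_fun ?v)
      = ih (\<lambda>i x. (f 1 x * f 0 x + f 0 x * f 1 x) - (g 1 x * g 0 x + g 0 x * g 1 x)) (inner_fun ?v)"
    by (rule ih_fun_cong) (auto simp: algebra_simps fun_eq_iff)
  also have "\<dots> = ih (\<lambda>i x. f 1 x * f 0 x + f 0 x * f 1 x) (inner_fun ?v) - ih (\<lambda>i x. g 1 x * g 0 x + g 0 x * g 1 x) (inner_fun ?v)"
    by (intro ih_diff bp c0 bsq_poly)
  finally have 3: "ih (\<lambda>i x. ?d 1 x * ?s 0 x + ?d 0 x * ?s 1 x) (inner_fun ?v) = \<dots>" .
  have "conv_residual ?d ?s ?v = conv_residual f f ?v - conv_residual g g ?v"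
    unfolding conv_residual_def 2 3 by simp
  then show ?thesis unfolding 1 mesh_stress_def by (simp add: algebra_simps)
qed

text \<open>The projection does not alter the pairing of the time difference with \<open>v\<close>,
  so the time derivative contributes its truncation error only; the other residuals are those of
  flux, diffusion and convection.\<close>

lemma galerkin_scheme_mesh:
  assumes sol: "wg_solution \<nu> g k (Suc k) X N \<tau> M U" and pos: "0 < \<nu>" "0 < \<tau>" "0 < B" "0 < B'"
    and ch: "\<And>n. sobolev_chain (k + 2) (A n) (f n)"
    and bd: "\<And>n. n \<le> M \<Longrightarrow> f n 0 0 = 0 \<and> f n 0 1 = 0"
    and init: "U 0 = Q_h X N k (f 0 0)"
    and ut: "\<And>n. n \<in> {1..M} \<Longrightarrow> sqint 0 1 (ut n)"
    and pde: "\<And>n. n \<in> {1..M} \<Longrightarrow> AE x in leb 0 1. ut n x + f n 0 x * f n 1 x - \<nu> * f n 2 x = 0"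
    and rate: "\<And>n. n \<in> {1..M} \<Longrightarrow> (LINT x|leb 0 1. ((f n 0 x - f (n - 1) 0 x) / \<tau> - ut n x)\<^sup>2) \<le> (a n)\<^sup>2"
    and incr: "\<And>n. n \<in> {1..M} \<Longrightarrow> sobolev_chain (k + 2) (\<tau> * \<delta> n) (\<lambda>j x. f n j x - f (n - 1) j x)"
    and nonneg: "\<And>n. 0 \<le> a n" "\<And>n. 0 \<le> \<delta> n"
    and bound: "\<And>n. A n \<le> B" "\<And>n. n \<in> {1..M} \<Longrightarrow> \<delta> n \<le> B'"
  shows "galerkin_scheme mass stiff conv K K \<nu> \<tau> B B' M U (\<lambda>n. Q_h X N k (f n 0))
    (\<lambda>n. mesh_load (f n) (\<lambda>x. (f n 0 x - f (n - 1) 0 x) / \<tau> - ut n x)) (\<lambda>n. mesh_stress \<nu> (f n))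
    (\<lambda>n. a n + (1 + K) * h ^ (k + 1) * (A n)\<^sup>2) (\<lambda>n. (2 * \<nu> * A n + C1 * A n * A n) * h ^ (k + 1))
    (\<lambda>n. (2 * \<nu> + C1 * (2 * B)) * h ^ (k + 1) * \<delta> n)"
proof (rule galerkin_scheme.intro[OF galerkin_mesh galerkin_scheme_axioms.intro])
  interpret G: galerkin mass stiff conv K K by (rule galerkin_mesh)
  let ?W = "\<lambda>n. Q_h X N k (f n 0)"
  have A: "0 \<le> A n" for n using sobolev_chainD(2)[OF ch] .
  have C1: "0 \<le> C1" using K_ge by simp
  have sq: "sqint 0 1 (f n j)" if "j \<le> 2" for n j using that sobolev_chainD(4)[OF ch] by simp
  have US: "U n \<in> S_h0 N k" if "n \<le> M" for n using sol that by (auto simp: wg_solution_def)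
  show "mass (U n - U (n - 1)) v / \<tau> + \<nu> * stiff (U n) v + conv (U n) (U n) v - conv (U n) v (U n) = 0"
    if n: "n \<in> {1..M}" for n v
  proof -
    let ?v = "restr N k v"
    have eq: "ih (\<lambda>i y. (inner_fun (U n) i y - inner_fun (U (n - 1)) i y) / \<tau>) (inner_fun ?v)
        + \<nu> * ih (D (U n)) (D ?v) + 1 / 3 * ih (\<lambda>i y. inner_fun (U n) i y * D (U n) i y) (inner_fun ?v)
        - 1 / 3 * ih (\<lambda>i y. inner_fun (U n) i y * inner_fun (U n) i y) (D ?v) = 0"
      using sol n restr_in_S_h0[of N k v] by (auto simp: wg_solution_def)
    have r: "restr N k (U n) = U n" "restr N k (U (n - 1)) = U (n - 1)" using restr_id US n by auto
    have "mass (U n - U (n - 1)) v / \<tau> = ih (\<lambda>i y. (inner_fun (U n) i y - inner_fun (U (n - 1)) i y) / \<tau>) (inner_fun ?v)"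
      unfolding mass_def restr_lin r by (simp add: ih_eq sum_divide_distrib)
    moreover have "stiff (U n) v = ih (D (U n)) (D ?v)" unfolding stiff_def r by simp
    moreover have "conv (U n) (U n) v = 1 / 3 * ih (\<lambda>i y. inner_fun (U n) i y * D (U n) i y) (inner_fun ?v)"
      unfolding conv_def r by simp
    moreover have "conv (U n) v (U n) = 1 / 3 * ih (\<lambda>i y. inner_fun (U n) i y * inner_fun (U n) i y) (D ?v)"
      unfolding conv_def r by (simp add: ih_eq mult_ac)
    ultimately show ?thesis using eq by simp
  qed
  have rW: "restr N k (?W n) = ?W n" if "n \<le> M" for n
    by (rule restr_id[OF S_h0_Q_h]) (use bd[OF that] sq in auto)
  have massW: "mass (?W n - ?W (n - 1)) v = ih (\<lambda>i x. f n 0 x - f (n - 1) 0 x) (inner_fun (restr N k v))" if n: "n \<in> {1..M}" for n v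
  proof -
    have "mass (?W n - ?W (n - 1)) v = ih (\<lambda>i. poly (P (\<lambda>x. f n 0 x - f (n - 1) 0 x) i)) (inner_fun (restr N k v))"
      unfolding mass_def restr_lin rW[OF le_trans[OF diff_le_self]] using n rW
      by (intro ih_fun_cong) (auto simp: Q_h_sel elt_proj_diff[OF X_less sqint_elt[OF sq] sqint_elt[OF sq]])
    then show ?thesis using ih_Q_h[OF sqint_diff[OF sq sq] restr_in_S_h0] by simp
  qed
  show "mass (?W n - ?W (n - 1)) v / \<tau> + \<nu> * stiff (?W n) v + conv (?W n) (?W n) v - conv (?W n) v (?W n)
      = mesh_load (f n) (\<lambda>x. (f n 0 x - f (n - 1) 0 x) / \<tau> - ut n x) v + mesh_stress \<nu> (f n) v" if n: "n \<in> {1..M}" for n v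
  proof -
    let ?v = "restr N k v" and ?d = "\<lambda>x. f n 0 x - f (n - 1) 0 x"
    have c0: "continuous_on {0..1} (f n 0)" using sobolev_chainD(5)[OF ch] by simp
    have bs: "bsq (\<lambda>i. f n 0)" "bsq (\<lambda>i. f n 1)" "bsq (\<lambda>i. f n 2)" "bsq (\<lambda>i. ut n)" "bsq (\<lambda>i. ?d)"
      using sq ut[OF n] by (auto intro!: bsq_global sqint_diff)
    have bff: "bsq (\<lambda>i x. f n 0 x * f n 1 x)" by (rule bsq_mult_global[OF bs(2) c0])
    have 1: "ih (\<lambda>i x. ?d x / \<tau> - ut n x) (inner_fun ?v) = ih (\<lambda>i. ?d) (inner_fun ?v) / \<tau> - ih (\<lambda>i. ut n) (inner_fun ?v)"
      using ih_lin[OF bs(5,4) bsq_poly(1)[of "inner_part ?v"], of "1 / \<tau>" "-1"] by simp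
    have 2: "ih (\<lambda>i x. f n 1 x * f n 0 x + f n 0 x * f n 1 x) (inner_fun ?v) = 2 * ih (\<lambda>i x. f n 0 x * f n 1 x) (inner_fun ?v)"
      using ih_add[OF bff bff bsq_poly(1)[of "inner_part ?v"]] by (simp add: mult.commute[of "f n 1 _"])
    have 3: "ih (\<lambda>i x. poly (P (f n 0) i) x * poly (R (f n 1) i) x - f n 0 x * f n 1 x) (inner_fun ?v)
        = ih (\<lambda>i x. poly (P (f n 0) i) x * poly (R (f n 1) i) x) (inner_fun ?v) - ih (\<lambda>i x. f n 0 x * f n 1 x) (inner_fun ?v)"
      by (intro ih_diff bsq_poly_mult bff bsq_poly)
    \<comment> \<open>The tested form of the equation; the factors 1 and 0 bring both sides into the
      shape of \<open>bsq_lin\<close>.\<close>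
    have "ih (\<lambda>i x. 1 * ut n x + 1 * (f n 0 x * f n 1 x)) (inner_fun ?v) = ih (\<lambda>i x. \<nu> * f n 2 x + 0 * f n 2 x) (inner_fun ?v)"
    proof (rule ih_AE_cong)
      fix i assume "i \<in> {1..<N}"
      then have "AE x in E i. ut n x + f n 0 x * f n 1 x - \<nu> * f n 2 x = 0"
        using AE_leb_subinterval[OF pde[OF n]] X_sub[of i] by auto
      then show "AE x in E i. 1 * ut n x + 1 * (f n 0 x * f n 1 x) = \<nu> * f n 2 x + 0 * f n 2 x"
        by eventually_elim simp
    qed (intro bsq_lin bs bff bsq_poly)+
    then have 4: "ih (\<lambda>i. ut n) (inner_fun ?v) + ih (\<lambda>i x. f n 0 x * f n 1 x) (inner_fun ?v) = \<nu> * ih (\<lambda>i. f n 2) (inner_fun ?v)"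
      using ih_lin[OF bs(4) bff bsq_poly(1)[of "inner_part ?v"], of 1 1] ih_lin[OF bs(3,3) bsq_poly(1)[of "inner_part ?v"], of \<nu> 0] by simp
    have bd': "f n 0 0 = 0" "f n 0 1 = 0" using bd n by auto
    show ?thesis
      unfolding massW[OF n] conv_Q_h(1,2,3)[OF ch bd'] mesh_load_def mesh_stress_def diff_residual_def conv_residual_def 1 2 3
      using 4 by (simp add: algebra_simps)
  qed
  show "\<bar>mesh_load (f n) (\<lambda>x. (f n 0 x - f (n - 1) 0 x) / \<tau> - ut n x) v\<bar>
      \<le> (a n + (1 + K) * h ^ (k + 1) * (A n)\<^sup>2) * G.nm v" if n: "n \<in> {1..M}" for n v
    unfolding G.nm_def
    by (rule mesh_load_le[OF ch _ rate[OF n] nonneg(1)]) (intro sqint_diff sqint_divide sq ut[OF n], auto)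
  show "\<bar>mesh_stress \<nu> (f n) v\<bar> \<le> (2 * \<nu> * A n + C1 * A n * A n) * h ^ (k + 1) * G.na v" if n: "n \<in> {1..M}" for n v
    unfolding G.na_def mesh_stress_def by (rule stress_le[OF ch ch ch pos(1)])
  show "linear (mesh_stress \<nu> (f n))" for n by (rule linear_mesh_stress[OF ch])
  show "\<bar>mesh_stress \<nu> (f n) v - mesh_stress \<nu> (f (n - 1)) v\<bar>
      \<le> \<tau> * ((2 * \<nu> + C1 * (2 * B)) * h ^ (k + 1) * \<delta> n) * G.na v" if n: "n \<in> {2..M}" for n v
  proof -
    have n': "n \<in> {1..M}" using n by simp
    have "\<bar>mesh_stress \<nu> (f n) v - mesh_stress \<nu> (f (n - 1)) v\<bar>
        \<le> (2 * \<nu> * (\<tau> * \<delta> n) + C1 * (\<tau> * \<delta> n) * (A n + A (n - 1))) * h ^ (k + 1) * G.na v"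
      unfolding mesh_stress_diff[OF ch ch] G.na_def
      by (rule stress_le[OF incr[OF n'] incr[OF n'] sobolev_chain_add[OF ch ch] pos(1)])
    also have "\<dots> \<le> (2 * \<nu> * (\<tau> * \<delta> n) + C1 * (\<tau> * \<delta> n) * (2 * B)) * h ^ (k + 1) * G.na v"
      using C1 pos nonneg(2)[of n] bound(1)[of n] bound(1)[of "n - 1"] h_nonneg
      by (intro mult_right_mono add_left_mono mult_left_mono) auto
    also have "\<dots> = \<tau> * ((2 * \<nu> + C1 * (2 * B)) * h ^ (k + 1) * \<delta> n) * G.na v" by (simp add: algebra_simps)
    finally show ?thesis .
  qed
  show "G.na (?W n) \<le> B" if n: "n \<le> M" for n
  proof -
    have "G.na (?W n) \<le> sqrt ((A n)\<^sup>2)" unfolding G.na_def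
      using conv_Q_h(4)[OF ch] bd[OF n] by (intro real_sqrt_le_mono) simp
    then show ?thesis using A[of n] bound(1)[of n] by simp
  qed
  show "G.nm (?W n - ?W (n - 1)) \<le> \<tau> * B'" if n: "n \<in> {1..M}" for n
  proof -
    let ?d = "\<lambda>x. f n 0 x - f (n - 1) 0 x"
    have r: "restr N k (?W n) = ?W n" "restr N k (?W (n - 1)) = ?W (n - 1)" using n rW by auto
    have "G.nm (?W n - ?W (n - 1)) = nh (\<lambda>i. poly (P ?d i))"
      unfolding G.nm_def mass_def restr_lin r norm_h_def
      by (intro arg_cong[where f = sqrt] ih_fun_cong) (auto simp: Q_h_sel elt_proj_diff[OF X_less sqint_elt[OF sq] sqint_elt[OF sq]])
    also have "\<dots> \<le> \<tau> * \<delta> n"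
      using sobolev_chainD(3)[OF incr[OF n], of 0] pos nonneg(2)[of n] by (intro nh_P_le sqint_diff sq) auto
    also have "\<dots> \<le> \<tau> * B'" using bound(2)[OF n] pos by simp
    finally show ?thesis .
  qed
  show "0 \<le> a n + (1 + K) * h ^ (k + 1) * (A n)\<^sup>2" for n using nonneg(1)[of n] h_nonneg K_ge by simp
  show "0 \<le> (2 * \<nu> * A n + C1 * A n * A n) * h ^ (k + 1)" for n
    using A[of n] C1 pos h_nonneg K_ge by (intro mult_nonneg_nonneg add_nonneg_nonneg) auto
  show "0 \<le> (2 * \<nu> + C1 * (2 * B)) * h ^ (k + 1) * \<delta> n" for n
    using nonneg(2)[of n] C1 pos h_nonneg K_ge by (intro mult_nonneg_nonneg add_nonneg_nonneg) auto
qed (use pos init in auto)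

end

section \<open>The exact solution\<close>

lemma deriv_chain_scale:
  assumes "deriv_chain m a b f" shows "deriv_chain m a b (\<lambda>j x. c * f j x)"
  unfolding deriv_chain_def
proof (intro conjI allI impI ballI)
  fix j x assume "j < m" "x \<in> {a..b}"
  from deriv_chainD(1)[OF assms this] show "c * f j x = c * f j a + (LINT s|leb a x. c * f (Suc j) s)"
    by (simp add: distrib_left)
qed (use deriv_chainD(2)[OF assms] in \<open>auto intro: sqint_scale\<close>)

lemma deriv_chain_sub:
  assumes "deriv_chain m a b f" "deriv_chain m a b g" shows "deriv_chain m a b (\<lambda>j x. f j x - g j x)"
  using deriv_chain_add[OF assms(1) deriv_chain_scale[OF assms(2), of "-1"]] by simp

lemma sobolev_chainI:
  assumes f: "deriv_chain s 0 1 f" and w: "in_H s w" and eq: "\<And>j. j \<le> s \<Longrightarrow> AE x in leb 0 1. f j x = weak_deriv j w x"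
  shows "sobolev_chain s (H_norm s w) f"
  unfolding sobolev_chain_def
proof (intro conjI allI impI)
  fix j assume j: "j \<le> s"
  have "(LINT x|leb 0 1. (f j x)\<^sup>2) = (LINT x|leb 0 1. (weak_deriv j w x)\<^sup>2)"
    using eq[OF j] deriv_chainD(2)[OF f j] sqint_weak_deriv[OF w j]
    by (intro integral_cong_AE) (auto simp: sqint_def elim: eventually_mono)
  then show "(LINT x|leb 0 1. (f j x)\<^sup>2) \<le> (H_norm s w)\<^sup>2" using integral_weak_deriv_sq_le[OF j, of w] by simp
qed (use f in auto)

lemma sobolev_chain_mono:
  assumes "sobolev_chain m A f" "A \<le> B" shows "sobolev_chain m B f"
proof -
  have "A\<^sup>2 \<le> B\<^sup>2" using assms by (intro power_mono) (auto simp: sobolev_chain_def)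
  then show ?thesis using assms by (auto simp: sobolev_chain_def intro: order.trans)
qed

lemma deriv_chain_deriv_zero:
  assumes f: "deriv_chain m 0 1 f" "1 \<le> m" and z: "\<And>x. x \<in> {0..1} \<Longrightarrow> f 0 x = 0"
  shows "AE x in leb 0 1. f 1 x = 0"
proof (rule AE_eq_0_if_interval_integrals_eq_0)
  show "integrable (leb 0 1) (f 1)" using deriv_chainD(2)[OF f] by (rule sqint_integrable)
  show "(LINT s|leb x y. f 1 s) = 0" if "0 \<le> x" "x \<le> y" "y \<le> 1" for x y
    using deriv_chain_diff[OF f(1), of 0 x y] f(2) that z[of x] z[of y] by simp
qed

lemma AE_eq_0_if_integral_sq_eq_0:
  assumes "sqint a b f" "(LINT x|leb a b. (f x)\<^sup>2) = 0"
  shows "AE x in leb a b. f x = 0"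
proof -
  have "AE x in leb a b. (f x)\<^sup>2 = 0"
    using assms by (subst integral_nonneg_eq_0_iff_AE[symmetric]) (auto simp: sqint_def)
  then show ?thesis by simp
qed

locale burgers =
  fixes s :: nat and \<nu> T :: real and g :: "real \<Rightarrow> real" and u ut utt :: "real \<Rightarrow> real \<Rightarrow> real"
  assumes s: "2 \<le> s" and \<nu>_pos: "0 < \<nu>" and T_pos: "0 < T"
    and d1: "is_time_deriv T s u ut" and d2: "is_time_deriv T s ut utt"
    and c1: "H_continuous T s u" and c2: "H_continuous T s ut"
    and cont_u: "\<And>t. t \<in> {0..T} \<Longrightarrow> continuous_on {0..1} (u t)" and cont_g: "continuous_on {0..1} g"
    and sol: "burgers_solution \<nu> T g u ut"
begin

lemma u_H: "t \<in> {0..T} \<Longrightarrow> in_H s (u t)" and ut_H: "t \<in> {0..T} \<Longrightarrow> in_H s (ut t)"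
  using c1 c2 by (auto simp: H_continuous_def)

definition F :: "real \<Rightarrow> nat \<Rightarrow> real \<Rightarrow> real" where
  "F t = (SOME f. deriv_chain s 0 1 f \<and> f 0 = u t \<and> (\<forall>j\<le>s. AE x in leb 0 1. f j x = weak_deriv j (u t) x))"

lemma F:
  assumes t: "t \<in> {0..T}"
  shows "deriv_chain s 0 1 (F t)" "F t 0 = u t" "j \<le> s \<Longrightarrow> AE x in leb 0 1. F t j x = weak_deriv j (u t) x"
proof -
  obtain f where "deriv_chain s 0 1 f" "f 0 = u t" "\<And>j. j \<le> s \<Longrightarrow> AE x in leb 0 1. f j x = weak_deriv j (u t) x"
    by (rule in_H_deriv_chain[OF u_H[OF t] cont_u[OF t]]) (use s in auto)
  then have "\<exists>f. deriv_chain s 0 1 f \<and> f 0 = u t \<and> (\<forall>j\<le>s. AE x in leb 0 1. f j x = weak_deriv j (u t) x)" by blast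
  note * = someI_ex[OF this, folded F_def]
  show "deriv_chain s 0 1 (F t)" "F t 0 = u t" "j \<le> s \<Longrightarrow> AE x in leb 0 1. F t j x = weak_deriv j (u t) x"
    using * by blast+
qed

lemma F_sobolev: "t \<in> {0..T} \<Longrightarrow> sobolev_chain s (H_norm s (u t)) (F t)"
  by (rule sobolev_chainI[OF F(1) u_H F(3)])

lemma F_diff_sobolev:
  assumes t: "t \<in> {0..T}" "t' \<in> {0..T}"
  shows "sobolev_chain s (H_norm s (\<lambda>x. u t x - u t' x)) (\<lambda>j x. F t j x - F t' j x)"
proof (rule sobolev_chainI[OF deriv_chain_sub[OF F(1)[OF t(1)] F(1)[OF t(2)]] in_H_diff[OF u_H[OF t(1)] u_H[OF t(2)]]])
  fix j assume j: "j \<le> s"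
  have "AE x in leb 0 1. weak_deriv j (\<lambda>x. u t x - u t' x) x = weak_deriv j (u t) x - weak_deriv j (u t') x"
    using weak_deriv_lin_AE[OF u_H[OF t(1)] u_H[OF t(2)] j, of 1 "-1"] by simp
  then show "AE x in leb 0 1. F t j x - F t' j x = weak_deriv j (\<lambda>x. u t x - u t' x) x"
    using F(3)[OF t(1) j] F(3)[OF t(2) j] by eventually_elim simp
qed

lemma pde:
  assumes t: "t \<in> {0<..T}"
  shows "AE x in leb 0 1. ut t x + F t 0 x * F t 1 x - \<nu> * F t 2 x = 0"
proof -
  have t': "t \<in> {0..T}" using t by simp
  have "AE x in leb 0 1. ut t x + u t x * weak_deriv 1 (u t) x - \<nu> * weak_deriv 2 (u t) x = 0"
    using sol t by (simp add: burgers_solution_def)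
  then show ?thesis using F(3)[OF t', of 1] F(3)[OF t', of 2] s unfolding F(2)[OF t'] by (auto elim: eventually_elim2)
qed

lemma boundary: "t \<in> {0<..T} \<Longrightarrow> u t 0 = 0" "t \<in> {0<..T} \<Longrightarrow> u t 1 = 0"
  using sol by (auto simp: burgers_solution_def)

text \<open>The initial condition is given on the open interval. The nodal values of
  \<open>Q_h\<close> also need the endpoints, which continuity supplies.\<close>

lemma initial: "x \<in> {0..1} \<Longrightarrow> g x = u 0 x"
proof (rule continuous_AE_eq[OF cont_g cont_u zero_less_one])
  show "AE x in leb 0 1. g x = u 0 x" using sol by (intro AE_I2) (simp add: burgers_solution_def)
qed (use T_pos in auto)

text \<open>The equation is multiplied by \<open>u\<close> and integrated: convection is the
  derivative of \<open>u^3 / 3\<close> and vanishes by the boundary values, and the viscous term is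
  integrated by parts.\<close>

lemma energy:
  assumes t: "t \<in> {0<..T}"
  shows "(LINT x|leb 0 1. ut t x * u t x) + \<nu> * (LINT x|leb 0 1. (F t 1 x)\<^sup>2) = 0"
proof -
  have t': "t \<in> {0..T}" using t by simp
  note ch = F_sobolev[OF t']
  let ?f = "F t"
  have bd: "?f 0 0 = 0" "?f 0 1 = 0" using boundary[OF t] F(2)[OF t'] by auto
  have c: "continuous_on {0..1} (?f 0)" "continuous_on {0..1} (?f 1)" using sobolev_chainD(5)[OF ch] s by auto
  have sq: "sqint 0 1 (?f 0)" "sqint 0 1 (?f 1)" "sqint 0 1 (?f 2)" using sobolev_chainD(4)[OF ch] s by auto
  have sut: "sqint 0 1 (ut t)" by (rule sqint_in_H[OF ut_H[OF t']])
  have d: "(?f 0 has_real_derivative ?f 1 x) (at x within {0..1})" if "x \<in> {0..1}" for x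
    using deriv_chain_has_derivative[OF F(1)[OF t'], of 0 x] s that by simp
  have "(LINT x|leb 0 1. ?f 1 x * ?f 1 x) + (LINT x|leb 0 1. ?f 2 x * ?f 0 x) = ?f 1 1 * ?f 0 1 - ?f 1 0 * ?f 0 0"
  proof (rule integral_by_parts_AC[OF _ _ d])
    show "?f 1 x = ?f 1 0 + (LINT s|leb 0 x. ?f 2 s)" if "x \<in> {0..1}" for x
      using deriv_chainD(1)[OF F(1)[OF t'] _ that, of 1] s by (simp add: numeral_2_eq_2)
  qed (use sq c sqint_integrable in auto)
  then have 1: "(LINT x|leb 0 1. ?f 2 x * ?f 0 x) = - (LINT x|leb 0 1. (?f 1 x)\<^sup>2)" using bd by (simp add: power2_eq_square)
  have 2: "(LINT x|leb 0 1. (?f 0 x)\<^sup>2 * ?f 1 x) = (?f 0 1) ^ 3 / 3 - (?f 0 0) ^ 3 / 3"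
  proof (rule integral_leb_FTC)
    fix x :: real assume "x \<in> {0..1}"
    from DERIV_power[OF d[OF this], of 3]
    have "((\<lambda>x. (?f 0 x) ^ 3 / 3) has_real_derivative (of_nat 3 * (?f 1 x * (?f 0 x) ^ (3 - Suc 0))) / 3) (at x within {0..1})"
      by (rule DERIV_cdivide)
    then show "((\<lambda>x. (?f 0 x) ^ 3 / 3) has_real_derivative (?f 0 x)\<^sup>2 * ?f 1 x) (at x within {0..1})" by (simp add: mult.commute)
  qed (use c in \<open>auto intro!: integrable_leb_continuous continuous_intros\<close>)
  have i: "integrable (leb 0 1) (\<lambda>x. ut t x * ?f 0 x)" "integrable (leb 0 1) (\<lambda>x. ?f 2 x * ?f 0 x)"
    by (intro sqint_integrable_mult sut sq)+
  have i': "integrable (leb 0 1) (\<lambda>x. (?f 0 x)\<^sup>2 * ?f 1 x)" by (intro integrable_leb_continuous continuous_intros c)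
  have "(LINT x|leb 0 1. (ut t x * ?f 0 x + (?f 0 x)\<^sup>2 * ?f 1 x) - \<nu> * (?f 2 x * ?f 0 x)) = (LINT x|leb 0 1. 0)"
  proof (rule integral_cong_AE)
    show "AE x in leb 0 1. (ut t x * ?f 0 x + (?f 0 x)\<^sup>2 * ?f 1 x) - \<nu> * (?f 2 x * ?f 0 x) = 0"
      using pde[OF t]
    proof eventually_elim
      case (elim x)
      have "(ut t x * ?f 0 x + (?f 0 x)\<^sup>2 * ?f 1 x) - \<nu> * (?f 2 x * ?f 0 x)
          = (ut t x + ?f 0 x * ?f 1 x - \<nu> * ?f 2 x) * ?f 0 x" by (simp add: power2_eq_square algebra_simps)
      then show ?case using elim by simp
    qed
  qed (use i i' in \<open>auto intro!: borel_measurable_diff borel_measurable_add borel_measurable_times\<close>)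
  then have "(LINT x|leb 0 1. ut t x * ?f 0 x) + (LINT x|leb 0 1. (?f 0 x)\<^sup>2 * ?f 1 x) - \<nu> * (LINT x|leb 0 1. ?f 2 x * ?f 0 x) = 0"
    using i i' by simp
  then show ?thesis using 1 2 bd F(2)[OF t'] by simp
qed

lemma utt_sqint: "sqint 0 T (\<lambda>t. H_norm s (utt t))"
  using d2 by (intro L2_time_H_norm) (simp add: is_time_deriv_def)

lemma utt_integral_sq_le:
  assumes "0 \<le> p" "p \<le> q" "q \<le> T"
  shows "(LINT t|leb p q. H_norm s (utt t))\<^sup>2 \<le> (q - p) * (LINT t|leb p q. (H_norm s (utt t))\<^sup>2)"
  using integral_abs_square_le[OF sqint_subinterval[OF utt_sqint assms(1,3)] assms(2)] by simp

lemma taylor: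
  assumes "0 \<le> p" "p \<le> q" "q \<le> T" "r \<in> {p..q}"
  shows "H_norm s (\<lambda>x. (u q x - u p x) - (q - p) * ut r x) \<le> (q - p) * (LINT t|leb p q. H_norm s (utt t))"
  by (rule time_taylor_le[OF d1 d2 c1 c2 assms(1-3) T_pos assms(4)])

text \<open>
  If \<open>u\<close> is affine in time, the energy identity is a polynomial identity in time; its second
  difference isolates the viscous term of the slope, which therefore vanishes.
\<close>

lemma zero_if_utt_zero:
  assumes b: "0 < b" "b \<le> T" and z: "(LINT t|leb 0 b. (H_norm s (utt t))\<^sup>2) = 0"
    and t: "t \<in> {0..b}" and x: "x \<in> {0..1}"
  shows "u t x = 0"
proof -
  have J0: "(LINT t|leb 0 b. H_norm s (utt t)) = 0" using utt_integral_sq_le[of 0 b] b z by simp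
  \<comment> \<open>The Taylor remainder is zero, so every \<open>ut r\<close> in between is the
    exact slope.\<close>
  have aff: "AE x in leb 0 1. u q x - u p x = (q - p) * ut r x" if pq: "0 \<le> p" "p \<le> q" "q \<le> b" "r \<in> {p..q}" for p q r
  proof -
    have i: "integrable (leb 0 b) (\<lambda>t. H_norm s (utt t))" "integrable (leb p b) (\<lambda>t. H_norm s (utt t))"
      using sqint_integrable[OF utt_sqint] b pq by (auto elim!: integrable_leb_subinterval)
    have "(LINT t|leb p q. H_norm s (utt t)) \<le> (LINT t|leb 0 p. H_norm s (utt t))
        + ((LINT t|leb p q. H_norm s (utt t)) + (LINT t|leb q b. H_norm s (utt t)))" by simp
    also have "\<dots> = 0" using integral_leb_combine[OF i(1), of p] integral_leb_combine[OF i(2), of q] pq J0 by simp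
    finally have "(LINT t|leb p q. H_norm s (utt t)) = 0" by (intro antisym) simp_all
    then have N0: "H_norm s (\<lambda>x. (u q x - u p x) - (q - p) * ut r x) = 0"
      using taylor[of p q r] pq b H_norm_nonneg[of s "\<lambda>x. (u q x - u p x) - (q - p) * ut r x"] by simp
    have H: "in_H s (\<lambda>x. (u q x - u p x) - (q - p) * ut r x)"
      using pq b by (intro in_H_diff in_H_scale u_H ut_H) auto
    have "(LINT x|leb 0 1. ((u q x - u p x) - (q - p) * ut r x)\<^sup>2) = 0"
      using integral_sq_le_H_norm[OF H] N0 by (intro antisym) simp_all
    from AE_eq_0_if_integral_sq_eq_0[OF sqint_in_H[OF H] this] show ?thesis by eventually_elim simp
  qed
  \<comment> \<open>Three equidistant times \<open>p\<close>, \<open>q\<close>, \<open>b\<close>,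
    all positive because the equation is available only for positive times.\<close>
  define p q where "p = b / 3" and "q = 2 * b / 3"
  have pq: "0 < p" "p < q" "q < b" "q - p = b / 3" "b - q = b / 3" "b - p = q" using b by (auto simp: p_def q_def)
  have mem: "p \<in> {0..T}" "q \<in> {0..T}" "b \<in> {0..T}" "p \<in> {0<..T}" "q \<in> {0<..T}" "b \<in> {0<..T}" using pq b by auto
  have sqF: "sqint 0 1 (F t 0)" "sqint 0 1 (F t 1)" "continuous_on {0..1} (F t 0)" if "t \<in> {0..T}" for t
    using sobolev_chainD(4,5)[OF F_sobolev[OF that]] s by auto
  let ?w = "ut q"
  have sw: "sqint 0 1 ?w" by (rule sqint_in_H[OF ut_H[OF mem(2)]])
  have ut_eq: "AE x in leb 0 1. ut r x = ?w x" if "r \<in> {p..b}" for r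
    using aff[of p b r] aff[of p b q] that pq by (auto elim: eventually_elim2)
  \<comment> \<open>Second time difference of the whole chain. It vanishes at level 0 since
    \<open>u\<close> is affine in time, hence at level 1 almost everywhere.\<close>
  define y where "y j x = (F b j x - F q j x) - (F q j x - F p j x)" for j x
  have ych: "deriv_chain s 0 1 y" unfolding y_def by (intro deriv_chain_sub F(1) mem)
  have y0: "y 0 x = 0" if "x \<in> {0..1}" for x
  proof -
    have "AE x in leb 0 1. F b 0 x - F q 0 x = F q 0 x - F p 0 x"
      using aff[of q b q] aff[of p q q] pq unfolding F(2)[OF mem(1)] F(2)[OF mem(2)] F(2)[OF mem(3)]
      by (auto elim: eventually_elim2)
    then have "F b 0 x - F q 0 x = F q 0 x - F p 0 x"
      by (rule continuous_AE_eq[OF continuous_on_diff continuous_on_diff zero_less_one _ that, rotated 4]) (intro sqF mem)+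
    then show ?thesis by (simp add: y_def)
  qed
  have y1: "AE x in leb 0 1. y 1 x = 0" by (rule deriv_chain_deriv_zero[OF ych _ y0]) (use s in auto)
  define e where "e t = (LINT x|leb 0 1. (F t 1 x)\<^sup>2)" for t
  have en: "(LINT x|leb 0 1. ?w x * F r 0 x) + \<nu> * e r = 0" if "r \<in> {p..b}" for r
  proof -
    have r: "r \<in> {0<..T}" "r \<in> {0..T}" using that pq b by auto
    have "(LINT x|leb 0 1. ?w x * F r 0 x) = (LINT x|leb 0 1. ut r x * F r 0 x)"
    proof (rule integral_cong_AE)
      show "(\<lambda>x. ?w x * F r 0 x) \<in> borel_measurable (leb 0 1)" "(\<lambda>x. ut r x * F r 0 x) \<in> borel_measurable (leb 0 1)"
        using sqint_integrable_mult[OF sw sqF(1)[OF r(2)]] sqint_integrable_mult[OF sqint_in_H[OF ut_H[OF r(2)]] sqF(1)[OF r(2)]] by auto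
      show "AE x in leb 0 1. ?w x * F r 0 x = ut r x * F r 0 x" using ut_eq[OF that] by eventually_elim simp
    qed
    then show ?thesis using energy[OF r(1)] by (simp add: F(2)[OF r(2)] e_def)
  qed
  \<comment> \<open>With a slope \<open>?w\<close> that is constant in time, the first term of the
    energy identity is linear in \<open>F\<close> and drops out of the second difference.\<close>
  have "(LINT x|leb 0 1. ?w x * F b 0 x) - 2 * (LINT x|leb 0 1. ?w x * F q 0 x) + (LINT x|leb 0 1. ?w x * F p 0 x)
      = (LINT x|leb 0 1. ?w x * F b 0 x - 2 * (?w x * F q 0 x) + ?w x * F p 0 x)"
    using sqint_integrable_mult[OF sw sqF(1)] mem by simp
  also have "\<dots> = (LINT x|leb 0 1. ?w x * y 0 x)" by (simp add: y_def algebra_simps)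
  also have "\<dots> = (LINT x|leb 0 1. 0)" by (rule Bochner_Integration.integral_cong) (auto simp: y0)
  finally have "\<nu> * (e b - 2 * e q + e p) = 0" using en[of b] en[of q] en[of p] pq by (simp add: algebra_simps)
  then have e2: "e b - 2 * e q + e p = 0" using \<nu>_pos by simp
  \<comment> \<open>Parallelogram identity: \<open>F q 1\<close> is the mean of \<open>F b 1\<close>
    and \<open>F p 1\<close>, so the second difference of \<open>e\<close> is half the squared L2
    distance of these two.\<close>
  have "2 * e q = (LINT x|leb 0 1. (F b 1 x + F p 1 x)\<^sup>2 / 2)"
  proof -
    have "2 * e q = (LINT x|leb 0 1. 2 * (F q 1 x)\<^sup>2)" by (simp add: e_def)
    also have "\<dots> = (LINT x|leb 0 1. (F b 1 x + F p 1 x)\<^sup>2 / 2)"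
    proof (rule integral_cong_AE)
      show "(\<lambda>x. 2 * (F q 1 x)\<^sup>2) \<in> borel_measurable (leb 0 1)" "(\<lambda>x. (F b 1 x + F p 1 x)\<^sup>2 / 2) \<in> borel_measurable (leb 0 1)"
        using sqF(2)[OF mem(1)] sqF(2)[OF mem(2)] sqF(2)[OF mem(3)] unfolding sqint_def
        by (auto intro!: borel_measurable_times borel_measurable_power borel_measurable_divide borel_measurable_add)
      show "AE x in leb 0 1. 2 * (F q 1 x)\<^sup>2 = (F b 1 x + F p 1 x)\<^sup>2 / 2"
        using y1
      proof eventually_elim
        case (elim x)
        then have "F b 1 x + F p 1 x = 2 * F q 1 x" by (simp add: y_def)
        then show ?case by (simp add: power2_eq_square)
      qed
    qed
    finally show ?thesis .
  qed
  moreover have sqs: "sqint 0 1 (\<lambda>x. F b 1 x + F p 1 x)" "sqint 0 1 (\<lambda>x. F b 1 x - F p 1 x)"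
    using sqF mem by (auto intro: sqint_add sqint_diff)
  moreover have "(LINT x|leb 0 1. (F b 1 x - F p 1 x)\<^sup>2) = (LINT x|leb 0 1. 2 * (F b 1 x)\<^sup>2 + 2 * (F p 1 x)\<^sup>2 - (F b 1 x + F p 1 x)\<^sup>2)"
    by (simp add: power2_eq_square algebra_simps)
  moreover have "\<dots> = 2 * e b + 2 * e p - (LINT x|leb 0 1. (F b 1 x + F p 1 x)\<^sup>2)"
    using sqF(2)[OF mem(1)] sqF(2)[OF mem(3)] sqs(1) by (simp add: e_def sqint_def)
  ultimately have "(LINT x|leb 0 1. (F b 1 x - F p 1 x)\<^sup>2) = 0" using e2 by simp
  from AE_eq_0_if_integral_sq_eq_0[OF sqs(2) this] have bp1: "AE x in leb 0 1. F b 1 x - F p 1 x = 0" .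
  have bp0: "F b 0 x = F p 0 x" if x: "x \<in> {0..1}" for x
  proof -
    have "(LINT s|leb 0 x. F b 1 s - F p 1 s) = (LINT s|leb 0 x. 0)"
      using AE_leb_subinterval[OF bp1, of 0 x] sqint_subinterval[OF sqs(2), of 0 x] x
      by (intro integral_cong_AE) (auto simp: sqint_def)
    then show ?thesis
      using deriv_chainD(1)[OF deriv_chain_sub[OF F(1)[OF mem(3)] F(1)[OF mem(1)]], of 0 x] s x
        boundary(1)[OF mem(6)] boundary(1)[OF mem(4)] F(2) mem by simp
  qed
  \<comment> \<open>Equal values at two distinct times force the slope to vanish; the energy
    identity at \<open>b\<close> then leaves only the viscous term.\<close>
  have w0: "AE x in leb 0 1. ?w x = 0"
  proof -
    have "AE x in leb 0 1. F b 0 x = F p 0 x" by (rule AE_I2) (simp add: bp0)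
    then show ?thesis using aff[of p b q] pq mem by (auto simp: F(2) elim: eventually_elim2)
  qed
  have "(LINT x|leb 0 1. ?w x * F b 0 x) = (LINT x|leb 0 1. 0)"
    using w0 sqint_integrable_mult[OF sw sqF(1)[OF mem(3)]] by (intro integral_cong_AE) (auto elim: eventually_mono)
  then have "e b = 0" using en[of b] pq \<nu>_pos by simp
  then have b1: "AE x in leb 0 1. F b 1 x = 0" unfolding e_def by (rule AE_eq_0_if_integral_sq_eq_0[OF sqF(2)[OF mem(3)]])
  have b0: "u b x = 0" if x: "x \<in> {0..1}" for x
  proof -
    have "(LINT s|leb 0 x. F b 1 s) = (LINT s|leb 0 x. 0)"
      using AE_leb_subinterval[OF b1, of 0 x] sqint_subinterval[OF sqF(2)[OF mem(3)], of 0 x] x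
      by (intro integral_cong_AE) (auto simp: sqint_def)
    then show ?thesis
      using deriv_chainD(1)[OF F(1)[OF mem(3)], of 0 x] s x boundary(1)[OF mem(6)] F(2)[OF mem(3)] by simp
  qed
  \<comment> \<open>Back from \<open>b\<close> to every \<open>t\<close>, including the initial
    time, along the affine dependence with slope zero.\<close>
  show ?thesis
  proof (rule continuous_AE_eq[OF cont_u continuous_on_const zero_less_one _ x])
    have "AE x in leb 0 1. u b x = 0" by (rule AE_I2) (simp add: b0)
    moreover have "AE x in leb 0 1. ut b x = 0" using ut_eq[of b] w0 pq by (auto elim: eventually_elim2)
    moreover have "AE x in leb 0 1. u b x - u t x = (b - t) * ut b x" using aff[of t b b] t by simp
    ultimately show "AE x in leb 0 1. u t x = 0" by eventually_elim simp
  qed (use t b in auto)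
qed

end

section \<open>Error of the scheme\<close>

lemma (in mesh) nh_AE_cong:
  assumes "bsq f" "bsq g" "\<And>i. i \<in> {1..<N} \<Longrightarrow> AE y in E i. f i y = g i y"
  shows "nh f = nh g"
proof -
  have "ih f f = ih g f" by (rule ih_AE_cong[OF assms(1,2,1,3)])
  also have "\<dots> = ih f g" by (rule ih_commute)
  also have "\<dots> = ih g g" by (rule ih_AE_cong[OF assms(1,2,2,3)])
  finally show ?thesis by (simp add: norm_h_def)
qed

lemma (in mesh) nh_diff_sq_le:
  assumes "bsq f" "bsq g" "bsq e"
  shows "(nh (\<lambda>i x. f i x - e i x))\<^sup>2 \<le> 2 * (nh (\<lambda>i x. f i x - g i x))\<^sup>2 + 2 * (nh (\<lambda>i x. g i x - e i x))\<^sup>2"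
proof -
  let ?a = "nh (\<lambda>i x. f i x - g i x)" and ?b = "nh (\<lambda>i x. g i x - e i x)"
  have "(nh (\<lambda>i x. f i x - e i x))\<^sup>2 \<le> (?a + ?b)\<^sup>2"
    by (intro power_mono nh_triangle_diff assms) simp
  also have "\<dots> \<le> 2 * ?a\<^sup>2 + 2 * ?b\<^sup>2"
    using zero_le_power2[of "?a - ?b"] unfolding power2_sum power2_diff by linarith
  finally show ?thesis .
qed

locale burgers_scheme = burgers "k + 2" \<nu> T g u ut utt + mesh X N k K
  for k :: nat and \<nu> T g u ut utt X N K +
  fixes M :: nat and U :: "nat \<Rightarrow> weak_fun" and B B1 :: real
  assumes M: "1 \<le> M" and scheme: "wg_solution \<nu> g k (Suc k) X N (T / real M) M U"
    and B_pos: "0 < B" and B: "\<And>t. t \<in> {0..T} \<Longrightarrow> H_norm (k + 2) (u t) \<le> B"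
    and B1_pos: "0 < B1" and B1: "\<And>t. t \<in> {0..T} \<Longrightarrow> H_norm (k + 2) (ut t) \<le> B1"
begin

declare add_2_eq_Suc [simp del] add_2_eq_Suc' [simp del]

definition \<tau> :: real where "\<tau> = T / real M"
abbreviation "Jtot \<equiv> LINT t|leb 0 T. H_norm (k + 2) (utt t)"

text \<open>Time levels beyond the last one are clipped, so that sequences indexed by all naturals stay meaningful.\<close>

definition tm :: "nat \<Rightarrow> real" where "tm n = real (min n M) * \<tau>"
definition J :: "nat \<Rightarrow> real" where "J n = (LINT t|leb (tm (n - 1)) (tm n). H_norm (k + 2) (utt t))"
definition J2 :: "nat \<Rightarrow> real" where "J2 n = (LINT t|leb (tm (n - 1)) (tm n). (H_norm (k + 2) (utt t))\<^sup>2)"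
definition A :: "nat \<Rightarrow> real" where "A n = H_norm (k + 2) (u (tm n))"
definition At :: "nat \<Rightarrow> real" where "At n = H_norm (k + 2) (ut (tm n))"
abbreviation "W n \<equiv> Q_h X N k (u (tm n))"

lemma \<tau>_pos: "0 < \<tau>" and \<tau>_M: "\<tau> * real M = T" using T_pos M by (auto simp: \<tau>_def)

lemma scheme': "wg_solution \<nu> g k (Suc k) X N \<tau> M U" using scheme by (simp add: \<tau>_def)

lemma U_mem: "n \<le> M \<Longrightarrow> U n \<in> S_h0 N k"
  using scheme unfolding wg_solution_def by blast

lemma tm_range: "tm n \<in> {0..T}"
proof -
  have "real (min n M) * \<tau> \<le> real M * \<tau>" using \<tau>_pos by (intro mult_right_mono) auto
  then show ?thesis using \<tau>_pos \<tau>_M by (simp add: tm_def mult.commute[of _ \<tau>])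
qed

lemma tm_0 [simp]: "tm 0 = 0" by (simp add: tm_def)

lemma tm_step: "n \<in> {1..M} \<Longrightarrow> tm n = tm (n - 1) + \<tau>"
  by (auto simp: tm_def min_def of_nat_diff algebra_simps)

lemma tm_pos: "n \<in> {1..M} \<Longrightarrow> tm n \<in> {0<..T}"
  using tm_range[of n] \<tau>_pos by (auto simp: tm_def min_def)

lemma utt_int: "integrable (leb a b) (\<lambda>t. H_norm (k + 2) (utt t))" "integrable (leb a b) (\<lambda>t. (H_norm (k + 2) (utt t))\<^sup>2)"
  if "0 \<le> a" "b \<le> T" for a b
  using sqint_subinterval[OF utt_sqint that] by (auto intro: sqint_integrable simp: sqint_def)

lemma J_nonneg [simp]: "0 \<le> J n" and J2_nonneg [simp]: "0 \<le> J2 n"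
  by (simp_all add: J_def J2_def)

text \<open>Cauchy-Schwarz on one time step. The factor \<open>\<tau>\<close> gained here makes
  \<open>\<tau>\<close> times the sum of the squares of order \<open>\<tau>^2\<close>.\<close>

lemma J_sq_le: "n \<in> {1..M} \<Longrightarrow> (J n)\<^sup>2 \<le> \<tau> * J2 n"
  using utt_integral_sq_le[of "tm (n - 1)" "tm n"] tm_range[of n] tm_range[of "n - 1"] tm_step[of n] \<tau>_pos
  by (simp add: J_def J2_def)

lemma J_le_total: "n \<in> {1..M} \<Longrightarrow> J n \<le> Jtot"
proof -
  assume n: "n \<in> {1..M}"
  have r: "0 \<le> tm (n - 1)" "tm (n - 1) \<le> tm n" "tm n \<le> T" "tm (n - 1) \<le> T"
    using tm_range[of n] tm_range[of "n - 1"] tm_step[OF n] \<tau>_pos by auto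
  have "J n \<le> (LINT t|leb 0 (tm (n - 1)). H_norm (k + 2) (utt t)) + (J n + (LINT t|leb (tm n) T. H_norm (k + 2) (utt t)))"
    by simp
  also have "\<dots> = Jtot"
    using integral_leb_combine[OF utt_int(1)[OF r(1) order_refl] r(2,3)] integral_leb_combine[OF utt_int(1)[OF order_refl order_refl] r(1,4)]
    by (simp add: J_def)
  finally show ?thesis .
qed

lemma sum_J2: "n \<le> M \<Longrightarrow> (\<Sum>j=1..n. J2 j) = (LINT t|leb 0 (tm n). (H_norm (k + 2) (utt t))\<^sup>2)"
proof (induction n)
  case (Suc n)
  have "Suc n \<in> {1..M}" using Suc.prems by simp
  then have "tm n \<le> tm (Suc n)" using tm_step[of "Suc n"] \<tau>_pos by simp
  then have "(LINT t|leb 0 (tm n). (H_norm (k + 2) (utt t))\<^sup>2) + J2 (Suc n) = (LINT t|leb 0 (tm (Suc n)). (H_norm (k + 2) (utt t))\<^sup>2)"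
    using integral_leb_combine[OF utt_int(2)[of 0 "tm (Suc n)"], of "tm n"] tm_range[of n] tm_range[of "Suc n"] by (simp add: J2_def)
  then show ?case using Suc by simp
qed simp

lemma A_nonneg [simp]: "0 \<le> A n" and At_nonneg [simp]: "0 \<le> At n" and A_le: "A n \<le> B" and At_le: "At n \<le> B1"
  using B[OF tm_range] B1[OF tm_range] by (simp_all add: A_def At_def)

lemma F_tm: "F (tm n) 0 = u (tm n)" "sobolev_chain (k + 2) (A n) (F (tm n))"
  using F(2)[OF tm_range] F_sobolev[OF tm_range] by (simp_all add: A_def)

lemma U_0: "U 0 = W 0"
proof -
  have sq: "sqint 0 1 g" "sqint 0 1 (u 0)" using cont_g cont_u T_pos by (auto intro: sqint_continuous)
  have "L2_proj X k g i = L2_proj X k (u 0) i" if i: "i \<in> {1..<N}" for i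
    unfolding L2_proj_eq by (rule elt_proj_cong[OF X_less[OF i] sqint_elt[OF sq(1) i] sqint_elt[OF sq(2) i]])
      (use X_sub[OF i] initial in auto)
  then have "Q_h X N k g = W 0" using X_range initial by (auto simp: Q_h_def fun_eq_iff)
  then show ?thesis using scheme unfolding wg_solution_def by simp
qed

text \<open>The boundary conditions of the problem hold for positive times. At time 0 the values
  come from the discrete side: \<open>U 0\<close> is the projection of \<open>u 0\<close> and
  belongs to \<open>S_h0\<close>.\<close>

lemma boundary_tm: "n \<le> M \<Longrightarrow> u (tm n) 0 = 0 \<and> u (tm n) 1 = 0"
proof (cases "n = 0")
  case True
  have "U 0 \<in> S_h0 N k" by (rule U_mem) simp
  then have "node_val (W 0) 1 = 0" "node_val (W 0) N = 0" unfolding U_0 by (auto dest: S_h0D)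
  then show ?thesis using True N_ge by (simp add: Q_h_def)
next
  case False
  assume "n \<le> M"
  then show ?thesis using tm_pos[of n] boundary False by simp
qed

lemma rate_le:
  assumes n: "n \<in> {1..M}"
  shows "H_norm (k + 2) (\<lambda>x. (u (tm n) x - u (tm (n - 1)) x) - \<tau> * ut (tm n) x) \<le> \<tau> * J n"
  using taylor[of "tm (n - 1)" "tm n" "tm n"] tm_range[of n] tm_range[of "n - 1"] tm_step[OF n] \<tau>_pos
  by (simp add: J_def)

lemma rate_in_H: "in_H (k + 2) (\<lambda>x. (u (tm n) x - u (tm (n - 1)) x) - \<tau> * ut (tm n) x)"
  by (intro in_H_diff in_H_scale u_H ut_H tm_range)

lemma increment_le:
  assumes n: "n \<in> {1..M}"
  shows "H_norm (k + 2) (\<lambda>x. u (tm n) x - u (tm (n - 1)) x) \<le> \<tau> * (J n + At n)"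
proof -
  have "H_norm (k + 2) (\<lambda>x. 1 * ((u (tm n) x - u (tm (n - 1)) x) - \<tau> * ut (tm n) x) + \<tau> * ut (tm n) x)
      \<le> \<bar>1\<bar> * H_norm (k + 2) (\<lambda>x. (u (tm n) x - u (tm (n - 1)) x) - \<tau> * ut (tm n) x) + \<bar>\<tau>\<bar> * H_norm (k + 2) (ut (tm n))"
    by (rule H_norm_lin_le[OF rate_in_H ut_H[OF tm_range]])
  also have "\<dots> \<le> \<tau> * J n + \<tau> * At n" using rate_le[OF n] \<tau>_pos by (simp add: At_def)
  finally show ?thesis by (simp add: distrib_left)
qed

abbreviation "C2 \<equiv> 2 * \<nu> + C1 * (2 * B)"

lemma C1_pos: "0 < C1" using K_ge by (intro add_pos_pos) auto

lemma C2_pos: "0 < C2"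
proof (rule add_pos_pos)
  show "0 < C1 * (2 * B)" by (rule mult_pos_pos[OF C1_pos]) (use B_pos in simp)
qed (use \<nu>_pos in simp)

abbreviation "\<alpha> n \<equiv> J n + (1 + K) * h ^ (k + 1) * (A n)\<^sup>2"
abbreviation "\<sigma> n \<equiv> (2 * \<nu> * A n + C1 * A n * A n) * h ^ (k + 1)"
abbreviation "\<sigma>' n \<equiv> C2 * h ^ (k + 1) * (J n + At n)"

lemma galerkin_burgers:
  "galerkin_scheme mass stiff conv K K \<nu> \<tau> B (B1 + Jtot) M U W
    (\<lambda>n. mesh_load (F (tm n)) (\<lambda>x. (F (tm n) 0 x - F (tm (n - 1)) 0 x) / \<tau> - ut (tm n) x))
    (\<lambda>n. mesh_stress \<nu> (F (tm n))) \<alpha> \<sigma> \<sigma>'"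
proof -
  have "galerkin_scheme mass stiff conv K K \<nu> \<tau> B (B1 + Jtot) M U (\<lambda>n. Q_h X N k (F (tm n) 0))
    (\<lambda>n. mesh_load (F (tm n)) (\<lambda>x. (F (tm n) 0 x - F (tm (n - 1)) 0 x) / \<tau> - ut (tm n) x))
    (\<lambda>n. mesh_stress \<nu> (F (tm n))) \<alpha> \<sigma> \<sigma>'"
  proof (rule galerkin_scheme_mesh[OF scheme' \<nu>_pos \<tau>_pos B_pos _ F_tm(2)])
    have "0 \<le> Jtot" by simp
    then show "0 < B1 + Jtot" using B1_pos by linarith
    show "F (tm n) 0 0 = 0 \<and> F (tm n) 0 1 = 0" if "n \<le> M" for n using boundary_tm[OF that] by (simp add: F_tm)
    show "U 0 = Q_h X N k (F (tm 0) 0)" using U_0 F_tm(1)[of 0] by simp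
    show "sqint 0 1 (ut (tm n))" for n by (rule sqint_in_H[OF ut_H[OF tm_range]])
    show "AE x in leb 0 1. ut (tm n) x + F (tm n) 0 x * F (tm n) 1 x - \<nu> * F (tm n) 2 x = 0" if "n \<in> {1..M}" for n
      by (rule pde[OF tm_pos[OF that]])
    show "(LINT x|leb 0 1. ((F (tm n) 0 x - F (tm (n - 1)) 0 x) / \<tau> - ut (tm n) x)\<^sup>2) \<le> (J n)\<^sup>2" if n: "n \<in> {1..M}" for n
    proof -
      let ?w = "\<lambda>x. (u (tm n) x - u (tm (n - 1)) x) - \<tau> * ut (tm n) x"
      have eq: "(u (tm n) x - u (tm (n - 1)) x) / \<tau> - ut (tm n) x = ?w x / \<tau>" for x
        unfolding diff_divide_distrib using \<tau>_pos by (simp add: nonzero_mult_div_cancel_left)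
      have "(LINT x|leb 0 1. ((F (tm n) 0 x - F (tm (n - 1)) 0 x) / \<tau> - ut (tm n) x)\<^sup>2) = (LINT x|leb 0 1. (?w x)\<^sup>2) / \<tau>\<^sup>2"
        unfolding F_tm eq power_divide by simp
      also have "\<dots> \<le> (\<tau> * J n)\<^sup>2 / \<tau>\<^sup>2"
        using order.trans[OF integral_sq_le_H_norm[OF rate_in_H[of n]] power_mono[OF rate_le[OF n], of 2]]
        by (intro divide_right_mono) auto
      also have "\<dots> = (J n)\<^sup>2" using \<tau>_pos by (simp add: power_mult_distrib)
      finally show ?thesis .
    qed
    show "sobolev_chain (k + 2) (\<tau> * (J n + At n)) (\<lambda>j x. F (tm n) j x - F (tm (n - 1)) j x)" if n: "n \<in> {1..M}" for n
      by (rule sobolev_chain_mono[OF F_diff_sobolev[OF tm_range tm_range] increment_le[OF n]])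
    show "J n + At n \<le> B1 + Jtot" if "n \<in> {1..M}" for n using J_le_total[OF that] At_le[of n] by simp
  qed (auto simp: A_le)
  then show ?thesis unfolding F_tm .
qed

lemma sq_add_le: "(x + y)\<^sup>2 \<le> 2 * x\<^sup>2 + 2 * (y :: real)\<^sup>2"
  using zero_le_power2[of "x - y"] unfolding power2_sum power2_diff by linarith

lemma h_pow_sq: "(h ^ (k + 1))\<^sup>2 = h ^ (2 * (k + 1))"
  unfolding power_mult[symmetric] by (simp only: mult.commute)

lemma h_pow_le: "h ^ m \<le> 1" using h_nonneg h_le_1 by (simp add: power_le_one)

text \<open>The bracket on the right of the claimed estimate.\<close>

definition load where "load n = h ^ (2 * (k + 1)) * Max ((\<lambda>j. (A j)\<^sup>2) ` {1..n})
   + h ^ (2 * (k + 1)) * Max ((\<lambda>j. (At j)\<^sup>2) ` {1..n}) + \<tau>\<^sup>2 * (LINT t|leb 0 (tm n). (H_norm (k + 2) (utt t))\<^sup>2)"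

text \<open>The first summand comes from \<open>\<sigma>\<close>, the next two from the truncation
  and the flux part of \<open>\<alpha>\<close>, and the last from \<open>\<sigma>'\<close>.\<close>

abbreviation "C3 \<equiv> (2 * \<nu> + C1 * B)\<^sup>2 + 2 + 2 * (1 + K)\<^sup>2 * B\<^sup>2 * T + 2 * C2\<^sup>2 * (1 + T)"

text \<open>Opaque names for the three summands of \<open>load\<close>, with the only facts about
  them that the estimates use; these then become linear arithmetic.\<close>

lemma load_split:
  assumes n: "n \<in> {1..M}"
  obtains a b c where "load n = a + b + c" "0 \<le> a" "0 \<le> b" "0 \<le> c"
    "\<And>j. j \<in> {1..n} \<Longrightarrow> h ^ (2 * (k + 1)) * (A j)\<^sup>2 \<le> a"
    "\<And>j. j \<in> {1..n} \<Longrightarrow> h ^ (2 * (k + 1)) * (At j)\<^sup>2 \<le> b"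
    "\<tau> * (\<Sum>j=1..n. (J j)\<^sup>2) \<le> c"
proof (rule that[OF load_def])
  let ?H = "h ^ (2 * (k + 1))"
  have H: "0 \<le> ?H" using h_nonneg by simp
  show 1: "?H * (A j)\<^sup>2 \<le> ?H * Max ((\<lambda>j. (A j)\<^sup>2) ` {1..n})" if "j \<in> {1..n}" for j
    using that H by (intro mult_left_mono Max_ge) auto
  show 2: "?H * (At j)\<^sup>2 \<le> ?H * Max ((\<lambda>j. (At j)\<^sup>2) ` {1..n})" if "j \<in> {1..n}" for j
    using that H by (intro mult_left_mono Max_ge) auto
  have "0 \<le> ?H * (A n)\<^sup>2" "0 \<le> ?H * (At n)\<^sup>2" using H by auto
  then show "0 \<le> ?H * Max ((\<lambda>j. (A j)\<^sup>2) ` {1..n})" "0 \<le> ?H * Max ((\<lambda>j. (At j)\<^sup>2) ` {1..n})"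
    using 1[of n] 2[of n] n by (auto intro: order.trans)
  show "0 \<le> \<tau>\<^sup>2 * (LINT t|leb 0 (tm n). (H_norm (k + 2) (utt t))\<^sup>2)" by simp
  have "(\<Sum>j=1..n. (J j)\<^sup>2) \<le> (\<Sum>j=1..n. \<tau> * J2 j)" using n by (intro sum_mono J_sq_le) auto
  also have "\<dots> = \<tau> * (LINT t|leb 0 (tm n). (H_norm (k + 2) (utt t))\<^sup>2)" using sum_J2[of n] n by (simp add: sum_distrib_left[symmetric])
  finally have "\<tau> * (\<Sum>j=1..n. (J j)\<^sup>2) \<le> \<tau> * (\<tau> * (LINT t|leb 0 (tm n). (H_norm (k + 2) (utt t))\<^sup>2))"
    using \<tau>_pos by (intro mult_left_mono) auto
  then show "\<tau> * (\<Sum>j=1..n. (J j)\<^sup>2) \<le> \<tau>\<^sup>2 * (LINT t|leb 0 (tm n). (H_norm (k + 2) (utt t))\<^sup>2)"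
    by (simp add: power2_eq_square mult.assoc)
qed

lemma tau_sum_le:
  assumes n: "n \<in> {1..M}" and le: "\<And>j. j \<in> {1..n} \<Longrightarrow> x j \<le> c * y j + z" and z: "0 \<le> z"
    and y: "\<tau> * (\<Sum>j=1..n. y j) \<le> d" "0 \<le> c"
  shows "\<tau> * (\<Sum>j=1..n. x j) \<le> c * d + T * (z :: real)"
proof -
  have "\<tau> * (\<Sum>j=1..n. x j) \<le> \<tau> * (\<Sum>j=1..n. c * y j + z)"
    using \<tau>_pos le by (intro mult_left_mono sum_mono) auto
  also have "\<dots> = c * (\<tau> * (\<Sum>j=1..n. y j)) + (\<tau> * n) * z" by (simp add: sum.distrib sum_distrib_left[symmetric] algebra_simps)
  also have "\<dots> \<le> c * d + T * z"
  proof (rule add_mono)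
    have "\<tau> * n \<le> \<tau> * M" using n \<tau>_pos by (intro mult_left_mono) auto
    then show "\<tau> * n * z \<le> T * z" using z \<tau>_M by (intro mult_right_mono) auto
  qed (rule mult_left_mono[OF y])
  finally show ?thesis .
qed

lemma load_bounds:
  assumes n: "n \<in> {1..M}"
  shows "j \<in> {1..n} \<Longrightarrow> (\<sigma> j)\<^sup>2 \<le> C3 * load n" "\<tau> * (\<Sum>j=1..n. (\<alpha> j)\<^sup>2) \<le> C3 * load n"
    "\<tau> * (\<Sum>j=1..n. (\<sigma>' j)\<^sup>2) \<le> C3 * load n" "0 \<le> load n" "h ^ (2 * (k + 1)) * (A n)\<^sup>2 \<le> load n"
proof -
  let ?H = "h ^ (2 * (k + 1))"
  obtain a b c where l: "load n = a + b + c" "0 \<le> a" "0 \<le> b" "0 \<le> c"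
    "\<And>j. j \<in> {1..n} \<Longrightarrow> ?H * (A j)\<^sup>2 \<le> a" "\<And>j. j \<in> {1..n} \<Longrightarrow> ?H * (At j)\<^sup>2 \<le> b"
    "\<tau> * (\<Sum>j=1..n. (J j)\<^sup>2) \<le> c" by (rule load_split[OF n]) blast
  show l0: "0 \<le> load n" using l by simp
  have "?H * (A n)\<^sup>2 \<le> a" by (rule l(5)) (use n in simp)
  then show "?H * (A n)\<^sup>2 \<le> load n" using l(1-4) by linarith
  define q1 q2 q3 where "q1 = (2 * \<nu> + C1 * B)\<^sup>2" and "q2 = 2 * (1 + K)\<^sup>2 * B\<^sup>2" and "q3 = 2 * C2\<^sup>2"
  have q: "0 \<le> q1" "0 \<le> q2" "0 \<le> q3" by (auto simp: q1_def q2_def q3_def)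
  have C3: "C3 = q1 + 2 + q2 * T + q3 + T * q3" by (simp add: q1_def q2_def q3_def algebra_simps)
  have T0: "0 \<le> T" using T_pos by simp
  have qT: "0 \<le> q2 * T" "0 \<le> T * q3" using q T0 by auto
  show "(\<sigma> j)\<^sup>2 \<le> C3 * load n" if j: "j \<in> {1..n}"
  proof -
    have "(2 * \<nu> * A j + C1 * A j * A j) \<le> (2 * \<nu> + C1 * B) * A j"
      using mult_right_mono[OF mult_left_mono[OF A_le[of j], of C1] A_nonneg[of j]] C1_pos by (simp add: algebra_simps)
    then have "\<sigma> j \<le> (2 * \<nu> + C1 * B) * A j * h ^ (k + 1)" using h_nonneg by (intro mult_right_mono) auto
    moreover have "0 \<le> \<sigma> j" using K_ge \<nu>_pos h_nonneg by (intro mult_nonneg_nonneg add_nonneg_nonneg) auto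
    ultimately have "(\<sigma> j)\<^sup>2 \<le> ((2 * \<nu> + C1 * B) * A j * h ^ (k + 1))\<^sup>2" by (intro power_mono)
    also have "\<dots> = q1 * (?H * (A j)\<^sup>2)" unfolding power_mult_distrib h_pow_sq q1_def by simp
    also have "\<dots> \<le> q1 * load n" using l(5)[OF j] l q by (intro mult_left_mono) auto
    also have "\<dots> \<le> C3 * load n" unfolding C3 using q qT l0 by (intro mult_right_mono) auto
    finally show ?thesis .
  qed
  have "(\<alpha> j)\<^sup>2 \<le> 2 * (J j)\<^sup>2 + q2 * a" if j: "j \<in> {1..n}" for j
  proof -
    have "((1 + K) * h ^ (k + 1) * (A j)\<^sup>2)\<^sup>2 = (1 + K)\<^sup>2 * (A j)\<^sup>2 * (?H * (A j)\<^sup>2)"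
      unfolding power_mult_distrib h_pow_sq by (simp add: power2_eq_square)
    also have "\<dots> \<le> (1 + K)\<^sup>2 * B\<^sup>2 * a"
      using l(5)[OF j] l A_le[of j] h_nonneg by (intro mult_mono mult_left_mono power_mono mult_nonneg_nonneg) auto
    finally show ?thesis using sq_add_le[of "J j" "(1 + K) * h ^ (k + 1) * (A j)\<^sup>2"] by (simp add: q2_def)
  qed
  from tau_sum_le[OF n this _ l(7)] have "\<tau> * (\<Sum>j=1..n. (\<alpha> j)\<^sup>2) \<le> 2 * c + T * (q2 * a)" using q l by simp
  also have "\<dots> \<le> 2 * load n + q2 * T * load n"
    using mult_left_mono[of a "load n" "q2 * T"] qT l by (simp add: mult_ac)
  also have "\<dots> \<le> (q1 + 2 + q2 * T + q3 + T * q3) * load n"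
    using mult_nonneg_nonneg[OF q(1) l0] mult_nonneg_nonneg[OF q(3) l0] mult_nonneg_nonneg[OF qT(2) l0]
    unfolding distrib_right by linarith
  also have "\<dots> = C3 * load n" by (simp only: C3)
  finally show "\<tau> * (\<Sum>j=1..n. (\<alpha> j)\<^sup>2) \<le> C3 * load n" .
  have "(\<sigma>' j)\<^sup>2 \<le> q3 * (J j)\<^sup>2 + q3 * b" if j: "j \<in> {1..n}" for j
  proof -
    have "(\<sigma>' j)\<^sup>2 = C2\<^sup>2 * (?H * (J j + At j)\<^sup>2)" unfolding power_mult_distrib h_pow_sq by simp
    also have "\<dots> \<le> C2\<^sup>2 * (?H * (2 * (J j)\<^sup>2 + 2 * (At j)\<^sup>2))"
      using h_nonneg by (intro mult_left_mono sq_add_le) auto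
    also have "\<dots> \<le> C2\<^sup>2 * (2 * (J j)\<^sup>2 + 2 * b)"
    proof (rule mult_left_mono)
      have "?H * (J j)\<^sup>2 \<le> 1 * (J j)\<^sup>2" by (intro mult_right_mono h_pow_le) auto
      then show "?H * (2 * (J j)\<^sup>2 + 2 * (At j)\<^sup>2) \<le> 2 * (J j)\<^sup>2 + 2 * b" using l(6)[OF j] by (simp add: distrib_left)
    qed simp
    finally show ?thesis by (simp add: q3_def algebra_simps)
  qed
  from tau_sum_le[OF n this _ l(7)] have "\<tau> * (\<Sum>j=1..n. (\<sigma>' j)\<^sup>2) \<le> q3 * c + T * (q3 * b)" using q l by simp
  also have "\<dots> \<le> q3 * load n + T * q3 * load n"
    using mult_left_mono[of c "load n" q3] mult_left_mono[of b "load n" "T * q3"] q qT l by (simp add: mult_ac)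
  also have "\<dots> \<le> (q1 + 2 + q2 * T + q3 + T * q3) * load n"
    using mult_nonneg_nonneg[OF q(1) l0] mult_nonneg_nonneg[OF qT(1) l0] l0
    unfolding distrib_right by linarith
  also have "\<dots> = C3 * load n" by (simp only: C3)
  finally show "\<tau> * (\<Sum>j=1..n. (\<sigma>' j)\<^sup>2) \<le> C3 * load n" .
qed

text \<open>Some uniform bound without a rate, as \<open>galerkin_error\<close> demands for choosing
  its constants; the summands cover the three sequences, and the 1 makes the bound positive.\<close>

lemma residual_bounded:
  assumes j: "j \<in> {1..M}"
  shows "\<alpha> j \<le> Jtot + (1 + K) * B\<^sup>2 + (2 * \<nu> * B + C1 * B * B) + C2 * (B1 + Jtot) + 1 \<and>
    \<sigma> j \<le> Jtot + (1 + K) * B\<^sup>2 + (2 * \<nu> * B + C1 * B * B) + C2 * (B1 + Jtot) + 1 \<and>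
    \<sigma>' j \<le> Jtot + (1 + K) * B\<^sup>2 + (2 * \<nu> * B + C1 * B * B) + C2 * (B1 + Jtot) + 1"
proof -
  have J0: "0 \<le> Jtot" by simp
  have "(1 + K) * h ^ (k + 1) * (A j)\<^sup>2 \<le> (1 + K) * 1 * B\<^sup>2"
    using K_ge A_le h_nonneg by (intro mult_mono power_mono h_pow_le) auto
  then have 1: "\<alpha> j \<le> Jtot + (1 + K) * B\<^sup>2" using J_le_total[OF j] by simp
  have 2: "\<sigma> j \<le> (2 * \<nu> * B + C1 * B * B) * 1"
    using K_ge \<nu>_pos B_pos A_le h_nonneg
    by (intro mult_mono add_mono mult_left_mono add_nonneg_nonneg mult_nonneg_nonneg h_pow_le) auto
  have 3: "\<sigma>' j \<le> C2 * 1 * (B1 + Jtot)"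
  proof (intro mult_mono mult_left_mono h_pow_le)
    show "J j + At j \<le> B1 + Jtot" using J_le_total[OF j] At_le[of j] by simp
  qed (use C2_pos h_nonneg in auto)
  have "0 \<le> (1 + K) * B\<^sup>2" "0 \<le> 2 * \<nu> * B + C1 * B * B" "0 \<le> C2 * (B1 + Jtot)"
    using K_ge C1_pos C2_pos \<nu>_pos B_pos B1_pos J0 by (auto intro!: mult_nonneg_nonneg add_nonneg_nonneg)
  moreover have "x \<le> a + b + c + d + 1 \<and> y \<le> a + b + c + d + 1 \<and> z \<le> a + b + c + d + 1"
    if "x \<le> a + b" "y \<le> c" "z \<le> d" "0 \<le> a" "0 \<le> b" "0 \<le> c" "0 \<le> d" for x y z a b c d :: real
    using that by simp
  ultimately show ?thesis using 1 2[unfolded mult_1_right] 3[unfolded mult_1_right] J0 by blast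
qed

section \<open>The error for small and for large time steps\<close>

abbreviation "err n \<equiv> (nh (\<lambda>i y. weak_deriv 1 (u (tm n)) y - D (U n) i y))\<^sup>2"

lemma bsq_F1: "bsq (\<lambda>i. F (tm n) 1)"
  by (rule bsq_global[OF sobolev_chainD(4)[OF F_tm(2)]]) simp

lemma err_eq: "err n = (nh (\<lambda>i y. F (tm n) 1 y - D (U n) i y))\<^sup>2"
proof -
  have w: "bsq (\<lambda>i. weak_deriv 1 (u (tm n)))"
    by (rule bsq_global[OF sqint_weak_deriv[OF u_H[OF tm_range]]]) simp
  have "nh (\<lambda>i y. weak_deriv 1 (u (tm n)) y - D (U n) i y) = nh (\<lambda>i y. F (tm n) 1 y - D (U n) i y)"
  proof (rule nh_AE_cong)
    fix i assume "i \<in> {1..<N}"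
    then have "AE y in E i. F (tm n) 1 y = weak_deriv 1 (u (tm n)) y"
      using AE_leb_subinterval[OF F(3)[OF tm_range, of 1 n]] X_sub[of i] by simp
    then show "AE y in E i. weak_deriv 1 (u (tm n)) y - D (U n) i y = F (tm n) 1 y - D (U n) i y"
      by eventually_elim simp
  qed (intro bsq_diff w bsq_F1 bsq_poly)+
  then show ?thesis by simp
qed

lemma err_le:
  assumes n: "n \<in> {1..M}"
  shows "err n \<le> 2 * (h ^ (2 * (k + 1)) * (A n)\<^sup>2) + 2 * stiff (W n - U n) (W n - U n)"
proof -
  have W: "W n \<in> S_h0 N k"
    by (rule S_h0_Q_h[OF sqint_in_H[OF u_H[OF tm_range]]]) (use boundary_tm n in auto)
  have r: "restr N k (W n) = W n" "restr N k (U n) = U n" using restr_id W U_mem n by auto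
  have "stiff (W n - U n) (W n - U n) = (nh (\<lambda>i y. poly (R (F (tm n) 1) i) y - D (U n) i y))\<^sup>2"
    unfolding stiff_def restr_lin r nh_sq
    by (rule ih_fun_cong) (auto simp: weak_diff_lin weak_diff_Q_h[OF sobolev_chainD(1)[OF F_tm(2)], unfolded F_tm] fun_eq_iff)
  moreover have "(nh (\<lambda>i y. F (tm n) 1 y - poly (R (F (tm n) 1) i) y))\<^sup>2 \<le> (h ^ (k + 1) * A n)\<^sup>2"
    by (intro power_mono R_error F_tm) simp
  ultimately show ?thesis
    using nh_diff_sq_le[OF bsq_F1[of n] bsq_poly(1)[of "\<lambda>i. R (F (tm n) 1) i"] bsq_poly(1)[of "weak_diff X (Suc k) (U n)"]]
    unfolding err_eq power_mult_distrib h_pow_sq by simp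
qed

text \<open>A bound without any rate, for the finitely many large time steps.\<close>

lemma err_crude:
  assumes n: "n \<in> {1..M}"
  shows "err n \<le> 2 * (LINT x|leb 0 1. (F (tm n) 1 x)\<^sup>2) + (LINT x|leb 0 1. (u 0 x)\<^sup>2) / (\<tau> * \<nu>)"
proof -
  interpret G: galerkin_scheme mass stiff conv K K \<nu> \<tau> B "B1 + Jtot" M U W
    "\<lambda>n. mesh_load (F (tm n)) (\<lambda>x. (F (tm n) 0 x - F (tm (n - 1)) 0 x) / \<tau> - ut (tm n) x)"
    "\<lambda>n. mesh_stress \<nu> (F (tm n))" \<alpha> \<sigma> \<sigma>' by (rule galerkin_burgers)
  have nM: "n \<le> M" using n by simp
  have rU: "restr N k (U n) = U n" "restr N k (U 0) = U 0" using restr_id U_mem nM by auto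
  have sq0: "sqint 0 1 (u 0)" using cont_u[of 0] T_pos by (intro sqint_continuous) simp
  let ?I = "LINT x|leb 0 1. (u 0 x)\<^sup>2"
  have "(G.nm (U 0))\<^sup>2 = (nh (\<lambda>i. poly (P (u 0) i)))\<^sup>2"
    unfolding G.nm_sq mass_def rU nh_sq by (rule ih_fun_cong) (auto simp: U_0 Q_h_sel)
  also have "\<dots> \<le> (sqrt ?I)\<^sup>2" by (intro power_mono nh_P_le sq0) auto
  also have "\<dots> = ?I" by simp
  finally have U0: "(G.nm (U 0))\<^sup>2 \<le> ?I" .
  have "(G.na (U n))\<^sup>2 \<le> (\<Sum>j=1..n. (G.na (U j))\<^sup>2)" using n by (intro member_le_sum) auto
  then have "2 * \<tau> * \<nu> * (G.na (U n))\<^sup>2 \<le> 2 * \<tau> * \<nu> * (\<Sum>j=1..n. (G.na (U j))\<^sup>2)"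
    using \<tau>_pos \<nu>_pos by (intro mult_left_mono) auto
  also have "\<dots> \<le> ?I" using G.U_energy[OF nM] U0 zero_le_power2[of "G.nm (U n)"] by linarith
  finally have "2 * (G.na (U n))\<^sup>2 \<le> ?I / (\<tau> * \<nu>)" using \<tau>_pos \<nu>_pos by (subst pos_le_divide_eq) (simp_all add: mult_ac)
  moreover have "(nh (\<lambda>i y. 0 - D (U n) i y))\<^sup>2 = (G.na (U n))\<^sup>2"
    unfolding G.na_sq stiff_def rU nh_sq by (simp add: ih_eq)
  moreover have F1: "sqint 0 1 (F (tm n) 1)" by (rule sobolev_chainD(4)[OF F_tm(2)]) simp
  moreover have "(nh (\<lambda>i y. F (tm n) 1 y - 0))\<^sup>2 = (LINT x|leb 0 1. (F (tm n) 1 x)\<^sup>2)"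
    using ih_global[OF F1 F1] unfolding nh_sq by (simp add: power2_eq_square)
  moreover have "bsq (\<lambda>i y. 0)" using bsq_poly(2)[of "\<lambda>i. 0"] by simp
  ultimately show ?thesis
    using nh_diff_sq_le[OF bsq_F1[of n] _ bsq_poly(1)[of "weak_diff X (Suc k) (U n)"], of "\<lambda>i y. 0"]
    unfolding err_eq by linarith
qed

text \<open>Without a rate it suffices that the load contains the term with \<open>utt\<close>, by
  which the crude bound is divided. If that term is 0, the quotient is 0 by the convention for
  division, and the claim says that the error vanishes: then \<open>u\<close> is zero up to
  \<open>tm n\<close>, and so are the bounds in \<open>err_crude\<close>.\<close>

lemma err_large_step:
  assumes n: "n \<in> {1..M}"
  shows "err n \<le> (2 * B\<^sup>2 + B\<^sup>2 / (\<tau> * \<nu>)) / (\<tau>\<^sup>2 * (LINT t|leb 0 (tm n). (H_norm (k + 2) (utt t))\<^sup>2)) * load n"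
proof -
  let ?I = "LINT t|leb 0 (tm n). (H_norm (k + 2) (utt t))\<^sup>2" and ?b = "2 * B\<^sup>2 + B\<^sup>2 / (\<tau> * \<nu>)"
  have t: "tm n \<in> {0<..T}" by (rule tm_pos[OF n])
  show ?thesis
  proof (cases "?I = 0")
    case True
    have z: "u t x = 0" if "t \<in> {0..tm n}" "x \<in> {0..1}" for t x
      by (rule zero_if_utt_zero[OF _ _ True that]) (use t in auto)
    have "AE x in leb 0 1. F (tm n) 1 x = 0"
      by (rule deriv_chain_deriv_zero[OF sobolev_chainD(1)[OF F_tm(2)]]) (use z t in \<open>auto simp: F_tm\<close>)
    then have "(LINT x|leb 0 1. (F (tm n) 1 x)\<^sup>2) = (LINT x|leb 0 1. 0)"
      using sobolev_chainD(4)[OF F_tm(2), of 1] by (intro integral_cong_AE) (auto simp: sqint_def elim: eventually_mono)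
    moreover have "(LINT x|leb 0 1. (u 0 x)\<^sup>2) = (LINT x|leb 0 1. 0)"
      by (rule Bochner_Integration.integral_cong) (use z t in auto)
    ultimately show ?thesis using err_crude[OF n] True by simp
  next
    case False
    have "0 \<le> ?I" by simp
    then have "0 < ?I" using False by linarith
    then have I: "0 < \<tau>\<^sup>2 * ?I" using \<tau>_pos by (intro mult_pos_pos) auto
    have "(LINT x|leb 0 1. (F (tm n) 1 x)\<^sup>2) \<le> B\<^sup>2"
      using sobolev_chainD(3)[OF F_tm(2), of 1 n] power_mono[OF A_le[of n] A_nonneg, of 2] by simp
    moreover have "(LINT x|leb 0 1. (u 0 x)\<^sup>2) / (\<tau> * \<nu>) \<le> B\<^sup>2 / (\<tau> * \<nu>)"
    proof (rule divide_right_mono)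
      show "(LINT x|leb 0 1. (u 0 x)\<^sup>2) \<le> B\<^sup>2"
        using sobolev_chainD(3)[OF F_tm(2), of 0 0] F_tm(1)[of 0] power_mono[OF A_le[of 0] A_nonneg, of 2] by simp
    qed (use \<tau>_pos \<nu>_pos in simp)
    ultimately have "err n \<le> ?b" using err_crude[OF n] by linarith
    also have "\<dots> = ?b / (\<tau>\<^sup>2 * ?I) * (\<tau>\<^sup>2 * ?I)"
    proof -
      have "b = b / x * x" if "0 < x" for b x :: real using that by simp
      from this[OF I] show ?thesis .
    qed
    also have "\<dots> \<le> ?b / (\<tau>\<^sup>2 * ?I) * load n"
    proof (rule mult_left_mono)
      have "0 \<le> h ^ (2 * (k + 1)) * (A n)\<^sup>2" "0 \<le> h ^ (2 * (k + 1)) * (At n)\<^sup>2" using h_nonneg by auto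
      moreover have "h ^ (2 * (k + 1)) * (A n)\<^sup>2 \<le> h ^ (2 * (k + 1)) * Max ((\<lambda>j. (A j)\<^sup>2) ` {1..n})"
        "h ^ (2 * (k + 1)) * (At n)\<^sup>2 \<le> h ^ (2 * (k + 1)) * Max ((\<lambda>j. (At j)\<^sup>2) ` {1..n})"
        using n h_nonneg by (auto intro!: mult_left_mono Max_ge)
      ultimately show "\<tau>\<^sup>2 * ?I \<le> load n" unfolding load_def by linarith
      show "0 \<le> ?b / (\<tau>\<^sup>2 * ?I)" using I \<tau>_pos \<nu>_pos by (intro divide_nonneg_nonneg add_nonneg_nonneg) auto
    qed
    finally show ?thesis .
  qed
qed

text \<open>The hypothesis \<open>le\<close> is the conclusion of \<open>galerkin_error\<close> for
  the present mesh. It is assumed here because the constant \<open>C\<close> has to be obtained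
  before a mesh is given.\<close>

lemma err_small_step:
  assumes n: "n \<in> {1..M}" and C: "0 \<le> C"
    and le: "\<And>F. 0 \<le> F \<Longrightarrow> (\<And>j. j \<in> {1..n} \<Longrightarrow> (\<sigma> j)\<^sup>2 \<le> F) \<Longrightarrow> \<tau> * (\<Sum>j=1..n. (\<alpha> j)\<^sup>2) \<le> F \<Longrightarrow>
      \<tau> * (\<Sum>j=1..n. (\<sigma>' j)\<^sup>2) \<le> F \<Longrightarrow> stiff (W n - U n) (W n - U n) \<le> C * F"
  shows "err n \<le> (2 + 2 * (C * C3)) * load n"
proof -
  have "0 \<le> C3" using T_pos C2_pos by (intro add_nonneg_nonneg mult_nonneg_nonneg) auto
  then have "stiff (W n - U n) (W n - U n) \<le> C * (C3 * load n)"
    using load_bounds[OF n] by (intro le mult_nonneg_nonneg) auto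
  then show ?thesis using err_le[OF n] load_bounds(5)[OF n] by (simp add: algebra_simps)
qed

lemma load_eq:
  assumes n: "n \<in> {1..M}"
  shows "load n = h ^ (2 * (k + 1)) * Max ((\<lambda>j. (H_norm (k + 2) (u (real j * (T / real M))))\<^sup>2) ` {1..n})
    + h ^ (2 * (k + 1)) * Max ((\<lambda>j. (H_norm (k + 2) (ut (real j * (T / real M))))\<^sup>2) ` {1..n})
    + (T / real M)\<^sup>2 * (LINT t|leb 0 (real n * (T / real M)). (H_norm (k + 2) (utt t))\<^sup>2)"
proof -
  have tm: "tm j = real j * (T / real M)" if "j \<in> {1..n}" for j using that n by (simp add: tm_def \<tau>_def min_def)
  have "(\<lambda>j. (A j)\<^sup>2) ` {1..n} = (\<lambda>j. (H_norm (k + 2) (u (real j * (T / real M))))\<^sup>2) ` {1..n}"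
    "(\<lambda>j. (At j)\<^sup>2) ` {1..n} = (\<lambda>j. (H_norm (k + 2) (ut (real j * (T / real M))))\<^sup>2) ` {1..n}"
    by (rule image_cong; simp add: A_def At_def tm)+
  then show ?thesis using tm[of n] n unfolding load_def by (simp add: \<tau>_def)
qed

end

theorem theorem4:
  fixes k r :: nat and \<nu> T :: real
    and g :: "real \<Rightarrow> real" and u u\<^sub>t u\<^sub>t\<^sub>t :: "real \<Rightarrow> real \<Rightarrow> real"
  assumes "r = k + 1" and "\<nu> > 0" and "T > 0"
    and "H_time_H 2 T (1 + r) u"
    and "is_time_deriv T (1 + r) u u\<^sub>t" and "is_time_deriv T (1 + r) u\<^sub>t u\<^sub>t\<^sub>t"
    and "H_continuous T (1 + r) u" and "H_continuous T (1 + r) u\<^sub>t"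
    and "\<forall>t\<in>{0..T}. continuous_on {0..1} (u t)" and "continuous_on {0..1} g"
    and "burgers_solution \<nu> T g u u\<^sub>t"
  shows "\<exists>C::real. \<forall>X N M U n.
    is_partition X N \<longrightarrow> M \<ge> 1 \<longrightarrow> wg_solution \<nu> g k r X N (T / real M) M U \<longrightarrow> n \<in> {1..M} \<longrightarrow>
    (let h = mesh_size X N; \<tau> = T / real M; t = (\<lambda>j::nat. real j * \<tau>) in
      (norm_h X N (\<lambda>i y. weak_deriv 1 (u (t n)) y - weak_diff_fun X r (U n) i y))\<^sup>2
      \<le> C * (h ^ (2 * (k + 1)) * Max ((\<lambda>j. (H_norm (k + 2) (u (t j)))\<^sup>2) ` {1..n})
           + h ^ (2 * (k + 1)) * Max ((\<lambda>j. (H_norm (k + 2) (u\<^sub>t (t j)))\<^sup>2) ` {1..n})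
           + \<tau>\<^sup>2 * (LINT s|lebesgue_on {0<..<t n}. (H_norm (k + 2) (u\<^sub>t\<^sub>t s))\<^sup>2)))"
proof -
  have r: "1 + r = k + 2" "r = Suc k" using assms(1) by simp_all
  interpret burgers "k + 2" \<nu> T g u u\<^sub>t u\<^sub>t\<^sub>t
    using assms(2-) unfolding r(1) by unfold_locales auto
  obtain Ci where Ci: "0 < Ci" "\<And>a b (p :: real poly) x. a < b \<Longrightarrow> degree p \<le> k \<Longrightarrow> x \<in> {a..b} \<Longrightarrow>
      (b - a) * (poly p x)\<^sup>2 \<le> Ci * (LINT y|leb a b. (poly p y)\<^sup>2)"
    using poly_inverse_inequality[of k] by blast
  \<comment> \<open>Ensures both \<open>1 \<le> K\<close> and \<open>Ci \<le> K^2\<close>.\<close>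
  define K where "K = sqrt Ci + 1"
  have K: "1 \<le> K" using Ci(1) by (simp add: K_def)
  have inv: "(b - a) * (poly p x)\<^sup>2 \<le> K\<^sup>2 * (LINT y|leb a b. (poly p y)\<^sup>2)"
    if "a < b" "degree p \<le> k" "x \<in> {a..b}" for a b x and p :: "real poly"
  proof -
    have "Ci = (sqrt Ci)\<^sup>2" using Ci(1) by simp
    also have "\<dots> \<le> K\<^sup>2" unfolding K_def using Ci(1) by (intro power_mono) auto
    finally have "Ci * (LINT y|leb a b. (poly p y)\<^sup>2) \<le> K\<^sup>2 * (LINT y|leb a b. (poly p y)\<^sup>2)"
      by (intro mult_right_mono) auto
    then show ?thesis using Ci(2)[OF that] by linarith
  qed
  obtain B where B: "0 < B" "\<And>t. t \<in> {0..T} \<Longrightarrow> H_norm (k + 2) (u t) \<le> B" using H_continuous_norm_bounded[OF c1] by blast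
  obtain B1 where B1: "0 < B1" "\<And>t. t \<in> {0..T} \<Longrightarrow> H_norm (k + 2) (u\<^sub>t t) \<le> B1" using H_continuous_norm_bounded[OF c2] by blast
  define I where "I = (LINT t|leb 0 T. H_norm (k + 2) (u\<^sub>t\<^sub>t t))"
  have I: "0 \<le> I" by (simp add: I_def)
  \<comment> \<open>\<open>C1\<close>, \<open>C2\<close>, \<open>Bd\<close> and \<open>C3\<close>
    repeat expressions of the locale \<open>burgers_scheme\<close>, formed here from quantities that
    exist before a partition is chosen.\<close>
  define C1 where "C1 = 8 * 2 ^ k + 2 + 2 * K"
  have C1: "0 < C1" using K unfolding C1_def by (intro add_pos_pos) auto
  define C2 where "C2 = 2 * \<nu> + C1 * (2 * B)"
  have C2: "0 < C2" using assms(2) B(1) C1 by (simp add: C2_def add_pos_pos)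
  define Bd where "Bd = I + (1 + K) * B\<^sup>2 + (2 * \<nu> * B + C1 * B * B) + C2 * (B1 + I) + 1"
  have Bd: "0 < Bd"
    unfolding Bd_def using I K B(1) B1(1) C1 C2 assms(2)
    by (intro add_nonneg_pos add_nonneg_nonneg mult_nonneg_nonneg) auto
  define C3 where "C3 = (2 * \<nu> + C1 * B)\<^sup>2 + 2 + 2 * (1 + K)\<^sup>2 * B\<^sup>2 * T + 2 * C2\<^sup>2 * (1 + T)"
  have C3: "0 \<le> C3" using T_pos by (auto simp: C3_def)
  have BI: "0 < B1 + I" and K0: "0 < K" using B1(1) I K by auto
  obtain C \<tau>0 where C: "0 \<le> C" "0 < \<tau>0"
    "\<And>m a c \<tau> M U W \<rho> S \<alpha> s s' n F.
      galerkin_scheme (m :: weak_fun \<Rightarrow> weak_fun \<Rightarrow> real) a c K K \<nu> \<tau> B (B1 + I) M U W \<rho> S \<alpha> s s' \<Longrightarrow>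
      \<tau> * real M = T \<Longrightarrow> \<tau> \<le> \<tau>0 \<Longrightarrow>
      (\<And>j. j \<in> {1..M} \<Longrightarrow> \<alpha> j \<le> Bd \<and> s j \<le> Bd \<and> s' j \<le> Bd) \<Longrightarrow>
      n \<in> {1..M} \<Longrightarrow> 0 \<le> F \<Longrightarrow> (\<And>j. j \<in> {1..n} \<Longrightarrow> (s j)\<^sup>2 \<le> F) \<Longrightarrow>
      \<tau> * (\<Sum>j=1..n. (\<alpha> j)\<^sup>2) \<le> F \<Longrightarrow> \<tau> * (\<Sum>j=1..n. (s' j)\<^sup>2) \<le> F \<Longrightarrow>
      a (W n - U n) (W n - U n) \<le> C * F"
    by (rule galerkin_error[OF K0 K0 assms(2) B(1) BI T_pos Bd, where ?'a = weak_fun]) blast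
  \<comment> \<open>The factor of \<open>err_large_step\<close>: it depends on the step, the level
    and the solution, but not on the partition.\<close>
  define L where "L M n = (2 * B\<^sup>2 + B\<^sup>2 / (T / real M * \<nu>)) /
      ((T / real M)\<^sup>2 * (LINT t|leb 0 (real n * (T / real M)). (H_norm (k + 2) (u\<^sub>t\<^sub>t t))\<^sup>2))" for M n :: nat
  have L: "0 \<le> L M n" for M n
    unfolding L_def using T_pos assms(2) by (intro divide_nonneg_nonneg add_nonneg_nonneg mult_nonneg_nonneg) auto
  \<comment> \<open>The step counts with a large time step; each is below
    \<open>T / \<tau>0\<close>, so there are finitely many.\<close>
  define Q where "Q = {M :: nat. 1 \<le> M \<and> \<tau>0 < T / real M}"
  have "Q \<subseteq> {..nat \<lceil>T / \<tau>0\<rceil>}"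
  proof
    fix M assume "M \<in> Q"
    then have "0 < real M" "\<tau>0 < T / real M" by (auto simp: Q_def)
    then have "real M < T / \<tau>0" using C(2) by (simp add: pos_less_divide_eq mult.commute)
    then show "M \<in> {..nat \<lceil>T / \<tau>0\<rceil>}" by (simp add: nat_le_iff le_nat_iff) linarith
  qed
  then have Q: "finite Q" by (rule finite_subset) simp
  \<comment> \<open>The sum over the finitely many pairs of step count and level stands in for a
    maximum.\<close>
  define Ct where "Ct = 2 + 2 * (C * C3) + (\<Sum>M\<in>Q. \<Sum>n=1..M. L M n)"
  have sumL: "0 \<le> (\<Sum>M\<in>Q. \<Sum>n=1..M. L M n)" by (intro sum_nonneg L)
  have main: "(norm_h X N (\<lambda>i y. weak_deriv 1 (u (real n * (T / real M))) y - weak_diff_fun X (Suc k) (U n) i y))\<^sup>2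
      \<le> Ct * (mesh_size X N ^ (2 * (k + 1)) * Max ((\<lambda>j. (H_norm (k + 2) (u (real j * (T / real M))))\<^sup>2) ` {1..n})
        + mesh_size X N ^ (2 * (k + 1)) * Max ((\<lambda>j. (H_norm (k + 2) (u\<^sub>t (real j * (T / real M))))\<^sup>2) ` {1..n})
        + (T / real M)\<^sup>2 * (LINT t|leb 0 (real n * (T / real M)). (H_norm (k + 2) (u\<^sub>t\<^sub>t t))\<^sup>2))"
    if part: "is_partition X N" and M: "M \<ge> 1" and wg: "wg_solution \<nu> g k (Suc k) X N (T / real M) M U" and n: "n \<in> {1..M}"
    for X N M U n
  proof -
    interpret S: burgers_scheme k \<nu> T g u u\<^sub>t u\<^sub>t\<^sub>t X N K M U B B1
      by unfold_locales (use part K inv M wg B B1 in auto)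
    have tm: "S.tm n = real n * (T / real M)" using n by (simp add: S.tm_def S.\<tau>_def min_def)
    have load: "0 \<le> S.load n" by (rule S.load_bounds(4)[OF n])
    have "S.err n \<le> Ct * S.load n"
    proof (cases "S.\<tau> \<le> \<tau>0")
      case True
      have "S.err n \<le> (2 + 2 * (C * C3)) * S.load n"
        unfolding C3_def C2_def C1_def
      proof (rule S.err_small_step[OF n C(1)])
        show "S.stiff (S.W n - U n) (S.W n - U n) \<le> C * F"
          if "0 \<le> F" "\<And>j. j \<in> {1..n} \<Longrightarrow> (S.\<sigma> j)\<^sup>2 \<le> F" "S.\<tau> * (\<Sum>j=1..n. (S.\<alpha> j)\<^sup>2) \<le> F"
            "S.\<tau> * (\<Sum>j=1..n. (S.\<sigma>' j)\<^sup>2) \<le> F" for F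
          by (rule C(3)[OF S.galerkin_burgers[folded I_def] S.\<tau>_M True
                S.residual_bounded[folded I_def, folded C1_def, folded C2_def, folded Bd_def, unfolded C2_def C1_def] n that])
      qed
      also have "\<dots> \<le> Ct * S.load n" using sumL load by (intro mult_right_mono) (auto simp: Ct_def)
      finally show ?thesis .
    next
      case False
      then have MQ: "M \<in> Q" using M by (simp add: Q_def S.\<tau>_def)
      have "S.err n \<le> L M n * S.load n" using S.err_large_step[OF n] unfolding L_def tm S.\<tau>_def .
      also have "L M n \<le> Ct"
      proof -
        have "L M n \<le> (\<Sum>n=1..M. L M n)" using n L by (intro member_le_sum) auto
        also have "\<dots> \<le> (\<Sum>M\<in>Q. \<Sum>n=1..M. L M n)"
          using MQ Q by (intro member_le_sum sum_nonneg L) auto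
        also have "\<dots> \<le> Ct" using C C3 by (simp add: Ct_def)
        finally show ?thesis .
      qed
      finally show ?thesis using load by (simp add: mult_right_mono)
    qed
    then show ?thesis unfolding S.load_eq[OF n] tm .
  qed
  show ?thesis unfolding Let_def r(2) by (intro exI[of _ Ct] allI impI) (rule main)
qed

end
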